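(* Assume $r=2$, so $E=C_p^2$ and $S=T_{p-1}$. Then for any $X\in\mathrm{Rep}\,E$, every cyclic direct summand of $S\otimes X$ is isomorphic to the restriction to $E$ of an $SL_2$-tilting module.
   Context: $\Bbbk$ is an algebraically closed field of characteristic $p>0$. $E=C_p^2$ has generators $g_1,g_2$. Fix $\lambda_1,\lambda_2\in\Bbbk$ linearly independent over $\mathbb{F}_p$ and the resulting embedding $E\hookrightarrow SL_2(\Bbbk)$, $g_i\mapsto\begin{pmatrix}1&0\\ \lambda_i&1\end{pmatrix}$, along which $SL_2$-modules are restricted to $E$. $\mathrm{Rep}\,E$ is the category of finite-dimensional $\Bbbk E$-modules. $T_i$ is the indecomposable tilting $SL_2$-module of highest weight $i$, and also its restriction to $E$. A module is cyclic if it is generated by one element. *)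

theory Defs
  imports
    "Jordan_Normal_Form.VS_Connect"
    "Jordan_Normal_Form.Matrix_Kernel"
    "HOL-Algebra.Elementary_Groups"
begin

section \<open>Finite-dimensional representations\<close>

text \<open>
  A finite-dimensional representation is given in coordinates: a dimension \<open>n\<close> and a homomorphism to
  \<open>GL\<^sub>n\<close>, matrices acting on column vectors. The dimension is part of the data, so that one may
  quantify existentially over representations of unknown dimension (\<open>n = 0\<close> is allowed and
  is the zero module).
\<close>

datatype ('g, 'k) rep = Rep (deg: nat) (act: "'g \<Rightarrow> 'k mat")

definition GL :: "'k::field itself \<Rightarrow> nat \<Rightarrow> 'k mat monoid" where
  "GL ty n = units_of (ring_mat ty n ())"

definition representation :: "('g, 'm) monoid_scheme \<Rightarrow> ('g, 'k::field) rep \<Rightarrow> bool" where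
  "representation G V \<longleftrightarrow> act V \<in> hom G (GL TYPE('k) (deg V))"

definition intertwiners ::
  "('g, 'm) monoid_scheme \<Rightarrow> ('g, 'k::field) rep \<Rightarrow> ('g, 'k) rep \<Rightarrow> 'k mat set" where
  "intertwiners G V W =
     {A \<in> carrier_mat (deg W) (deg V). \<forall>g\<in>carrier G. A * act V g = act W g * A}"

definition isomorphic_rep ::
  "('g, 'm) monoid_scheme \<Rightarrow> ('g, 'k::field) rep \<Rightarrow> ('g, 'k) rep \<Rightarrow> bool" where
  "isomorphic_rep G V W \<longleftrightarrow> (\<exists>A\<in>intertwiners G V W. invertible_mat A)"

definition direct_sum_rep :: "('g, 'k::field) rep \<Rightarrow> ('g, 'k) rep \<Rightarrow> ('g, 'k) rep" where
  "direct_sum_rep V W = Rep (deg V + deg W)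
     (\<lambda>g. four_block_mat (act V g) (0\<^sub>m (deg V) (deg W)) (0\<^sub>m (deg W) (deg V)) (act W g))"

text \<open>
  The tensor product is the Kronecker product of matrices: \<open>e\<^sub>i \<otimes> f\<^sub>k\<close> is the basis vector
  with index \<open>i * deg W + k\<close>.
\<close>

definition tensor_rep :: "('g, 'k::field) rep \<Rightarrow> ('g, 'k) rep \<Rightarrow> ('g, 'k) rep" where
  "tensor_rep V W = Rep (deg V * deg W)
     (\<lambda>g. mat (deg V * deg W) (deg V * deg W)
        (\<lambda>(i, j). act V g $$ (i div deg W, j div deg W) * act W g $$ (i mod deg W, j mod deg W)))"

definition dual_rep :: "('g, 'm) monoid_scheme \<Rightarrow> ('g, 'k::field) rep \<Rightarrow> ('g, 'k) rep" where
  "dual_rep G V = Rep (deg V) (\<lambda>g. (act V (inv\<^bsub>G\<^esub> g))\<^sup>T)"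

definition restrict_rep :: "('h \<Rightarrow> 'g) \<Rightarrow> ('g, 'k) rep \<Rightarrow> ('h, 'k) rep" where
  "restrict_rep \<phi> V = Rep (deg V) (act V \<circ> \<phi>)"

definition direct_summand ::
  "('g, 'm) monoid_scheme \<Rightarrow> ('g, 'k::field) rep \<Rightarrow> ('g, 'k) rep \<Rightarrow> bool" where
  "direct_summand G M V \<longleftrightarrow> representation G M \<and>
     (\<exists>N. representation G N \<and> isomorphic_rep G V (direct_sum_rep M N))"

definition indecomposable_rep :: "('g, 'm) monoid_scheme \<Rightarrow> ('g, 'k::field) rep \<Rightarrow> bool" where
  "indecomposable_rep G V \<longleftrightarrow> deg V \<noteq> 0 \<and>
     (\<forall>A B. representation G A \<longrightarrow> representation G B \<longrightarrow>
        isomorphic_rep G V (direct_sum_rep A B) \<longrightarrow> deg A = 0 \<or> deg B = 0)"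

text \<open>The submodule generated by \<open>v\<close> is the linear span of the orbit of \<open>v\<close>.\<close>

definition cyclic_rep :: "('g, 'm) monoid_scheme \<Rightarrow> ('g, 'k::field) rep \<Rightarrow> bool" where
  "cyclic_rep G V \<longleftrightarrow> (\<exists>v\<in>carrier_vec (deg V).
     LinearCombinations.module.span class_ring (module_vec TYPE('k) (deg V))
       ((\<lambda>g. act V g *\<^sub>v v) ` carrier G) = carrier_vec (deg V))"

definition short_exact ::
  "('g, 'm) monoid_scheme \<Rightarrow> ('g, 'k::field) rep \<Rightarrow> ('g, 'k) rep \<Rightarrow> ('g, 'k) rep \<Rightarrow> bool" where
  "short_exact G U V W \<longleftrightarrow> (\<exists>A\<in>intertwiners G U V. \<exists>B\<in>intertwiners G V W.
     inj_on ((*\<^sub>v) A) (carrier_vec (deg U)) \<and>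
     (*\<^sub>v) A ` carrier_vec (deg U) = mat_kernel B \<and>
     (*\<^sub>v) B ` carrier_vec (deg V) = carrier_vec (deg W))"

inductive has_filtration ::
  "('g, 'm) monoid_scheme \<Rightarrow> ('g, 'k::field) rep set \<Rightarrow> ('g, 'k) rep \<Rightarrow> bool" for G F where
  zero: "representation G V \<Longrightarrow> deg V = 0 \<Longrightarrow> has_filtration G F V"
| step: "has_filtration G F U \<Longrightarrow> representation G V \<Longrightarrow> W \<in> F \<Longrightarrow> short_exact G U V W
    \<Longrightarrow> has_filtration G F V"

section \<open>Tilting modules for \<open>SL\<^sub>2\<close>\<close>

definition mat2 :: "'k \<Rightarrow> 'k \<Rightarrow> 'k \<Rightarrow> 'k \<Rightarrow> 'k mat" where
  "mat2 a b c d = mat_of_rows_list 2 [[a, b], [c, d]]"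

definition SL2 :: "'k::field mat monoid" where
  "SL2 = \<lparr>carrier = {A \<in> carrier_mat 2 2. det A = 1}, mult = (*), one = 1\<^sub>m 2\<rparr>"

inductive_set polynomial_functions :: "('k::field mat \<Rightarrow> 'k) set" where
  const: "(\<lambda>_. c) \<in> polynomial_functions"
| coord: "i < 2 \<Longrightarrow> j < 2 \<Longrightarrow> (\<lambda>A. A $$ (i, j)) \<in> polynomial_functions"
| add: "f \<in> polynomial_functions \<Longrightarrow> g \<in> polynomial_functions \<Longrightarrow>
    (\<lambda>A. f A + g A) \<in> polynomial_functions"
| mult: "f \<in> polynomial_functions \<Longrightarrow> g \<in> polynomial_functions \<Longrightarrow>
    (\<lambda>A. f A * g A) \<in> polynomial_functions"

text \<open>
  Over an algebraically closed field, modules for the algebraic group \<open>SL\<^sub>2\<close> are the representations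
  of its group of rational points whose matrix coefficients are regular functions. Subrepresentations
  and quotients of rational representations are automatically rational, so the notions above need no
  separate rational versions.
\<close>

definition rational_rep :: "('k::alg_closed_field mat, 'k) rep \<Rightarrow> bool" where
  "rational_rep V \<longleftrightarrow> representation SL2 V \<and>
     (\<forall>i<deg V. \<forall>j<deg V. \<exists>f\<in>polynomial_functions. \<forall>A\<in>carrier SL2. act V A $$ (i, j) = f A)"

text \<open>
  The induced module of highest weight \<open>n\<close> is the \<open>n\<close>-th symmetric power of the natural
  module with basis \<open>x, y\<close>. The matrix is taken in the basis \<open>x ^ (n - j) * y ^ j\<close> for \<open>0 \<le> j \<le> n\<close>:
  a matrix with rows \<open>(a, b)\<close> and \<open>(c, d)\<close> sends this to
  \<open>(a * x + c * y) ^ (n - j) * (b * x + d * y) ^ j\<close>, written below with \<open>x = 1\<close>. The Weyl module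
  is its dual (every \<open>SL\<^sub>2\<close> weight is minus its image under the longest Weyl group element).
\<close>

definition dual_weyl_module :: "nat \<Rightarrow> ('k::alg_closed_field mat, 'k) rep" where
  "dual_weyl_module n = Rep (Suc n)
     (\<lambda>A. mat (Suc n) (Suc n) (\<lambda>(i, j).
        coeff ([:A $$ (0, 0), A $$ (1, 0):] ^ (n - j) * [:A $$ (0, 1), A $$ (1, 1):] ^ j) i))"

definition weyl_module :: "nat \<Rightarrow> ('k::alg_closed_field mat, 'k) rep" where
  "weyl_module n = dual_rep SL2 (dual_weyl_module n)"

definition tilting :: "('k::alg_closed_field mat, 'k) rep \<Rightarrow> bool" where
  "tilting V \<longleftrightarrow> rational_rep V \<and>
     has_filtration SL2 (range weyl_module) V \<and> has_filtration SL2 (range dual_weyl_module) V"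

definition is_weight :: "('k::alg_closed_field mat, 'k) rep \<Rightarrow> int \<Rightarrow> bool" where
  "is_weight V m \<longleftrightarrow> (\<exists>v\<in>carrier_vec (deg V). v \<noteq> 0\<^sub>v (deg V) \<and>
     (\<forall>t. t \<noteq> 0 \<longrightarrow> act V (mat2 t 0 0 (inverse t)) *\<^sub>v v = (t powi m) \<cdot>\<^sub>v v))"

definition highest_weight :: "('k::alg_closed_field mat, 'k) rep \<Rightarrow> int \<Rightarrow> bool" where
  "highest_weight V m \<longleftrightarrow> is_weight V m \<and> (\<forall>m'. is_weight V m' \<longrightarrow> m' \<le> m)"

text \<open>
  The indecomposable tilting module \<open>T\<^sub>i\<close> is only determined up to isomorphism;
  the predicate says that \<open>V\<close> is a copy of \<open>T\<^sub>i\<close>.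
\<close>

definition indecomposable_tilting :: "nat \<Rightarrow> ('k::alg_closed_field mat, 'k) rep \<Rightarrow> bool" where
  "indecomposable_tilting i V \<longleftrightarrow>
     tilting V \<and> indecomposable_rep SL2 V \<and> highest_weight V (int i)"

text \<open>The prime subfield is the image of the integers (in positive characteristic).\<close>

definition independent_over_prime_field :: "'k::field \<Rightarrow> 'k \<Rightarrow> bool" where
  "independent_over_prime_field x y \<longleftrightarrow>
     (\<forall>a\<in>range of_int. \<forall>b\<in>range of_int. a * x + b * y = 0 \<longrightarrow> a = 0 \<and> b = 0)"

end

theory Submission
  imports Defs "Jordan_Normal_Form.Char_Poly"
begin

text \<open>
  Let \<open>\<mu> = l\<^sub>2 / l\<^sub>1\<close>, let \<open>x = g\<^sub>1 - 1\<close> and let \<open>y = g\<^sub>2 - (1 + x) ^ \<mu>\<close>, where the binomial series is cut off at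
  \<open>x ^ p\<close>. The group algebra of \<open>E\<close> is \<open>'k[x, y] / (x ^ p, y ^ p)\<close>. The entries of the unipotent matrices acting
  on \<open>\<nabla>(n)\<close> are polynomials in the parameter, and it follows that \<open>y\<close> vanishes on \<open>S = \<nabla>(p - 1)\<close>, which is
  the regular module of \<open>'k[x] / (x ^ p)\<close>, and that \<open>\<nabla>(k * p - 1)\<close> is \<open>'k[x, y] / (x ^ p, y ^ k)\<close> for
  \<open>k \<le> p\<close>. The latter module is self-dual, hence tilting, because no \<open>(k * p - 1) choose i\<close> is divisible by \<open>p\<close>.

  It remains to see that a cyclic summand \<open>'k[x, y] / J\<close> of \<open>S \<otimes> X\<close> has this form. A certain module of
  dimension \<open>2 * p\<close> maps onto the trivial module, and this map splits after tensoring with \<open>S\<close>, hence after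
  tensoring with any summand of \<open>S \<otimes> X\<close>. For a cyclic module the splitting amounts to a
  family of operators on \<open>'k[x, y] / J\<close>, among them a derivation that sends \<open>x\<close> to \<open>1\<close>, and their existence
  forces \<open>J = (x ^ p, y ^ k)\<close>.
\<close>

section \<open>Truncated powers of \<open>1 + x\<close>\<close>

text \<open>The module of dimension \<open>2 * p\<close> answers a defect. Write \<open>c\<close>
  for the truncated power of \<open>1 + x\<close>. Substituting \<open>(1 + x) * (1 + s)\<close> for
  \<open>1 + x\<close> is the natural map from \<open>S\<close> to
  \<open>S \<otimes> 'k[s] / (s ^ p)\<close>. It respects the first generator but not the second,
  because truncated powers multiply only up to an error \<Phi>, which is \<open>s\<close> times an
  element of order \<open>p - 1\<close> in \<open>x\<close> and \<open>s\<close>. Gluing two copies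
  of \<open>'k[s] / (s ^ p)\<close> by \<open>s * \<epsilon>\<close> lets one copy absorb the error
  of the other; what is left has order \<open>2 * p - 1\<close> and vanishes modulo
  \<open>x ^ p\<close> and \<open>s ^ p\<close>.

  In the converse direction a derivation alone cannot suffice: for any polynomial \<open>h\<close>
  in \<open>x\<close>, the ideal \<open>(x ^ p, (y - h) ^ k)\<close> is stable under the derivation
  with \<open>x \<mapsto> 1\<close> and \<open>y \<mapsto> h'\<close>. The derivation leads to
  ideals of this shape, and the higher coefficients in \<open>s\<close> exclude
  \<open>h \<noteq> 0\<close>: if \<open>h\<close> starts with \<open>\<gamma> * x ^ n\<close>, they
  would make the form \<open>((x + s) ^ n - x ^ n)\<^sup>2 / s\<close> of degree
  \<open>2 * n - 1\<close> vanish.\<close>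

definition binom_coeff :: "'k::field \<Rightarrow> nat \<Rightarrow> 'k" where
  "binom_coeff \<mu> j = (\<Prod>i<j. \<mu> - of_nat i) / of_nat (fact j)"

text \<open>The factorial in \<open>binom_coeff\<close> is invertible only for \<open>j < p\<close>,
  which is where the series has to stop.\<close>

definition binom_poly :: "nat \<Rightarrow> 'k::field \<Rightarrow> 'k poly" where
  "binom_poly p \<mu> = (\<Sum>j<p. monom (binom_coeff \<mu> j) j)"

lemma of_nat_neq_0_char:
  assumes "CHAR('k::field) = p" "0 < m" "m < p"
  shows "(of_nat m :: 'k) \<noteq> 0"
  using assms by (auto simp: of_nat_eq_0_iff_char_dvd dest: nat_dvd_not_less)

lemma of_nat_fact_neq_0:
  assumes "CHAR('k::field) = p" "prime p" "m < p"
  shows "(of_nat (fact m) :: 'k) \<noteq> 0"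
  using assms by (auto simp: of_nat_eq_0_iff_char_dvd prime_dvd_fact_iff)

lemma coeff_binom_poly: "coeff (binom_poly p \<mu>) j = (if j < p then binom_coeff \<mu> j else 0)"
proof -
  have "coeff (binom_poly p \<mu>) j = (\<Sum>i<p. if i = j then binom_coeff \<mu> i else 0)"
    by (simp add: binom_poly_def coeff_sum coeff_monom)
  then show ?thesis by simp
qed

lemma binom_coeff_0 [simp]: "binom_coeff \<mu> 0 = 1"
  by (simp add: binom_coeff_def)

lemma binom_coeff_pascal:
  fixes \<mu> :: "'k::field"
  assumes "CHAR('k) = p" "prime p" "Suc j < p"
  shows "binom_coeff (\<mu> + 1) (Suc j) = binom_coeff \<mu> (Suc j) + binom_coeff \<mu> j"
proof -
  have 1: "(\<Prod>i<Suc j. \<mu> + 1 - of_nat i) = (\<mu> + 1) * (\<Prod>i<j. \<mu> - of_nat i)"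
    by (simp add: prod.lessThan_Suc_shift del: prod.lessThan_Suc)
  have nz: "of_nat (fact j) \<noteq> (0::'k)" "of_nat (Suc j) \<noteq> (0::'k)"
    using assms of_nat_fact_neq_0[of p j] of_nat_neq_0_char[of p "Suc j"] by auto
  have f: "(of_nat (fact (Suc j)) :: 'k) = of_nat (Suc j) * of_nat (fact j)"
    by (simp only: fact_Suc of_nat_mult of_nat_id)
  define A where "A = (\<Prod>i<j. \<mu> - of_nat i)"
  have "binom_coeff (\<mu> + 1) (Suc j) = (\<mu> + 1) * A / (of_nat (Suc j) * of_nat (fact j))"
    unfolding binom_coeff_def 1 f A_def ..
  moreover have "binom_coeff \<mu> (Suc j) = A * (\<mu> - of_nat j) / (of_nat (Suc j) * of_nat (fact j))"
    unfolding binom_coeff_def f A_def prod.lessThan_Suc ..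
  moreover have "binom_coeff \<mu> j = A / of_nat (fact j)"
    by (simp add: binom_coeff_def A_def)
  moreover have "A / of_nat (fact j) = of_nat (Suc j) * A / (of_nat (Suc j) * of_nat (fact j))"
    using nz by (simp del: of_nat_Suc)
  ultimately have "binom_coeff (\<mu> + 1) (Suc j) = (\<mu> + 1) * A / (of_nat (Suc j) * of_nat (fact j))"
    "binom_coeff \<mu> (Suc j) + binom_coeff \<mu> j = (A * (\<mu> - of_nat j) + of_nat (Suc j) * A) / (of_nat (Suc j) * of_nat (fact j))"
    by (simp_all only: add_divide_distrib)
  moreover have "(\<mu> + 1) * A = A * (\<mu> - of_nat j) + of_nat (Suc j) * A"
    by (simp add: algebra_simps)
  ultimately show ?thesis by simp
qed

text \<open>Both sides are the falling factorial of length \<open>b + l\<close> divided by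
  \<open>fact b * fact l\<close>; on the right it is split after its first \<open>l\<close>
  factors.\<close>

lemma binom_coeff_absorb:
  fixes \<mu> :: "'k::field"
  assumes "CHAR('k) = p" "prime p" "b + l < p"
  shows "of_nat ((b + l) choose l) * binom_coeff \<mu> (b + l)
    = binom_coeff \<mu> l * binom_coeff (\<mu> - of_nat l) b"
proof -
  have 1: "(\<Prod>i<l+b. \<mu> - of_nat i) = (\<Prod>i<l. \<mu> - of_nat i) * (\<Prod>i<b. \<mu> - of_nat l - of_nat i)" for b
    by (induction b) (simp_all add: algebra_simps)
  have nz: "of_nat (fact b) \<noteq> (0::'k)" "of_nat (fact l) \<noteq> (0::'k)" "of_nat (fact (b+l)) \<noteq> (0::'k)"
    by (rule of_nat_fact_neq_0[of p]; use assms in simp)+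
  have "fact l * fact b * ((b + l) choose l) = (fact (b + l) :: nat)"
    using binomial_fact_lemma[of l "b + l"] by simp
  then have "(of_nat (fact (b + l)) :: 'k) = of_nat (fact l) * of_nat (fact b) * of_nat ((b + l) choose l)"
    by (metis of_nat_mult)
  then show ?thesis using nz 1[of b] unfolding binom_coeff_def by (simp add: divide_simps add.commute[of b l])
qed

text \<open>One of the two summands is a natural number, so Pascal's rule gives an induction on it.
  This is the case that Hasse derivatives ask for, where \<mu> is split as
  \<open>(\<mu> - of_nat l) + of_nat l\<close>.\<close>

lemma binom_coeff_vandermonde:
  fixes \<nu> :: "'k::field"
  assumes "CHAR('k) = p" "prime p" "j < p"
  shows "binom_coeff (\<nu> + of_nat l) j = (\<Sum>a\<le>j. of_nat (l choose a) * binom_coeff \<nu> (j - a))"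
  using assms(3)
proof (induction l arbitrary: j)
  case 0
  have "(\<Sum>a\<le>j. of_nat (0 choose a) * binom_coeff \<nu> (j - a)) = (\<Sum>a\<in>{0}. binom_coeff \<nu> (j - a))"
    by (rule sum.mono_neutral_cong_right) (auto simp: binomial_eq_0)
  then show ?case by simp
next
  case (Suc l)
  show ?case
  proof (cases j)
    case 0 then show ?thesis by simp
  next
    case (Suc i)
    have "binom_coeff (\<nu> + of_nat (Suc l)) j = binom_coeff (\<nu> + of_nat l + 1) (Suc i)"
      by (simp add: Suc algebra_simps)
    also have "\<dots> = binom_coeff (\<nu> + of_nat l) (Suc i) + binom_coeff (\<nu> + of_nat l) i"
      using assms Suc.prems Suc by (intro binom_coeff_pascal) auto
    also have "\<dots> = (\<Sum>a\<le>Suc i. of_nat (l choose a) * binom_coeff \<nu> (Suc i - a))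
        + (\<Sum>a\<le>i. of_nat (l choose a) * binom_coeff \<nu> (i - a))"
      using Suc.IH[of "Suc i"] Suc.IH[of i] Suc.prems Suc by simp
    also have "\<dots> = (\<Sum>a\<le>Suc i. of_nat (Suc l choose a) * binom_coeff \<nu> (Suc i - a))"
      by (simp add: sum.atMost_Suc_shift[of _ i] ring_distribs sum.distrib del: sum.atMost_Suc)
    finally show ?thesis by (simp add: Suc)
  qed
qed

lemma coeff_1_X_power: "coeff ([:1, 1:] ^ l) x = (of_nat (l choose x) :: 'k::comm_semiring_1)"
proof (cases "x \<le> l")
  case False
  then have "degree ([:1, 1:] ^ l :: 'k poly) < x"
    using degree_power_le[of "[:1, 1:] :: 'k poly" l] by (intro le_less_trans[OF degree_power_le]) simp
  with False show ?thesis by (simp add: coeff_eq_0 binomial_eq_0)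
qed (simp add: coeff_linear_poly_power)

text \<open>For \<open>f = (1 + x) ^ \<mu>\<close> and its \<open>l\<close>-th Hasse derivative \<open>D f\<close>, this is the truncation of
  \<open>(1 + x) ^ l * D f = binom_coeff \<mu> l * f\<close>.\<close>

lemma binom_poly_hasse:
  fixes \<mu> :: "'k::field"
  assumes "CHAR('k) = p" "prime p" "l < p"
  shows "monom 1 (p - l) dvd
    Polynomial.smult (coeff (binom_poly p \<mu>) l) (binom_poly p \<mu>) -
    [:1, 1:] ^ l * (\<Sum>i<p. monom (of_nat (i choose l) * binom_coeff \<mu> i) (i - l))"
  unfolding monom_1_dvd_iff'
proof (intro allI impI)
  fix j assume j: "j < p - l"
  \<comment> \<open>Only degrees \<open>j < p - l\<close> are compared; there every index
    \<open>b + l\<close> with \<open>b \<le> j\<close> is below \<open>p\<close>, so the truncation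
    has removed no coefficient that occurs.\<close>
  have c1: "coeff (\<Sum>i<p. monom (of_nat (i choose l) * binom_coeff \<mu> i) (i - l)) b
     = of_nat ((b + l) choose l) * binom_coeff \<mu> (b + l)" if b: "b + l < p" for b
  proof -
    have "coeff (\<Sum>i<p. monom (of_nat (i choose l) * binom_coeff \<mu> i) (i - l)) b
      = (\<Sum>i<p. if i - l = b then of_nat (i choose l) * binom_coeff \<mu> i else 0)"
      by (simp add: coeff_sum coeff_monom)
    also have "\<dots> = (\<Sum>i\<in>{b + l}. of_nat (i choose l) * binom_coeff \<mu> i)"
      by (rule sum.mono_neutral_cong_right) (use b in \<open>auto simp: binomial_eq_0\<close>)
    finally show ?thesis by simp
  qed
  have "coeff ([:1, 1:] ^ l * (\<Sum>i<p. monom (of_nat (i choose l) * binom_coeff \<mu> i) (i - l))) j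
     = (\<Sum>a\<le>j. of_nat (l choose a) * (of_nat ((j - a + l) choose l) * binom_coeff \<mu> (j - a + l)))"
    unfolding coeff_mult using j by (intro sum.cong refl) (simp add: c1 coeff_1_X_power)
  also have "\<dots> = (\<Sum>a\<le>j. of_nat (l choose a) * (binom_coeff \<mu> l * binom_coeff (\<mu> - of_nat l) (j - a)))"
    using j assms by (intro sum.cong refl, subst binom_coeff_absorb) auto
  also have "\<dots> = binom_coeff \<mu> l * binom_coeff (\<mu> - of_nat l + of_nat l) j"
    using j assms by (subst binom_coeff_vandermonde[of p]) (auto simp: sum_distrib_left mult_ac)
  finally show "coeff (Polynomial.smult (coeff (binom_poly p \<mu>) l) (binom_poly p \<mu>) -
    [:1, 1:] ^ l * (\<Sum>i<p. monom (of_nat (i choose l) * binom_coeff \<mu> i) (i - l))) j = 0"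
    using j assms by (simp add: coeff_binom_poly)
qed

section \<open>Ideals, and the filtration by order in \<open>x\<close> and \<open>s\<close>\<close>

locale ideal_filtration =
  fixes J :: "'r::comm_ring_1 set" and x :: 'r and p :: nat
  assumes zero_J: "0 \<in> J" and add_J: "a \<in> J \<Longrightarrow> b \<in> J \<Longrightarrow> a + b \<in> J"
    and mult_J: "a \<in> J \<Longrightarrow> c * a \<in> J"
begin

lemma mult_J': "a \<in> J \<Longrightarrow> a * c \<in> J"
  using mult_J by (simp add: mult.commute)

lemma diff_J: "a \<in> J \<Longrightarrow> b \<in> J \<Longrightarrow> a - b \<in> J"
  using add_J[of a "-1 * b"] mult_J[of b "-1"] by simp

lemma uminus_J: "a \<in> J \<Longrightarrow> - a \<in> J"
  using mult_J[of a "-1"] by simp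

lemma cong_J: "a - b \<in> J \<Longrightarrow> a \<in> J \<longleftrightarrow> b \<in> J"
  using add_J[of "a - b" b] diff_J[of a "a - b"] by auto

lemma sum_J: "(\<And>i. i \<in> A \<Longrightarrow> f i \<in> J) \<Longrightarrow> sum f A \<in> J"
  by (induction A rule: infinite_finite_induct) (auto simp: zero_J intro: add_J)

text \<open>The ideal generated by \<open>J\<close> and \<open>x ^ m\<close>, that is, the
  \<open>m\<close>-th power of \<open>(x)\<close> modulo \<open>J\<close>. Keeping it as a subset of
  the ring avoids quotient rings throughout.\<close>

definition xpow :: "nat \<Rightarrow> 'r set" where
  "xpow m = {a. \<exists>b. a - x ^ m * b \<in> J}"

lemma xpowI: "a - x ^ m * b \<in> J \<Longrightarrow> a \<in> xpow m"
  unfolding xpow_def by blast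

lemma J_xpow: "a \<in> J \<Longrightarrow> a \<in> xpow m"
  by (rule xpowI[of _ _ 0]) simp

lemma xpow_base: "x ^ m * b \<in> xpow m"
  by (rule xpowI[of _ _ b]) (simp add: zero_J)

lemma xpow_0 [simp]: "a \<in> xpow 0"
  by (rule xpowI[of _ _ a]) (simp add: zero_J)

lemma xpow_add: "a \<in> xpow m \<Longrightarrow> b \<in> xpow m \<Longrightarrow> a + b \<in> xpow m"
proof -
  assume "a \<in> xpow m" "b \<in> xpow m"
  then obtain a' b' where "a - x ^ m * a' \<in> J" "b - x ^ m * b' \<in> J" unfolding xpow_def by auto
  from add_J[OF this] show ?thesis by (intro xpowI[of _ _ "a' + b'"]) (simp add: algebra_simps)
qed

lemma xpow_mult: "a \<in> xpow m \<Longrightarrow> b \<in> xpow n \<Longrightarrow> a * b \<in> xpow (m + n)"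
proof -
  assume "a \<in> xpow m" "b \<in> xpow n"
  then obtain a' b' where ab: "a - x ^ m * a' \<in> J" "b - x ^ n * b' \<in> J" unfolding xpow_def by auto
  have "a * b - x ^ (m + n) * (a' * b') = (a - x ^ m * a') * b + x ^ m * a' * (b - x ^ n * b')"
    by (simp add: algebra_simps power_add)
  moreover have "(a - x ^ m * a') * b + x ^ m * a' * (b - x ^ n * b') \<in> J"
    using add_J[OF mult_J'[OF ab(1)] mult_J[OF ab(2)]] by blast
  ultimately show ?thesis by (intro xpowI[of _ _ "a' * b'"]) simp
qed

lemma xpow_mono: "a \<in> xpow n \<Longrightarrow> m \<le> n \<Longrightarrow> a \<in> xpow m"
proof -
  assume "a \<in> xpow n" "m \<le> n"
  then obtain a' where a': "a - x ^ n * a' \<in> J" unfolding xpow_def by auto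
  have "x ^ n = x ^ m * x ^ (n - m)" using \<open>m \<le> n\<close> by (metis le_add_diff_inverse power_add)
  with a' show ?thesis by (intro xpowI[of _ _ "x ^ (n - m) * a'"]) (simp add: mult.assoc)
qed

lemma xpow_scale: "a \<in> xpow m \<Longrightarrow> c * a \<in> xpow m"
  using xpow_mult[of c 0 a m] by simp

lemma xpow_uminus: "a \<in> xpow m \<Longrightarrow> - a \<in> xpow m"
  using xpow_scale[of a m "-1"] by simp

lemma xpow_diff: "a \<in> xpow m \<Longrightarrow> b \<in> xpow m \<Longrightarrow> a - b \<in> xpow m"
  using xpow_add[of a m "- b"] xpow_uminus[of b m] by simp

lemma xpow_cong: "a - b \<in> xpow m \<Longrightarrow> a \<in> xpow m \<longleftrightarrow> b \<in> xpow m"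
  using xpow_add[of "a - b" m b] xpow_diff[of a m "a - b"] by auto

lemma xpow_sum: "(\<And>i. i \<in> A \<Longrightarrow> f i \<in> xpow m) \<Longrightarrow> sum f A \<in> xpow m"
  by (induction A rule: infinite_finite_induct) (auto intro: xpow_add J_xpow zero_J)

text \<open>Polynomials in an auxiliary variable \<open>s\<close>, read modulo \<open>J\<close> and \<open>s ^ p\<close>: those in the \<open>r\<close>-th
  power of the ideal generated by \<open>x\<close> and \<open>s\<close>.\<close>

definition fil :: "nat \<Rightarrow> 'r poly set" where
  "fil r = {Q. \<forall>l<p. coeff Q l \<in> xpow (r - l)}"

definition Js :: "'r poly set" where
  "Js = {Q. \<forall>l<p. coeff Q l \<in> J}"

lemma filD: "Q \<in> fil r \<Longrightarrow> l < p \<Longrightarrow> coeff Q l \<in> xpow (r - l)"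
  unfolding fil_def by auto

lemma Js_fil: "Q \<in> Js \<Longrightarrow> Q \<in> fil r"
  unfolding Js_def fil_def by (auto intro: J_xpow)

lemma fil_0 [simp]: "Q \<in> fil 0"
  unfolding fil_def by auto

lemma fil_add: "Q \<in> fil r \<Longrightarrow> R \<in> fil r \<Longrightarrow> Q + R \<in> fil r"
  unfolding fil_def by (auto intro: xpow_add)

lemma fil_mult:
  assumes "Q \<in> fil r" "R \<in> fil t"
  shows "Q * R \<in> fil (r + t)"
proof -
  have "coeff Q i * coeff R (l - i) \<in> xpow (r + t - l)" if "l < p" "i \<le> l" for l i
    by (rule xpow_mono[OF xpow_mult[OF filD[OF assms(1), of i] filD[OF assms(2), of "l - i"]]])
      (use that in auto)
  then show ?thesis unfolding fil_def by (auto simp: coeff_mult intro!: xpow_sum)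
qed

lemma fil_mono: "Q \<in> fil r \<Longrightarrow> t \<le> r \<Longrightarrow> Q \<in> fil t"
  unfolding fil_def using xpow_mono[of _ "r - l" "t - l" for l] diff_le_mono by fastforce

lemma fil_scale: "Q \<in> fil r \<Longrightarrow> R * Q \<in> fil r"
  using fil_mult[of R 0 Q r] by simp

lemma fil_scale': "Q \<in> fil r \<Longrightarrow> Q * R \<in> fil r"
  using fil_scale by (simp add: mult.commute)

lemma fil_uminus: "Q \<in> fil r \<Longrightarrow> - Q \<in> fil r"
  using fil_scale[of Q r "-1"] by simp

lemma fil_diff: "Q \<in> fil r \<Longrightarrow> R \<in> fil r \<Longrightarrow> Q - R \<in> fil r"
  using fil_add[of Q r "- R"] fil_uminus[of R r] by simp

lemma fil_const: "a \<in> xpow r \<Longrightarrow> [:a:] \<in> fil r"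
  unfolding fil_def by (auto simp: coeff_pCons J_xpow zero_J split: nat.splits)

lemma fil_s: "[:0, 1:] \<in> fil 1"
  unfolding fil_def by (auto simp: coeff_pCons J_xpow zero_J split: nat.splits)

lemma fil_x: "[:x:] \<in> fil 1"
  using xpow_base[of 1 1] by (intro fil_const) simp

lemma fil_power: "Q \<in> fil r \<Longrightarrow> Q ^ n \<in> fil (n * r)"
  by (induction n) (auto intro: fil_mult)

text \<open>Division by \<open>s\<close> moves a coefficient of degree \<open>p\<close>, about which
  the filtration says nothing, to degree \<open>p - 1\<close>. The bound \<open>r \<le> p\<close>
  makes the requirement in degree \<open>p - 1\<close> void.\<close>

lemma fil_divide_s:
  assumes "Q \<in> fil r" "coeff Q 0 = 0" "r \<le> p"
  obtains R where "Q = [:0, 1:] * R" "R \<in> fil (r - 1)"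
proof -
  obtain a R where Q: "Q = pCons a R" by (cases Q)
  have "coeff R l \<in> xpow (r - 1 - l)" if l: "l < p" for l
  proof (cases "Suc l < p")
    case True
    then show ?thesis using filD[OF assms(1) True] Q by simp
  next
    case False
    then show ?thesis using l assms(3) by (metis Suc_diff_eq_diff_pred Suc_lessI diff_is_0_eq less_or_eq_imp_le xpow_0 diff_Suc_eq_diff_pred le_less_trans leI order_le_less_trans not_less)
  qed
  then have "R \<in> fil (r - 1)" unfolding fil_def by auto
  with Q assms(2) that show ?thesis by auto
qed

lemma Js_add: "Q \<in> Js \<Longrightarrow> R \<in> Js \<Longrightarrow> Q + R \<in> Js"
  unfolding Js_def by (auto intro: add_J)

lemma Js_mult: "Q \<in> Js \<Longrightarrow> R * Q \<in> Js"
  unfolding Js_def by (auto simp: coeff_mult intro!: sum_J mult_J)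

lemma Js_ideal: "ideal_filtration Js"
  by unfold_locales (use Js_add Js_mult in \<open>auto simp: Js_def zero_J\<close>)

lemma Js_s_power: "[:0, 1:] ^ p * Q \<in> Js"
proof -
  have "[:0, 1:] ^ p = (monom 1 p :: 'r poly)"
    by (simp add: monom_altdef)
  then show ?thesis by (simp add: Js_def coeff_monom_mult zero_J)
qed

end

section \<open>Multiplying the group element \<open>1 + x\<close> by \<open>1 + s\<close>\<close>

locale binom_shift = ideal_filtration J x p + e: comm_ring_hom e
  for J :: "'r::comm_ring_1 set" and x :: 'r and p :: nat and e :: "'k::field poly \<Rightarrow> 'r" +
  fixes \<mu> :: 'k
  assumes x_def: "x = e [:0, 1:]" and prime_p: "prime p" and char_p: "CHAR('k) = p"
begin

abbreviation c :: "'k poly" where "c \<equiv> binom_poly p \<mu>"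
abbreviation s :: "'r poly" where "s \<equiv> [:0, 1:]"

text \<open>The substitution \<open>1 + x \<mapsto> (1 + x) * (1 + s)\<close>.\<close>

definition shift :: "'k poly \<Rightarrow> 'r poly" where
  "shift q = poly (map_poly (\<lambda>a. [:e [:a:]:]) q) [:x, 1 + x:]"

lemma e_1 [simp]: "e [:1:] = 1"
  using e.hom_one by (simp add: one_pCons)

lemma e_smult: "e (Polynomial.smult a q) = e [:a:] * e q"
  using e.hom_mult[of "[:a:]" q] by simp

text \<open>The polynomial \<open>c\<close> in the variable \<open>s\<close>, the truncation of
  \<open>(1 + s) ^ \<mu>\<close>.\<close>

definition cs :: "'r poly" where
  "cs = map_poly (\<lambda>a. e [:a:]) c"

text \<open>The failure of truncated powers to be multiplicative:
  \<open>(1 + s) ^ \<mu> * (1 + x) ^ \<mu>\<close> minus \<open>((1 + x) * (1 + s)) ^ \<mu>\<close>,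
  where each of the three powers is truncated.\<close>

definition \<Phi> :: "'r poly" where
  "\<Phi> = cs * [:e c:] - shift c"

lemma const_hom: "comm_ring_hom (\<lambda>a. [:e [:a:]:])"
  by unfold_locales (simp_all add: one_pCons flip: e.hom_mult e.hom_add)

lemma shift_hom: "comm_ring_hom shift"
proof -
  interpret h: comm_ring_hom "\<lambda>a. [:e [:a:]:]" by (rule const_hom)
  interpret m: map_poly_comm_ring_hom "\<lambda>a. [:e [:a:]:]" ..
  show ?thesis unfolding shift_def by unfold_locales (simp_all add: m.hom_add m.hom_mult poly_hom.hom_add poly_hom.hom_mult)
qed

sublocale shift: comm_ring_hom shift by (rule shift_hom)

lemma shift_const: "shift [:a:] = [:e [:a:]:]"
  by (cases "a = 0") (simp_all add: shift_def map_poly_pCons)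

lemma shift_x: "shift [:0, 1:] = [:x, 1 + x:]"
  by (simp add: shift_def map_poly_pCons)

lemma shift_smult: "shift (Polynomial.smult a q) = [:e [:a:]:] * shift q"
  using shift.hom_mult[of "[:a:]" q] by (simp add: shift_const)

lemma e_sum: "e q = (\<Sum>i\<le>degree q. e [:coeff q i:] * x ^ i)"
proof -
  have "e q = e (\<Sum>i\<le>degree q. [:coeff q i:] * [:0, 1:] ^ i)"
    by (simp add: poly_as_sum_of_monoms[of q, unfolded monom_altdef])
  then show ?thesis by (simp add: e.hom_sum e_smult e.hom_power x_def)
qed

lemma shift_sum: "shift q = (\<Sum>i\<le>degree q. [:e [:coeff q i:]:] * [:x, 1 + x:] ^ i)"
proof -
  have "shift q = shift (\<Sum>i\<le>degree q. [:coeff q i:] * [:0, 1:] ^ i)"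
    by (simp add: poly_as_sum_of_monoms[of q, unfolded monom_altdef])
  then show ?thesis by (simp add: shift.hom_sum shift_smult shift.hom_power shift_x)
qed

lemma coeff0_power: "coeff (Q ^ n) 0 = coeff Q 0 ^ n"
  by (induction n) (auto simp: coeff_mult)

lemma coeff_shift_0: "coeff (shift q) 0 = e q"
  unfolding shift_sum by (subst e_sum) (simp add: coeff_sum coeff0_power)

lemma coeff_cs: "coeff cs l = (if l < p then e [:binom_coeff \<mu> l:] else 0)"
  by (simp add: cs_def coeff_map_poly coeff_binom_poly)

lemma p_pos: "p > 0" and p_ge_2: "p \<ge> 2"
  using prime_p by (auto simp: prime_gt_0_nat prime_ge_2_nat)

lemma coeff_cs_0: "coeff cs 0 = 1"
  using p_pos by (simp add: coeff_cs)

lemma shift_fil_1: "[:x, 1 + x:] \<in> fil 1"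
proof -
  have "[:x, 1 + x:] = [:x:] + [:1 + x:] * s" by simp
  then show ?thesis using fil_x fil_s fil_scale fil_add by metis
qed

lemma fil_shift: "monom 1 n dvd q \<Longrightarrow> shift q \<in> fil n"
proof -
  assume "monom 1 n dvd q"
  then obtain r where "q = monom 1 n * r" by auto
  then have "shift q = [:x, 1 + x:] ^ n * shift r"
    by (simp add: monom_altdef shift.hom_mult shift.hom_power shift_x)
  then show ?thesis using fil_scale'[OF fil_power[OF shift_fil_1, of n]] by simp
qed

lemma xpow_e: "monom 1 n dvd q \<Longrightarrow> e q \<in> xpow n"
  by (auto elim!: dvdE simp: monom_altdef e.hom_mult e.hom_power x_def[symmetric] xpow_base)

lemma coeff_linear: "coeff ([:a, b:] ^ n) i = of_nat (n choose i) * b ^ i * a ^ (n - i)" for a b :: 'r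
proof (cases "i \<le> n")
  case False
  then have "degree ([:a, b:] ^ n) < i"
    by (intro le_less_trans[OF degree_power_le]) (auto intro: le_less_trans[of _ "1 * n"])
  with False show ?thesis by (simp add: coeff_eq_0 binomial_eq_0)
qed (rule coeff_linear_poly_power)

text \<open>Taylor's formula: since \<open>x\<close> is replaced by \<open>x + (1 + x) * s\<close>,
  the coefficient of \<open>s ^ l\<close> is \<open>(1 + x) ^ l\<close> times the
  \<open>l\<close>-th Hasse derivative of \<open>c\<close>.\<close>

lemma coeff_shift_c:
  assumes "l < p"
  shows "coeff (shift c) l = e ([:1, 1:] ^ l * (\<Sum>i<p. monom (of_nat (i choose l) * binom_coeff \<mu> i) (i - l)))"
proof -
  have c: "c = (\<Sum>i<p. [:binom_coeff \<mu> i:] * [:0, 1:] ^ i)"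
    by (simp add: binom_poly_def monom_altdef)
  have x1: "e [:1, 1:] = 1 + x"
    using e.hom_add[of 1 "[:0, 1:]"] by (simp add: x_def one_pCons)
  have m: "e (monom a i) = e [:a:] * x ^ i" for a i
    using e.hom_mult[of "[:a:]" "[:0, 1:] ^ i"] by (simp add: monom_altdef x_def e.hom_power)
  have n: "e [:of_nat k * a:] = of_nat k * e [:a:]" for k a
    using e.hom_mult[of "of_nat k" "[:a:]"] e.hom_of_nat[of k] by (simp add: of_nat_poly mult.commute)
  have "coeff (shift c) l = (\<Sum>i<p. e [:binom_coeff \<mu> i:] * (of_nat (i choose l) * (1 + x) ^ l * x ^ (i - l)))"
    by (subst c) (simp add: shift.hom_sum shift_smult shift.hom_power shift_x coeff_sum coeff_linear)
  then show ?thesis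
    by (simp add: e.hom_mult e.hom_power x1 e.hom_sum m n sum_distrib_left) (simp add: mult_ac)
qed

lemma coeff_\<Phi>_0: "coeff \<Phi> 0 = 0"
  by (simp add: \<Phi>_def coeff_mult coeff_cs_0 coeff_shift_0)

text \<open>For untruncated series the error would be zero. The coefficient of \<open>s ^ l\<close>
  is the difference in \<open>binom_poly_hasse\<close>, which is divisible by
  \<open>x ^ (p - l)\<close>.\<close>

lemma \<Phi>_fil: "\<Phi> \<in> fil p"
  unfolding fil_def
proof (intro CollectI allI impI)
  fix l assume l: "l < p"
  have "coeff \<Phi> l = e (Polynomial.smult (coeff c l) c - [:1, 1:] ^ l *
      (\<Sum>i<p. monom (of_nat (i choose l) * binom_coeff \<mu> i) (i - l)))"
    using l by (simp add: \<Phi>_def coeff_shift_c coeff_cs coeff_binom_poly e.hom_minus e_smult)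
  then show "coeff \<Phi> l \<in> xpow (p - l)"
    using xpow_e[OF binom_poly_hasse[OF char_p prime_p l]] by simp
qed

text \<open>Elements with constant coefficient \<open>1\<close> are units modulo \<open>s ^ p\<close>.\<close>

lemma Js_inverse:
  assumes "coeff Q 0 = 1"
  obtains R where "Q * R - 1 \<in> Js"
proof -
  obtain a Q' where Q: "1 - Q = pCons a Q'" by (cases "1 - Q")
  then have "a = 0" using assms by (metis coeff_diff coeff_pCons_0 lead_coeff_1 degree_1 diff_self)
  with Q have Q': "1 - Q = s * Q'" by simp
  have "(1 - Q) * (\<Sum>i<p. (1 - Q) ^ i) = (\<Sum>i<p. (1 - Q) ^ i) - (1 - (1 - Q) ^ p)"
    using one_diff_power_eq[of "1 - Q" p] by (simp add: algebra_simps)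
  moreover have "(1 - Q) ^ p = s ^ p * Q' ^ p"
    unfolding Q' by (rule power_mult_distrib)
  ultimately have "Q * (\<Sum>i<p. (1 - Q) ^ i) - 1 = s ^ p * (- (Q' ^ p))"
    by (simp add: algebra_simps)
  then show thesis using Js_s_power that by metis
qed

end

lemma power_add_expand:
  fixes a b :: "'a::comm_ring_1"
  obtains A where "(a + b) ^ n = a ^ n + of_nat n * a ^ (n - 1) * b + b\<^sup>2 * A"
proof -
  have "\<exists>A. (a + b) ^ n = a ^ n + of_nat n * a ^ (n - 1) * b + b\<^sup>2 * A"
  proof (induction n)
    case 0 then show ?case by (intro exI[of _ 0]) simp
  next
    case (Suc n)
    then obtain A where A: "(a + b) ^ n = a ^ n + of_nat n * a ^ (n - 1) * b + b\<^sup>2 * A" by blast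
    have r: "a * (of_nat n * a ^ (n - 1)) = of_nat n * a ^ n"
      by (cases n) (simp_all add: mult_ac)
    have *: "(a + b) * (t + r * b + b\<^sup>2 * A) = a * t + (t + a * r) * b + b\<^sup>2 * (r + (a + b) * A)" for t r
      by (simp add: power2_eq_square algebra_simps)
    have "(a + b) ^ Suc n = a ^ Suc n + of_nat (Suc n) * a ^ n * b + b\<^sup>2 * (of_nat n * a ^ (n - 1) + (a + b) * A)"
      unfolding power_Suc A * r by (simp add: algebra_simps)
    then show ?case unfolding diff_Suc_1 by blast
  qed
  with that show ?thesis by blast
qed

lemma diff_dvd_power_diff: "(a - b :: 'a::comm_ring_1) dvd a ^ n - b ^ n"
proof (induction n)
  case (Suc n)
  have "a ^ Suc n - b ^ Suc n = a * (a ^ n - b ^ n) + (a - b) * b ^ n" by (simp add: algebra_simps)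
  with Suc show ?case by simp
qed simp

text \<open>By symmetry the coefficient is \<open>(p + r) choose r\<close> with
  \<open>r = N - p < p\<close>. Passing from \<open>r\<close> to \<open>r + 1\<close> multiplies it
  by \<open>(p + r + 1) / (r + 1)\<close>, whose numerator is prime to \<open>p\<close> as long as
  \<open>r + 1 < p\<close>.\<close>

lemma not_dvd_choose_prime:
  assumes "prime p" "p \<le> N" "N < 2 * p"
  shows "\<not> p dvd (N choose p)"
proof -
  have "\<not> p dvd ((p + r) choose r)" if "r < p" for r
    using that
  proof (induction r)
    case 0 then show ?case using prime_gt_1_nat[OF assms(1)] by simp
  next
    case (Suc r)
    show ?case
    proof
      assume "p dvd ((p + Suc r) choose Suc r)"
      then have "p dvd Suc r * (Suc (p + r) choose Suc r)"
        unfolding add_Suc_right by (rule dvd_mult)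
      then have "p dvd Suc (p + r) * ((p + r) choose r)"
        by (simp only: Suc_times_binomial)
      then consider "p dvd Suc (p + r)" | "p dvd ((p + r) choose r)"
        using prime_dvd_multD[OF assms(1)] by blast
      then show False
      proof cases
        case 1
        then have "p dvd Suc r" by (metis add_Suc_right dvd_add_triv_left_iff)
        with Suc.prems show False using nat_dvd_not_less[of "Suc r" p] by blast
      next
        case 2
        with Suc show False by simp
      qed
    qed
  qed
  from this[of "N - p"] have "\<not> p dvd (N choose (N - p))" using assms by simp
  then show ?thesis unfolding binomial_symmetric[OF assms(2)] .
qed

text \<open>Polynomials in \<open>x\<close> and \<open>y\<close> are polynomials in the outer
  variable \<open>y\<close> over \<open>'k[x]\<close>; \<open>polyK\<close> embeds the
  scalars.\<close>

definition polyX :: "'k::comm_ring_1 poly poly" where "polyX = [:[:0, 1:]:]"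
definition polyY :: "'k::comm_ring_1 poly poly" where "polyY = [:0, 1:]"
definition polyK :: "'k::comm_ring_1 \<Rightarrow> 'k poly poly" where "polyK a = [:[:a:]:]"

section \<open>Operators on a quotient of \<open>'k[x, y]\<close>\<close>

locale cyclic_core = binom_shift J polyX p "\<lambda>q. [:q:]" \<mu>
  for J :: "'k::field poly poly set" and p :: nat and \<mu> :: 'k +
  fixes u u' :: "'k poly poly poly"
begin

abbreviation X :: "'k poly poly" where "X \<equiv> polyX"
abbreviation y :: "'k poly poly" where "y \<equiv> polyY"
abbreviation K :: "'k \<Rightarrow> 'k poly poly" where "K a \<equiv> polyK a"

text \<open>The image of \<open>y\<close> that makes the second generator \<open>c + y\<close> go to
  \<open>cs * (c + y)\<close>: in the sum with \<open>shift c\<close> the term \<Phi> leaves exactly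
  \<open>cs * c\<close>.\<close>

definition Y :: "'k poly poly poly" where
  "Y = cs * [:y:] + \<Phi>"

text \<open>The ring map behind the diagonal action on a tensor product with
  \<open>'k[s] / (s ^ p)\<close>: it multiplies the generator \<open>1 + x\<close> by
  \<open>1 + s\<close> and the generator \<open>c + y\<close> by \<open>cs\<close>.\<close>

definition d0 :: "'k poly poly \<Rightarrow> 'k poly poly poly" where
  "d0 Q = poly (map_poly shift Q) Y"

text \<open>The part of first order in \<epsilon>: for \<open>\<epsilon>\<^sup>2 = 0\<close>, the
  sum \<open>d0 + \<epsilon> * d1\<close> is the ring map that multiplies \<open>1 + x\<close> by
  \<open>1 + s\<close> and \<open>c + y\<close> by \<open>cs + s * \<epsilon>\<close>.\<close>

definition d1 :: "'k poly poly \<Rightarrow> 'k poly poly poly" where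
  "d1 Q = poly (map_poly shift (pderiv Q)) Y * (s * [:[:c:] + y:])"

lemma d0_hom: "comm_ring_hom d0"
proof -
  interpret m: map_poly_comm_ring_hom shift ..
  show ?thesis unfolding d0_def by unfold_locales (simp_all add: m.hom_add m.hom_mult)
qed

sublocale d0: comm_ring_hom d0 by (rule d0_hom)

lemma d0_pCons: "d0 (pCons a Q) = shift a + Y * d0 Q"
  by (cases "a = 0 \<and> Q = 0") (auto simp: d0_def map_poly_pCons)

lemma d0_const: "d0 [:q:] = shift q"
  using d0_pCons[of q 0] by simp

lemma d0_y: "d0 y = Y"
  using d0_pCons[of 0 1] by (simp add: polyY_def)

lemma coeff_d0_0: "coeff (d0 Q) 0 = Q"
proof (induction Q)
  case (pCons a Q)
  then show ?case
    by (simp add: d0_pCons Y_def coeff_mult coeff_shift_0 coeff_cs_0 coeff_\<Phi>_0 polyY_def)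
qed simp

lemma d1_add: "d1 (A + B) = d1 A + d1 B"
  unfolding d1_def pderiv_add d0_def[symmetric] by (simp add: d0.hom_add algebra_simps)

lemma d1_mult: "d1 (A * B) = d0 A * d1 B + d0 B * d1 A"
  unfolding d1_def pderiv_mult d0_def[symmetric] by (simp add: d0.hom_add d0.hom_mult algebra_simps)

lemma d1_const: "d1 [:q:] = 0"
  unfolding d1_def by (simp add: pderiv_pCons)

lemma d1_y: "d1 y = s * [:[:c:] + y:]"
  unfolding d1_def by (simp add: polyY_def pderiv_pCons d0_def[symmetric] del: mult_pCons_left)

lemma d1_diff: "d1 (A - B) = d1 A - d1 B"
  using d1_add[of "A - B" B] by simp

lemma d1_power: "d1 (A ^ n) = of_nat n * d0 A ^ (n - 1) * d1 A"
proof (induction n)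
  case 0
  then show ?case using d1_const[of 1] by (simp flip: one_pCons)
next
  case (Suc n)
  then show ?case by (cases n) (simp_all add: d1_mult d0.hom_mult d0.hom_power algebra_simps)
qed

lemma coeff_d1_0: "coeff (d1 Q) 0 = 0"
  unfolding d1_def by (simp add: coeff_mult)

lemma K_mult_xpow: "a \<noteq> 0 \<Longrightarrow> K a * Q \<in> xpow n \<longleftrightarrow> Q \<in> xpow n"
proof
  assume "a \<noteq> 0" "K a * Q \<in> xpow n"
  have k: "K (inverse a) * K a = 1" using \<open>a \<noteq> 0\<close> by (simp add: polyK_def)
  have eq: "K (inverse a) * (K a * Q) = Q" unfolding mult.assoc[symmetric] k by (rule mult_1_left)
  have "K (inverse a) * (K a * Q) \<in> xpow n" by (rule xpow_scale) fact
  then show "Q \<in> xpow n" unfolding eq .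
qed (rule xpow_scale)

lemma of_nat_K: "of_nat m = K (of_nat m)"
  unfolding polyK_def of_nat_poly[where ?'a = "'k poly"] of_nat_poly[where ?'a = 'k] ..

lemma of_nat_mult_xpow:
  assumes "\<not> p dvd m"
  shows "of_nat m * Q \<in> xpow n \<longleftrightarrow> Q \<in> xpow n"
  unfolding of_nat_K using assms by (intro K_mult_xpow) (simp add: of_nat_eq_0_iff_char_dvd char_p)

end

lemma coeff_mult_1: "coeff (A * B) (Suc 0) = coeff A 0 * coeff B 1 + coeff A 1 * coeff B 0"
  for A B :: "'a::comm_ring_1 poly"
  by (simp add: coeff_mult)

text \<open>The series \<open>u\<close> and \<open>u'\<close> are the values of the operators
  \<open>J0\<close> and \<open>J1\<close> of a splitting on the generator of a cyclic module with
  annihilator \<open>J\<close>. The assumptions \<open>F0\<close> and \<open>F1\<close> say that the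
  operators \<open>Q \<mapsto> d0 Q * u\<close> and \<open>Q \<mapsto> d0 Q * u' + d1 Q * u\<close>
  are well defined modulo \<open>J\<close>.\<close>

locale cyclic_core_rel = cyclic_core J p \<mu> u u'
  for J :: "'k::field poly poly set" and p :: nat and \<mu> :: 'k and u u' :: "'k poly poly poly" +
  assumes u'_0: "coeff u' 0 = 1" and X_p: "X ^ p \<in> J" and y_p: "y ^ p \<in> J" and one_J: "1 \<notin> J"
    and F0: "F \<in> J \<Longrightarrow> d0 F * u \<in> Js" and F1: "F \<in> J \<Longrightarrow> d0 F * u' + d1 F * u \<in> Js"
begin

lemma xpow_p: "a \<in> xpow p \<longleftrightarrow> a \<in> J"
proof
  assume "a \<in> xpow p"
  then obtain b where "a - X ^ p * b \<in> J" unfolding xpow_def by blast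
  with mult_J'[OF X_p, of b] show "a \<in> J" using cong_J by blast
qed (rule J_xpow)

definition w :: "'k poly poly" where "w = (\<Sum>i<p. (- X) ^ i)"

lemma w: "(1 + X) * w - 1 \<in> J"
proof -
  have "1 - (- X) ^ p = (1 - (- X)) * w"
    unfolding w_def by (rule one_diff_power_eq)
  then have "(1 + X) * w - 1 = - ((- X) ^ p)"
    by (simp add: algebra_simps)
  then have "(1 + X) * w - 1 = - ((-1) ^ p) * X ^ p"
    by (simp add: power_minus[of X])
  then show ?thesis using mult_J[OF X_p] by (simp only:)
qed

text \<open>The coefficients of \<open>s\<close> give a derivation of \<open>'k[x, y] / J\<close> that sends \<open>x\<close> to \<open>1\<close>.\<close>

definition D :: "'k poly poly \<Rightarrow> 'k poly poly" where
  "D Q = w * (coeff (d0 Q) 1 + coeff (d1 Q) 1 * coeff u 0)"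

lemma D_mult: "D (A * B) = A * D B + B * D A"
  unfolding D_def by (simp add: d0.hom_mult d1_mult coeff_mult_1 coeff_d0_0 coeff_d1_0 algebra_simps)

lemma D_diff: "D (A - B) = D A - D B"
  unfolding D_def by (simp add: d0.hom_minus d1_diff algebra_simps)

text \<open>This is the coefficient of \<open>s\<close> in \<open>F1\<close>, less the term
  \<open>F * coeff u' 1\<close>, which lies in \<open>J\<close> anyway.\<close>

lemma D_J: "F \<in> J \<Longrightarrow> D F \<in> J"
proof -
  assume F: "F \<in> J"
  have "coeff (d0 F * u' + d1 F * u) 1 \<in> J"
    using F1[OF F] p_ge_2 unfolding Js_def by auto
  then have "F * coeff u' 1 + coeff (d0 F) 1 + coeff (d1 F) 1 * coeff u 0 \<in> J"
    by (simp add: coeff_mult_1 coeff_d0_0 coeff_d1_0 u'_0)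
  then have "coeff (d0 F) 1 + coeff (d1 F) 1 * coeff u 0 \<in> J"
    using diff_J[OF _ mult_J'[OF F, of "coeff u' 1"]] by (metis add.assoc add_diff_cancel_left')
  then show ?thesis unfolding D_def by (rule mult_J)
qed

lemma d0_X: "d0 X = [:X, 1 + X:]"
  using d0_const[of "[:0, 1:]"] shift_x by (simp only: polyX_def)

lemma d1_X: "d1 X = 0"
  unfolding polyX_def by (rule d1_const)

lemma D_X: "D X - 1 \<in> J"
  using w unfolding D_def by (simp add: d0_X d1_X mult.commute)

lemma D_power: "D (A ^ n) = of_nat n * A ^ (n - 1) * D A"
proof (induction n)
  case 0
  have "D 1 = 0" using D_mult[of 1 1, unfolded mult_1_left] by (metis add_cancel_right_right)
  then show ?case by simp
next
  case (Suc n)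
  then show ?case by (cases n) (simp_all add: D_mult algebra_simps)
qed

lemma D_X_power: "D (X ^ n * Q) - (of_nat n * X ^ (n - 1) * Q + X ^ n * D Q) \<in> J"
proof -
  have "D (X ^ n * Q) - (of_nat n * X ^ (n - 1) * Q + X ^ n * D Q)
    = (D X - 1) * (of_nat n * X ^ (n - 1) * Q)"
    by (simp only: D_mult D_power) (simp add: algebra_simps)
  then show ?thesis using mult_J'[OF D_X] by simp
qed

text \<open>If \<open>X\<close> kills \<open>R = X ^ i * (D ^^ i) Q\<close> modulo \<open>J\<close>,
  then applying \<open>D\<close> to \<open>X * R\<close> gives
  \<open>X ^ (i + 1) * (D ^^ (i + 1)) Q = - (i + 1) * R\<close> modulo \<open>J\<close>. Hence
  \<open>X ^ i * (D ^^ i) Q\<close> is \<open>Q\<close> up to sign and the factor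
  \<open>fact i\<close>, and this factor is still a unit for \<open>i = p - 1\<close>.\<close>

lemma X_cancel_1:
  assumes "X * Q \<in> J"
  shows "Q \<in> xpow (p - 1)"
proof -
  have "X ^ i * (D ^^ i) Q - (-1) ^ i * of_nat (fact i) * Q \<in> J" if "i < p" for i
    using that
  proof (induction i)
    case 0
    then show ?case by (simp add: zero_J)
  next
    case (Suc i)
    define R where "R = X ^ i * (D ^^ i) Q"
    define T where "T = (-1) ^ i * of_nat (fact i) * Q"
    have RT: "R - T \<in> J" using Suc unfolding R_def T_def by simp
    have "X * T \<in> J" using mult_J[OF assms, of "(-1) ^ i * of_nat (fact i)"] by (simp add: T_def mult_ac)
    then have "X * R \<in> J" using mult_J[OF RT, of X] cong_J[of "X * R" "X * T"]
      by (simp only: right_diff_distrib)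
    from D_J[OF this] have 1: "X * D R + R * D X \<in> J" by (simp only: D_mult)
    have 2: "X * (D R - (of_nat i * X ^ (i - 1) * (D ^^ i) Q + X ^ i * (D ^^ Suc i) Q)) \<in> J"
      using D_X_power[of i "(D ^^ i) Q"] unfolding R_def funpow.simps comp_def by (rule mult_J)
    have 3: "R * (D X - 1) \<in> J" using D_X by (rule mult_J)
    have 4: "X * (of_nat i * X ^ (i - 1) * (D ^^ i) Q) = of_nat i * R"
      unfolding R_def by (cases i) (simp_all only: power_0 of_nat_0 mult_zero_left mult_zero_right power_Suc diff_Suc_1 mult_ac)
    define V where "V = of_nat i * X ^ (i - 1) * (D ^^ i) Q"
    define U where "U = X ^ i * (D ^^ Suc i) Q"
    have "(X * D R + R * D X) - X * (D R - (V + U)) - R * (D X - 1) = R + X * V + X * U"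
      by (simp add: algebra_simps)
    also have "\<dots> = of_nat (Suc i) * R + X * U"
      unfolding 4[folded V_def] by (simp add: algebra_simps)
    finally have a: "of_nat (Suc i) * R + X * U - of_nat (Suc i) * (R - T)
       = (X * D R + R * D X) - X * (D R - (V + U)) - R * (D X - 1) - of_nat (Suc i) * (R - T)"
      by simp
    have b: "(X * D R + R * D X) - X * (D R - (V + U)) - R * (D X - 1) - of_nat (Suc i) * (R - T) \<in> J"
      using diff_J[OF diff_J[OF diff_J[OF 1 2[folded V_def U_def]] 3] mult_J[OF RT, of "of_nat (Suc i)"]] .
    have c: "of_nat (Suc i) * R + X * U - of_nat (Suc i) * (R - T)
       = X ^ Suc i * (D ^^ Suc i) Q - (-1) ^ Suc i * of_nat (fact (Suc i)) * Q"
      unfolding T_def U_def fact_Suc of_nat_mult of_nat_id power_Suc by (simp add: algebra_simps)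
    show ?case using b unfolding a[symmetric] c .
  qed
  from this[of "p - 1"] have "X ^ (p - 1) * (D ^^ (p - 1)) Q - (-1) ^ (p - 1) * of_nat (fact (p - 1)) * Q \<in> J"
    using p_pos by simp
  then have "X ^ (p - 1) * (D ^^ (p - 1)) Q - (-1) ^ (p - 1) * of_nat (fact (p - 1)) * Q \<in> xpow (p - 1)"
    by (rule J_xpow)
  then have "(-1) ^ (p - 1) * (of_nat (fact (p - 1)) * Q) \<in> xpow (p - 1)"
    unfolding mult.assoc using xpow_cong xpow_base by blast
  then have "(-1) ^ (p - 1) * ((-1) ^ (p - 1) * (of_nat (fact (p - 1)) * Q)) \<in> xpow (p - 1)"
    by (rule xpow_scale)
  then have "of_nat (fact (p - 1)) * Q \<in> xpow (p - 1)"
    by (simp add: mult.assoc[symmetric] power_mult_distrib[symmetric])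
  moreover have "\<not> p dvd fact (p - 1)"
    using prime_dvd_fact_iff[OF prime_p, of "p - 1"] p_pos by auto
  ultimately show ?thesis using of_nat_mult_xpow by blast
qed

text \<open>In other words, the quotient by \<open>J\<close> is free over
  \<open>'k[x] / (x ^ p)\<close>: elements killed by a power of \<open>x\<close> are divisible by
  the complementary power.\<close>

lemma X_power_cancel: "X ^ e * Q \<in> J \<Longrightarrow> e \<le> p \<Longrightarrow> Q \<in> xpow (p - e)"
proof (induction e arbitrary: Q)
  case 0
  then show ?case by (simp add: J_xpow)
next
  case (Suc e)
  have "X ^ e * Q \<in> xpow (p - 1)" by (rule X_cancel_1) (use Suc.prems in \<open>simp only: power_Suc mult.assoc\<close>)
  then obtain R where R: "X ^ e * Q - X ^ (p - 1) * R \<in> J" unfolding xpow_def by blast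
  have "X ^ (p - 1) = X ^ e * X ^ (p - 1 - e)"
    using Suc.prems by (simp flip: power_add)
  with R have "X ^ e * (Q - X ^ (p - 1 - e) * R) \<in> J" by (simp only: right_diff_distrib mult.assoc)
  from Suc.IH[OF this] Suc.prems have "Q - X ^ (p - 1 - e) * R \<in> xpow (p - e)" by simp
  then have "Q - X ^ (p - 1 - e) * R \<in> xpow (p - 1 - e)" by (rule xpow_mono) simp
  then show ?case using xpow_cong xpow_base by fastforce
qed

lemma xpow_cancel:
  assumes "X ^ e * Q \<in> xpow n" "e \<le> n" "n \<le> p"
  shows "Q \<in> xpow (n - e)"
proof -
  obtain R where R: "X ^ e * Q - X ^ n * R \<in> J" using assms unfolding xpow_def by blast
  have "X ^ n = X ^ e * X ^ (n - e)" using assms by (simp flip: power_add)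
  with R have "X ^ e * (Q - X ^ (n - e) * R) \<in> J" by (simp only: right_diff_distrib mult.assoc)
  from X_power_cancel[OF this] assms have "Q - X ^ (n - e) * R \<in> xpow (p - e)" by simp
  then have "Q - X ^ (n - e) * R \<in> xpow (n - e)" by (rule xpow_mono) (use assms in simp)
  then show ?thesis using xpow_cong xpow_base by blast
qed

end

section \<open>The exponent of \<open>y\<close>, and a better second variable\<close>

context cyclic_core_rel
begin

lemma X_xpow_1: "X * Q \<in> xpow 1"
  using xpow_base[of 1 Q] by simp

lemma one_not_xpow: "1 \<notin> xpow 1"
proof
  assume "1 \<in> xpow 1"
  then obtain b where b: "1 - X * b \<in> J" unfolding xpow_def by auto
  have "1 - (X * b) ^ p = (1 - X * b) * (\<Sum>i<p. (X * b) ^ i)"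
    by (rule one_diff_power_eq)
  then have "1 - X ^ p * b ^ p \<in> J" using mult_J'[OF b] by (simp only: power_mult_distrib)
  from add_J[OF this mult_J'[OF X_p, of "b ^ p"]] have "1 \<in> J" by (simp only: diff_add_cancel)
  with one_J show False ..
qed

text \<open>The quotient by \<open>J\<close> and \<open>x\<close> is
  \<open>'k[y] / (y ^ rank)\<close>. This is the exponent \<open>k\<close> of the final description
  of \<open>J\<close>.\<close>

definition rank :: nat where "rank = (LEAST k. y ^ k \<in> xpow 1)"

lemma y_rank: "y ^ rank \<in> xpow 1"
  unfolding rank_def by (rule LeastI[of _ p]) (rule J_xpow[OF y_p])

lemma rank_le: "rank \<le> p"
  unfolding rank_def by (rule Least_le) (rule J_xpow[OF y_p])

lemma y_power_not: "j < rank \<Longrightarrow> y ^ j \<notin> xpow 1"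
  unfolding rank_def by (rule not_less_Least)

lemma rank_pos: "rank > 0"
  using y_rank one_not_xpow by (cases rank) auto

lemma poly2_split:
  obtains a q R where "Q = K a + X * q + y * R"
proof -
  obtain f R where Q: "Q = pCons f R" by (cases Q)
  obtain a q where f: "f = pCons a q" by (cases f)
  have "Q = K a + X * [:q:] + y * R"
    by (simp add: Q f polyK_def polyX_def polyY_def)
  with that show thesis by blast
qed

lemma K_0: "K 0 = 0"
  by (simp add: polyK_def)

text \<open>If \<open>a \<noteq> 0\<close>, then \<open>K a + y * R\<close> is a unit, because
  \<open>y\<close> is nilpotent modulo \<open>J\<close>. Then \<open>y ^ j\<close> itself would lie
  in \<open>xpow 1\<close>, against the minimality of \<open>rank\<close>.\<close>

lemma const_coeff_0:
  assumes "y ^ j * (K a + y * R) \<in> xpow 1" "j < rank"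
  shows "a = 0"
proof (rule ccontr)
  assume a: "a \<noteq> 0"
  define b where "b = K (inverse a)"
  have ba: "b * K a = 1" using a by (simp add: b_def polyK_def)
  define n where "n = - (b * (y * R))"
  have "b * (y ^ j * (K a + y * R)) = y ^ j * (b * K a + b * (y * R))"
    by (simp only: distrib_left mult_ac)
  also have "\<dots> = y ^ j * (1 - n)" unfolding ba n_def by simp
  finally have 1: "y ^ j * (1 - n) \<in> xpow 1" using xpow_scale[OF assms(1), of b] by (simp only:)
  have "1 - n ^ p = (1 - n) * (\<Sum>i<p. n ^ i)" by (rule one_diff_power_eq)
  then have "y ^ j * (1 - n ^ p) = (\<Sum>i<p. n ^ i) * (y ^ j * (1 - n))" by (simp only: mult_ac)
  with xpow_scale[OF 1] have 2: "y ^ j * (1 - n ^ p) \<in> xpow 1" by (simp only:)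
  have "n ^ p = y ^ p * (- (b * R)) ^ p" unfolding power_mult_distrib[symmetric] n_def
    by (rule arg_cong[of _ _ "\<lambda>t. t ^ p"]) (simp add: mult_ac)
  then have "n ^ p \<in> J" using mult_J'[OF y_p] by (simp only:)
  then have "y ^ j * n ^ p \<in> xpow 1" by (intro J_xpow mult_J)
  from xpow_add[OF 2 this] have "y ^ j \<in> xpow 1" by (simp add: algebra_simps)
  with y_power_not[OF assms(2)] show False ..
qed

text \<open>The constant coefficient is peeled off \<open>j\<close> times, and it is zero each time
  by \<open>const_coeff_0\<close>. The resulting equation holds in the polynomial ring itself, so
  that it can be read modulo two different ideals in \<open>J_subset\<close>.\<close>

lemma xpow_1_expand:
  assumes "y ^ i * Q \<in> xpow 1" "i + j \<le> rank"
  obtains R S where "Q = y ^ j * R + X * S"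
proof -
  have "\<exists>R S. Q = y ^ j * R + X * S" using assms(2)
  proof (induction j)
    case 0
    then show ?case by (intro exI[of _ Q] exI[of _ 0]) simp
  next
    case (Suc j)
    then obtain R S where Q: "Q = y ^ j * R + X * S" by auto
    obtain a q R' where R: "R = K a + X * q + y * R'" by (rule poly2_split)
    have "y ^ i * Q - X * (y ^ i * S + y ^ (i + j) * q) = y ^ (i + j) * (K a + y * R')"
      unfolding Q R by (simp add: algebra_simps power_add)
    with xpow_diff[OF assms(1) X_xpow_1] have "y ^ (i + j) * (K a + y * R') \<in> xpow 1" by metis
    then have "a = 0" by (rule const_coeff_0) (use Suc.prems in simp)
    then have "Q = y ^ Suc j * R' + X * (S + y ^ j * q)"
      unfolding Q R by (simp add: algebra_simps K_0)
    then show ?case by blast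
  qed
  with that show thesis by blast
qed

lemma K_X_power: "K a * X ^ m = [:monom a m:]"
  unfolding polyK_def polyX_def poly_const_pow monom_altdef by simp

lemma X_div: "poly h 0 = 0 \<Longrightarrow> \<exists>q. [:h:] = X * q"
proof -
  assume "poly h 0 = 0"
  then obtain q where "h = pCons 0 q" by (cases h) auto
  then show ?thesis by (intro exI[of _ "[:q:]"]) (simp add: polyX_def)
qed

lemma y_minus_power:
  assumes "poly h 0 = 0"
  shows "(y - [:h:]) ^ n - y ^ n \<in> xpow 1"
proof -
  obtain q where q: "[:h:] = X * q" using X_div[OF assms] by blast
  have "(y - [:h:]) - y dvd (y - [:h:]) ^ n - y ^ n" by (rule diff_dvd_power_diff)
  then obtain r where "(y - [:h:]) ^ n - y ^ n = - [:h:] * r" 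
    by (auto elim!: dvdE)
  also have "- [:h:] * r = X * (- q * r)" unfolding q by (simp only: mult_minus_left mult_minus_right mult.assoc)
  finally show ?thesis using X_xpow_1 by (simp only:)
qed

text \<open>The derivation forces the leading coefficient of \<open>(y - h) ^ k\<close> with respect to \<open>x\<close> to be a
  multiple of \<open>y ^ (k - 1)\<close>, so that it can be removed by a change of \<open>h\<close>.\<close>

lemma complete_power:
  assumes "rank < p"
  obtains h where "poly h 0 = 0" "(y - [:h:]) ^ rank \<in> J"
proof -
  have "\<exists>h. poly h 0 = 0 \<and> (y - [:h:]) ^ rank \<in> xpow m" if "1 \<le> m" "m \<le> p" for m
    using that
  proof (induction m rule: dec_induct)
    case base
    then show ?case using y_rank by (intro exI[of _ 0]) simp
  next
    case (step m)
    then obtain h where h: "poly h 0 = 0" "(y - [:h:]) ^ rank \<in> xpow m" by auto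
    define \<eta> where "\<eta> = y - [:h:]"
    obtain r where r: "\<eta> ^ rank - X ^ m * r \<in> J" using h(2) unfolding xpow_def \<eta>_def by blast
    have "D (\<eta> ^ rank - X ^ m * r) \<in> J" by (rule D_J[OF r])
    then have 1: "of_nat rank * \<eta> ^ (rank - 1) * D \<eta> - D (X ^ m * r) \<in> J" by (simp only: D_diff D_power)
    \<comment> \<open>Multiplying the derived relation by \<eta> turns its first term into a
      multiple of \<open>\<eta> ^ rank\<close>, which lies in \<open>xpow m\<close>. What remains is
      \<open>m * X ^ (m - 1) * \<eta> * r\<close>, and \<open>m < p\<close> is invertible, so
      \<open>\<eta> * r\<close> is divisible by \<open>X\<close>.\<close>
    have "\<eta> * (of_nat rank * \<eta> ^ (rank - 1) * D \<eta>) = (of_nat rank * D \<eta>) * \<eta> ^ rank"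
      using rank_pos by (cases rank) (simp_all add: mult_ac)
    moreover have "\<eta> ^ rank \<in> xpow m" using h(2) unfolding \<eta>_def .
    ultimately have "\<eta> * (of_nat rank * \<eta> ^ (rank - 1) * D \<eta>) \<in> xpow m"
      using xpow_scale by (simp only:)
    with xpow_cong[OF J_xpow[OF mult_J[OF 1, of \<eta>], of m, unfolded right_diff_distrib]]
    have "\<eta> * D (X ^ m * r) \<in> xpow m" by blast
    with xpow_cong[OF J_xpow[OF mult_J[OF D_X_power[of m r], of \<eta>], of m, unfolded right_diff_distrib]]
    have 2: "\<eta> * (of_nat m * X ^ (m - 1) * r + X ^ m * D r) \<in> xpow m" by blast
    have "\<eta> * (of_nat m * X ^ (m - 1) * r + X ^ m * D r) - X ^ m * (\<eta> * D r) = of_nat m * (X ^ (m - 1) * (\<eta> * r))"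
      by (simp add: algebra_simps)
    with xpow_diff[OF 2 xpow_base[of m "\<eta> * D r"]] have "of_nat m * (X ^ (m - 1) * (\<eta> * r)) \<in> xpow m" by (simp only:)
    moreover have "\<not> p dvd m" using step by (auto dest: dvd_imp_le)
    ultimately have "X ^ (m - 1) * (\<eta> * r) \<in> xpow m" using of_nat_mult_xpow by blast
    then have "\<eta> * r \<in> xpow (m - (m - 1))" by (rule xpow_cancel) (use step in auto)
    then have 3: "\<eta> * r \<in> xpow 1" using step by simp
    obtain q where q: "[:h:] = X * q" using X_div[OF h(1)] by blast
    have "y ^ 1 * r = \<eta> * r + X * (q * r)" unfolding \<eta>_def q by (simp add: algebra_simps)
    with xpow_add[OF 3 X_xpow_1[of "q * r"]] have "y ^ 1 * r \<in> xpow 1" by (simp only:)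
    then obtain R S where RS: "r = y ^ (rank - 1) * R + X * S"
      by (rule xpow_1_expand[where j = "rank - 1"]) (use rank_pos in simp)
    obtain a b R' where R: "R = K a + X * b + y * R'" by (rule poly2_split)
    \<comment> \<open>To first order, replacing \<eta> by \<open>\<eta> - t\<close> changes
      \<open>\<eta> ^ rank\<close> by \<open>- rank * \<eta> ^ (rank - 1) * t\<close>, and this has
      to cancel the leading part \<open>X ^ m * K a * \<eta> ^ (rank - 1)\<close>. The division is
      possible because \<open>rank < p\<close>.\<close>
    define t where "t = K (a / of_nat rank) * X ^ m"
    have rk: "(of_nat rank :: 'k) \<noteq> 0"
      using assms rank_pos by (intro of_nat_neq_0_char[OF char_p]) auto
    have rK: "of_nat rank * K (a / of_nat rank) = K a"
      unfolding of_nat_K using rk by (simp add: polyK_def)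
    have t: "of_nat rank * \<eta> ^ (rank - 1) * t = X ^ m * (K a * \<eta> ^ (rank - 1))"
    proof -
      have "of_nat rank * \<eta> ^ (rank - 1) * t = X ^ m * ((of_nat rank * K (a / of_nat rank)) * \<eta> ^ (rank - 1))"
        unfolding t_def by (simp only: mult_ac)
      then show ?thesis unfolding rK .
    qed
    have "y ^ (rank - 1) * y = y ^ rank"
      using rank_pos by (cases rank) simp_all
    moreover have "r - K a * \<eta> ^ (rank - 1) = X * (S + y ^ (rank - 1) * b) + R' * (y ^ (rank - 1) * y)
        - K a * (\<eta> ^ (rank - 1) - y ^ (rank - 1))"
      unfolding RS R by (simp add: algebra_simps)
    ultimately have "r - K a * \<eta> ^ (rank - 1) = X * (S + y ^ (rank - 1) * b) + R' * y ^ rank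
        - K a * (\<eta> ^ (rank - 1) - y ^ (rank - 1))"
      by (simp only:)
    moreover have "X * (S + y ^ (rank - 1) * b) + R' * y ^ rank
        - K a * (\<eta> ^ (rank - 1) - y ^ (rank - 1)) \<in> xpow 1"
      unfolding \<eta>_def using y_minus_power[OF h(1)] y_rank
      by (intro xpow_add xpow_diff X_xpow_1) (simp_all only: xpow_scale)
    ultimately have 4: "r - K a * \<eta> ^ (rank - 1) \<in> xpow 1" by (simp only:)
    have 5: "X ^ m * (r - K a * \<eta> ^ (rank - 1)) \<in> xpow (m + 1)"
      using xpow_mult[OF xpow_base[of m 1] 4] by simp
    obtain A where A: "(\<eta> + - t) ^ rank = \<eta> ^ rank + of_nat rank * \<eta> ^ (rank - 1) * - t + (- t)\<^sup>2 * A"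
      by (rule power_add_expand)
    have "t \<in> xpow m" unfolding t_def by (intro xpow_scale) (use xpow_base[of m 1] in simp)
    then have "t * t \<in> xpow (m + m)" by (intro xpow_mult)
    then have "t * t \<in> xpow (m + 1)" by (rule xpow_mono) (use step in simp)
    then have "(A * t) * t \<in> xpow (m + 1)" unfolding mult.assoc by (rule xpow_scale)
    then have 6: "(- t)\<^sup>2 * A \<in> xpow (m + 1)" by (simp only: power2_eq_square minus_mult_minus mult_ac)
    have "(\<eta> + - t) ^ rank = (\<eta> ^ rank - X ^ m * r) + X ^ m * (r - K a * \<eta> ^ (rank - 1)) + (- t)\<^sup>2 * A"
      unfolding A mult_minus_right t by (simp add: right_diff_distrib)
    then have "(\<eta> + - t) ^ rank \<in> xpow (m + 1)"
      using xpow_add[OF xpow_add[OF J_xpow[OF r] 5] 6] by (simp only:)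
    moreover have "t = [:monom (a / of_nat rank) m:]"
      unfolding t_def by (rule K_X_power)
    then have "\<eta> + - t = y - ([:h:] + [:monom (a / of_nat rank) m:])" unfolding \<eta>_def by (simp only: diff_diff_add add_uminus_conv_diff)
    then have "\<eta> + - t = y - [:h + monom (a / of_nat rank) m:]" by (simp only: add_pCons add_0_left)
    moreover have "poly (h + monom (a / of_nat rank) m) 0 = 0" using h(1) step by (simp add: poly_monom)
    ultimately show ?case unfolding Suc_eq_plus1 by (intro exI[of _ "h + monom (a / of_nat rank) m"]) (simp only: simp_thms)
  qed
  from this[of p] show thesis using p_pos that xpow_p by auto
qed

end

section \<open>The second variable is \<open>y\<close> itself\<close>

context cyclic_core_rel
begin

lemma const_Js: "a \<in> J \<Longrightarrow> [:a:] \<in> Js"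
  unfolding Js_def by (auto simp: coeff_pCons zero_J split: nat.splits)

lemma coeff_s_mult: "coeff (s * Q) (Suc l) = coeff Q l"
  by simp

lemma zero_fil [simp]: "0 \<in> fil r"
  by (rule Js_fil) (simp add: Js_def zero_J)

lemma fil_power_diff:
  assumes "a \<in> fil 1" "b \<in> fil 1" "a - b \<in> fil 2"
  shows "a ^ n - b ^ n \<in> fil (n + 1)"
proof (induction n)
  case (Suc n)
  have "a ^ Suc n - b ^ Suc n = a * (a ^ n - b ^ n) + (a - b) * b ^ n" by (simp add: algebra_simps)
  moreover have "a * (a ^ n - b ^ n) \<in> fil (1 + (n + 1))" by (rule fil_mult[OF assms(1) Suc])
  moreover have "(a - b) * b ^ n \<in> fil (2 + n * 1)" by (rule fil_mult[OF assms(3) fil_power[OF assms(2)]])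
  ultimately show ?case using fil_add[of "a * (a ^ n - b ^ n)" "Suc n + 1" "(a - b) * b ^ n"] by simp
qed simp

lemma unit_cancel_fil:
  assumes "coeff Q 0 = 1" "Q * A \<in> fil r"
  shows "A \<in> fil r"
proof -
  obtain R where R: "Q * R - 1 \<in> Js" by (rule Js_inverse[OF assms(1)])
  have "A = R * (Q * A) - (Q * R - 1) * A" by (simp add: algebra_simps)
  moreover have "(Q * R - 1) * A \<in> fil r" by (rule fil_scale'[OF Js_fil[OF R]])
  ultimately show ?thesis using fil_diff[OF fil_scale[OF assms(2), of R]] by metis
qed

text \<open>Of the three terms of the square only \<open>[:X, 1:] ^ (2 * n)\<close> has degree above
  \<open>n\<close> in \<open>s\<close>.\<close>

lemma coeff_square_diff:
  assumes "1 \<le> n" "n < m"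
  shows "coeff (([:X, 1:] ^ n - [:X:] ^ n)\<^sup>2) m = of_nat ((2 * n) choose m) * X ^ (2 * n - m)"
proof -
  have "([:X, 1:] ^ n - [:X:] ^ n)\<^sup>2 = [:X, 1:] ^ (2 * n) - [:2 * X ^ n:] * [:X, 1:] ^ n + [:X ^ (2 * n):]"
  proof -
    have "[:f:] * [:f:] = [:f * f:]" "[:f:] + [:f:] = [:2 * f:]" for f :: "'k poly poly"
      by (simp_all only: mult_pCons_left mult_zero_left smult_pCons smult_0_right pCons_0_0 add_0_right add_pCons mult_2 add_0_left)
    then have c: "[:X:] ^ n = [:X ^ n:]" "[:X ^ n:] * [:X ^ n:] = [:X ^ (2 * n):]" "[:X ^ n:] + [:X ^ n:] = [:2 * X ^ n:]"
      unfolding poly_const_pow mult_2[of n] power_add by blast+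
    have "(a - b)\<^sup>2 = a * a - (b + b) * a + b * b" for a b :: "'k poly poly poly"
      by (simp add: power2_eq_square algebra_simps)
    from this[of "[:X, 1:] ^ n" "[:X ^ n:]"] show ?thesis
      unfolding c by (simp only: mult_2 power_add)
  qed
  moreover have "coeff ([:2 * X ^ n:] * [:X, 1:] ^ n) m = 0"
    using assms by (simp add: coeff_linear binomial_eq_0)
  moreover have "coeff [:X ^ (2 * n):] m = 0"
    using assms by (simp add: coeff_pCons split: nat.splits)
  ultimately show ?thesis by (simp add: coeff_linear)
qed

text \<open>The series \<open>s * e\<^sup>2\<close> is homogeneous of degree
  \<open>2 * n - 1\<close> in \<open>x\<close> and \<open>s\<close>, so lying one order deeper
  forces \<open>q\<close> to vanish modulo \<open>x\<close>. The coefficient to look at is that of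
  \<open>s ^ (m - 1)\<close> with \<open>m = min (2 * n) p\<close>: as \<open>m > n\<close>, it is
  the single term \<open>((2 * n) choose m) * X ^ (2 * n - m)\<close>, its binomial coefficient is
  prime to \<open>p\<close>, and \<open>2 * n - m < p\<close> allows the power of \<open>X\<close>
  to be cancelled.\<close>

lemma leading_term_contradiction:
  assumes n: "1 \<le> n" "n < p" and e: "[:X, 1:] ^ n - [:X:] ^ n = s * e"
    and q: "[:q:] * (s * e\<^sup>2) \<in> fil (2 * n)"
  shows "q \<in> xpow 1"
proof -
  define m where "m = min (2 * n) p"
  define l where "l = m - 1"
  have m: "n < m" "m \<le> p" "m \<le> 2 * n" "2 * n - m < p" "l < p" "m = Suc l"
    using n unfolding m_def l_def by auto
  have C: "\<not> p dvd ((2 * n) choose m)"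
    using not_dvd_choose_prime[OF prime_p, of "2 * n"] n prime_gt_1_nat[OF prime_p]
    by (cases "2 * n < p") (auto simp: m_def min_def)
  have "s * (s * e\<^sup>2) = (s * e)\<^sup>2" by (simp only: power2_eq_square mult_ac)
  also have "\<dots> = ([:X, 1:] ^ n - [:X:] ^ n)\<^sup>2" by (simp only: e)
  finally have "coeff (s * (s * e\<^sup>2)) m = of_nat ((2 * n) choose m) * X ^ (2 * n - m)"
    using coeff_square_diff[OF n(1) m(1)] by (simp only:)
  then have "coeff (s * e\<^sup>2) l = of_nat ((2 * n) choose m) * X ^ (2 * n - m)"
    unfolding m(6) coeff_s_mult .
  then have "coeff ([:q:] * (s * e\<^sup>2)) l = of_nat ((2 * n) choose m) * (X ^ (2 * n - m) * q)"
    by (simp only: mult_pCons_left coeff_add coeff_smult pCons_0_0 coeff_0 add_0_right mult_zero_left mult_ac)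
  with filD[OF q m(5)] have "of_nat ((2 * n) choose m) * (X ^ (2 * n - m) * q) \<in> xpow (2 * n - l)"
    by (simp only:)
  then have "X ^ (2 * n - m) * q \<in> xpow (2 * n - l)" using of_nat_mult_xpow[OF C] by blast
  then have "q \<in> xpow (2 * n - l - (2 * n - m))" by (rule xpow_cancel) (use m n in auto)
  then show ?thesis using m by simp
qed

text \<open>Let \<open>T = d0 \<eta>\<close>. Applied to \<open>\<eta> ^ rank\<close>, the relations
  \<open>F0\<close> and \<open>F1\<close> become \<open>T ^ rank * z = 0\<close> and
  \<open>T ^ rank = rank * T ^ (rank - 1) * s * z\<close> for one unknown series \<open>z\<close>.
  Here \<open>T = cs * \<eta> + s * \<Psi>1\<close>, and \<open>(cs * \<eta>) ^ rank = 0\<close>. To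
  leading order the second relation says \<open>N * s * \<Psi>1 = N * s * z\<close> and the first
  says \<open>N * s * \<Psi>1 * z = 0\<close>, so \<open>N * s * \<Psi>1\<^sup>2\<close> vanishes in
  its lowest degree. As \<open>\<Psi>1\<close> starts with \<open>- \<gamma> * e\<close>, where
  \<open>s * e = (x + s) ^ n - x ^ n\<close>, this makes \<open>\<eta> ^ (rank - 1)\<close>
  divisible by \<open>x\<close>, against the minimality of \<open>rank\<close>.\<close>

lemma change_of_variable_trivial:
  assumes rank: "rank < p" and n: "1 \<le> n" "n < p" and h: "h = monom \<gamma> n + monom 1 (Suc n) * h2"
    and \<gamma>: "\<gamma> \<noteq> 0" and J: "(y - [:h:]) ^ rank \<in> J"
  shows False
proof -
  define \<eta> where "\<eta> = y - [:h:]"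
  define G where "G = [:[:c:] + y:]"
  define \<sigma> where "\<sigma> = s"
  define hc where "hc = [:[:h:]:]"
  define g where "g = [:K \<gamma>:]"
  define x0 where "x0 = [:X:]"
  define x1 where "x1 = [:X, 1 + X:]"
  define E where "E = [:X, 1:]"
  define \<Psi> where "\<Psi> = cs * hc + \<Phi> - shift h"
  \<comment> \<open>The initial form of \<Psi> is \<open>- \<gamma> * ((x + s) ^ n - x ^ n)\<close>,
    and \<open>W\<close> is the remainder, of order \<open>n + 1\<close>.\<close>
  define W where "W = \<Psi> + g * (E ^ n - x0 ^ n)"
  have hn: "monom 1 n dvd h"
  proof -
    have "h = monom 1 n * ([:\<gamma>:] + [:0, 1:] * h2)"
      unfolding h by (simp add: monom_altdef algebra_simps)
    then show ?thesis by (simp only: dvd_triv_left)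
  qed
  have \<sigma>1: "\<sigma> \<in> fil 1" and x01: "x0 \<in> fil 1" and x11: "x1 \<in> fil 1"
    using fil_s fil_x shift_fil_1 by (simp_all only: \<sigma>_def x0_def x1_def)
  have Ex0: "E = x0 + \<sigma>" and x1E: "x1 = E + x0 * \<sigma>" by (simp_all add: E_def x0_def x1_def \<sigma>_def)
  have E1: "E \<in> fil 1" unfolding Ex0 by (rule fil_add[OF x01 \<sigma>1])
  have f1: "cs - 1 \<in> fil 1" unfolding fil_def
  proof (intro CollectI allI impI)
    fix l assume "l < p"
    show "coeff (cs - 1) l \<in> xpow (1 - l)"
      by (cases l) (simp_all add: coeff_cs_0 J_xpow zero_J)
  qed
  have f2: "hc \<in> fil n" unfolding hc_def by (intro fil_const xpow_e hn)
  have g_pow: "[:[:monom \<gamma> n:]:] = g * x0 ^ n"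
    unfolding K_X_power[symmetric] g_def x0_def poly_const_pow by simp
  have "hc - g * x0 ^ n = [:[:monom 1 (Suc n) * h2:]:]"
    unfolding g_pow[symmetric] hc_def h by (simp add: algebra_simps)
  then have f3: "hc - g * x0 ^ n \<in> fil (n + 1)"
    using fil_const[OF xpow_e[of "Suc n" "monom 1 (Suc n) * h2"]] by simp
  have "shift (monom \<gamma> n) = g * x1 ^ n"
    unfolding monom_altdef shift_smult shift.hom_power shift_x g_def x1_def polyK_def ..
  then have "shift h - g * x1 ^ n = shift (monom 1 (Suc n) * h2)"
    unfolding h shift.hom_add by simp
  then have f4: "shift h - g * x1 ^ n \<in> fil (n + 1)"
    using fil_shift[of "Suc n" "monom 1 (Suc n) * h2"] by simp
  have "x1 - E \<in> fil 2"
    using fil_mult[OF x01 \<sigma>1] by (simp add: x1E numeral_2_eq_2)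
  then have f5: "x1 ^ n - E ^ n \<in> fil (n + 1)" by (rule fil_power_diff[OF x11 E1])
  have f6: "\<Phi> \<in> fil (n + 1)" by (rule fil_mono[OF \<Phi>_fil]) (use n in simp)
  have W: "W = \<Phi> + (cs - 1) * hc + (hc - g * x0 ^ n) - (shift h - g * x1 ^ n) - g * (x1 ^ n - E ^ n)"
    unfolding W_def \<Psi>_def by (simp add: algebra_simps)
  have "(cs - 1) * hc \<in> fil (n + 1)" using fil_mult[OF f1 f2] by (simp add: add.commute)
  then have W1: "W \<in> fil (n + 1)" unfolding W
    by (intro fil_diff[OF fil_diff[OF fil_add[OF fil_add[OF f6] f3] f4] fil_scale[OF f5]])
  have c0: "coeff (E ^ n - x0 ^ n) 0 = 0" by (simp add: coeff0_power E_def x0_def)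
  have "coeff W 0 = 0"
    unfolding W_def coeff_add[of _ _ 0] coeff_mult_0[of g] c0
    by (simp add: \<Psi>_def coeff_mult_0 coeff_cs_0 coeff_\<Phi>_0 coeff_shift_0 hc_def)
  then obtain \<Xi> where \<Xi>: "W = \<sigma> * \<Xi>" "\<Xi> \<in> fil (n + 1 - 1)"
    unfolding \<sigma>_def by (rule fil_divide_s[OF W1]) (use n in simp)
  have "E ^ n - x0 ^ n \<in> fil n"
    using fil_diff[OF fil_power[OF E1, of n] fil_power[OF x01, of n]] by simp
  then obtain e where e: "E ^ n - x0 ^ n = \<sigma> * e" "e \<in> fil (n - 1)"
    unfolding \<sigma>_def by (rule fil_divide_s[OF _ c0]) (use n in simp)
  define \<Psi>1 where "\<Psi>1 = \<Xi> - g * e"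
  have \<Psi>: "\<Psi> = \<sigma> * \<Psi>1"
    using \<Xi>(1) e(1) unfolding W_def \<Psi>1_def by (simp add: algebra_simps)
  have \<Psi>1: "\<Psi>1 \<in> fil (n - 1)" unfolding \<Psi>1_def
    by (intro fil_diff fil_scale e fil_mono[OF \<Xi>(2)]) simp
  have \<Psi>n: "\<Psi> \<in> fil n" using fil_mult[OF \<sigma>1 \<Psi>1] n unfolding \<Psi> by simp

  define T where "T = d0 \<eta>"
  define a where "a = cs * [:\<eta>:]"
  have T: "T = a + \<Psi>"
  proof -
    have eq: "cs * f + \<Phi> - sh = cs * (f - hc) + (cs * hc + \<Phi> - sh)" for f sh
      by (simp add: algebra_simps)
    have \<eta>': "[:\<eta>:] = [:y:] - hc" by (simp add: \<eta>_def hc_def)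
    have d: "d0 \<eta> = cs * [:y:] + \<Phi> - shift h"
      unfolding \<eta>_def d0.hom_minus d0_const d0_y Y_def ..
    show ?thesis unfolding T_def d a_def \<eta>' \<Psi>_def by (rule eq)
  qed
  have d1\<eta>: "d1 \<eta> = \<sigma> * G" unfolding \<eta>_def d1_diff d1_const d1_y \<sigma>_def G_def by simp
  have J\<eta>: "\<eta> ^ rank \<in> J" using J unfolding \<eta>_def .
  have R1: "T ^ rank * u \<in> Js" using F0[OF J\<eta>] unfolding T_def d0.hom_power .
  have R2: "T ^ rank * u' + of_nat rank * T ^ (rank - 1) * (\<sigma> * G) * u \<in> Js"
    using F1[OF J\<eta>] unfolding T_def d0.hom_power d1_power d1\<eta> .
  interpret Js: ideal_filtration Js 0 0 by (rule Js_ideal)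
  obtain v where v: "u' * v - 1 \<in> Js" by (rule Js_inverse[OF u'_0])
  \<comment> \<open>Dividing the second relation by the unit \<open>u'\<close> leaves a single
    unknown, in which both relations can be expressed.\<close>
  define z where "z = - (G * u * v)"
  have "T ^ rank * z = (- (G * v)) * (T ^ rank * u)" unfolding z_def by (simp only: mult_minus_left mult_minus_right mult_ac)
  then have R1': "T ^ rank * z \<in> Js" using Js_mult[OF R1] by (simp only:)
  have "T ^ rank - of_nat rank * T ^ (rank - 1) * \<sigma> * z
    = v * (T ^ rank * u' + of_nat rank * T ^ (rank - 1) * (\<sigma> * G) * u) - T ^ rank * (u' * v - 1)"
    unfolding z_def by (simp add: algebra_simps)
  then have R2': "T ^ rank - of_nat rank * T ^ (rank - 1) * \<sigma> * z \<in> Js"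
    using Js.diff_J[OF Js_mult[OF R2, of v] Js_mult[OF v, of "T ^ rank"]] by (simp only:)
  obtain A where A: "T ^ rank = a ^ rank + of_nat rank * a ^ (rank - 1) * \<Psi> + \<Psi>\<^sup>2 * A"
    unfolding T by (rule power_add_expand)
  have "T - a dvd T ^ (rank - 1) - a ^ (rank - 1)" by (rule diff_dvd_power_diff)
  moreover have "T - a = \<Psi>" unfolding T by simp
  ultimately obtain B where "T ^ (rank - 1) - a ^ (rank - 1) = \<Psi> * B" by (simp only:) (elim dvdE)
  then have B: "T ^ (rank - 1) = a ^ (rank - 1) + \<Psi> * B" by (simp only: diff_eq_eq add.commute)
  have "a ^ rank = cs ^ rank * [:\<eta> ^ rank:]" unfolding a_def power_mult_distrib poly_const_pow ..
  then have a: "a ^ rank \<in> Js" using Js_mult[OF const_Js[OF J\<eta>]] by (simp only:)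
  define N where "N = of_nat rank * a ^ (rank - 1)"
  have \<Psi>2: "\<Psi>\<^sup>2 \<in> fil (2 * n)" using fil_power[OF \<Psi>n, of 2] .
  have \<sigma>\<Psi>: "\<sigma> * \<Psi> \<in> fil (n + 1)" using fil_mult[OF \<sigma>1 \<Psi>n] by simp
  \<comment> \<open>The error terms are the two relations themselves, the square of \<Psi>, of order
    \<open>2 * n \<ge> n + 1\<close>, and multiples of \<open>\<sigma> * \<Psi>\<close>, of order
    \<open>n + 1\<close>.\<close>
  have "N * \<sigma> * (\<Psi>1 - z) = (T ^ rank - of_nat rank * T ^ (rank - 1) * \<sigma> * z) - a ^ rank - \<Psi>\<^sup>2 * A
      + (\<sigma> * \<Psi>) * (of_nat rank * B * z)"
    unfolding A B N_def unfolding \<Psi> by (simp add: algebra_simps)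
  moreover have "\<dots> \<in> fil (n + 1)"
    by (intro fil_add fil_diff fil_scale' \<sigma>\<Psi> Js_fil[OF R2'] Js_fil[OF a] fil_mono[OF \<Psi>2]) (use n in simp)
  ultimately have P1: "N * \<sigma> * (\<Psi>1 - z) \<in> fil (n + 1)" by (simp only:)
  have "N * \<sigma> * \<Psi>1 * z = T ^ rank * z - a ^ rank * z - \<Psi>\<^sup>2 * (A * z)"
    unfolding A N_def unfolding \<Psi> by (simp add: algebra_simps)
  moreover have "\<dots> \<in> fil (2 * n)"
    by (intro fil_diff fil_scale' \<Psi>2 Js_fil[OF R1'] Js_fil[OF a])
  ultimately have P2: "N * \<sigma> * \<Psi>1 * z \<in> fil (2 * n)" by (simp only:)
  \<comment> \<open>The factor \<open>\<Psi>1\<close> has order \<open>n - 1\<close>, which raises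
    \<open>n + 1\<close> to exactly the order \<open>2 * n\<close> of the other relation.\<close>
  have P3: "N * \<sigma> * (\<Psi>1 - z) * \<Psi>1 \<in> fil (2 * n)"
    using fil_mult[OF P1 \<Psi>1] n by (simp add: mult_2)
  have "N * \<sigma> * \<Psi>1\<^sup>2 = N * \<sigma> * (\<Psi>1 - z) * \<Psi>1 + N * \<sigma> * \<Psi>1 * z"
    by (simp add: power2_eq_square algebra_simps)
  then have P4: "N * \<sigma> * \<Psi>1\<^sup>2 \<in> fil (2 * n)" using fil_add[OF P3 P2] by (simp only:)
  \<comment> \<open>As \<open>\<Psi>1 = \<Xi> - g * e\<close>, its square differs from
    \<open>(g * e)\<^sup>2\<close> by \<open>\<Xi> * (\<Xi> - 2 * g * e)\<close>. The factor \<Xi>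
    has order \<open>n\<close> instead of \<open>n - 1\<close>, so \<open>\<Psi>1\<close> may be
    replaced by its leading form.\<close>
  have P5: "\<sigma> * \<Xi> * (\<Xi> - (g * e + g * e)) \<in> fil (2 * n)"
  proof -
    have "\<Xi> - (g * e + g * e) \<in> fil (n - 1)" 
      by (intro fil_diff[OF fil_mono[OF \<Xi>(2)] fil_add[OF fil_scale[OF e(2)] fil_scale[OF e(2)]]]) simp
    moreover have "1 + (n + 1 - 1) + (n - 1) = 2 * n" using n by simp
    ultimately show ?thesis using fil_mult[OF fil_mult[OF \<sigma>1 \<Xi>(2)]] by metis
  qed
  have "N * g\<^sup>2 * (\<sigma> * e\<^sup>2) = N * \<sigma> * \<Psi>1\<^sup>2 - N * (\<sigma> * \<Xi> * (\<Xi> - (g * e + g * e)))"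
    unfolding \<Psi>1_def by (simp add: power2_eq_square algebra_simps)
  then have P6: "N * g\<^sup>2 * (\<sigma> * e\<^sup>2) \<in> fil (2 * n)" using fil_diff[OF P4 fil_scale[OF P5]] by (simp only:)
  define q where "q = of_nat rank * (K \<gamma> * (K \<gamma> * \<eta> ^ (rank - 1)))"
  have "[:q:] = of_nat rank * g * g * [:\<eta> ^ (rank - 1):]"
    unfolding q_def g_def of_nat_poly[where ?'a = "'k poly poly"] by simp
  then have "N * g\<^sup>2 * (\<sigma> * e\<^sup>2) = cs ^ (rank - 1) * ([:q:] * (\<sigma> * e\<^sup>2))"
    unfolding N_def a_def power_mult_distrib poly_const_pow power2_eq_square by (simp only: mult_ac)
  with P6 have "cs ^ (rank - 1) * ([:q:] * (\<sigma> * e\<^sup>2)) \<in> fil (2 * n)" by (simp only:)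
  then have "[:q:] * (\<sigma> * e\<^sup>2) \<in> fil (2 * n)"
    by (rule unit_cancel_fil[rotated]) (simp add: coeff0_power coeff_cs_0)
  then have "q \<in> xpow 1"
    using leading_term_contradiction[OF n e(1)[unfolded E_def x0_def \<sigma>_def]] unfolding \<sigma>_def by blast
  moreover have "\<not> p dvd rank" using rank rank_pos by (auto dest: dvd_imp_le)
  ultimately have "\<eta> ^ (rank - 1) \<in> xpow 1"
    unfolding q_def using of_nat_mult_xpow K_mult_xpow[OF \<gamma>] by blast
  moreover have "poly h 0 = 0" using hn n by (auto elim!: dvdE simp: poly_monom)
  ultimately have "y ^ (rank - 1) \<in> xpow 1"
    using xpow_cong[OF y_minus_power] unfolding \<eta>_def by blast
  with y_power_not[of "rank - 1"] rank_pos show False by simp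
qed

text \<open>For \<open>rank = p\<close> this is the assumption on \<open>y ^ p\<close>. Otherwise
  \<open>(y - h) ^ rank\<close> lies in \<open>J\<close> for some \<open>h\<close>: if
  \<open>x ^ p\<close> divides \<open>h\<close>, then \<open>h\<close> drops out, and a lowest term
  of degree below \<open>p\<close> is excluded by \<open>change_of_variable_trivial\<close>.\<close>

theorem y_power_rank: "y ^ rank \<in> J"
proof (cases "rank < p")
  case False
  then show ?thesis using y_p rank_le by (metis le_antisym not_le)
next
  case True
  obtain h where h: "poly h 0 = 0" "(y - [:h:]) ^ rank \<in> J" by (rule complete_power[OF True])
  show ?thesis
  proof (cases "monom 1 p dvd h")
    case True
    then have "[:h:] \<in> J" using xpow_e[of p h] xpow_p by blast
    have "(y - [:h:]) - y dvd (y - [:h:]) ^ rank - y ^ rank" by (rule diff_dvd_power_diff)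
    moreover have "(y - [:h:]) - y = - [:h:]" by (simp only: diff_diff_eq2 diff_diff_add add.commute) simp
    ultimately obtain r where "(y - [:h:]) ^ rank - y ^ rank = - [:h:] * r" by (simp only:) (elim dvdE)
    moreover from \<open>[:h:] \<in> J\<close> have "- [:h:] * r \<in> J" by (intro mult_J' uminus_J)
    ultimately have "(y - [:h:]) ^ rank - y ^ rank \<in> J" by (simp only:)
    with h(2) show ?thesis using cong_J by blast
  next
    case False
    define n where "n = (LEAST k. coeff h k \<noteq> 0)"
    obtain k where k: "k < p" "coeff h k \<noteq> 0" using False unfolding monom_1_dvd_iff' by auto
    have "coeff h n \<noteq> 0" unfolding n_def by (rule LeastI[of "\<lambda>k. coeff h k \<noteq> 0" k]) (rule k(2))
    moreover have "n \<le> k" unfolding n_def by (rule Least_le) (rule k(2))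
    ultimately have n: "coeff h n \<noteq> 0" "n < p" using k by auto
    have least: "coeff h i = 0" if "i < n" for i
      using not_less_Least[of i "\<lambda>k. coeff h k \<noteq> 0"] that unfolding n_def by blast
    have "n \<noteq> 0" using n(1) h(1) by (metis poly_0_coeff_0)
    have "monom 1 (Suc n) dvd h - monom (coeff h n) n"
      unfolding monom_1_dvd_iff' using least by (auto simp: less_Suc_eq)
    then obtain h2 where "h - monom (coeff h n) n = monom 1 (Suc n) * h2" by auto
    then have "h = monom (coeff h n) n + monom 1 (Suc n) * h2" by (metis diff_eq_eq add.commute)
    from change_of_variable_trivial[OF True _ n(2) this n(1) h(2)] \<open>n \<noteq> 0\<close> show ?thesis by auto
  qed
qed

text \<open>\<open>J\<close> is the ideal generated by \<open>x ^ p\<close> and \<open>y ^ k\<close>.\<close>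

theorem J_subset:
  assumes "ideal_filtration J'" "X ^ p \<in> J'" "y ^ rank \<in> J'"
  shows "J \<subseteq> J'"
proof
  interpret J': ideal_filtration J' X p by (rule assms(1))
  fix Q assume Q: "Q \<in> J"
  \<comment> \<open>Membership is tracked in both ideals: in \<open>J\<close> in order to cancel
    powers of \<open>X\<close>, in \<open>J'\<close> for the conclusion.\<close>
  have "\<exists>R. Q - X ^ m * R \<in> J \<inter> J'" if "m \<le> p" for m
    using that
  proof (induction m)
    case 0
    then show ?case by (intro exI[of _ Q]) (simp add: zero_J J'.zero_J)
  next
    case (Suc m)
    then obtain R where R: "Q - X ^ m * R \<in> J" "Q - X ^ m * R \<in> J'" by auto
    have "X ^ m * R \<in> J" using R(1) Q cong_J by blast
    then have "R \<in> xpow (p - m)" by (rule X_power_cancel) (use Suc.prems in simp)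
    then have "y ^ 0 * R \<in> xpow 1" using Suc.prems by (auto elim: xpow_mono)
    then obtain A S where RA: "R = y ^ rank * A + X * S" by (rule xpow_1_expand[where j = rank]) simp
    have eq: "Q - X ^ Suc m * S = (Q - X ^ m * R) + y ^ rank * (X ^ m * A)"
      unfolding RA by (simp add: algebra_simps)
    have "Q - X ^ Suc m * S \<in> J" unfolding eq by (intro add_J R mult_J' y_power_rank)
    moreover have "Q - X ^ Suc m * S \<in> J'" unfolding eq by (intro J'.add_J R J'.mult_J' assms)
    ultimately show ?case by blast
  qed
  from this[of p] obtain R where "Q - X ^ p * R \<in> J'" by auto
  then show "Q \<in> J'" using J'.cong_J J'.mult_J'[OF assms(2)] by blast
qed

end

section \<open>The splitting property\<close>

lemma sqm:
  fixes A B C :: "'k::comm_ring_1 mat" and n :: nat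
  shows "A \<in> carrier_mat n n \<Longrightarrow> B \<in> carrier_mat n n \<Longrightarrow> A + B \<in> carrier_mat n n"
    "A \<in> carrier_mat n n \<Longrightarrow> B \<in> carrier_mat n n \<Longrightarrow> A * B \<in> carrier_mat n n"
    "A \<in> carrier_mat n n \<Longrightarrow> B \<in> carrier_mat n n \<Longrightarrow> A - B \<in> carrier_mat n n"
    "A \<in> carrier_mat n n \<Longrightarrow> a \<cdot>\<^sub>m A \<in> carrier_mat n n"
    "A \<in> carrier_mat n n \<Longrightarrow> A + 0\<^sub>m n n = A"
    "A \<in> carrier_mat n n \<Longrightarrow> 0\<^sub>m n n + A = A"
    "A \<in> carrier_mat n n \<Longrightarrow> A * 0\<^sub>m n n = 0\<^sub>m n n"
    "A \<in> carrier_mat n n \<Longrightarrow> 0\<^sub>m n n * A = 0\<^sub>m n n"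
    "A \<in> carrier_mat n n \<Longrightarrow> A * 1\<^sub>m n = A"
    "A \<in> carrier_mat n n \<Longrightarrow> 1\<^sub>m n * A = A"
    "A \<in> carrier_mat n n \<Longrightarrow> A - A = 0\<^sub>m n n"
  by auto

lemma sqm_distrib:
  fixes A B C :: "'k::comm_ring_1 mat" and n :: nat
  assumes "A \<in> carrier_mat n n" "B \<in> carrier_mat n n" "C \<in> carrier_mat n n"
  shows "A * (B + C) = A * B + A * C" "(A + B) * C = A * C + B * C"
    "A * (B - C) = A * B - A * C" "(A - B) * C = A * C - B * C"
    "(A * B) * C = A * (B * C)" "(A + B) + C = A + (B + C)"
  using assms by (auto intro: mult_add_distrib_mat add_mult_distrib_mat mult_minus_distrib_mat
    minus_mult_distrib_mat assoc_mult_mat assoc_add_mat)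

lemma sqm_add4:
  fixes A B C D :: "'k::comm_ring_1 mat" and n :: nat
  assumes "A \<in> carrier_mat n n" "B \<in> carrier_mat n n" "C \<in> carrier_mat n n" "D \<in> carrier_mat n n"
  shows "(A + B) + (C + D) = (A + C) + (B + D)"
  using assms by (intro eq_matI) auto

lemma sqm_diff:
  fixes A B C :: "'k::comm_ring_1 mat" and n :: nat
  assumes "A \<in> carrier_mat n n" "B \<in> carrier_mat n n" "C \<in> carrier_mat n n"
  shows "A + B - B = A" "A + B - A = B" "A - B + B = A" "A + C = B + C \<longleftrightarrow> A = B"
    "A + B - (A + C) = B - C" "(A + B) - C = A + (B - C)"
proof -
  have eq: "M = N" if "\<forall>i<n. \<forall>j<n. M $$ (i, j) = N $$ (i, j)" "M \<in> carrier_mat n n" "N \<in> carrier_mat n n"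
    for M N :: "'k mat" using that by (intro eq_matI) auto
  have entries: "\<forall>i<n. \<forall>j<n. (A + C) $$ (i, j) = A $$ (i, j) + C $$ (i, j)"
    "\<forall>i<n. \<forall>j<n. (B + C) $$ (i, j) = B $$ (i, j) + C $$ (i, j)" using assms by auto
  have "A = B" if "A + C = B + C"
    by (rule eq) (use entries that assms in auto)
  then show "A + C = B + C \<longleftrightarrow> A = B" by blast
  show "A + B - B = A" "A + B - A = B" "A - B + B = A" "A + B - (A + C) = B - C" "(A + B) - C = A + (B - C)"
    by (rule eq; use assms in \<open>auto simp: sqm[where n = n]\<close>)+
qed

section \<open>Polynomial rings acting by matrices\<close>

locale mat_hom =
  fixes n :: nat and \<phi> :: "'r::comm_ring_1 \<Rightarrow> 'k::field mat"
  assumes carrier [simp]: "\<phi> a \<in> carrier_mat n n"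
    and add: "\<phi> (a + b) = \<phi> a + \<phi> b"
    and mult: "\<phi> (a * b) = \<phi> a * \<phi> b"
    and one: "\<phi> 1 = 1\<^sub>m n"
begin

lemma diff: "\<phi> (a - b) = \<phi> a - \<phi> b"
  using add[of "a - b" b] sqm_diff(1)[OF carrier[of "a - b"] carrier[of b] carrier[of b]] by simp

lemma zero: "\<phi> 0 = 0\<^sub>m n n"
  using diff[of 0 0] sqm(11)[OF carrier] by simp

lemma power: "\<phi> (a ^ m) = \<phi> a ^\<^sub>m m"
proof (induction m)
  case (Suc m)
  then show ?case by (simp add: mult.commute[of a] mult)
qed (use carrier_matD(1)[OF carrier[of a]] in \<open>simp add: one\<close>)

lemma mult_vec: "w \<in> carrier_vec n \<Longrightarrow> \<phi> (a * b) *\<^sub>v w = \<phi> a *\<^sub>v (\<phi> b *\<^sub>v w)"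
  unfolding mult by (rule assoc_mult_mat_vec[of _ n n _ n]) auto

lemma add_vec: "w \<in> carrier_vec n \<Longrightarrow> \<phi> (a + b) *\<^sub>v w = \<phi> a *\<^sub>v w + \<phi> b *\<^sub>v w"
  unfolding add by (rule add_mult_distrib_mat_vec[of _ n n]) auto

lemma diff_vec: "w \<in> carrier_vec n \<Longrightarrow> \<phi> (a - b) *\<^sub>v w = \<phi> a *\<^sub>v w - \<phi> b *\<^sub>v w"
  unfolding diff by (rule minus_mult_distrib_mat_vec[of _ n n]) auto

lemma one_vec: "w \<in> carrier_vec n \<Longrightarrow> \<phi> 1 *\<^sub>v w = w"
  by (simp add: one)

lemma zero_vec: "w \<in> carrier_vec n \<Longrightarrow> \<phi> 0 *\<^sub>v w = 0\<^sub>v n"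
  unfolding zero by (intro eq_vecI) auto

end

text \<open>Horner evaluation at the matrix \<open>Y\<close>. The size \<open>n\<close> is a value
  and not part of the type, so the matrices of one size do not form a ring type to which
  \<open>poly\<close> would apply.\<close>

definition poly_mat :: "nat \<Rightarrow> ('r::comm_ring_1 \<Rightarrow> 'k::field mat) \<Rightarrow> 'k mat \<Rightarrow> 'r poly \<Rightarrow> 'k mat" where
  "poly_mat n \<phi> Y P = fold_coeffs (\<lambda>r R. \<phi> r + Y * R) P (0\<^sub>m n n)"

locale mat_hom_ext = mat_hom n \<phi> for n and \<phi> :: "'r::comm_ring_1 \<Rightarrow> 'k::field mat" +
  fixes Y :: "'k mat"
  assumes Y [simp]: "Y \<in> carrier_mat n n" and Y_comm: "Y * \<phi> a = \<phi> a * Y"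
begin

abbreviation \<psi> where "\<psi> \<equiv> poly_mat n \<phi> Y"

lemma ext_0: "\<psi> 0 = 0\<^sub>m n n"
  by (simp add: poly_mat_def)

lemma ext_pCons: "\<psi> (pCons a P) = \<phi> a + Y * \<psi> P"
proof (cases "a = 0 \<and> P = 0")
  case True
  then show ?thesis using Y by (simp add: poly_mat_def zero sqm[where n = n])
next
  case False
  then show ?thesis by (auto simp: poly_mat_def fold_coeffs_pCons_not_0_0_eq)
qed

lemma ext_carrier [simp]: "\<psi> P \<in> carrier_mat n n"
  by (induction P) (simp_all add: ext_0 ext_pCons sqm[where n = n])

lemma ext_add: "\<psi> (P + Q) = \<psi> P + \<psi> Q"
proof (induction P Q rule: poly_induct2)
  case (pCons a p b q)
  have "\<psi> (pCons a p + pCons b q) = (\<phi> a + \<phi> b) + (Y * \<psi> p + Y * \<psi> q)"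
    by (simp add: ext_pCons pCons add mult_add_distrib_mat[of _ n n _ n])
  also have "\<dots> = (\<phi> a + Y * \<psi> p) + (\<phi> b + Y * \<psi> q)"
    by (rule sqm_add4[where n = n]) (simp_all add: sqm[where n = n])
  finally show ?case by (simp add: ext_pCons)
qed (simp add: ext_0)

lemma ext_const: "\<psi> [:a:] = \<phi> a"
  by (simp add: ext_pCons ext_0 sqm[where n = n])

lemma ext_smult: "\<psi> (Polynomial.smult a P) = \<phi> a * \<psi> P"
proof (induction P)
  case 0 then show ?case by (simp add: ext_0 sqm[where n = n])
next
  case (pCons b P)
  have "\<psi> (Polynomial.smult a (pCons b P)) = \<phi> a * \<phi> b + Y * (\<phi> a * \<psi> P)"
    by (simp add: ext_pCons pCons mult)
  also have "Y * (\<phi> a * \<psi> P) = \<phi> a * (Y * \<psi> P)"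
    by (metis Y_comm assoc_mult_mat[OF Y carrier ext_carrier] assoc_mult_mat[OF carrier Y ext_carrier])
  also have "\<phi> a * \<phi> b + \<phi> a * (Y * \<psi> P) = \<phi> a * (\<phi> b + Y * \<psi> P)"
    by (rule mult_add_distrib_mat[of _ n n _ n, symmetric]) (simp_all add: sqm[where n = n])
  finally show ?case by (simp add: ext_pCons)
qed

lemma ext_pCons_0: "\<psi> (pCons 0 P) = Y * \<psi> P"
  using left_add_zero_mat[of "Y * \<psi> P" n n] mult_carrier_mat[OF Y ext_carrier] by (simp add: ext_pCons zero)

lemma ext_mult: "\<psi> (P * Q) = \<psi> P * \<psi> Q"
proof (induction P)
  case 0 then show ?case by (simp add: ext_0 sqm[where n = n])
next
  case (pCons a P)
  have "\<psi> (pCons a P * Q) = \<phi> a * \<psi> Q + Y * (\<psi> P * \<psi> Q)"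
    by (simp add: ext_add ext_smult ext_pCons_0 pCons)
  also have "Y * (\<psi> P * \<psi> Q) = (Y * \<psi> P) * \<psi> Q"
    by (rule assoc_mult_mat[OF Y ext_carrier ext_carrier, symmetric])
  also have "\<phi> a * \<psi> Q + (Y * \<psi> P) * \<psi> Q = (\<phi> a + Y * \<psi> P) * \<psi> Q"
    by (rule add_mult_distrib_mat[symmetric, of _ n n _ _ n]) (simp_all add: sqm[where n = n])
  finally show ?case by (simp add: ext_pCons)
qed

lemma ext_var: "\<psi> [:0, 1:] = Y"
  using right_mult_one_mat[OF Y] by (simp add: ext_pCons_0 ext_const[of 1, unfolded one_pCons[symmetric]] one one_pCons[symmetric] ext_const)

lemma ext_mat_hom: "mat_hom n \<psi>"
  by unfold_locales (simp_all add: ext_add ext_mult one_pCons ext_const one)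

text \<open>This supplies the commutation assumption of \<open>mat_hom_ext\<close> when the
  extension is iterated for a second variable.\<close>

lemma ext_commute:
  assumes Z: "Z \<in> carrier_mat n n" "\<And>a. Z * \<phi> a = \<phi> a * Z" "Z * Y = Y * Z"
  shows "Z * \<psi> P = \<psi> P * Z"
proof (induction P)
  case 0 then show ?case using Z by (simp add: ext_0)
next
  case (pCons a P)
  have "Z * \<psi> (pCons a P) = Z * \<phi> a + Z * (Y * \<psi> P)"
    unfolding ext_pCons by (rule mult_add_distrib_mat[OF Z(1), of _ n]) (simp_all add: sqm[where n = n])
  also have "Z * (Y * \<psi> P) = (Y * \<psi> P) * Z"
    by (metis Z(1,3) pCons.IH assoc_mult_mat[OF Z(1) Y ext_carrier] assoc_mult_mat[OF Y Z(1) ext_carrier] assoc_mult_mat[OF Y ext_carrier Z(1)])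
  also have "Z * \<phi> a + (Y * \<psi> P) * Z = (\<phi> a + Y * \<psi> P) * Z"
    unfolding Z(2) by (rule add_mult_distrib_mat[symmetric, of _ n n _ _ n]) (use Z in \<open>simp_all add: sqm[where n = n]\<close>)
  finally show ?case by (simp add: ext_pCons)
qed

end

lemma scalar_mat_hom: "mat_hom n (\<lambda>a. a \<cdot>\<^sub>m 1\<^sub>m n)"
  by unfold_locales (auto simp: add_smult_distrib_right_mat intro!: eq_matI)

definition poly_mat1 :: "nat \<Rightarrow> 'k::field mat \<Rightarrow> 'k poly \<Rightarrow> 'k mat" where
  "poly_mat1 n X = poly_mat n (\<lambda>a. a \<cdot>\<^sub>m 1\<^sub>m n) X"

definition poly_mat2 :: "nat \<Rightarrow> 'k::field mat \<Rightarrow> 'k mat \<Rightarrow> 'k poly poly \<Rightarrow> 'k mat" where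
  "poly_mat2 n X Y = poly_mat n (poly_mat1 n X) Y"

lemma mat_hom_ext_scalar: "X \<in> carrier_mat n n \<Longrightarrow> mat_hom_ext n (\<lambda>a. a \<cdot>\<^sub>m 1\<^sub>m n) X"
  unfolding mat_hom_ext_def mat_hom_ext_axioms_def using scalar_mat_hom[of n] by auto

lemma poly_mat1_hom: "X \<in> carrier_mat n n \<Longrightarrow> mat_hom n (poly_mat1 n X)"
  unfolding poly_mat1_def using mat_hom_ext.ext_mat_hom[OF mat_hom_ext_scalar] .

lemma poly_mat1_var: "X \<in> carrier_mat n n \<Longrightarrow> poly_mat1 n X [:0, 1:] = X"
  unfolding poly_mat1_def using mat_hom_ext.ext_var[OF mat_hom_ext_scalar] .

lemma poly_mat1_const: "X \<in> carrier_mat n n \<Longrightarrow> poly_mat1 n X [:a:] = a \<cdot>\<^sub>m 1\<^sub>m n"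
  unfolding poly_mat1_def using mat_hom_ext.ext_const[OF mat_hom_ext_scalar] .

lemma poly_mat1_commute:
  assumes "X \<in> carrier_mat n n" "Z \<in> carrier_mat n n" "Z * X = X * Z"
  shows "Z * poly_mat1 n X q = poly_mat1 n X q * Z"
  unfolding poly_mat1_def
  by (rule mat_hom_ext.ext_commute[OF mat_hom_ext_scalar[OF assms(1)] assms(2) _ assms(3)]) (use assms(2) in auto)

lemma mat_hom_ext_poly:
  assumes "X \<in> carrier_mat n n" "Y \<in> carrier_mat n n" "Y * X = X * Y"
  shows "mat_hom_ext n (poly_mat1 n X) Y"
  unfolding mat_hom_ext_def mat_hom_ext_axioms_def
  using poly_mat1_hom[OF assms(1)] poly_mat1_commute[OF assms] assms by auto

lemma poly_mat2_hom:
  assumes "X \<in> carrier_mat n n" "Y \<in> carrier_mat n n" "Y * X = X * Y"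
  shows "mat_hom n (poly_mat2 n X Y)"
  unfolding poly_mat2_def using mat_hom_ext.ext_mat_hom[OF mat_hom_ext_poly[OF assms]] .

lemma poly_mat2_var:
  assumes "X \<in> carrier_mat n n" "Y \<in> carrier_mat n n" "Y * X = X * Y"
  shows "poly_mat2 n X Y [:0, 1:] = Y"
  unfolding poly_mat2_def using mat_hom_ext.ext_var[OF mat_hom_ext_poly[OF assms]] .

lemma poly_mat2_const:
  assumes "X \<in> carrier_mat n n" "Y \<in> carrier_mat n n" "Y * X = X * Y"
  shows "poly_mat2 n X Y [:q:] = poly_mat1 n X q"
  unfolding poly_mat2_def using mat_hom_ext.ext_const[OF mat_hom_ext_poly[OF assms]] .

section \<open>Splittings as families of matrices, with tensor products and summands\<close>

primrec conv_aux :: "nat \<Rightarrow> (nat \<Rightarrow> 'k::field) \<Rightarrow> (nat \<Rightarrow> 'k mat) \<Rightarrow> nat \<Rightarrow> nat \<Rightarrow> 'k mat" where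
  "conv_aux n c J l 0 = 0\<^sub>m n n"
| "conv_aux n c J l (Suc i) = conv_aux n c J l i + c i \<cdot>\<^sub>m J (l - i)"

text \<open>The coefficient of \<open>s ^ l\<close> in \<open>c(s) * J(s)\<close>, where
  \<open>J(s)\<close> is the generating series of the family. The sum is a recursion because the
  zero matrix to start from depends on \<open>n\<close>.\<close>

definition conv :: "nat \<Rightarrow> (nat \<Rightarrow> 'k::field) \<Rightarrow> (nat \<Rightarrow> 'k mat) \<Rightarrow> nat \<Rightarrow> 'k mat" where
  "conv n c J l = conv_aux n c J l (Suc l)"

text \<open>The coefficient of \<open>s ^ l\<close> in \<open>s * J(s)\<close>.\<close>

definition prev :: "nat \<Rightarrow> (nat \<Rightarrow> 'k::field mat) \<Rightarrow> nat \<Rightarrow> 'k mat" where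
  "prev n J l = (if l = 0 then 0\<^sub>m n n else J (l - 1))"

text \<open>This expresses that tensoring with the module splits the map from the \<open>2 * p\<close>-dimensional module
  \<open>'k[s, \<epsilon>] / (s ^ p, \<epsilon>\<^sup>2)\<close>, on which the two generators act as \<open>1 + s\<close> and \<open>c s + s * \<epsilon>\<close>, to its
  trivial quotient: \<open>J0\<close> and \<open>J1\<close> are the coefficients of \<open>1\<close> and \<open>\<epsilon>\<close> of the splitting.\<close>

definition splitting :: "nat \<Rightarrow> (nat \<Rightarrow> 'k::field) \<Rightarrow> nat \<Rightarrow> 'k mat \<Rightarrow> 'k mat \<Rightarrow> bool" where
  "splitting p c n G1 G2 \<longleftrightarrow> (\<exists>J0 J1. (\<forall>l. J0 l \<in> carrier_mat n n) \<and> (\<forall>l. J1 l \<in> carrier_mat n n) \<and>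
     J1 0 = 1\<^sub>m n \<and> (\<forall>l<p.
       J0 l * G1 = G1 * (J0 l + prev n J0 l) \<and> J0 l * G2 = G2 * conv n c J0 l \<and>
       J1 l * G1 = G1 * (J1 l + prev n J1 l) \<and> J1 l * G2 = G2 * (conv n c J1 l + prev n J0 l)))"

lemma conv_aux_carrier: "(\<And>l. J l \<in> carrier_mat n n) \<Longrightarrow> conv_aux n c J l i \<in> carrier_mat n n"
  by (induction i) (auto simp: sqm[where n = n])

lemma conv_carrier: "(\<And>l. J l \<in> carrier_mat n n) \<Longrightarrow> conv n c J l \<in> carrier_mat n n"
  unfolding conv_def by (rule conv_aux_carrier)

lemma prev_carrier: "(\<And>l. J l \<in> carrier_mat n n) \<Longrightarrow> prev n J l \<in> carrier_mat n n"
  unfolding prev_def by auto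

definition kron :: "'k::field mat \<Rightarrow> 'k mat \<Rightarrow> 'k mat" where
  "kron A B = mat (dim_row A * dim_row B) (dim_col A * dim_col B)
     (\<lambda>(i, j). A $$ (i div dim_row B, j div dim_col B) * B $$ (i mod dim_row B, j mod dim_col B))"

lemma kron_carrier: "A \<in> carrier_mat a b \<Longrightarrow> B \<in> carrier_mat c d \<Longrightarrow> kron A B \<in> carrier_mat (a * c) (b * d)"
  unfolding kron_def by auto

lemma sum_div_mod:
  fixes f :: "nat \<Rightarrow> nat \<Rightarrow> 'a::comm_monoid_add"
  shows "(\<Sum>k<a * b. f (k div b) (k mod b)) = (\<Sum>i<a. \<Sum>j<b. f i j)"
proof (cases "b = 0")
  case False
  have "(\<Sum>k<a * b. f (k div b) (k mod b)) = (\<Sum>m<a. \<Sum>k\<in>{m * b..<m * b + b}. f (k div b) (k mod b))"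
    by (rule sum.nat_group[symmetric])
  also have "\<dots> = (\<Sum>i<a. \<Sum>j<b. f i j)"
  proof (rule sum.cong[OF refl])
    fix m
    have "(\<Sum>k\<in>{m * b..<m * b + b}. f (k div b) (k mod b)) = (\<Sum>j\<in>{0..<b}. f ((j + m * b) div b) ((j + m * b) mod b))"
      using sum.shift_bounds_nat_ivl[of "\<lambda>k. f (k div b) (k mod b)" 0 "m * b" b] by (simp add: add.commute)
    also have "\<dots> = (\<Sum>j\<in>{0..<b}. f m j)" by (rule sum.cong) auto
    finally show "(\<Sum>k\<in>{m * b..<m * b + b}. f (k div b) (k mod b)) = (\<Sum>j<b. f m j)"
      by (simp add: atLeast0LessThan)
  qed
  finally show ?thesis .
qed simp

lemma kron_mult:
  assumes "A \<in> carrier_mat a b" "A' \<in> carrier_mat b c" "B \<in> carrier_mat d e" "B' \<in> carrier_mat e f"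
  shows "kron A B * kron A' B' = kron (A * A') (B * B')"
proof (rule eq_matI)
  fix i j assume "i < dim_row (kron (A * A') (B * B'))" "j < dim_col (kron (A * A') (B * B'))"
  then have ij: "i < a * d" "j < c * f" using assms unfolding kron_def by auto
  then have nz: "0 < d" "0 < f" by (auto intro: Nat.gr0I)
  have i: "i div d < a" "i mod d < d" and j: "j div f < c" "j mod f < f"
    using ij nz by (auto simp: less_mult_imp_div_less)
  have kk: "k div e < b \<and> k mod e < e" if "k < b * e" for k
    using that by (auto simp: less_mult_imp_div_less intro!: mod_less_divisor Nat.gr0I)
  have "(kron A B * kron A' B') $$ (i, j) = (\<Sum>k<b * e. (A $$ (i div d, k div e) * B $$ (i mod d, k mod e))
      * (A' $$ (k div e, j div f) * B' $$ (k mod e, j mod f)))"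
    using ij assms kk by (simp add: kron_def scalar_prod_def atLeast0LessThan)
  also have "\<dots> = (\<Sum>k<b. \<Sum>l<e. (A $$ (i div d, k) * B $$ (i mod d, l)) * (A' $$ (k, j div f) * B' $$ (l, j mod f)))"
    by (rule sum_div_mod[where f = "\<lambda>k l. (A $$ (i div d, k) * B $$ (i mod d, l)) * (A' $$ (k, j div f) * B' $$ (l, j mod f))"])
  also have "\<dots> = (\<Sum>k<b. A $$ (i div d, k) * A' $$ (k, j div f)) * (\<Sum>l<e. B $$ (i mod d, l) * B' $$ (l, j mod f))"
    by (simp add: sum_product mult_ac)
  also have "\<dots> = kron (A * A') (B * B') $$ (i, j)"
    using ij i j assms by (simp add: kron_def scalar_prod_def atLeast0LessThan)
  finally show "(kron A B * kron A' B') $$ (i, j) = kron (A * A') (B * B') $$ (i, j)" .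
qed (use assms in \<open>auto simp: kron_def\<close>)

lemma kron_add_left:
  assumes "A \<in> carrier_mat a a" "A' \<in> carrier_mat a a" "B \<in> carrier_mat b b"
  shows "kron (A + A') B = kron A B + kron A' B"
  by (rule eq_matI) (use assms in \<open>auto simp: kron_def algebra_simps less_mult_imp_div_less\<close>)

lemma kron_smult_left:
  assumes "A \<in> carrier_mat a a" "B \<in> carrier_mat b b"
  shows "kron (t \<cdot>\<^sub>m A) B = t \<cdot>\<^sub>m kron A B"
  by (rule eq_matI) (use assms in \<open>auto simp: kron_def algebra_simps less_mult_imp_div_less\<close>)

lemma kron_zero_left: "B \<in> carrier_mat b b \<Longrightarrow> kron (0\<^sub>m a a) B = 0\<^sub>m (a * b) (a * b)"
  by (rule eq_matI) (auto simp: kron_def less_mult_imp_div_less)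

lemma kron_one: "kron (1\<^sub>m a) (1\<^sub>m b) = (1\<^sub>m (a * b) :: 'k::field mat)"
proof (rule eq_matI)
  fix i j assume "i < dim_row (1\<^sub>m (a * b) :: 'k mat)" "j < dim_col (1\<^sub>m (a * b) :: 'k mat)"
  then have ij: "i < a * b" "j < a * b" by auto
  then have "0 < b" by (auto intro: Nat.gr0I)
  then have "i div b = j div b \<and> i mod b = j mod b \<longleftrightarrow> i = j" by (metis div_mult_mod_eq)
  then show "kron (1\<^sub>m a) (1\<^sub>m b) $$ (i, j) = (1\<^sub>m (a * b) :: 'k mat) $$ (i, j)"
    using ij \<open>0 < b\<close> by (auto simp: kron_def less_mult_imp_div_less)
qed (auto simp: kron_def)

text \<open>A splitting stays one after tensoring with a further module: the operators
  \<open>kron (J l) 1\<close> satisfy the same relations.\<close>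

lemma splitting_kron:
  fixes G1 G2 X1 X2 :: "'k::field mat"
  assumes "splitting p c n G1 G2" and G: "G1 \<in> carrier_mat n n" "G2 \<in> carrier_mat n n"
    and X: "X1 \<in> carrier_mat m m" "X2 \<in> carrier_mat m m"
  shows "splitting p c (n * m) (kron G1 X1) (kron G2 X2)"
proof -
  obtain J0 J1 where JR: "(\<forall>l. J0 l \<in> carrier_mat n n) \<and> (\<forall>l. J1 l \<in> carrier_mat n n) \<and>
     J1 0 = 1\<^sub>m n \<and> (\<forall>l<p.
       J0 l * G1 = G1 * (J0 l + prev n J0 l) \<and> J0 l * G2 = G2 * conv n c J0 l \<and>
       J1 l * G1 = G1 * (J1 l + prev n J1 l) \<and> J1 l * G2 = G2 * (conv n c J1 l + prev n J0 l))"
    using assms(1) unfolding splitting_def by blast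
  have J: "\<And>l. J0 l \<in> carrier_mat n n" "\<And>l. J1 l \<in> carrier_mat n n" "J1 0 = 1\<^sub>m n"
    using JR by blast+
  have R: "\<And>l. l < p \<Longrightarrow> J0 l * G1 = G1 * (J0 l + prev n J0 l)" "\<And>l. l < p \<Longrightarrow> J0 l * G2 = G2 * conv n c J0 l"
      "\<And>l. l < p \<Longrightarrow> J1 l * G1 = G1 * (J1 l + prev n J1 l)"
      "\<And>l. l < p \<Longrightarrow> J1 l * G2 = G2 * (conv n c J1 l + prev n J0 l)"
    using JR by blast+
  define K where "K J l = kron (J l) (1\<^sub>m m)" for J :: "nat \<Rightarrow> 'k mat" and l
  have I: "1\<^sub>m m \<in> carrier_mat m m" by simp
  have prev: "prev (n * m) (K J) l = kron (prev n J l) (1\<^sub>m m)" for J l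
    by (simp add: prev_def K_def kron_zero_left[OF I])
  have conv_aux: "conv_aux (n * m) c (K J) l i = kron (conv_aux n c J l i) (1\<^sub>m m)"
    if J: "\<And>l. J l \<in> carrier_mat n n" for J l i
  proof (induction i)
    case (Suc i)
    have KJ: "K J (l - i) = kron (J (l - i)) (1\<^sub>m m)" by (rule K_def)
    show ?case using J[of "l - i"] conv_aux_carrier[of J n c l i, OF J]
      by (simp add: Suc KJ kron_add_left[of _ n _ _ m] kron_smult_left[of _ n _ m] sqm[where n = n])
  qed (simp add: kron_zero_left[OF I])
  have main: "kron A (1\<^sub>m m) * kron G X = kron G X * kron B (1\<^sub>m m)"
    if "A * G = G * B" "A \<in> carrier_mat n n" "B \<in> carrier_mat n n" "G \<in> carrier_mat n n" "X \<in> carrier_mat m m" for A B G X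
    using that by (simp add: kron_mult[of _ n n _ n _ m m _ m])
  note car = J prev_carrier[of _ n] conv_carrier[of _ n]
  have a: "K J l + prev (n * m) (K J) l = kron (J l + prev n J l) (1\<^sub>m m)" if "\<And>l. J l \<in> carrier_mat n n" for J l
    unfolding prev unfolding K_def using that by (simp add: kron_add_left[of _ n _ _ m] prev_carrier)
  have b: "conv (n * m) c (K J) l = kron (conv n c J l) (1\<^sub>m m)" if "\<And>l. J l \<in> carrier_mat n n" for J l
    unfolding conv_def by (rule conv_aux[OF that])
  have d: "conv (n * m) c (K J1) l + prev (n * m) (K J0) l = kron (conv n c J1 l + prev n J0 l) (1\<^sub>m m)" for l
    unfolding b[OF J(2)] prev using J by (simp add: kron_add_left[of _ n _ _ m] prev_carrier conv_carrier)
  show ?thesis unfolding splitting_def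
  proof (rule exI[of _ "K J0"], rule exI[of _ "K J1"], intro conjI allI impI)
    show "K J0 l \<in> carrier_mat (n * m) (n * m)" "K J1 l \<in> carrier_mat (n * m) (n * m)" for l
      unfolding K_def by (rule kron_carrier[OF J(1) I], rule kron_carrier[OF J(2) I])
    show "K J1 0 = 1\<^sub>m (n * m)" by (simp add: K_def J kron_one)
  next
    fix l assume l: "l < p"
    show "K J0 l * kron G1 X1 = kron G1 X1 * (K J0 l + prev (n * m) (K J0) l)"
      unfolding a[OF J(1)] unfolding K_def by (rule main[OF R(1)[OF l]]) (use J G X in \<open>auto simp: sqm[where n = n] prev_carrier\<close>)
    show "K J0 l * kron G2 X2 = kron G2 X2 * conv (n * m) c (K J0) l"
      unfolding b[OF J(1)] unfolding K_def by (rule main[OF R(2)[OF l]]) (use J G X in \<open>auto simp: sqm[where n = n] conv_carrier\<close>)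
    show "K J1 l * kron G1 X1 = kron G1 X1 * (K J1 l + prev (n * m) (K J1) l)"
      unfolding a[OF J(2)] unfolding K_def by (rule main[OF R(3)[OF l]]) (use J G X in \<open>auto simp: sqm[where n = n] prev_carrier\<close>)
    show "K J1 l * kron G2 X2 = kron G2 X2 * (conv (n * m) c (K J1) l + prev (n * m) (K J0) l)"
      unfolding d unfolding K_def by (rule main[OF R(4)[OF l]]) (use J G X in \<open>auto simp: sqm[where n = n] prev_carrier conv_carrier\<close>)
  qed
qed

text \<open>The compression \<open>A \<mapsto> P * A * I\<close> is linear and, since projection and
  inclusion are equivariant, it preserves every relation. With invertible \<open>P\<close> this also
  transports a splitting along an isomorphism.\<close>

lemma splitting_summand:
  fixes G1 G2 H1 H2 P I :: "'k::field mat"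
  assumes "splitting p c n G1 G2" and G: "G1 \<in> carrier_mat n n" "G2 \<in> carrier_mat n n"
    and H: "H1 \<in> carrier_mat m m" "H2 \<in> carrier_mat m m"
    and P: "P \<in> carrier_mat m n" and I: "I \<in> carrier_mat n m" and PI: "P * I = 1\<^sub>m m"
    and PG: "P * G1 = H1 * P" "P * G2 = H2 * P" and IG: "G1 * I = I * H1" "G2 * I = I * H2"
  shows "splitting p c m H1 H2"
proof -
  obtain J0 J1 where JR: "(\<forall>l. J0 l \<in> carrier_mat n n) \<and> (\<forall>l. J1 l \<in> carrier_mat n n) \<and>
     J1 0 = 1\<^sub>m n \<and> (\<forall>l<p.
       J0 l * G1 = G1 * (J0 l + prev n J0 l) \<and> J0 l * G2 = G2 * conv n c J0 l \<and>
       J1 l * G1 = G1 * (J1 l + prev n J1 l) \<and> J1 l * G2 = G2 * (conv n c J1 l + prev n J0 l))"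
    using assms(1) unfolding splitting_def by blast
  have J: "\<And>l. J0 l \<in> carrier_mat n n" "\<And>l. J1 l \<in> carrier_mat n n" "J1 0 = 1\<^sub>m n"
    using JR by blast+
  have R: "\<And>l. l < p \<Longrightarrow> J0 l * G1 = G1 * (J0 l + prev n J0 l)" "\<And>l. l < p \<Longrightarrow> J0 l * G2 = G2 * conv n c J0 l"
      "\<And>l. l < p \<Longrightarrow> J1 l * G1 = G1 * (J1 l + prev n J1 l)"
      "\<And>l. l < p \<Longrightarrow> J1 l * G2 = G2 * (conv n c J1 l + prev n J0 l)"
    using JR by blast+
  define f where "f A = P * (A * I)" for A
  have fc: "A \<in> carrier_mat n n \<Longrightarrow> f A \<in> carrier_mat m m" for A
    unfolding f_def using P I by (meson mult_carrier_mat)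
  have f0: "f (0\<^sub>m n n) = 0\<^sub>m m m" unfolding f_def using P I by simp
  have fadd: "f (A + B) = f A + f B" if "A \<in> carrier_mat n n" "B \<in> carrier_mat n n" for A B
    unfolding f_def using that P I
    by (simp add: add_mult_distrib_mat[of _ n n _ _ m] mult_add_distrib_mat[of _ m n _ m])
  have fsmult: "f (t \<cdot>\<^sub>m A) = t \<cdot>\<^sub>m f A" if "A \<in> carrier_mat n n" for A t
    unfolding f_def using that P I
    by (simp add: mult_smult_assoc_mat[of _ n n _ m] mult_smult_distrib[of _ m n _ m])
  have prev: "prev m (\<lambda>l. f (J l)) l = f (prev n J l)" for J l
    by (simp add: prev_def f0)
  have conv_aux: "conv_aux m c (\<lambda>l. f (J l)) l i = f (conv_aux n c J l i)"
    if "\<And>l. J l \<in> carrier_mat n n" for J l i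
  proof (induction i)
    case (Suc i)
    show ?case using that[of "l - i"] conv_aux_carrier[of J n c l i, OF that]
      by (simp add: Suc fadd fsmult sqm[where n = n])
  qed (simp add: f0)
  have conv: "conv m c (\<lambda>l. f (J l)) l = f (conv n c J l)" if "\<And>l. J l \<in> carrier_mat n n" for J l
    unfolding conv_def by (rule conv_aux[OF that])
  have main: "f A * H = H * f B"
    if "A * G = G * B" "A \<in> carrier_mat n n" "B \<in> carrier_mat n n" "G \<in> carrier_mat n n" "H \<in> carrier_mat m m"
      "P * G = H * P" "G * I = I * H" for A B G H
  proof -
    have "f A * H = P * ((A * I) * H)" unfolding f_def using that P I by (intro assoc_mult_mat[of _ m n _ m _ m]) auto
    also have "(A * I) * H = A * (I * H)" using that I by (intro assoc_mult_mat[of _ n n _ m _ m]) auto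
    also have "\<dots> = (A * G) * I" unfolding that(7)[symmetric] using that I by (intro assoc_mult_mat[symmetric, of _ n n _ n _ m]) auto
    also have "\<dots> = G * (B * I)" unfolding that(1) using that I by (intro assoc_mult_mat[of _ n n _ n _ m]) auto
    also have "P * (G * (B * I)) = (P * G) * (B * I)" using that P I by (intro assoc_mult_mat[symmetric, of _ m n _ n _ m]) auto
    also have "\<dots> = H * f B" unfolding that(6) f_def using that P I by (intro assoc_mult_mat[of _ m m _ n _ m]) auto
    finally show ?thesis .
  qed
  have a: "f (J l) + prev m (\<lambda>l. f (J l)) l = f (J l + prev n J l)" if "\<And>l. J l \<in> carrier_mat n n" for J l
    unfolding prev using that by (simp add: fadd prev_carrier)
  have d: "conv m c (\<lambda>l. f (J1 l)) l + prev m (\<lambda>l. f (J0 l)) l = f (conv n c J1 l + prev n J0 l)" for l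
    unfolding conv[OF J(2)] prev using J by (simp add: fadd prev_carrier conv_carrier)
  show ?thesis unfolding splitting_def
  proof (rule exI[of _ "\<lambda>l. f (J0 l)"], rule exI[of _ "\<lambda>l. f (J1 l)"], intro conjI allI impI)
    show "f (J0 l) \<in> carrier_mat m m" "f (J1 l) \<in> carrier_mat m m" for l
      using fc J by blast+
    show "f (J1 0) = 1\<^sub>m m" using I by (simp add: f_def J PI)
  next
    fix l assume l: "l < p"
    show "f (J0 l) * H1 = H1 * (f (J0 l) + prev m (\<lambda>l. f (J0 l)) l)"
      unfolding a[of J0, OF J(1)] by (rule main[OF R(1)[OF l]]) (use J G H PG IG in \<open>auto simp: sqm[where n = n] prev_carrier\<close>)
    show "f (J0 l) * H2 = H2 * conv m c (\<lambda>l. f (J0 l)) l"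
      unfolding conv[of J0, OF J(1)] by (rule main[OF R(2)[OF l]]) (use J G H PG IG in \<open>auto simp: sqm[where n = n] conv_carrier\<close>)
    show "f (J1 l) * H1 = H1 * (f (J1 l) + prev m (\<lambda>l. f (J1 l)) l)"
      unfolding a[of J1, OF J(2)] by (rule main[OF R(3)[OF l]]) (use J G H PG IG in \<open>auto simp: sqm[where n = n] prev_carrier\<close>)
    show "f (J1 l) * H2 = H2 * (conv m c (\<lambda>l. f (J1 l)) l + prev m (\<lambda>l. f (J0 l)) l)"
      unfolding d by (rule main[OF R(4)[OF l]]) (use J G H PG IG in \<open>auto simp: sqm[where n = n] prev_carrier conv_carrier\<close>)
  qed
qed

lemma smult_mat_vec:
  fixes A :: "'k::comm_ring_1 mat"
  assumes "A \<in> carrier_mat m n" "w \<in> carrier_vec n"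
  shows "(c \<cdot>\<^sub>m A) *\<^sub>v w = c \<cdot>\<^sub>v (A *\<^sub>v w)"
  by (intro eq_vecI) (use assms in \<open>auto simp: scalar_prod_def sum_distrib_left mult.assoc\<close>)

lemma one_add_polyX: "1 + polyX = [:[:1, 1 :: 'k::comm_ring_1:]:]"
  by (simp add: polyX_def one_pCons)

lemma polyK_minus_1: "polyK (- 1 :: 'k::comm_ring_1) = - 1"
  by (simp add: polyK_def one_pCons)

lemma linear_1_1: "[:1, 1 :: 'a::comm_ring_1:] = 1 + [:0, 1:]"
  by (simp add: one_pCons)

lemma one_add_linear: "1 + [:a, 1 + a:] = [:1 + a:] * [:1, 1 :: 'a::comm_ring_1:]"
  by (simp add: one_pCons)

section \<open>Two commuting matrices with \<open>p\<close>-th power \<open>1\<close>\<close>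

locale unipotent_pair =
  fixes n p :: nat and \<mu> :: "'k::field" and G1 G2 :: "'k mat"
  assumes char_p: "CHAR('k) = p" and prime_p: "prime p"
    and G1 [simp]: "G1 \<in> carrier_mat n n" and G2 [simp]: "G2 \<in> carrier_mat n n"
    and comm: "G1 * G2 = G2 * G1" and G1_pow: "G1 ^\<^sub>m p = 1\<^sub>m n" and G2_pow: "G2 ^\<^sub>m p = 1\<^sub>m n"
begin

definition X :: "'k mat" where "X = G1 - 1\<^sub>m n"

lemma X [simp]: "X \<in> carrier_mat n n"
  unfolding X_def by (simp add: sqm[where n = n])

sublocale P1: mat_hom n "poly_mat1 n X" by (rule poly_mat1_hom) simp

lemma P1_1x: "poly_mat1 n X [:1, 1:] = G1"
proof -
  have eq: "[:1, 1:] = 1 + [:0, 1 :: 'k:]" by (simp add: one_pCons)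
  have "poly_mat1 n X [:1, 1:] = 1\<^sub>m n + X"
    unfolding eq P1.add P1.one poly_mat1_var[OF X] ..
  also have "\<dots> = G1" unfolding X_def by (rule eq_matI) (auto simp: carrier_matD[OF G1])
  finally show ?thesis .
qed

lemma X_G2: "X * G2 = G2 * X"
  unfolding X_def by (simp add: sqm_distrib[where n = n] sqm[where n = n] comm)

definition Y :: "'k mat" where "Y = G2 - poly_mat1 n X (binom_poly p \<mu>)"

lemma Y [simp]: "Y \<in> carrier_mat n n"
  unfolding Y_def by (simp add: sqm[where n = n])

lemma X_P1: "X * poly_mat1 n X q = poly_mat1 n X q * X"
  by (rule poly_mat1_commute) simp_all

lemma Y_X: "Y * X = X * Y"
  unfolding Y_def by (simp add: sqm_distrib[where n = n] X_G2 X_P1)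

sublocale P2: mat_hom n "poly_mat2 n X Y" by (rule poly_mat2_hom) (simp_all add: Y_X)

abbreviation M where "M \<equiv> poly_mat2 n X Y"

lemma M_const: "M [:q:] = poly_mat1 n X q"
  by (rule poly_mat2_const) (simp_all add: Y_X)

lemma M_Y: "M polyY = Y"
  unfolding polyY_def by (rule poly_mat2_var) (simp_all add: Y_X)

lemma M_K: "M (polyK a) = a \<cdot>\<^sub>m 1\<^sub>m n"
  unfolding polyK_def M_const by (rule poly_mat1_const) simp

lemma M_G1: "M (1 + polyX) = G1"
proof -
  have eq: "1 + polyX = [:[:1, 1 :: 'k:]:]" by (simp add: polyX_def one_pCons)
  show ?thesis unfolding eq M_const P1_1x ..
qed

lemma M_G2: "M ([:binom_poly p \<mu>:] + polyY) = G2"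
proof -
  have "poly_mat1 n X (binom_poly p \<mu>) + Y = G2"
    unfolding Y_def by (rule eq_matI) (auto simp: carrier_matD[OF G2] carrier_matD[OF P1.carrier])
  then show ?thesis unfolding P2.add M_const M_Y .
qed

lemma M_X_p: "M (polyX ^ p) = 0\<^sub>m n n"
proof -
  have "[:0, 1:] ^ p = [:1, 1:] ^ p - (1 :: 'k poly)"
  proof -
    have "([:0, 1:] + 1 :: 'k poly) ^ p = [:0, 1:] ^ p + 1 ^ p"
      by (rule freshmans_dream) (simp_all add: prime_p char_p)
    moreover have "[:0, 1:] + 1 = [:1, 1 :: 'k:]" by (simp add: one_pCons)
    ultimately show ?thesis by (simp only: power_one add_diff_cancel_right')
  qed
  then have "poly_mat1 n X ([:0, 1:] ^ p) = 0\<^sub>m n n"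
    by (simp add: P1.diff P1.power P1_1x G1_pow P1.one sqm[where n = n])
  then show ?thesis unfolding polyX_def poly_const_pow M_const .
qed

text \<open>In characteristic \<open>p\<close> the power is taken term by term, and only the
  constant term is not divisible by \<open>x ^ p\<close>. So \<open>c(X)\<close> has
  \<open>p\<close>-th power \<open>1\<close>, just as \<open>G2\<close>, and their difference
  \<open>Y\<close> has \<open>p\<close>-th power \<open>0\<close>.\<close>

lemma binom_poly_power_p: "\<exists>q. binom_poly p \<mu> ^ p = 1 + [:0, 1:] ^ p * q"
proof -
  have "binom_poly p \<mu> ^ p = (\<Sum>i<p. monom (binom_coeff \<mu> i) i ^ p)"
    unfolding binom_poly_def by (rule freshmans_dream_sum) (simp_all add: prime_p char_p)
  also have "\<dots> = monom (binom_coeff \<mu> 0) 0 ^ p + (\<Sum>i\<in>{..<p} - {0}. monom (binom_coeff \<mu> i) i ^ p)"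
    using prime_gt_0_nat[OF prime_p] by (subst sum.remove[of _ 0]) auto
  also have "monom (binom_coeff \<mu> 0) 0 ^ p = 1" by simp
  also have "(\<Sum>i\<in>{..<p} - {0}. monom (binom_coeff \<mu> i) i ^ p)
    = [:0, 1:] ^ p * (\<Sum>i\<in>{..<p} - {0}. monom (binom_coeff \<mu> i ^ p) (p * i - p))"
    unfolding sum_distrib_left
  proof (rule sum.cong[OF refl])
    fix i assume "i \<in> {..<p} - {0}"
    then have "p * i = p + (p * i - p)" by simp
    moreover have "[:0, 1:] ^ p = monom (1 :: 'k) p" by (simp add: monom_altdef)
    ultimately show "monom (binom_coeff \<mu> i) i ^ p = [:0, 1:] ^ p * monom (binom_coeff \<mu> i ^ p) (p * i - p)"
      by (simp add: monom_power mult_monom mult.commute)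
  qed
  finally show ?thesis by blast
qed

lemma M_Y_p: "M (polyY ^ p) = 0\<^sub>m n n"
proof -
  obtain q where q: "binom_poly p \<mu> ^ p = 1 + [:0, 1:] ^ p * q" using binom_poly_power_p by blast
  have "([:binom_poly p \<mu>:] + polyY) ^ p = [:binom_poly p \<mu>:] ^ p + polyY ^ p"
    by (rule freshmans_dream) (simp_all add: prime_p char_p)
  then have "polyY ^ p = ([:binom_poly p \<mu>:] + polyY) ^ p - [:binom_poly p \<mu> ^ p:]"
    by (simp add: poly_const_pow)
  then have "M (polyY ^ p) = 1\<^sub>m n - poly_mat1 n X (1 + [:0, 1:] ^ p * q)"
    by (simp add: P2.diff P2.power M_G2 G2_pow M_const q)
  also have "poly_mat1 n X (1 + [:0, 1:] ^ p * q) = 1\<^sub>m n + 0\<^sub>m n n * poly_mat1 n X q"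
    using M_X_p unfolding polyX_def poly_const_pow M_const by (simp add: P1.add P1.mult P1.one)
  finally show ?thesis by (simp add: sqm[where n = n])
qed

lemma annihilator_ideal:
  assumes "v \<in> carrier_vec n"
  shows "ideal_filtration {Q. M Q *\<^sub>v v = 0\<^sub>v n}"
proof
  fix a b c assume a: "a \<in> {Q. M Q *\<^sub>v v = 0\<^sub>v n}"
  have "M c *\<^sub>v 0\<^sub>v n = 0\<^sub>v n" by (intro eq_vecI) (auto simp: carrier_matD[OF P2.carrier])
  with a show "c * a \<in> {Q. M Q *\<^sub>v v = 0\<^sub>v n}" by (simp add: P2.mult_vec[OF assms])
  assume "b \<in> {Q. M Q *\<^sub>v v = 0\<^sub>v n}"
  with a show "a + b \<in> {Q. M Q *\<^sub>v v = 0\<^sub>v n}" by (simp add: P2.add_vec[OF assms])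
qed (simp add: P2.zero_vec[OF assms])

lemma conv_aux_vec:
  assumes "\<And>l. J l \<in> carrier_mat n n" "v \<in> carrier_vec n" "w \<in> carrier_vec n"
    and "\<And>i. i \<le> l \<Longrightarrow> J i *\<^sub>v w = M (f i) *\<^sub>v v" "i \<le> Suc l"
  shows "conv_aux n c J l i *\<^sub>v w = M (\<Sum>j<i. polyK (c j) * f (l - j)) *\<^sub>v v"
  using assms(5)
proof (induction i)
  case 0
  show ?case using assms by (simp add: P2.zero_vec) (intro eq_vecI, auto)
next
  case (Suc i)
  have K: "M (polyK (c i) * f (l - i)) *\<^sub>v v = c i \<cdot>\<^sub>v (M (f (l - i)) *\<^sub>v v)"
    unfolding P2.mult_vec[OF assms(2)] M_K
    using smult_mat_vec[of "1\<^sub>m n" n n "M (f (l - i)) *\<^sub>v v" "c i"] mult_mat_vec_carrier[OF P2.carrier assms(2)] by simp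
  have "conv_aux n c J l (Suc i) *\<^sub>v w = conv_aux n c J l i *\<^sub>v w + (c i \<cdot>\<^sub>m J (l - i)) *\<^sub>v w"
    using assms conv_aux_carrier[of J n c l i] by (simp add: add_mult_distrib_mat_vec[of _ n n] sqm[where n = n])
  also have "(c i \<cdot>\<^sub>m J (l - i)) *\<^sub>v w = c i \<cdot>\<^sub>v (J (l - i) *\<^sub>v w)"
    using assms(1,3) by (rule smult_mat_vec)
  also have "J (l - i) *\<^sub>v w = M (f (l - i)) *\<^sub>v v" using assms(4) by simp
  finally show ?case using Suc by (simp add: K P2.add_vec[OF assms(2)])
qed

lemma conv_vec:
  assumes "\<And>l. J l \<in> carrier_mat n n" "v \<in> carrier_vec n" "w \<in> carrier_vec n"
    and "\<And>i. i \<le> l \<Longrightarrow> J i *\<^sub>v w = M (f i) *\<^sub>v v"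
  shows "conv n c J l *\<^sub>v w = M (\<Sum>j\<le>l. polyK (c j) * f (l - j)) *\<^sub>v v"
  unfolding conv_def using conv_aux_vec[of J v w l f "Suc l", OF assms] by (simp add: lessThan_Suc_atMost)

lemma prev_vec:
  assumes "v \<in> carrier_vec n" "w \<in> carrier_vec n" "\<And>i. i \<le> l \<Longrightarrow> J i *\<^sub>v w = M (f i) *\<^sub>v v"
  shows "prev n J l *\<^sub>v w = M (if l = 0 then 0 else f (l - 1)) *\<^sub>v v"
  using assms by (auto simp: prev_def P2.zero_vec intro!: eq_vecI)

lemma shift_vec:
  assumes "v \<in> carrier_vec n" "w \<in> carrier_vec n"
    and "\<And>l. A l \<in> carrier_mat n n" "\<And>i. i \<le> l \<Longrightarrow> A i *\<^sub>v w = M (coeff T i) *\<^sub>v v"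
  shows "(A l + prev n A l) *\<^sub>v w = M (coeff ([:1, 1:] * T) l) *\<^sub>v v"
proof -
  have "coeff ([:1, 1:] * T) l = coeff T l + (if l = 0 then 0 else coeff T (l - 1))"
    by (cases l) simp_all
  then show ?thesis
    using assms prev_vec[of v w l A "coeff T"] prev_carrier[of A n l]
    by (simp add: add_mult_distrib_mat_vec[of _ n n] P2.add_vec)
qed

lemma conv_vec_coeff:
  assumes "v \<in> carrier_vec n" "w \<in> carrier_vec n" "l < p" "\<And>j. j < p \<Longrightarrow> coeff C j = polyK (c j)"
    and "\<And>l. A l \<in> carrier_mat n n" "\<And>i. i \<le> l \<Longrightarrow> A i *\<^sub>v w = M (coeff T i) *\<^sub>v v"
  shows "conv n c A l *\<^sub>v w = M (coeff (C * T) l) *\<^sub>v v"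
proof -
  have "coeff (C * T) l = (\<Sum>j\<le>l. polyK (c j) * coeff T (l - j))"
    unfolding coeff_mult using assms(3,4) by (intro sum.cong refl) simp
  then show ?thesis using conv_vec[of A v w l "coeff T"] assms by simp
qed

lemma conv_prev_vec_coeff:
  assumes "v \<in> carrier_vec n" "w \<in> carrier_vec n" "l < p" "\<And>j. j < p \<Longrightarrow> coeff C j = polyK (c j)"
    and "\<And>l. A l \<in> carrier_mat n n" "\<And>i. i \<le> l \<Longrightarrow> A i *\<^sub>v w = M (coeff T i) *\<^sub>v v"
    and "\<And>l. B l \<in> carrier_mat n n" "\<And>i. i \<le> l \<Longrightarrow> B i *\<^sub>v w = M (coeff U i) *\<^sub>v v"
  shows "(conv n c A l + prev n B l) *\<^sub>v w = M (coeff (C * T + [:0, 1:] * U) l) *\<^sub>v v"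
proof -
  have "prev n B l *\<^sub>v w = M (coeff ([:0, 1:] * U) l) *\<^sub>v v"
    using prev_vec[of v w l B "coeff U"] assms by (cases l) simp_all
  moreover have "conv n c A l *\<^sub>v w = M (coeff (C * T) l) *\<^sub>v v"
    by (rule conv_vec_coeff) (use assms in auto)
  ultimately show ?thesis unfolding coeff_add P2.add_vec[OF assms(1)]
    using assms by (subst add_mult_distrib_mat_vec[of _ n n]) (simp_all add: prev_carrier conv_carrier)
qed

text \<open>A cyclic module that satisfies the splitting property is \<open>'k[x, y] / (x ^ p, y ^ k)\<close>.\<close>

theorem splitting_cyclic:
  assumes split: "splitting p (binom_coeff \<mu>) n G1 G2" and v [simp]: "v \<in> carrier_vec n"
    and surj: "\<And>w. w \<in> carrier_vec n \<Longrightarrow> \<exists>Q. M Q *\<^sub>v v = w" and n: "n > 0"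
  obtains k where "1 \<le> k" "k \<le> p" "M (polyY ^ k) *\<^sub>v v = 0\<^sub>v n"
    "\<And>J'. ideal_filtration J' \<Longrightarrow> polyX ^ p \<in> J' \<Longrightarrow> polyY ^ k \<in> J' \<Longrightarrow> {Q. M Q *\<^sub>v v = 0\<^sub>v n} \<subseteq> J'"
proof -
  obtain J0 J1 where JR: "(\<forall>l. J0 l \<in> carrier_mat n n) \<and> (\<forall>l. J1 l \<in> carrier_mat n n) \<and>
     J1 0 = 1\<^sub>m n \<and> (\<forall>l<p.
       J0 l * G1 = G1 * (J0 l + prev n J0 l) \<and> J0 l * G2 = G2 * conv n (binom_coeff \<mu>) J0 l \<and>
       J1 l * G1 = G1 * (J1 l + prev n J1 l) \<and> J1 l * G2 = G2 * (conv n (binom_coeff \<mu>) J1 l + prev n J0 l))"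
    using split unfolding splitting_def by blast
  have J [simp]: "\<And>l. J0 l \<in> carrier_mat n n" "\<And>l. J1 l \<in> carrier_mat n n" and J10: "J1 0 = 1\<^sub>m n"
    using JR by blast+
  have R: "\<And>l. l < p \<Longrightarrow> J0 l * G1 = G1 * (J0 l + prev n J0 l)" "\<And>l. l < p \<Longrightarrow> J0 l * G2 = G2 * conv n (binom_coeff \<mu>) J0 l"
      "\<And>l. l < p \<Longrightarrow> J1 l * G1 = G1 * (J1 l + prev n J1 l)"
      "\<And>l. l < p \<Longrightarrow> J1 l * G2 = G2 * (conv n (binom_coeff \<mu>) J1 l + prev n J0 l)"
    using JR by blast+
  have "\<exists>Q. M Q *\<^sub>v v = J0 l *\<^sub>v v" "\<exists>Q. M Q *\<^sub>v v = J1 l *\<^sub>v v" for l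
    by (intro surj mult_mat_vec_carrier[of _ n n]; simp)+
  then obtain f g where f: "\<And>l. M (f l) *\<^sub>v v = J0 l *\<^sub>v v" and g: "\<And>l. M (g l) *\<^sub>v v = J1 l *\<^sub>v v" by metis
  \<comment> \<open>As \<open>J1 0\<close> is the identity, its value on \<open>v\<close> may be
    represented by the polynomial \<open>1\<close>, so that \<open>coeff u' 0 = 1\<close> holds
    exactly and not merely modulo \<open>J\<close>.\<close>
  define g' where "g' l = (if l = 0 then 1 else g l)" for l
  have g': "M (g' l) *\<^sub>v v = J1 l *\<^sub>v v" for l
    by (cases "l = 0") (simp_all add: g'_def g J10 P2.one_vec)
  define u where "u = (\<Sum>l<p. monom (f l) l)"
  define u' where "u' = (\<Sum>l<p. monom (g' l) l)"
  have cu: "coeff u l = f l" "coeff u' l = g' l" if "l < p" for l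
  proof -
    have "coeff (\<Sum>i<p. monom (h i) i) l = (\<Sum>i<p. if i = l then h i else 0)" for h :: "nat \<Rightarrow> 'k poly poly"
      by (simp add: coeff_sum coeff_monom)
    then show "coeff u l = f l" "coeff u' l = g' l" using that by (simp_all add: u_def u'_def)
  qed
  define J where "J = {Q. M Q *\<^sub>v v = 0\<^sub>v n}"
  interpret J: ideal_filtration J polyX p unfolding J_def by (rule annihilator_ideal) simp
  interpret C: cyclic_core J p \<mu> u u'
    by unfold_locales (simp_all add: polyX_def prime_p char_p one_pCons)
  have carr: "M Q *\<^sub>v v \<in> carrier_vec n" for Q by (rule mult_mat_vec_carrier[OF P2.carrier v])
  text \<open>\<open>J0\<close> and \<open>J1\<close> are determined by their values on the generator.\<close>
  define P0 where "P0 Q l = coeff (C.d0 Q * u) l" for Q l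
  define P1 where "P1 Q l = coeff (C.d0 Q * u' + C.d1 Q * u) l" for Q l
  define good where "good Q \<longleftrightarrow> (\<forall>l<p. J0 l *\<^sub>v (M Q *\<^sub>v v) = M (P0 Q l) *\<^sub>v v \<and> J1 l *\<^sub>v (M Q *\<^sub>v v) = M (P1 Q l) *\<^sub>v v)" for Q
  have goodD: "J0 l *\<^sub>v (M Q *\<^sub>v v) = M (P0 Q l) *\<^sub>v v" "J1 l *\<^sub>v (M Q *\<^sub>v v) = M (P1 Q l) *\<^sub>v v"
    if "good Q" "l < p" for Q l using that unfolding good_def by auto
  have P0_add: "P0 (A + B) l = P0 A l + P0 B l" and P1_add: "P1 (A + B) l = P1 A l + P1 B l" for A B l
    unfolding P0_def P1_def C.d0.hom_add C.d1_add by (simp_all add: algebra_simps)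
  have good_1: "good 1"
  proof -
    have "P0 1 l = coeff u l" "P1 1 l = coeff u' l" for l
      using C.d1_const[of 1] by (simp_all add: P0_def P1_def flip: one_pCons)
    then show ?thesis unfolding good_def by (simp add: P2.one_vec cu f g')
  qed
  have good_add: "good (A + B)" if "good A" "good B" for A B
    unfolding good_def
    by (simp add: P0_add P1_add P2.add_vec goodD[OF that(1)] goodD[OF that(2)] mult_add_distrib_mat_vec[of _ n n, OF _ carr carr])
  \<comment> \<open>The formula passes from \<open>Q\<close> to \<open>Z * Q\<close> whenever
    \<open>d0\<close> and \<open>d1\<close> multiply \<open>Z\<close> by series \<open>V\<close> and
    \<open>W\<close> that match a commutation rule of \<open>J0\<close> and \<open>J1\<close> with
    \<open>M Z\<close>. This covers the two generators and the scalars, and from these all of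
    \<open>'k[x, y]\<close> is obtained by sums, differences and products.\<close>
  have good_scale: "good (Z * Q)"
    if Q: "good Q" and Z: "C.d0 Z = [:Z:] * V" "C.d1 Z = [:Z:] * W"
      and A: "\<And>l. l < p \<Longrightarrow> J0 l * M Z = M Z * A0 l" "\<And>l. l < p \<Longrightarrow> J1 l * M Z = M Z * A1 l"
      and Ac: "\<And>l. A0 l \<in> carrier_mat n n" "\<And>l. A1 l \<in> carrier_mat n n"
      and A0: "\<And>l. l < p \<Longrightarrow> A0 l *\<^sub>v (M Q *\<^sub>v v) = M (coeff (V * (C.d0 Q * u)) l) *\<^sub>v v"
      and A1: "\<And>l. l < p \<Longrightarrow> A1 l *\<^sub>v (M Q *\<^sub>v v) = M (coeff (V * (C.d0 Q * u' + C.d1 Q * u) + W * (C.d0 Q * u)) l) *\<^sub>v v"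
    for Z Q V W A0 A1
    unfolding good_def
  proof (intro allI impI conjI)
    fix l assume l: "l < p"
    have main: "B *\<^sub>v (M (Z * Q) *\<^sub>v v) = M (Z * t) *\<^sub>v v"
      if "B \<in> carrier_mat n n" "B' \<in> carrier_mat n n" "B * M Z = M Z * B'" "B' *\<^sub>v (M Q *\<^sub>v v) = M t *\<^sub>v v" for B B' t
    proof -
      have "B *\<^sub>v (M (Z * Q) *\<^sub>v v) = B *\<^sub>v (M Z *\<^sub>v (M Q *\<^sub>v v))" by (simp add: P2.mult_vec)
      also have "\<dots> = (B * M Z) *\<^sub>v (M Q *\<^sub>v v)" by (rule assoc_mult_mat_vec[OF that(1) P2.carrier carr, symmetric])
      also have "\<dots> = M Z *\<^sub>v (B' *\<^sub>v (M Q *\<^sub>v v))" unfolding that(3) by (rule assoc_mult_mat_vec[OF P2.carrier that(2) carr])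
      finally show ?thesis by (simp add: that(4) P2.mult_vec)
    qed
    have "P0 (Z * Q) l = Z * coeff (V * (C.d0 Q * u)) l"
      unfolding P0_def C.d0.hom_mult Z by (simp add: mult.assoc)
    then show "J0 l *\<^sub>v (M (Z * Q) *\<^sub>v v) = M (P0 (Z * Q) l) *\<^sub>v v"
      using main[OF J(1) Ac(1) A(1)[OF l] A0[OF l]] by simp
    have "C.d0 (Z * Q) * u' + C.d1 (Z * Q) * u = [:Z:] * (V * (C.d0 Q * u' + C.d1 Q * u) + W * (C.d0 Q * u))"
      unfolding C.d0.hom_mult C.d1_mult Z by (simp only: algebra_simps)
    then have "P1 (Z * Q) l = Z * coeff (V * (C.d0 Q * u' + C.d1 Q * u) + W * (C.d0 Q * u)) l"
      unfolding P1_def by simp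
    then show "J1 l *\<^sub>v (M (Z * Q) *\<^sub>v v) = M (P1 (Z * Q) l) *\<^sub>v v"
      using main[OF J(2) Ac(2) A(2)[OF l] A1[OF l]] by simp
  qed
  have cs: "coeff C.cs j = polyK (binom_coeff \<mu> j)" if "j < p" for j
    using that by (simp add: C.coeff_cs polyK_def)
  have good_1X: "good ((1 + polyX) * Q)" if Q: "good Q" for Q
  proof (rule good_scale[OF Q, where V = "[:1, 1:]" and W = 0 and ?A0.0 = "\<lambda>l. J0 l + prev n J0 l" and ?A1.0 = "\<lambda>l. J1 l + prev n J1 l"])
    have "C.d0 (1 + polyX) = 1 + [:polyX, 1 + polyX:]"
      unfolding one_add_polyX C.d0_const linear_1_1 C.shift.hom_add C.shift.hom_one C.shift_x by (simp only: one_add_polyX[symmetric])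
    then show "C.d0 (1 + polyX) = [:1 + polyX:] * [:1, 1:]" by (simp only: one_add_linear)
    show "C.d1 (1 + polyX) = [:1 + polyX:] * 0"
      unfolding one_add_polyX C.d1_const by (simp only: mult_zero_right)
  next
    fix l assume l: "l < p"
    show "(J0 l + prev n J0 l) *\<^sub>v (M Q *\<^sub>v v) = M (coeff ([:1, 1:] * (C.d0 Q * u)) l) *\<^sub>v v"
      by (rule shift_vec[OF v carr J(1)]) (use goodD(1)[OF Q] l in \<open>simp add: P0_def\<close>)
    show "(J1 l + prev n J1 l) *\<^sub>v (M Q *\<^sub>v v)
        = M (coeff ([:1, 1:] * (C.d0 Q * u' + C.d1 Q * u) + 0 * (C.d0 Q * u)) l) *\<^sub>v v"
      unfolding mult_zero_left add_0_right
      by (rule shift_vec[OF v carr J(2)]) (use goodD(2)[OF Q] l in \<open>simp add: P1_def\<close>)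
  qed (use R(1,3) in \<open>simp_all add: M_G1 sqm[where n = n] prev_carrier\<close>)
  have good_G: "good (([:binom_poly p \<mu>:] + polyY) * Q)" if Q: "good Q" for Q
  proof (rule good_scale[OF Q, where V = C.cs and W = "[:0, 1:]" and ?A0.0 = "\<lambda>l. conv n (binom_coeff \<mu>) J0 l"
        and ?A1.0 = "\<lambda>l. conv n (binom_coeff \<mu>) J1 l + prev n J0 l"])
    have "C.d0 ([:binom_poly p \<mu>:] + polyY) = C.cs * ([:polyY:] + [:[:binom_poly p \<mu>:]:])"
      unfolding C.d0.hom_add C.d0_const C.d0_y C.Y_def C.\<Phi>_def by (simp only: distrib_left) simp
    then show "C.d0 ([:binom_poly p \<mu>:] + polyY) = [:[:binom_poly p \<mu>:] + polyY:] * C.cs"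
      by (simp only: add_pCons add_0_left mult.commute add.commute)
    show "C.d1 ([:binom_poly p \<mu>:] + polyY) = [:[:binom_poly p \<mu>:] + polyY:] * [:0, 1:]"
      unfolding C.d1_add C.d1_const C.d1_y by (simp only: mult.commute add_0_left)
  next
    fix l assume l: "l < p"
    show "conv n (binom_coeff \<mu>) J0 l *\<^sub>v (M Q *\<^sub>v v) = M (coeff (C.cs * (C.d0 Q * u)) l) *\<^sub>v v"
    proof (rule conv_vec_coeff[OF v carr l cs J(1)])
      fix i assume "i \<le> l"
      then have "i < p" using l by simp
      then show "J0 i *\<^sub>v (M Q *\<^sub>v v) = M (coeff (C.d0 Q * u) i) *\<^sub>v v"
        using goodD(1)[OF Q] unfolding P0_def by blast
    qed
    show "(conv n (binom_coeff \<mu>) J1 l + prev n J0 l) *\<^sub>v (M Q *\<^sub>v v)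
        = M (coeff (C.cs * (C.d0 Q * u' + C.d1 Q * u) + [:0, 1:] * (C.d0 Q * u)) l) *\<^sub>v v"
    proof (rule conv_prev_vec_coeff[OF v carr l cs J(2) _ J(1)])
      fix i assume "i \<le> l"
      then have i: "i < p" using l by simp
      show "J1 i *\<^sub>v (M Q *\<^sub>v v) = M (coeff (C.d0 Q * u' + C.d1 Q * u) i) *\<^sub>v v"
        using goodD(2)[OF Q i] unfolding P1_def .
      show "J0 i *\<^sub>v (M Q *\<^sub>v v) = M (coeff (C.d0 Q * u) i) *\<^sub>v v"
        using goodD(1)[OF Q i] unfolding P0_def .
    qed
  qed (use R(2,4) in \<open>simp_all add: M_G2 sqm[where n = n] prev_carrier conv_carrier\<close>)
  have good_K: "good (polyK a * Q)" if Q: "good Q" for a Q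
  proof (rule good_scale[OF Q, where V = 1 and W = 0 and ?A0.0 = J0 and ?A1.0 = J1])
    show "C.d0 (polyK a) = [:polyK a:] * 1" unfolding polyK_def C.d0_const C.shift_const by simp
    show "C.d1 (polyK a) = [:polyK a:] * 0" unfolding polyK_def C.d1_const by simp
  qed (use goodD[OF Q] in \<open>simp_all add: M_K P0_def P1_def mult_smult_assoc_mat[of _ n n _ n] mult_smult_distrib[of _ n n _ n] sqm[where n = n]\<close>)
  have good_diff: "good (A - B)" if "good A" "good B" for A B
  proof -
    have "polyK (- 1) * B = - B" by (simp add: polyK_minus_1)
    then show ?thesis using good_add[OF that(1) good_K[OF that(2), of "- 1"]] by simp
  qed
  have good_X: "good (polyX * Q)" if "good Q" for Q
    using good_diff[OF good_1X[OF that] that] by (simp add: algebra_simps)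
  have good_const: "good ([:q:] * Q)" if "good Q" for q Q
  proof (induction q)
    case 0
    then show ?case using good_diff[OF that that] by simp
  next
    case (pCons a q)
    have "[:pCons a q:] * Q = polyK a * Q + polyX * ([:q:] * Q)"
      by (simp add: polyK_def polyX_def smult_add_left[symmetric])
    then show ?case using good_add[OF good_K[OF that, of a] good_X[OF pCons(2)]] by (simp only:)
  qed
  have good_Y: "good (polyY * Q)" if "good Q" for Q
    using good_diff[OF good_G[OF that] good_const[OF that, of "binom_poly p \<mu>"]] by (simp add: algebra_simps)
  have good: "good Q" for Q
  proof (induction Q)
    case 0
    then show ?case using good_diff[OF good_1 good_1] by simp
  next
    case (pCons q Q)
    have "pCons q Q = [:q:] * 1 + polyY * Q" by (simp add: polyY_def)
    then show ?case using good_add[OF good_const[OF good_1, of q] good_Y[OF pCons(2)]] by (simp only:)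
  qed
  have zero: "A *\<^sub>v 0\<^sub>v n = 0\<^sub>v n" if "A \<in> carrier_mat n n" for A :: "'k mat"
    by (intro eq_vecI) (use that in auto)
  have inJ: "Q \<in> J \<longleftrightarrow> M Q *\<^sub>v v = 0\<^sub>v n" for Q
    by (simp add: J_def)
  interpret R: cyclic_core_rel J p \<mu> u u'
  proof unfold_locales
    show "coeff u' 0 = 1" using prime_gt_0_nat[OF prime_p] by (simp add: cu g'_def)
    show "polyX ^ p \<in> J" "polyY ^ p \<in> J"
      unfolding J_def using M_X_p M_Y_p by (auto intro!: eq_vecI)
    show "1 \<notin> J"
    proof
      assume "1 \<in> J"
      then have "v = 0\<^sub>v n" by (simp add: J_def P2.one_vec)
      moreover obtain Q where "M Q *\<^sub>v v = unit_vec n 0" using surj[of "unit_vec n 0"] by auto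
      ultimately have "unit_vec n 0 = (0\<^sub>v n :: 'k vec)" using zero[OF P2.carrier] by simp
      then have "unit_vec n 0 $ 0 = (0\<^sub>v n :: 'k vec) $ 0" by simp
      with n show False by simp
    qed
    \<comment> \<open>\<open>J0\<close> and \<open>J1\<close> send
      \<open>M F *\<^sub>v v = 0\<close> to zero, so the polynomials that compute these values
      annihilate \<open>v\<close>.\<close>
    fix F assume "F \<in> J"
    then have F: "M F *\<^sub>v v = 0\<^sub>v n" by (simp add: J_def)
    show "C.d0 F * u \<in> J.Js" "C.d0 F * u' + C.d1 F * u \<in> J.Js"
      unfolding J.Js_def
    proof (safe)
      fix l assume l: "l < p"
      show "coeff (C.d0 F * u) l \<in> J" "coeff (C.d0 F * u' + C.d1 F * u) l \<in> J"
        using goodD[OF good[of F] l] unfolding inJ F zero[OF J(1)] zero[OF J(2)] P0_def P1_def by simp_all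
    qed
  qed
  show thesis
  proof (rule that[of R.rank])
    show "1 \<le> R.rank" "R.rank \<le> p" using R.rank_pos R.rank_le by auto
    show "M (polyY ^ R.rank) *\<^sub>v v = 0\<^sub>v n" using R.y_power_rank unfolding J_def by simp
    show "{Q. M Q *\<^sub>v v = 0\<^sub>v n} \<subseteq> J'" if "ideal_filtration J'" "polyX ^ p \<in> J'" "polyY ^ R.rank \<in> J'" for J'
      using R.J_subset[OF that] unfolding J_def .
  qed
qed

end

text \<open>A linear map factors through a surjection whose kernel it kills. The source is any
  abelian group with a scalar action, because it will be the infinite-dimensional ring
  \<open>'k[x, y]\<close> with scalars acting through \<open>polyK\<close>.\<close>

lemma linear_extension:
  fixes ev \<psi> :: "'q::ab_group_add \<Rightarrow> 'k::field vec" and sc :: "'k \<Rightarrow> 'q \<Rightarrow> 'q"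
  assumes ev: "\<And>q. ev q \<in> carrier_vec n" "\<And>a b. ev (a + b) = ev a + ev b" "\<And>t q. ev (sc t q) = t \<cdot>\<^sub>v ev q"
    and \<psi>: "\<And>q. \<psi> q \<in> carrier_vec m" "\<And>a b. \<psi> (a + b) = \<psi> a + \<psi> b" "\<And>t q. \<psi> (sc t q) = t \<cdot>\<^sub>v \<psi> q"
    and surj: "\<And>w. w \<in> carrier_vec n \<Longrightarrow> \<exists>q. ev q = w"
    and ker: "\<And>q. ev q = 0\<^sub>v n \<Longrightarrow> \<psi> q = 0\<^sub>v m"
  shows "\<exists>A \<in> carrier_mat m n. \<forall>q. A *\<^sub>v ev q = \<psi> q"
proof -
  have "\<exists>q. ev q = unit_vec n i" for i by (rule surj) simp
  then obtain Q where Q: "\<And>i. ev (Q i) = unit_vec n i" by metis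
  define A where "A = mat m n (\<lambda>(r, i). \<psi> (Q i) $ r)"
  have sums: "f (\<Sum>i\<in>S. g i) $ j = (\<Sum>i\<in>S. f (g i) $ j)"
    if "\<And>q. f q \<in> carrier_vec d" "\<And>a b. f (a + b) = f a + f b" "j < d" "finite S"
    for f :: "'q \<Rightarrow> 'k vec" and g :: "nat \<Rightarrow> 'q" and d j S
  proof -
    have "f 0 $ j = 0"
    proof -
      have "f 0 $ j + f 0 $ j = (f 0 + f 0) $ j" using that(3) carrier_vecD[OF that(1)[of 0]] by (subst index_add_vec) auto
      also have "\<dots> = f 0 $ j" using that(2)[of 0 0] by simp
      finally show ?thesis by (metis add_cancel_right_right)
    qed
    with that(4) show ?thesis
      by (induction S rule: finite_induct) (use that(2,3) carrier_vecD[OF that(1)] in simp_all)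
  qed
  have "A *\<^sub>v ev q = \<psi> q" for q
  proof -
    define q' where "q' = (\<Sum>i<n. sc (ev q $ i) (Q i))"
    have "ev q' = ev q"
    proof (rule eq_vecI)
      fix j assume "j < dim_vec (ev q)"
      then have j: "j < n" using carrier_vecD[OF ev(1)] by simp
      have "ev q' $ j = (\<Sum>i<n. ev (sc (ev q $ i) (Q i)) $ j)"
        unfolding q'_def by (rule sums[OF ev(1,2) j]) simp
      also have "\<dots> = (\<Sum>i<n. if i = j then ev q $ i else 0)"
        using j by (intro sum.cong refl) (simp add: ev(3) Q)
      also have "\<dots> = ev q $ j" using j by simp
      finally show "ev q' $ j = ev q $ j" .
    qed (simp add: carrier_vecD[OF ev(1)])
    moreover have "ev (q - q') + ev q' = ev q" using ev(2)[of "q - q'" q'] by simp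
    ultimately have "ev (q - q') + ev q = ev q" by simp
    then have "ev (q - q') = 0\<^sub>v n"
    proof -
      assume h: "ev (q - q') + ev q = ev q"
      show ?thesis
      proof (rule eq_vecI)
        fix j assume "j < dim_vec (0\<^sub>v n :: 'k vec)"
        then have j: "j < n" by simp
        have "(ev (q - q') + ev q) $ j = ev (q - q') $ j + ev q $ j"
          using j carrier_vecD[OF ev(1)] by simp
        with h j show "ev (q - q') $ j = 0\<^sub>v n $ j" by simp
      qed (simp add: carrier_vecD[OF ev(1)])
    qed
    from ker[OF this] have "\<psi> q = \<psi> q'" using \<psi>(2)[of "q - q'" q'] \<psi>(1)[of q'] by simp
    also have "\<psi> q' = A *\<^sub>v ev q"
    proof (rule eq_vecI)
      fix r assume "r < dim_vec (A *\<^sub>v ev q)"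
      then have r: "r < m" by (simp add: A_def)
      have "\<psi> q' $ r = (\<Sum>i<n. \<psi> (sc (ev q $ i) (Q i)) $ r)"
        unfolding q'_def by (rule sums[OF \<psi>(1,2) r]) simp
      also have "\<dots> = (\<Sum>i<n. ev q $ i * \<psi> (Q i) $ r)"
        using r carrier_vecD[OF \<psi>(1)] by (simp add: \<psi>(3))
      also have "\<dots> = (A *\<^sub>v ev q) $ r"
        using r carrier_vecD[OF ev(1)[of q]] by (simp add: A_def scalar_prod_def atLeast0LessThan mult.commute)
      finally show "\<psi> q' $ r = (A *\<^sub>v ev q) $ r" .
    qed (simp add: carrier_vecD[OF \<psi>(1)] A_def)
    finally show ?thesis ..
  qed
  moreover have "A \<in> carrier_mat m n" by (simp add: A_def)
  ultimately show ?thesis by blast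
qed

lemma vec_eq_of_diff:
  fixes a b :: "'k::ab_group_add vec"
  assumes "a \<in> carrier_vec n" "b \<in> carrier_vec n" "a - b = 0\<^sub>v n"
  shows "a = b"
proof (rule eq_vecI)
  fix i assume "i < dim_vec b"
  then have i: "i < n" using assms by simp
  then have "(a - b) $ i = a $ i - b $ i" using assms(1,2) by simp
  then have "a $ i - b $ i = 0" unfolding assms(3) using i by simp
  then show "a $ i = b $ i" by simp
qed (use assms in simp)

lemma mat_eq_on_vecs:
  fixes A B :: "'k::comm_ring_1 mat"
  assumes "A \<in> carrier_mat m n" "B \<in> carrier_mat m n" "\<And>w. w \<in> carrier_vec n \<Longrightarrow> A *\<^sub>v w = B *\<^sub>v w"
  shows "A = B"
proof (rule eq_matI)
  fix i j assume ij: "i < dim_row B" "j < dim_col B"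
  have "A *\<^sub>v unit_vec n j = B *\<^sub>v unit_vec n j" by (rule assms(3)) simp
  then have "(A *\<^sub>v unit_vec n j) $ i = (B *\<^sub>v unit_vec n j) $ i" by simp
  then show "A $$ (i, j) = B $$ (i, j)" using ij assms(1,2) by simp
qed (use assms in auto)

lemma surj_right_inverse:
  fixes A :: "'k::comm_ring_1 mat"
  assumes "A \<in> carrier_mat m n" "\<And>w. w \<in> carrier_vec m \<Longrightarrow> \<exists>u\<in>carrier_vec n. A *\<^sub>v u = w"
  obtains B where "B \<in> carrier_mat n m" "A * B = 1\<^sub>m m"
proof -
  have "\<exists>u\<in>carrier_vec n. A *\<^sub>v u = unit_vec m j" for j by (rule assms(2)) simp
  then obtain u where u: "\<And>j. u j \<in> carrier_vec n" "\<And>j. A *\<^sub>v u j = unit_vec m j" by metis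
  define B where "B = mat n m (\<lambda>(i, j). u j $ i)"
  have B: "B \<in> carrier_mat n m" by (simp add: B_def)
  have "A * B = 1\<^sub>m m"
  proof (rule mat_col_eqI)
    fix j assume "j < dim_col (1\<^sub>m m :: 'k mat)"
    then have j: "j < m" by simp
    have "col B j = u j" using j carrier_vecD[OF u(1)] by (intro eq_vecI) (simp_all add: B_def)
    have "col (A * B) j = A *\<^sub>v u j" using col_mult2[OF assms(1) B j] \<open>col B j = u j\<close> by (simp only:)
    then show "col (A * B) j = col (1\<^sub>m m) j" using j by (simp only: u(2) col_one)
  qed (use B assms(1) in auto)
  with B that show thesis by blast
qed

text \<open>Adding zero rows and columns to a factorization of the identity would otherwise give an
  invertible matrix with a zero row.\<close>

lemma right_inverse_dim:
  fixes A :: "'k::field mat"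
  assumes "A \<in> carrier_mat m n" "B \<in> carrier_mat n m" "A * B = 1\<^sub>m m"
  shows "m \<le> n"
proof (rule ccontr)
  assume "\<not> m \<le> n"
  then have n: "n < m" by simp
  define A' where "A' = mat m m (\<lambda>(i, j). if j < n then A $$ (i, j) else 0)"
  define B' where "B' = mat m m (\<lambda>(i, j). if i < n then B $$ (i, j) else 0)"
  have car: "A' \<in> carrier_mat m m" "B' \<in> carrier_mat m m" by (auto simp: A'_def B'_def)
  have "A' * B' = A * B"
  proof (rule eq_matI)
    fix i j assume ij: "i < dim_row (A * B)" "j < dim_col (A * B)"
    then have "(A' * B') $$ (i, j) = (\<Sum>k<m. if k < n then A $$ (i, k) * B $$ (k, j) else 0)"
      using assms by (auto simp: A'_def B'_def scalar_prod_def atLeast0LessThan intro!: sum.cong)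
    also have "\<dots> = (\<Sum>k<n. A $$ (i, k) * B $$ (k, j))"
      using n by (intro sum.mono_neutral_cong_right) auto
    finally show "(A' * B') $$ (i, j) = (A * B) $$ (i, j)"
      using ij assms(1,2) by (simp add: scalar_prod_def atLeast0LessThan)
  qed (use car assms in auto)
  then have "B' * A' = 1\<^sub>m m" using assms(3) by (intro mat_mult_left_right_inverse[OF car]) simp
  moreover have "(B' * A') $$ (n, n) = 0"
    using n by (simp add: A'_def B'_def scalar_prod_def)
  ultimately show False using n by simp
qed

section \<open>The splitting for the regular module of \<open>'k[x] / (x ^ p)\<close>\<close>

context unipotent_pair
begin

lemma carrier_M_vec: "v \<in> carrier_vec n \<Longrightarrow> M Q *\<^sub>v v \<in> carrier_vec n"
  by (rule mult_mat_vec_carrier[OF P2.carrier])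

lemma M_K_vec: "v \<in> carrier_vec n \<Longrightarrow> M (polyK a * Q) *\<^sub>v v = a \<cdot>\<^sub>v (M Q *\<^sub>v v)"
  unfolding P2.mult_vec M_K
  using smult_mat_vec[of "1\<^sub>m n" n n "M Q *\<^sub>v v" a] carrier_M_vec[of v Q] by simp

text \<open>\<open>J1\<close> is the substitution \<delta> of \<open>(1 + x) * (1 + s)\<close> for
  \<open>1 + x\<close>, and \<open>J0\<close> is \<delta> followed by multiplication with
  \<open>u\<close>. The relation for \<open>J1\<close> and the second generator asks for
  \<open>s * u = - \<Phi> / c\<close>, which determines the choice of \<open>u\<close>; the one for
  \<open>J0\<close> then asks that \<open>\<Phi> * \<Phi>1\<close> vanish, where
  \<open>\<Phi> = s * \<Phi>1\<close>.\<close>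

theorem splitting_regular:
  assumes Y0: "Y = 0\<^sub>m n n" and n: "n = p" and v [simp]: "v \<in> carrier_vec n"
    and surj: "\<And>w. w \<in> carrier_vec n \<Longrightarrow> \<exists>Q. M Q *\<^sub>v v = w"
  shows "splitting p (binom_coeff \<mu>) n G1 G2"
proof -
  define J where "J = {Q. M Q *\<^sub>v v = 0\<^sub>v n}"
  have inJ: "Q \<in> J \<longleftrightarrow> M Q *\<^sub>v v = 0\<^sub>v n" for Q by (simp add: J_def)
  interpret J: ideal_filtration J polyX p unfolding J_def by (rule annihilator_ideal) simp
  interpret C: binom_shift J polyX p "\<lambda>q. [:q:]" \<mu>
    by unfold_locales (simp_all add: polyX_def prime_p char_p one_pCons)
  have X_p: "polyX ^ p \<in> J" unfolding inJ M_X_p by (intro eq_vecI) auto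
  have Mpoly: "M Q = M [:coeff Q 0:]" for Q
  proof (cases Q)
    case (pCons q R)
    then have eq: "Q = [:q:] + polyY * R" by (simp add: polyY_def)
    have "Y * Z = 0\<^sub>m n n" if "Z \<in> carrier_mat n n" for Z using that by (simp add: Y0)
    then have "M ([:q:] + polyY * R) = M [:q:] + 0\<^sub>m n n"
      unfolding P2.add P2.mult M_Y by (simp only: P2.carrier)
    then have "M ([:q:] + polyY * R) = M [:q:]" by (simp only: sqm(5)[OF P2.carrier])
    moreover have "coeff Q 0 = q" using pCons by simp
    ultimately show ?thesis by (simp only: eq)
  qed
  \<comment> \<open>The columns are the \<open>p\<close> vectors \<open>X ^ j * v\<close> with
    \<open>j < p\<close>. They span a space of dimension \<open>p\<close>, hence are independent,
    and this shows that a polynomial in \<open>x\<close> alone which kills \<open>v\<close> is a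
    multiple of \<open>x ^ p\<close>.\<close>
  define basis where "basis = mat n n (\<lambda>(i, j). (M (polyX ^ j) *\<^sub>v v) $ i)"
  have basis: "basis \<in> carrier_mat n n" by (simp add: basis_def)
  have basis_vec: "M [:q:] *\<^sub>v v = basis *\<^sub>v vec n (coeff q)" if "\<And>i. i \<ge> p \<Longrightarrow> coeff q i = 0" for q
  proof -
    have q: "[:q:] = (\<Sum>j<p. polyK (coeff q j) * polyX ^ j)"
    proof -
      have "q = (\<Sum>j<p. monom (coeff q j) j)"
        by (rule poly_eqI) (use that in \<open>auto simp: coeff_sum coeff_monom not_less\<close>)
      then have "[:q:] = (\<Sum>j<p. [:monom (coeff q j) j:])"
        using C.e.hom_sum[of "\<lambda>j. monom (coeff q j) j" "{..<p}"] by simp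
      also have "\<dots> = (\<Sum>j<p. polyK (coeff q j) * polyX ^ j)"
        by (rule sum.cong[OF refl]) (simp add: polyK_def polyX_def poly_const_pow monom_altdef)
      finally show ?thesis .
    qed
    have "(M (\<Sum>j<m. polyK (coeff q j) * polyX ^ j) *\<^sub>v v) $ i = (\<Sum>j<m. coeff q j * (M (polyX ^ j) *\<^sub>v v) $ i)"
      if "i < n" for i m
      using that carrier_vecD[OF carrier_M_vec[OF v]]
      by (induction m) (simp_all add: P2.zero_vec P2.add_vec M_K_vec)
    then show ?thesis unfolding q
      using carrier_vecD[OF carrier_M_vec[OF v]] n
      by (intro eq_vecI) (auto simp: basis_def scalar_prod_def atLeast0LessThan mult.commute)
  qed
  have split_off: "\<exists>a r. q = monom 1 p * a + r \<and> (\<forall>i\<ge>p. coeff r i = 0)" for q :: "'k poly"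
  proof -
    have "q mod monom 1 p = 0 \<or> degree (q mod monom 1 p) < p"
      using degree_mod_less[of "monom 1 p" q] by (simp add: degree_monom_eq)
    then have "\<forall>i\<ge>p. coeff (q mod monom 1 p) i = 0" by (auto intro: coeff_eq_0)
    then show ?thesis by (intro exI[of _ "q div monom 1 p"] exI[of _ "q mod monom 1 p"]) simp
  qed
  have mono: "[:monom 1 p * a:] \<in> J" for a
  proof -
    have "[:monom 1 p * a:] = polyX ^ p * [:a:]"
      by (simp add: polyX_def poly_const_pow monom_altdef)
    then show ?thesis using J.mult_J'[OF X_p, of "[:a:]"] by (simp only:)
  qed
  have reduce: "M [:monom 1 p * a + r:] *\<^sub>v v = M [:r:] *\<^sub>v v" for a r
  proof -
    have "[:monom 1 p * a + r:] - [:r:] \<in> J" using mono[of a] by simp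
    then have "M [:monom 1 p * a + r:] *\<^sub>v v - M [:r:] *\<^sub>v v = 0\<^sub>v n" unfolding inJ P2.diff_vec[OF v] .
    then show ?thesis by (rule vec_eq_of_diff[OF carrier_M_vec[OF v] carrier_M_vec[OF v]])
  qed
  obtain D where D: "D \<in> carrier_mat n n" "basis * D = 1\<^sub>m n"
  proof (rule surj_right_inverse[OF basis])
    fix w :: "'k vec" assume "w \<in> carrier_vec n"
    then obtain Q where Q: "M Q *\<^sub>v v = w" using surj by blast
    obtain a r where ar: "coeff Q 0 = monom 1 p * a + r" "\<forall>i\<ge>p. coeff r i = 0" using split_off by blast
    have "w = basis *\<^sub>v vec n (coeff r)"
      using Q Mpoly[of Q] reduce[of a r] basis_vec[of r] ar by simp
    then show "\<exists>u\<in>carrier_vec n. basis *\<^sub>v u = w" by (intro bexI[of _ "vec n (coeff r)"]) auto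
  qed blast
  have D': "D * basis = 1\<^sub>m n" by (rule mat_mult_left_right_inverse[OF basis D])
  have ker: "\<exists>a. coeff Q 0 = monom 1 p * a" if "M Q *\<^sub>v v = 0\<^sub>v n" for Q
  proof -
    obtain a r where ar: "coeff Q 0 = monom 1 p * a + r" "\<forall>i\<ge>p. coeff r i = 0" using split_off by blast
    have "basis *\<^sub>v vec n (coeff r) = 0\<^sub>v n"
      using that Mpoly[of Q] reduce[of a r] basis_vec[of r] ar by simp
    then have "(D * basis) *\<^sub>v vec n (coeff r) = 0\<^sub>v n"
      using D basis by (subst assoc_mult_mat_vec[of _ n n _ n]) auto
    then have "vec n (coeff r) = 0\<^sub>v n" unfolding D' by simp
    then have "coeff r i = 0" for i
      using ar(2) n by (cases "i < p") (auto dest: arg_cong[of _ _ "\<lambda>w. w $ i"])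
    then have "r = 0" by (intro poly_eqI) simp
    with ar show ?thesis by auto
  qed
  define \<delta> where "\<delta> Q = C.shift (coeff Q 0)" for Q
  have \<delta>_add: "\<delta> (A + B) = \<delta> A + \<delta> B" and \<delta>_mult: "\<delta> (A * B) = \<delta> A * \<delta> B" for A B
    by (simp_all add: \<delta>_def C.shift.hom_add C.shift.hom_mult coeff_mult_0)
  have \<delta>_K: "\<delta> (polyK a) = [:polyK a:]" for a by (simp add: \<delta>_def polyK_def C.shift_const)
  \<comment> \<open>By Frobenius \<delta> sends \<open>x ^ p\<close> to
    \<open>x ^ p + s ^ p * (1 + x) ^ p\<close>, which is zero modulo \<open>J\<close> and
    \<open>s ^ p\<close>. So \<delta> is well defined on the module.\<close>
  have \<delta>_J: "\<delta> Q \<in> J.Js" if Q: "M Q *\<^sub>v v = 0\<^sub>v n" for Q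
  proof -
    obtain a where a: "coeff Q 0 = monom 1 p * a" using ker[OF Q] by blast
    have "[:polyX, 1 + polyX :: 'k poly poly:] = [:polyX:] + [:0, 1:] * [:1 + polyX:]" by simp
    moreover have "([:polyX:] + [:0, 1:] * [:1 + polyX :: 'k poly poly:]) ^ p = [:polyX:] ^ p + ([:0, 1:] * [:1 + polyX:]) ^ p"
      by (rule freshmans_dream) (simp_all add: prime_p char_p)
    ultimately have "[:polyX, 1 + polyX :: 'k poly poly:] ^ p = [:polyX ^ p:] + [:0, 1:] ^ p * [:1 + polyX:] ^ p"
      unfolding poly_const_pow[symmetric] power_mult_distrib[symmetric] by (simp only:)
    moreover have "[:polyX ^ p:] \<in> J.Js"
      using X_p unfolding J.Js_def by (auto simp: coeff_pCons J.zero_J split: nat.splits)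
    ultimately have "[:polyX, 1 + polyX:] ^ p \<in> J.Js"
      using J.Js_add[OF \<open>[:polyX ^ p:] \<in> J.Js\<close> J.Js_s_power[of "[:1 + polyX:] ^ p"]] by (simp only:)
    then have "C.shift a * [:polyX, 1 + polyX:] ^ p \<in> J.Js" by (rule J.Js_mult)
    then show ?thesis
      unfolding \<delta>_def a C.shift.hom_mult monom_altdef C.shift_smult C.shift.hom_power C.shift_x
      by (simp add: mult.commute C.e_1[unfolded one_pCons] flip: one_pCons)
  qed
  obtain \<Phi>1 where \<Phi>1: "C.\<Phi> = [:0, 1:] * \<Phi>1" "\<Phi>1 \<in> J.fil (p - 1)"
    by (rule J.fil_divide_s[OF C.\<Phi>_fil C.coeff_\<Phi>_0]) simp
  \<comment> \<open>The inverse of \<open>c\<close> modulo \<open>x ^ p\<close>, because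
    \<open>c ^ p\<close> is \<open>1\<close> modulo \<open>x ^ p\<close>.\<close>
  define c' where "c' = binom_poly p \<mu> ^ (p - 1)"
  have cc': "1 - [:binom_poly p \<mu> * c':] \<in> J"
  proof -
    obtain q where q: "binom_poly p \<mu> ^ p = 1 + [:0, 1:] ^ p * q" using binom_poly_power_p by blast
    have "binom_poly p \<mu> * c' = binom_poly p \<mu> ^ p"
      unfolding c'_def using prime_gt_0_nat[OF prime_p] by (cases p) simp_all
    then have "1 - [:binom_poly p \<mu> * c':] = - [:monom 1 p * q:]"
      by (simp add: q monom_altdef C.e.hom_add)
    then show ?thesis using J.uminus_J[OF mono[of q]] by simp
  qed
  \<comment> \<open>Chosen so that \<open>s * u\<close> is \<open>- \<Phi> / c\<close> modulo
    \<open>J\<close>.\<close>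
  define u where "u = - (\<Phi>1 * [:[:c':]:])"
  have ev_ext: "\<exists>A \<in> carrier_mat n n. \<forall>Q. A *\<^sub>v (M Q *\<^sub>v v) = M (coeff (\<delta> Q * t) l) *\<^sub>v v" if "l < p" for t l
  proof (rule linear_extension[where sc = "\<lambda>a Q. polyK a * Q"])
    show "M (polyK a * q) *\<^sub>v v = a \<cdot>\<^sub>v (M q *\<^sub>v v)" for a q by (rule M_K_vec[OF v])
    show "M (coeff (\<delta> (polyK a * q) * t) l) *\<^sub>v v = a \<cdot>\<^sub>v (M (coeff (\<delta> q * t) l) *\<^sub>v v)" for a q
      by (simp add: \<delta>_mult \<delta>_K M_K_vec[OF v] mult.assoc)
    show "M (coeff (\<delta> q * t) l) *\<^sub>v v = 0\<^sub>v n" if "M q *\<^sub>v v = 0\<^sub>v n" for q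
      using J.Js_mult[OF \<delta>_J[OF that], of t] \<open>l < p\<close> unfolding J.Js_def by (simp add: inJ mult.commute)
  qed (simp_all add: carrier_M_vec P2.add_vec \<delta>_add distrib_right surj)
  \<comment> \<open>The relations concern only \<open>l < p\<close>; the zero matrices beyond keep
    the whole family in the carrier.\<close>
  define J0 where "J0 l = (if l < p then SOME A. A \<in> carrier_mat n n \<and> (\<forall>Q. A *\<^sub>v (M Q *\<^sub>v v) = M (coeff (\<delta> Q * u) l) *\<^sub>v v) else 0\<^sub>m n n)" for l
  define J1 where "J1 l = (if l < p then SOME A. A \<in> carrier_mat n n \<and> (\<forall>Q. A *\<^sub>v (M Q *\<^sub>v v) = M (coeff (\<delta> Q) l) *\<^sub>v v) else 0\<^sub>m n n)" for l
  have J0: "J0 l \<in> carrier_mat n n \<and> (\<forall>Q. J0 l *\<^sub>v (M Q *\<^sub>v v) = M (coeff (\<delta> Q * u) l) *\<^sub>v v)" if "l < p" for l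
    unfolding J0_def using that ev_ext[OF that, of u] by (auto intro!: someI_ex[of "\<lambda>A. A \<in> carrier_mat n n \<and> (\<forall>Q. A *\<^sub>v (M Q *\<^sub>v v) = M (coeff (\<delta> Q * u) l) *\<^sub>v v)"])
  have J1: "J1 l \<in> carrier_mat n n \<and> (\<forall>Q. J1 l *\<^sub>v (M Q *\<^sub>v v) = M (coeff (\<delta> Q) l) *\<^sub>v v)" if "l < p" for l
    unfolding J1_def using that ev_ext[OF that, of 1] by (auto intro!: someI_ex[of "\<lambda>A. A \<in> carrier_mat n n \<and> (\<forall>Q. A *\<^sub>v (M Q *\<^sub>v v) = M (coeff (\<delta> Q) l) *\<^sub>v v)"])
  have Jc [simp]: "J0 l \<in> carrier_mat n n" "J1 l \<in> carrier_mat n n" for l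
    using J0[of l] J1[of l] by (cases "l < p"; simp add: J0_def J1_def)+
  have carr: "M Q *\<^sub>v v \<in> carrier_vec n" for Q by (rule carrier_M_vec[OF v])
  have matI: "A * M Z = M Z * B"
    if "A \<in> carrier_mat n n" "B \<in> carrier_mat n n" "\<And>Q. A *\<^sub>v (M (Z * Q) *\<^sub>v v) = M Z *\<^sub>v (B *\<^sub>v (M Q *\<^sub>v v))" for A B Z
  proof (rule mat_eq_on_vecs[of _ n n])
    fix w :: "'k vec" assume "w \<in> carrier_vec n"
    then obtain Q where Q: "w = M Q *\<^sub>v v" using surj by blast
    show "(A * M Z) *\<^sub>v w = (M Z * B) *\<^sub>v w"
      using that(3)[of Q] unfolding Q assoc_mult_mat_vec[OF that(1) P2.carrier carr] assoc_mult_mat_vec[OF P2.carrier that(2) carr]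
        P2.mult_vec[OF v] .
  qed (use that in \<open>auto simp: sqm[where n = n]\<close>)
  have congM: "M A *\<^sub>v v = M B *\<^sub>v v" if "A - B \<in> J" for A B
    using that unfolding inJ P2.diff_vec[OF v] by (rule vec_eq_of_diff[OF carr carr])
  have \<delta>_1X: "\<delta> (1 + polyX) = [:1 + polyX:] * [:1, 1:]"
    unfolding \<delta>_def by (simp only: one_add_polyX coeff_pCons_0 linear_1_1[where ?'a = 'k] C.shift.hom_add C.shift.hom_one C.shift_x)
      (simp only: one_add_linear one_add_polyX[symmetric] linear_1_1[where ?'a = 'k, symmetric])
  have \<delta>_G: "\<delta> ([:binom_poly p \<mu>:] + polyY) = C.cs * [:[:binom_poly p \<mu>:]:] - C.\<Phi>"
    unfolding \<delta>_def C.\<Phi>_def by (simp add: polyY_def)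
  have cs: "coeff C.cs j = polyK (binom_coeff \<mu> j)" if "j < p" for j
    using that by (simp add: C.coeff_cs polyK_def)
  have J1_0: "J1 0 = 1\<^sub>m n"
  proof (rule mat_eq_on_vecs[of _ n n])
    fix w :: "'k vec" assume w: "w \<in> carrier_vec n"
    then obtain Q where Q: "w = M Q *\<^sub>v v" using surj by blast
    have "J1 0 *\<^sub>v w = M [:coeff Q 0:] *\<^sub>v v"
      using J1[of 0] prime_gt_0_nat[OF prime_p] by (simp add: Q \<delta>_def C.coeff_shift_0)
    then show "J1 0 *\<^sub>v w = 1\<^sub>m n *\<^sub>v w" using w Q Mpoly[of Q] by simp
  qed simp_all
  \<comment> \<open>For every \<open>l < p\<close> the exponent \<open>2 * p - 1 - l\<close> is at
    least \<open>p\<close>, so a series of order \<open>2 * p - 1\<close> is zero.\<close>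
  have fil_Js: "Q \<in> J.Js" if "Q \<in> J.fil (1 + (p - 1) + (p - 1))" for Q
    unfolding J.Js_def
  proof (safe)
    fix l assume l: "l < p"
    have "coeff Q l \<in> J.xpow p" by (rule J.xpow_mono[OF J.filD[OF that l]]) (use l in simp)
    then obtain b where "coeff Q l - polyX ^ p * b \<in> J" unfolding J.xpow_def by blast
    then show "coeff Q l \<in> J" using J.cong_J J.mult_J'[OF X_p] by blast
  qed
  have polyY_J: "polyY * Q \<in> J" for Q
    using Mpoly[of "polyY * Q"] P2.zero_vec[OF v] by (simp add: inJ polyY_def)
  have J0_vec: "J0 l *\<^sub>v (M Q *\<^sub>v v) = M (coeff (\<delta> Q * u) l) *\<^sub>v v" if "l < p" for l Q
    using J0[OF that] by blast
  have J1_vec: "J1 l *\<^sub>v (M Q *\<^sub>v v) = M (coeff (\<delta> Q) l) *\<^sub>v v" if "l < p" for l Q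
    using J1[OF that] by blast
  define G where "G = [:binom_poly p \<mu>:] + polyY"
  have coeff_G: "coeff ([:[:binom_poly p \<mu>:]:] * R) l - G * coeff R l \<in> J" for R l
  proof -
    have "coeff ([:[:binom_poly p \<mu>:]:] * R) l - G * coeff R l = - (polyY * coeff R l)"
      unfolding G_def by (simp add: algebra_simps)
    then show ?thesis using J.uminus_J[OF polyY_J[of "coeff R l"]] by (simp only:)
  qed
  have G_vec: "M (coeff R l) *\<^sub>v v = M G *\<^sub>v (M (coeff R' l) *\<^sub>v v)"
    if "R - [:[:binom_poly p \<mu>:]:] * R' \<in> J.Js" "l < p" for R R' l
  proof -
    have "coeff R l - coeff ([:[:binom_poly p \<mu>:]:] * R') l \<in> J"
      using that unfolding J.Js_def by (simp only: mem_Collect_eq coeff_diff)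
    from J.add_J[OF this coeff_G[of R' l]] have "coeff R l - G * coeff R' l \<in> J" by simp
    from congM[OF this] show ?thesis by (simp only: P2.mult_vec[OF v])
  qed
  have \<Phi>\<Phi>: "C.\<Phi> * \<Phi>1 \<in> J.Js"
    using fil_Js[OF J.fil_mult[OF J.fil_mult[OF J.fil_s \<Phi>1(2)] \<Phi>1(2)]] unfolding \<Phi>1(1) .
  have cc_Js: "1 - [:[:binom_poly p \<mu>:]:] * [:[:c':]:] \<in> J.Js"
  proof -
    have "1 - [:[:binom_poly p \<mu>:]:] * [:[:c':]:] = [:1 - [:binom_poly p \<mu> * c':]:]"
      by (simp only: one_pCons mult_pCons_left smult_pCons smult_0_right pCons_0_0 add_0_right diff_pCons mult_zero_left diff_self)
    then show ?thesis using cc' unfolding J.Js_def by (auto simp: coeff_pCons J.zero_J split: nat.splits)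
  qed
  show ?thesis unfolding splitting_def
  proof (rule exI[of _ J0], rule exI[of _ J1], intro conjI allI impI)
    fix l assume l: "l < p"
    have shift: "M (coeff (\<delta> ((1 + polyX) * Q) * t) l) *\<^sub>v v = G1 *\<^sub>v (M (coeff ([:1, 1:] * (\<delta> Q * t)) l) *\<^sub>v v)" for Q t
    proof -
      have "\<delta> ((1 + polyX) * Q) * t = [:1 + polyX:] * ([:1, 1:] * (\<delta> Q * t))"
        unfolding \<delta>_mult \<delta>_1X by (simp only: mult.assoc)
      moreover have "coeff ([:1 + polyX:] * T) l = (1 + polyX) * coeff T l" for T :: "'k poly poly poly"
        by simp
      ultimately have "coeff (\<delta> ((1 + polyX) * Q) * t) l = (1 + polyX) * coeff ([:1, 1:] * (\<delta> Q * t)) l"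
        by (simp only:)
      then show ?thesis by (simp only: P2.mult_vec[OF v] M_G1)
    qed
    have "J0 l * M (1 + polyX) = M (1 + polyX) * (J0 l + prev n J0 l)"
    proof (rule matI)
      fix Q
      have "(J0 l + prev n J0 l) *\<^sub>v (M Q *\<^sub>v v) = M (coeff ([:1, 1:] * (\<delta> Q * u)) l) *\<^sub>v v"
        by (rule shift_vec[OF v carr Jc(1)]) (use J0_vec l in simp)
      then show "J0 l *\<^sub>v (M ((1 + polyX) * Q) *\<^sub>v v) = M (1 + polyX) *\<^sub>v ((J0 l + prev n J0 l) *\<^sub>v (M Q *\<^sub>v v))"
        unfolding M_G1 J0_vec[OF l] shift by (simp only:)
    qed (simp_all add: sqm[where n = n] prev_carrier)
    then show "J0 l * G1 = G1 * (J0 l + prev n J0 l)" unfolding M_G1 .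
    have "J1 l * M (1 + polyX) = M (1 + polyX) * (J1 l + prev n J1 l)"
    proof (rule matI)
      fix Q
      have "(J1 l + prev n J1 l) *\<^sub>v (M Q *\<^sub>v v) = M (coeff ([:1, 1:] * (\<delta> Q * 1)) l) *\<^sub>v v"
        by (rule shift_vec[OF v carr Jc(2)]) (use J1_vec l in simp)
      then show "J1 l *\<^sub>v (M ((1 + polyX) * Q) *\<^sub>v v) = M (1 + polyX) *\<^sub>v ((J1 l + prev n J1 l) *\<^sub>v (M Q *\<^sub>v v))"
        using shift[of Q 1] unfolding M_G1 J1_vec[OF l] mult_1_right by (simp only:)
    qed (simp_all add: sqm[where n = n] prev_carrier)
    then show "J1 l * G1 = G1 * (J1 l + prev n J1 l)" unfolding M_G1 .
    have "J0 l * M G = M G * conv n (binom_coeff \<mu>) J0 l"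
    proof (rule matI)
      fix Q
      have "conv n (binom_coeff \<mu>) J0 l *\<^sub>v (M Q *\<^sub>v v) = M (coeff (C.cs * (\<delta> Q * u)) l) *\<^sub>v v"
        by (rule conv_vec_coeff[OF v carr l cs Jc(1)]) (use J0_vec l in simp_all)
      moreover have "\<delta> (G * Q) * u - [:[:binom_poly p \<mu>:]:] * (C.cs * (\<delta> Q * u)) = (\<delta> Q * [:[:c':]:]) * (C.\<Phi> * \<Phi>1)"
        unfolding G_def \<delta>_mult \<delta>_G u_def by (simp only: algebra_simps minus_mult_minus mult_minus_left mult_minus_right) simp
      then have "\<delta> (G * Q) * u - [:[:binom_poly p \<mu>:]:] * (C.cs * (\<delta> Q * u)) \<in> J.Js"
        using J.Js_mult[OF \<Phi>\<Phi>] by (simp only:)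
      ultimately show "J0 l *\<^sub>v (M (G * Q) *\<^sub>v v) = M G *\<^sub>v (conv n (binom_coeff \<mu>) J0 l *\<^sub>v (M Q *\<^sub>v v))"
        using G_vec[OF _ l] unfolding J0_vec[OF l] by (simp only:)
    qed (simp_all add: sqm[where n = n] conv_carrier)
    then show "J0 l * G2 = G2 * conv n (binom_coeff \<mu>) J0 l" unfolding G_def M_G2 .
    have "J1 l * M G = M G * (conv n (binom_coeff \<mu>) J1 l + prev n J0 l)"
    proof (rule matI)
      fix Q
      have "(conv n (binom_coeff \<mu>) J1 l + prev n J0 l) *\<^sub>v (M Q *\<^sub>v v)
          = M (coeff (C.cs * \<delta> Q + [:0, 1:] * (\<delta> Q * u)) l) *\<^sub>v v"
        by (rule conv_prev_vec_coeff[OF v carr l cs Jc(2) _ Jc(1)]) (use J0_vec J1_vec l in simp_all)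
      moreover have "\<delta> (G * Q) - [:[:binom_poly p \<mu>:]:] * (C.cs * \<delta> Q + [:0, 1:] * (\<delta> Q * u))
          = - (\<delta> Q * ([:0, 1:] * \<Phi>1)) * (1 - [:[:binom_poly p \<mu>:]:] * [:[:c':]:])"
      proof -
        have "(cs * b - s * f) * d - b * (cs * d + s * (d * - (f * b'))) = - (d * (s * f)) * (1 - b * b')"
          for cs b s f d b' :: "'k poly poly poly" by (simp add: algebra_simps)
        then show ?thesis unfolding G_def \<delta>_mult \<delta>_G u_def \<Phi>1(1) .
      qed
      then have "\<delta> (G * Q) - [:[:binom_poly p \<mu>:]:] * (C.cs * \<delta> Q + [:0, 1:] * (\<delta> Q * u)) \<in> J.Js"
        using J.Js_mult[OF cc_Js] by (simp only:)
      ultimately show "J1 l *\<^sub>v (M (G * Q) *\<^sub>v v)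
          = M G *\<^sub>v ((conv n (binom_coeff \<mu>) J1 l + prev n J0 l) *\<^sub>v (M Q *\<^sub>v v))"
        using G_vec[OF _ l] unfolding J1_vec[OF l] by (simp only:)
    qed (simp_all add: sqm[where n = n] conv_carrier prev_carrier)
    then show "J1 l * G2 = G2 * (conv n (binom_coeff \<mu>) J1 l + prev n J0 l)" unfolding G_def M_G2 .
  qed (simp_all add: J1_0)
qed

end

section \<open>Matrices of size two and the group \<open>SL2\<close>\<close>

lemma mat2_carrier [simp]: "mat2 a b c d \<in> carrier_mat 2 2"
  by (auto simp: mat2_def mat_of_rows_list_def numeral_2_eq_2)

lemma mat2_index [simp]:
  "mat2 a b c d $$ (0, 0) = a" "mat2 a b c d $$ (0, Suc 0) = b"
  "mat2 a b c d $$ (Suc 0, 0) = c" "mat2 a b c d $$ (Suc 0, Suc 0) = d"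
  by (simp_all add: mat2_def mat_of_rows_list_def)

lemma mat2_eqI:
  assumes "A \<in> carrier_mat 2 2" "B \<in> carrier_mat 2 2" "A $$ (0, 0) = B $$ (0, 0)" "A $$ (0, 1) = B $$ (0, 1)"
    "A $$ (1, 0) = B $$ (1, 0)" "A $$ (1, 1) = B $$ (1, 1)"
  shows "A = B"
  by (rule eq_matI) (use assms in \<open>auto simp: less_2_cases_iff\<close>)

lemma mat2_collapse: "A \<in> carrier_mat 2 2 \<Longrightarrow> mat2 (A $$ (0, 0)) (A $$ (0, 1)) (A $$ (1, 0)) (A $$ (1, 1)) = A"
  by (rule mat2_eqI) simp_all

lemma mat2_transpose: "(mat2 a b c d)\<^sup>T = mat2 a c b d"
  using carrier_matD[OF mat2_carrier[of a b c d]] by (intro mat2_eqI) simp_all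

lemma mult_index_2:
  fixes A B :: "'k::comm_ring_1 mat"
  assumes "A \<in> carrier_mat 2 2" "B \<in> carrier_mat 2 2" "i < 2" "j < 2"
  shows "(A * B) $$ (i, j) = A $$ (i, 0) * B $$ (0, j) + A $$ (i, 1) * B $$ (1, j)"
  using assms by (simp add: scalar_prod_def numeral_2_eq_2)

lemma mat2_mult: "mat2 a b c d * mat2 a' b' c' d' =
  mat2 (a * a' + b * c') (a * b' + b * d') (c * a' + d * c') (c * b' + d * (d' :: 'k::comm_ring_1))"
  by (rule mat2_eqI) (simp_all add: mult_index_2 mult_carrier_mat[of _ 2 2 _ 2])

lemma det_2:
  assumes "A \<in> carrier_mat 2 2"
  shows "det A = A $$ (0, 0) * A $$ (1, 1) - A $$ (0, 1) * (A $$ (1, 0) :: 'k::comm_ring_1)"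
proof -
  have m: "det (mat_delete A 0 j) = mat_delete A 0 j $$ (0, 0)" for j
    using assms by (intro det_single) (auto simp: mat_delete_def)
  have "det A = (\<Sum>j<2. A $$ (0, j) * cofactor A 0 j)"
    by (rule laplace_expansion_row[OF assms]) simp
  also have "\<dots> = A $$ (0, 0) * A $$ (1, 1) - A $$ (0, 1) * A $$ (1, 0)"
    using assms by (simp add: numeral_2_eq_2 cofactor_def m) (simp add: mat_delete_def)
  finally show ?thesis .
qed

lemma SL2_iff: "A \<in> carrier SL2 \<longleftrightarrow> A \<in> carrier_mat 2 2 \<and> A $$ (0, 0) * A $$ (1, 1) - A $$ (0, 1) * A $$ (1, 0) = (1 :: 'k::field)"
  unfolding SL2_def by (auto simp: det_2)

lemma mat2_SL2: "mat2 a b c d \<in> carrier SL2 \<longleftrightarrow> a * d - b * c = (1 :: 'k::field)"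
  by (simp add: SL2_iff)

lemma SL2_mult: "(\<otimes>\<^bsub>SL2\<^esub>) = (*)" and SL2_one: "one SL2 = 1\<^sub>m 2"
  by (simp_all add: SL2_def)

lemma mat2_one: "mat2 1 0 0 1 = (1\<^sub>m 2 :: 'k::field mat)"
  by (rule mat2_eqI) simp_all

definition adj2 :: "'k::field mat \<Rightarrow> 'k mat" where
  "adj2 A = mat2 (A $$ (1, 1)) (- A $$ (0, 1)) (- A $$ (1, 0)) (A $$ (0, 0))"

lemma adj2_SL2: "A \<in> carrier SL2 \<Longrightarrow> adj2 A \<in> carrier SL2"
  unfolding SL2_iff[of A] adj2_def mat2_SL2 by (simp add: algebra_simps)

lemma adj2_mult:
  assumes "A \<in> carrier SL2"
  shows "A * adj2 A = 1\<^sub>m 2" "adj2 A * A = 1\<^sub>m 2"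
proof -
  have A: "A \<in> carrier_mat 2 2" using assms by (simp add: SL2_iff)
  have d: "A $$ (0, 0) * A $$ (1, 1) - A $$ (0, 1) * A $$ (1, 0) = 1" using assms by (simp add: SL2_iff)
  have "mat2 (A $$ (0, 0)) (A $$ (0, 1)) (A $$ (1, 0)) (A $$ (1, 1)) * adj2 A = 1\<^sub>m 2"
    "adj2 A * mat2 (A $$ (0, 0)) (A $$ (0, 1)) (A $$ (1, 0)) (A $$ (1, 1)) = 1\<^sub>m 2"
    unfolding adj2_def mat2_mult mat2_one[symmetric] using d
    by (auto intro!: arg_cong4[of _ _ _ _ _ _ _ _ mat2] simp: algebra_simps)
  then show "A * adj2 A = 1\<^sub>m 2" "adj2 A * A = 1\<^sub>m 2" by (simp_all only: mat2_collapse[OF A])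
qed

lemma group_SL2: "group (SL2 :: 'k::field mat monoid)"
proof (rule groupI)
  fix A B C :: "'k mat" assume A: "A \<in> carrier SL2" and B: "B \<in> carrier SL2"
  then have c: "A \<in> carrier_mat 2 2" "B \<in> carrier_mat 2 2" by (auto simp: SL2_def)
  show "A \<otimes>\<^bsub>SL2\<^esub> B \<in> carrier SL2" using A B c det_mult[OF c] by (auto simp: SL2_def)
  show "\<one>\<^bsub>SL2\<^esub> \<otimes>\<^bsub>SL2\<^esub> A = A" using c by (simp add: SL2_mult SL2_one)
  show "\<exists>y\<in>carrier SL2. y \<otimes>\<^bsub>SL2\<^esub> A = \<one>\<^bsub>SL2\<^esub>"
    using adj2_SL2[OF A] adj2_mult[OF A] by (auto simp: SL2_mult SL2_one)
  assume "C \<in> carrier SL2"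
  then have "C \<in> carrier_mat 2 2" by (auto simp: SL2_def)
  with c show "A \<otimes>\<^bsub>SL2\<^esub> B \<otimes>\<^bsub>SL2\<^esub> C = A \<otimes>\<^bsub>SL2\<^esub> (B \<otimes>\<^bsub>SL2\<^esub> C)"
    by (simp add: SL2_mult assoc_mult_mat[of _ 2 2 _ 2 _ 2])
qed (simp add: SL2_def)

lemma inv_SL2:
  assumes "A \<in> carrier SL2"
  shows "inv\<^bsub>SL2\<^esub> A = adj2 A"
proof (rule group.inv_equality[OF group_SL2])
  show "adj2 A \<otimes>\<^bsub>SL2\<^esub> A = \<one>\<^bsub>SL2\<^esub>" unfolding SL2_mult SL2_one by (rule adj2_mult(2)[OF assms])
qed (use assms adj2_SL2 in auto)

section \<open>Representations of \<open>SL\<^sub>2\<close>\<close>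

lemma representationI:
  assumes G: "group G" and car: "\<And>g. g \<in> carrier G \<Longrightarrow> act V g \<in> carrier_mat (deg V) (deg V)"
    and one: "act V \<one>\<^bsub>G\<^esub> = 1\<^sub>m (deg V)"
    and mult: "\<And>g h. g \<in> carrier G \<Longrightarrow> h \<in> carrier G \<Longrightarrow> act V (g \<otimes>\<^bsub>G\<^esub> h) = act V g * act V h"
  shows "representation G (V :: ('g, 'k::field) rep)"
  unfolding representation_def GL_def
proof (rule homI)
  interpret G: group G by (rule G)
  fix g assume g: "g \<in> carrier G"
  have "act V (inv\<^bsub>G\<^esub> g) * act V g = 1\<^sub>m (deg V)" "act V g * act V (inv\<^bsub>G\<^esub> g) = 1\<^sub>m (deg V)"
    using g mult[of "inv\<^bsub>G\<^esub> g" g] mult[of g "inv\<^bsub>G\<^esub> g"] one by simp_all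
  then show "act V g \<in> carrier (units_of (ring_mat TYPE('k) (deg V) ()))"
    using car[OF g] car[of "inv\<^bsub>G\<^esub> g"] g by (auto simp: units_of_def Units_def ring_mat_def)
  fix h assume "h \<in> carrier G"
  with g show "act V (g \<otimes>\<^bsub>G\<^esub> h) = act V g \<otimes>\<^bsub>units_of (ring_mat TYPE('k) (deg V) ())\<^esub> act V h"
    by (simp add: mult units_of_def ring_mat_def)
qed

lemma representation_carrier:
  fixes V :: "('g, 'k::field) rep"
  assumes "representation G V" "g \<in> carrier G"
  shows "act V g \<in> carrier_mat (deg V) (deg V)"
  using assms unfolding representation_def GL_def hom_def
  by (auto simp: units_of_def Units_def ring_mat_def Pi_def)

lemma representation_mult:
  fixes V :: "('g, 'k::field) rep"
  assumes "representation G V" "g \<in> carrier G" "h \<in> carrier G"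
  shows "act V (g \<otimes>\<^bsub>G\<^esub> h) = act V g * act V h"
  using assms unfolding representation_def GL_def hom_def
  by (auto simp: units_of_def ring_mat_def)

text \<open>The image of the neutral element is an idempotent unit.\<close>

lemma representation_one:
  fixes V :: "('g, 'k::field) rep"
  assumes "group G" "representation G V"
  shows "act V \<one>\<^bsub>G\<^esub> = 1\<^sub>m (deg V)"
proof -
  interpret G: group G by (rule assms(1))
  define A where "A = act V \<one>\<^bsub>G\<^esub>"
  have A: "A \<in> carrier_mat (deg V) (deg V)" "A * A = A"
    using representation_carrier[OF assms(2) G.one_closed] representation_mult[OF assms(2) G.one_closed G.one_closed]
    by (simp_all add: A_def)
  have "A \<in> Units (ring_mat TYPE('k) (deg V) ())"
    using assms(2) G.one_closed unfolding representation_def GL_def hom_def A_def units_of_def by auto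
  then obtain B where B: "B \<in> carrier_mat (deg V) (deg V)" "B * A = 1\<^sub>m (deg V)"
    by (auto simp: Units_def ring_mat_def)
  have "A = (B * A) * A" using A B by simp
  also have "\<dots> = B * (A * A)" using A B by (intro assoc_mult_mat[of _ "deg V" "deg V" _ "deg V" _ "deg V"])
  also have "\<dots> = 1\<^sub>m (deg V)" using A B by simp
  finally show ?thesis unfolding A_def .
qed

lemma representation_restrict:
  assumes "representation H V" "\<phi> \<in> hom G H"
  shows "representation G (restrict_rep \<phi> V)"
  using hom_compose[OF assms(2) assms(1)[unfolded representation_def]]
  by (simp add: representation_def restrict_rep_def)

section \<open>The modules \<open>\<nabla>(n)\<close> and tilting modules\<close>

text \<open>Here \<open>q\<close> is a dehomogenized binary form of degree \<open>n\<close>, into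
  whose two variables \<open>f\<close> and \<open>g\<close> are substituted. Multiplicativity of
  \<open>nabla\<close> is the composition of two such linear substitutions.\<close>

definition homog :: "nat \<Rightarrow> 'k::comm_ring_1 poly \<Rightarrow> 'k poly \<Rightarrow> 'k poly \<Rightarrow> 'k poly" where
  "homog n q f g = (\<Sum>i\<le>n. Polynomial.smult (coeff q i) (f ^ (n - i) * g ^ i))"

lemma homog_linear:
  assumes "degree q \<le> n"
  shows "homog (Suc n) ([:a, b:] * q) f g = (Polynomial.smult a f + Polynomial.smult b g) * homog n q f g"
proof -
  have z: "coeff q (Suc n) = 0" using assms by (simp add: coeff_eq_0)
  have c: "coeff ([:a, b:] * q) i = a * coeff q i + (case i of 0 \<Rightarrow> 0 | Suc j \<Rightarrow> b * coeff q j)" for i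
    by (simp add: coeff_pCons split: nat.splits)
  have "homog (Suc n) ([:a, b:] * q) f g
    = (\<Sum>i\<le>Suc n. Polynomial.smult (a * coeff q i) (f ^ (Suc n - i) * g ^ i))
    + (\<Sum>i\<le>Suc n. Polynomial.smult (case i of 0 \<Rightarrow> 0 | Suc j \<Rightarrow> b * coeff q j) (f ^ (Suc n - i) * g ^ i))"
    unfolding homog_def c by (simp add: smult_add_left sum.distrib)
  also have "(\<Sum>i\<le>Suc n. Polynomial.smult (a * coeff q i) (f ^ (Suc n - i) * g ^ i)) = Polynomial.smult a f * homog n q f g"
    unfolding homog_def sum_distrib_left using z by (simp add: Suc_diff_le mult_ac)
  also have "(\<Sum>i\<le>Suc n. Polynomial.smult (case i of 0 \<Rightarrow> 0 | Suc j \<Rightarrow> b * coeff q j) (f ^ (Suc n - i) * g ^ i)) = Polynomial.smult b g * homog n q f g"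
    unfolding homog_def sum_distrib_left by (subst sum.atMost_Suc_shift) (simp add: mult_ac)
  finally show ?thesis by (simp add: distrib_right)
qed

lemma degree_linear_products: "degree ([:a, b:] ^ m * [:c, d:] ^ j) \<le> m + j"
proof -
  have "degree ([:a, b:] ^ m) \<le> m" for a b :: 'a and m
  proof (induction m)
    case (Suc m)
    have "degree [:a, b:] \<le> 1" by (simp add: degree_pCons_eq_if)
    with Suc show ?case using degree_mult_le[of "[:a, b:]" "[:a, b:] ^ m"] by simp
  qed simp
  from this[of a b m] this[of c d j] have "degree ([:a, b:] ^ m) \<le> m" "degree ([:c, d:] ^ j) \<le> j" .
  then show ?thesis by (meson add_mono degree_mult_le order_trans)
qed

lemma homog_products:
  "homog (m + j) ([:a, b:] ^ m * [:c, d:] ^ j) f g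
    = (Polynomial.smult a f + Polynomial.smult b g) ^ m * (Polynomial.smult c f + Polynomial.smult d g) ^ j"
proof (induction m)
  case 0
  show ?case
  proof (induction j)
    case 0 then show ?case by (simp add: homog_def)
  next
    case (Suc j)
    then show ?case
      using homog_linear[OF degree_linear_products[of 1 0 0 c d j], of c d f g] by (simp add: mult_ac del: mult_pCons_left mult_pCons_right)
  qed
next
  case (Suc m)
  then show ?case
    using homog_linear[OF degree_linear_products[of a b m c d j], of a b f g] by (simp add: mult_ac del: mult_pCons_left mult_pCons_right)
qed

text \<open>The matrices of \<open>dual_weyl_module\<close> over an arbitrary field, because the
  results on restriction are stated without algebraic closure.\<close>

definition nabla :: "nat \<Rightarrow> 'k::field mat \<Rightarrow> 'k mat" where
  "nabla n A = mat (Suc n) (Suc n) (\<lambda>(i, j).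
     coeff ([:A $$ (0, 0), A $$ (1, 0):] ^ (n - j) * [:A $$ (0, 1), A $$ (1, 1):] ^ j) i)"

lemma deg_dual_weyl [simp]: "deg (dual_weyl_module n) = Suc n"
  by (simp add: dual_weyl_module_def)

lemma act_dual_weyl: "act (dual_weyl_module n) A = nabla n A"
  by (simp add: dual_weyl_module_def nabla_def)

lemma nabla_carrier [simp]: "nabla n A \<in> carrier_mat (Suc n) (Suc n)"
  by (simp add: nabla_def)

lemma nabla_mult:
  assumes "A \<in> carrier_mat 2 2" "B \<in> carrier_mat 2 2"
  shows "nabla n (A * B) = nabla n A * nabla n B"
proof (rule eq_matI)
  fix i j assume "i < dim_row (nabla n A * nabla n B)" "j < dim_col (nabla n A * nabla n B)"
  then have ij: "i < Suc n" "j < Suc n" by (simp_all add: nabla_def)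
  define f g where "f = [:A $$ (0, 0), A $$ (1, 0):]" and "g = [:A $$ (0, 1), A $$ (1, 1):]"
  define q where "q = [:B $$ (0, 0), B $$ (1, 0):] ^ (n - j) * [:B $$ (0, 1), B $$ (1, 1):] ^ j"
  have "(nabla n A * nabla n B) $$ (i, j) = (\<Sum>k<Suc n. coeff (f ^ (n - k) * g ^ k) i * coeff q k)"
    using ij by (simp add: nabla_def scalar_prod_def f_def g_def q_def atLeast0LessThan del: sum.lessThan_Suc)
  also have "\<dots> = coeff (homog n q f g) i"
    by (simp add: homog_def coeff_sum lessThan_Suc_atMost mult.commute)
  also have "homog n q f g = (Polynomial.smult (B $$ (0, 0)) f + Polynomial.smult (B $$ (1, 0)) g) ^ (n - j)
      * (Polynomial.smult (B $$ (0, 1)) f + Polynomial.smult (B $$ (1, 1)) g) ^ j"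
    unfolding q_def using homog_products[of "n - j" j] ij by simp
  also have "Polynomial.smult (B $$ (0, 0)) f + Polynomial.smult (B $$ (1, 0)) g = [:(A * B) $$ (0, 0), (A * B) $$ (1, 0):]"
    using assms by (simp add: f_def g_def mult_index_2 mult.commute del: index_mult_mat)
  also have "Polynomial.smult (B $$ (0, 1)) f + Polynomial.smult (B $$ (1, 1)) g = [:(A * B) $$ (0, 1), (A * B) $$ (1, 1):]"
    using assms by (simp add: f_def g_def mult_index_2 mult.commute del: index_mult_mat)
  finally show "nabla n (A * B) $$ (i, j) = (nabla n A * nabla n B) $$ (i, j)"
    using ij by (simp add: nabla_def)
qed (simp_all add: nabla_def)

lemma nabla_one: "nabla n (1\<^sub>m 2) = 1\<^sub>m (Suc n)"
proof (rule eq_matI)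
  fix i j assume "i < dim_row (1\<^sub>m (Suc n) :: 'a mat)" "j < dim_col (1\<^sub>m (Suc n) :: 'a mat)"
  then have ij: "i < Suc n" "j < Suc n" by simp_all
  have "[:1:] ^ (n - j) * [:0, 1:] ^ j = (monom 1 j :: 'a poly)" by (simp add: monom_altdef flip: one_pCons)
  then show "nabla n (1\<^sub>m 2) $$ (i, j) = (1\<^sub>m (Suc n) :: 'a mat) $$ (i, j)"
    using ij by (simp add: nabla_def)
qed (simp_all add: nabla_def)

lemma representation_dual_weyl: "representation SL2 (dual_weyl_module n)"
  by (rule representationI[OF group_SL2])
    (auto simp: act_dual_weyl SL2_mult SL2_one nabla_one SL2_iff nabla_mult)

lemma polynomial_functions_sum:
  "finite S \<Longrightarrow> (\<And>i. i \<in> S \<Longrightarrow> f i \<in> polynomial_functions) \<Longrightarrow> (\<lambda>A. \<Sum>i\<in>S. f i A) \<in> polynomial_functions"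
  by (induction S rule: finite_induct) (auto intro: polynomial_functions.intros)

lemma rational_dual_weyl: "rational_rep (dual_weyl_module n)"
  unfolding rational_rep_def
proof (intro conjI allI impI)
  fix i j assume ij: "i < deg (dual_weyl_module n)" "j < deg (dual_weyl_module n)"
  define P where "P F \<longleftrightarrow> (\<forall>i. (\<lambda>A. coeff (F A) i) \<in> polynomial_functions)" for F :: "'a mat \<Rightarrow> 'a poly"
  have mult: "P (\<lambda>A. F A * G A)" if "P F" "P G" for F G
    using that unfolding P_def coeff_mult by (intro allI polynomial_functions_sum) (auto intro: polynomial_functions.mult)
  have lin: "P (\<lambda>A. [:A $$ (a, b), A $$ (c, d):])" if "a < 2" "b < 2" "c < 2" "d < 2" for a b c d
    unfolding P_def
  proof
    fix i
    consider "i = 0" | "i = 1" | k where "i = Suc (Suc k)" by (metis One_nat_def not0_implies_Suc)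
    then show "(\<lambda>A. coeff [:A $$ (a, b), A $$ (c, d):] i) \<in> polynomial_functions"
      by cases (use that in \<open>simp_all add: polynomial_functions.coord polynomial_functions.const\<close>)
  qed
  have pow: "P (\<lambda>A. F A ^ m)" if "P F" for F m
  proof (induction m)
    case 0
    then show ?case unfolding P_def by (simp add: coeff_1 polynomial_functions.const)
  next
    case (Suc m)
    then show ?case using mult[OF that] by simp
  qed
  have "P (\<lambda>A. [:A $$ (0, 0), A $$ (1, 0):] ^ (n - j) * [:A $$ (0, 1), A $$ (1, 1):] ^ j)"
    by (intro mult pow lin) simp_all
  then show "\<exists>f\<in>polynomial_functions. \<forall>A\<in>carrier SL2. act (dual_weyl_module n :: ('a mat, 'a) rep) A $$ (i, j) = f A"
  proof -
    assume "P (\<lambda>A. [:A $$ (0, 0), A $$ (1, 0):] ^ (n - j) * [:A $$ (0, 1), A $$ (1, 1):] ^ j)"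
    then have "(\<lambda>A :: 'a mat. coeff ([:A $$ (0, 0), A $$ (1, 0):] ^ (n - j) * [:A $$ (0, 1), A $$ (1, 1):] ^ j) i) \<in> polynomial_functions"
      unfolding P_def by (rule spec)
    then show ?thesis by (rule bexI[rotated]) (use ij in \<open>simp add: act_dual_weyl nabla_def\<close>)
  qed
qed (rule representation_dual_weyl)

text \<open>With inner variable \<open>s\<close> and outer variable \<open>t\<close>, the power on
  the left is that of \<open>a + c * s + b * t + d * s * t\<close>. Exchanging \<open>s\<close> and
  \<open>t\<close> transposes the matrix of coefficients.\<close>

lemma bilinear_power_transpose:
  "coeff (coeff ([:[:a, c:], [:b, d:]:] ^ n) j) i = coeff (coeff ([:[:a, b:], [:c, d:]:] ^ n) i) j"
proof (induction n arbitrary: i j)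
  case 0
  then show ?case by (simp add: coeff_1)
next
  case (Suc n)
  have "coeff (coeff ([:[:a, c:], [:b, d:]:] * Q) j) i = a * coeff (coeff Q j) i
      + (case i of 0 \<Rightarrow> 0 | Suc i' \<Rightarrow> c * coeff (coeff Q j) i')
      + (case j of 0 \<Rightarrow> 0 | Suc j' \<Rightarrow> b * coeff (coeff Q j') i
          + (case i of 0 \<Rightarrow> 0 | Suc i' \<Rightarrow> d * coeff (coeff Q j') i'))" for a b c d :: 'a and Q i j
    by (auto simp: coeff_pCons split: nat.splits)
  then show ?case unfolding power_Suc by (auto simp: Suc.IH add_ac split: nat.splits)
qed

text \<open>The coefficient of \<open>t ^ j\<close> in
  \<open>((a + c * s) + (b + d * s) * t) ^ n\<close> is \<open>n choose j\<close> times column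
  \<open>j\<close> of \<open>nabla n A\<close>, so this is the symmetry of that generating
  function.\<close>

lemma nabla_transpose:
  assumes "A \<in> carrier_mat 2 2" "i \<le> n" "j \<le> n"
  shows "of_nat (n choose j) * nabla n A $$ (i, j) = of_nat (n choose i) * nabla n A\<^sup>T $$ (j, i)"
proof -
  have "coeff (coeff ([:[:a, c:], [:b, d:]:] ^ n) j) i = of_nat (n choose j) * coeff ([:a, c:] ^ (n - j) * [:b, d:] ^ j) i"
    if "j \<le> n" for a b c d :: 'a and i j
    using that by (simp add: coeff_linear_poly_power of_nat_poly mult_ac)
  from this[OF assms(3), of "A $$ (0,0)" "A $$ (1,0)" "A $$ (0,1)" "A $$ (1,1)" i]
    this[OF assms(2), of "A $$ (0,0)" "A $$ (0,1)" "A $$ (1,0)" "A $$ (1,1)" j]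
  show ?thesis using assms bilinear_power_transpose[of "A $$ (0,0)" "A $$ (1,0)" "A $$ (0,1)" "A $$ (1,1)" n j i]
    by (simp add: nabla_def)
qed

lemma isomorphic_repI:
  fixes V W :: "('g, 'k::field) rep"
  assumes "A \<in> carrier_mat n n" "B \<in> carrier_mat n n" "A * B = 1\<^sub>m n" "deg V = n" "deg W = n"
    and "\<And>g. g \<in> carrier G \<Longrightarrow> A * act V g = act W g * A"
  shows "isomorphic_rep G V W"
proof -
  have "B * A = 1\<^sub>m n" by (rule mat_mult_left_right_inverse[OF assms(1-3)])
  then have "invertible_mat A"
    using assms unfolding invertible_mat_def inverts_mat_def by (auto intro!: exI[of _ B])
  then show ?thesis using assms unfolding isomorphic_rep_def intertwiners_def by auto
qed

lemma isomorphic_repE: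
  fixes V W :: "('g, 'k::field) rep"
  assumes "isomorphic_rep G V W"
  obtains A B where "deg V = deg W" "A \<in> carrier_mat (deg W) (deg W)" "B \<in> carrier_mat (deg W) (deg W)"
    "A * B = 1\<^sub>m (deg W)" "B * A = 1\<^sub>m (deg W)" "\<And>g. g \<in> carrier G \<Longrightarrow> A * act V g = act W g * A"
proof -
  obtain A where A: "A \<in> carrier_mat (deg W) (deg V)" "\<And>g. g \<in> carrier G \<Longrightarrow> A * act V g = act W g * A" "invertible_mat A"
    using assms unfolding isomorphic_rep_def intertwiners_def by auto
  have sq: "dim_row A = dim_col A" and "\<exists>B. inverts_mat A B \<and> inverts_mat B A"
    using A(3) unfolding invertible_mat_def square_mat.simps by simp_all
  then obtain B where B: "A * B = 1\<^sub>m (dim_row A)" "B * A = 1\<^sub>m (dim_row B)"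
    unfolding inverts_mat_def by blast
  have d: "deg V = deg W" using carrier_matD[OF A(1)] sq by simp
  have "dim_col B = deg W" using arg_cong[OF B(1), of dim_col] A by simp
  moreover have "dim_row B = deg W" using arg_cong[OF B(2), of dim_col] A d by simp
  ultimately have "B \<in> carrier_mat (deg W) (deg W)" by (rule carrier_matI[rotated])
  show thesis
  proof (rule that[of A B])
    show "A \<in> carrier_mat (deg W) (deg W)" using A(1) d by simp
    show "A * B = 1\<^sub>m (deg W)" "B * A = 1\<^sub>m (deg W)" using A(1) B \<open>dim_row B = deg W\<close> by simp_all
    show "A * act V g = act W g * A" if "g \<in> carrier G" for g by (rule A(2)[OF that])
  qed fact+
qed

lemma isomorphic_rep_deg: "isomorphic_rep G V W \<Longrightarrow> deg V = deg W"
  by (erule isomorphic_repE)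

lemma representation_zero: "group G \<Longrightarrow> representation G (Rep 0 (\<lambda>_. 1\<^sub>m 0) :: ('g, 'k::field) rep)"
  by (rule representationI) auto

text \<open>A filtration with one layer, on top of the zero module.\<close>

lemma has_filtration_iso:
  fixes V W :: "('g, 'k::field) rep"
  assumes G: "group G" and V: "representation G V" and W: "W \<in> F" and iso: "isomorphic_rep G V W"
  shows "has_filtration G F V"
proof -
  define U :: "('g, 'k) rep" where "U = Rep 0 (\<lambda>_. 1\<^sub>m 0)"
  have U: "deg U = 0" "act U g = 1\<^sub>m 0" for g by (simp_all add: U_def)
  obtain A B where AB: "deg V = deg W" "A \<in> carrier_mat (deg W) (deg W)" "B \<in> carrier_mat (deg W) (deg W)"
    "A * B = 1\<^sub>m (deg W)" "B * A = 1\<^sub>m (deg W)" "\<And>g. g \<in> carrier G \<Longrightarrow> A * act V g = act W g * A"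
    by (rule isomorphic_repE[OF iso]) blast
  define n where "n = deg W"
  note AB = AB[folded n_def]
  have "short_exact G U V W"
    unfolding short_exact_def
  proof (intro bexI conjI)
    show "0\<^sub>m n 0 \<in> intertwiners G U V"
      unfolding intertwiners_def U AB(1) using representation_carrier[OF V, THEN carrier_matD(1)] AB(1) by (auto intro!: eq_matI)
    show "A \<in> intertwiners G V W" unfolding intertwiners_def using AB by (simp add: n_def)
    show "inj_on ((*\<^sub>v) (0\<^sub>m n 0 :: 'k mat)) (carrier_vec (deg U))" unfolding U by (auto simp: inj_on_def)
    have ker: "v = 0\<^sub>v n" if "v \<in> carrier_vec n" "A *\<^sub>v v = 0\<^sub>v n" for v
    proof -
      have "v = (B * A) *\<^sub>v v" using that AB by simp
      also have "\<dots> = B *\<^sub>v (A *\<^sub>v v)" using that AB by (intro assoc_mult_mat_vec) auto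
      finally show ?thesis using that AB by (intro eq_vecI) auto
    qed
    have img: "(0\<^sub>m n 0 :: 'k mat) *\<^sub>v v = 0\<^sub>v n" if "v \<in> carrier_vec 0" for v
      using that by (intro eq_vecI) (auto simp: scalar_prod_def)
    have A0: "A *\<^sub>v 0\<^sub>v n = 0\<^sub>v n" using AB(2) by (intro eq_vecI) auto
    have "mat_kernel A = {0\<^sub>v n}"
      using ker A0 AB(2) unfolding mat_kernel_def by auto
    moreover have "(*\<^sub>v) (0\<^sub>m n 0 :: 'k mat) ` carrier_vec (deg U) = {0\<^sub>v n}"
      unfolding U using img by (auto intro!: image_eqI[of _ _ "0\<^sub>v 0"])
    ultimately show "(*\<^sub>v) (0\<^sub>m n 0 :: 'k mat) ` carrier_vec (deg U) = mat_kernel A" by simp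
    show "(*\<^sub>v) A ` carrier_vec (deg V) = carrier_vec (deg W)"
    proof
      show "(*\<^sub>v) A ` carrier_vec (deg V) \<subseteq> carrier_vec (deg W)"
        using AB by (auto simp: n_def)
      show "carrier_vec (deg W) \<subseteq> (*\<^sub>v) A ` carrier_vec (deg V)"
      proof
        fix w :: "'k vec" assume "w \<in> carrier_vec (deg W)"
        then have w: "w \<in> carrier_vec n" by (simp add: n_def)
        have "A *\<^sub>v (B *\<^sub>v w) = (A * B) *\<^sub>v w" using w AB by (intro assoc_mult_mat_vec[symmetric]) auto
        then have "w = A *\<^sub>v (B *\<^sub>v w)" using w AB by simp
        then show "w \<in> (*\<^sub>v) A ` carrier_vec (deg V)" using w AB by (intro image_eqI[of _ _ "B *\<^sub>v w"]) auto
      qed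
    qed
  qed
  moreover have "has_filtration G F U"
    using has_filtration.zero representation_zero[OF G] U(1) unfolding U_def by blast
  ultimately show ?thesis using has_filtration.step V W by blast
qed

lemma isomorphic_rep_refl: "representation G (V :: ('g, 'k::field) rep) \<Longrightarrow> isomorphic_rep G V V"
  by (rule isomorphic_repI[of "1\<^sub>m (deg V)" "deg V" "1\<^sub>m (deg V)"]) (auto dest: representation_carrier)

text \<open>The diagonal matrix of binomial coefficients intertwines \<open>nabla n A\<close> with
  the transpose of \<open>nabla n\<close> at the transpose of \<open>A\<close>; it is invertible
  exactly because all of them are non-zero. It serves both for self-duality and, later, for
  recognizing a composite of two equivariant maps as invertible.\<close>

lemma nabla_form:
  assumes binom: "\<And>i. i \<le> n \<Longrightarrow> of_nat (n choose i) \<noteq> (0 :: 'k::field)"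
  obtains D E :: "'k::field mat" where "D \<in> carrier_mat (Suc n) (Suc n)" "E \<in> carrier_mat (Suc n) (Suc n)"
    "D * E = 1\<^sub>m (Suc n)" "E * D = 1\<^sub>m (Suc n)"
    "\<And>A. A \<in> carrier_mat 2 2 \<Longrightarrow> D * (nabla n A\<^sup>T)\<^sup>T = nabla n A * D"
    "\<And>i j. i < Suc n \<Longrightarrow> j < Suc n \<Longrightarrow> D $$ (i, j) = (if i = j then of_nat (n choose i) else 0)"
proof -
  define D E :: "'k mat" where "D = mat (Suc n) (Suc n) (\<lambda>(i, j). if i = j then of_nat (n choose i) else 0)"
    and "E = mat (Suc n) (Suc n) (\<lambda>(i, j). if i = j then inverse (of_nat (n choose i)) else 0)"
  note sq = sqm[where n = "Suc n"]
  have [simp]: "D \<in> carrier_mat (Suc n) (Suc n)" "E \<in> carrier_mat (Suc n) (Suc n)" by (simp_all add: D_def E_def)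
  have T [simp]: "(nabla n A)\<^sup>T \<in> carrier_mat (Suc n) (Suc n)" for A :: "'k mat" by simp
  have D_mult: "(D * Z) $$ (i, j) = of_nat (n choose i) * Z $$ (i, j)" "(Z * D) $$ (i, j) = Z $$ (i, j) * of_nat (n choose j)"
    if "Z \<in> carrier_mat (Suc n) (Suc n)" "i < Suc n" "j < Suc n" for Z i j
  proof -
    have "(D * Z) $$ (i, j) = (\<Sum>k<Suc n. if k = i then of_nat (n choose i) * Z $$ (i, j) else 0)"
      using that unfolding D_def by (simp add: scalar_prod_def atLeast0LessThan del: sum.lessThan_Suc) (subst sum.cong[OF refl, where h = "\<lambda>k. if k = i then of_nat (n choose i) * Z $$ (i, j) else 0"], auto)
    then show "(D * Z) $$ (i, j) = of_nat (n choose i) * Z $$ (i, j)" using that by (simp del: sum.lessThan_Suc)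
    have "(Z * D) $$ (i, j) = (\<Sum>k<Suc n. if k = j then Z $$ (i, j) * of_nat (n choose j) else 0)"
      using that unfolding D_def by (simp add: scalar_prod_def atLeast0LessThan del: sum.lessThan_Suc) (subst sum.cong[OF refl, where h = "\<lambda>k. if k = j then Z $$ (i, j) * of_nat (n choose j) else 0"], auto)
    then show "(Z * D) $$ (i, j) = Z $$ (i, j) * of_nat (n choose j)" using that by (simp del: sum.lessThan_Suc)
  qed
  have DE: "D * E = 1\<^sub>m (Suc n)"
    by (rule eq_matI) (use D_mult(1)[of E] binom in \<open>auto simp: E_def D_def\<close>)
  have ED: "E * D = 1\<^sub>m (Suc n)" by (rule mat_mult_left_right_inverse[OF _ _ DE]) simp_all
  have wD: "D * (nabla n A\<^sup>T)\<^sup>T = nabla n A * D" if "A \<in> carrier_mat 2 2" for A :: "'k mat"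
  proof (rule eq_matI)
    fix i j assume "i < dim_row (nabla n A * D)" "j < dim_col (nabla n A * D)"
    then have ij: "i < Suc n" "j < Suc n" by (simp_all add: D_def nabla_def)
    show "(D * (nabla n A\<^sup>T)\<^sup>T) $$ (i, j) = (nabla n A * D) $$ (i, j)"
      using nabla_transpose[OF that, of i n j] ij
      by (subst D_mult(1), simp_all add: D_mult(2) mult.commute) (simp add: nabla_def)
  qed (simp_all add: D_def nabla_def)
  show thesis
    by (rule that[OF _ _ DE ED wD]) (simp_all add: D_def)
qed

text \<open>The inverse of \<open>A\<close> is \<open>w * A\<^sup>T * w'\<close> for the Weyl group
  element \<open>w\<close>. So the dual, on which \<open>A\<close> acts by the transpose of its
  inverse, is conjugate to \<open>A \<mapsto> (nabla n A\<^sup>T)\<^sup>T\<close>, and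
  \<open>nabla_form\<close> compares this with \<open>nabla n A\<close>.\<close>

lemma dual_weyl_selfdual:
  assumes binom: "\<And>i. i \<le> n \<Longrightarrow> of_nat (n choose i) \<noteq> (0 :: 'k::alg_closed_field)"
  shows "isomorphic_rep SL2 (dual_weyl_module n :: ('k mat, 'k) rep) (weyl_module n)"
proof -
  define w w' :: "'k mat" where "w = mat2 0 1 (- 1) 0" and "w' = mat2 0 (- 1) 1 0"
  obtain D E :: "'k mat" where Dc [simp]: "D \<in> carrier_mat (Suc n) (Suc n)" and Ec [simp]: "E \<in> carrier_mat (Suc n) (Suc n)"
    and DE: "D * E = 1\<^sub>m (Suc n)" and ED: "E * D = 1\<^sub>m (Suc n)"
    and wD: "\<And>A. A \<in> carrier_mat 2 2 \<Longrightarrow> D * (nabla n A\<^sup>T)\<^sup>T = nabla n A * D"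
    by (rule nabla_form) (erule binom, (rule that; assumption))
  note sq = sqm[where n = "Suc n"]
  have T [simp]: "(nabla n A)\<^sup>T \<in> carrier_mat (Suc n) (Suc n)" for A :: "'k mat" by simp
  have ww': "w * w' = 1\<^sub>m 2" "w' * w = 1\<^sub>m 2"
    by (simp_all add: w_def w'_def mat2_mult mat2_one[symmetric])
  have wc: "w \<in> carrier_mat 2 2" "w' \<in> carrier_mat 2 2" by (simp_all add: w_def w'_def)
  have nn: "nabla n w * nabla n w' = 1\<^sub>m (Suc n)" "nabla n w' * nabla n w = 1\<^sub>m (Suc n)"
    unfolding nabla_mult[OF wc, symmetric] nabla_mult[OF wc(2,1), symmetric] ww' nabla_one by simp_all
  have Tn: "(nabla n w)\<^sup>T * (nabla n w')\<^sup>T = 1\<^sub>m (Suc n)"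
    using transpose_mult[of "nabla n w'" "Suc n" "Suc n" "nabla n w" "Suc n"] nn(2) by simp
  have Tn': "(nabla n w')\<^sup>T * (nabla n w)\<^sup>T = 1\<^sub>m (Suc n)"
    using transpose_mult[of "nabla n w" "Suc n" "Suc n" "nabla n w'" "Suc n"] nn(1) by simp
  define K where "K = (nabla n w')\<^sup>T * E"
  show ?thesis
  proof (rule isomorphic_repI[of K "Suc n" "D * (nabla n w)\<^sup>T"])
    have "K * (D * (nabla n w)\<^sup>T) = (nabla n w')\<^sup>T * ((E * D) * (nabla n w)\<^sup>T)"
      unfolding K_def by (simp add: sqm_distrib(5)[where n = "Suc n"] sq)
    then show "K * (D * (nabla n w)\<^sup>T) = 1\<^sub>m (Suc n)" by (simp add: ED Tn' sq)
    fix A :: "'k mat" assume A: "A \<in> carrier SL2"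
    then have Ac: "A \<in> carrier_mat 2 2" by (simp add: SL2_iff)
    have "adj2 A = w * (A\<^sup>T * w')"
      unfolding w_def w'_def adj2_def
      by (rule mat2_eqI) (use Ac in \<open>simp_all add: mult_index_2 mult_carrier_mat[of _ 2 2 _ 2] del: index_mult_mat(1)\<close>)
    then have "nabla n (adj2 A) = nabla n w * (nabla n A\<^sup>T * nabla n w')"
      using Ac wc by (simp add: nabla_mult mult_carrier_mat[of _ 2 2 _ 2])
    then have "(nabla n (adj2 A))\<^sup>T = (nabla n A\<^sup>T * nabla n w')\<^sup>T * (nabla n w)\<^sup>T"
      using transpose_mult[of "nabla n w" "Suc n" "Suc n" "nabla n A\<^sup>T * nabla n w'" "Suc n"] by (simp add: sq)
    also have "(nabla n A\<^sup>T * nabla n w')\<^sup>T = (nabla n w')\<^sup>T * (nabla n A\<^sup>T)\<^sup>T"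
      using transpose_mult[of "nabla n A\<^sup>T" "Suc n" "Suc n" "nabla n w'" "Suc n"] by simp
    finally have eq: "(nabla n (adj2 A))\<^sup>T = (nabla n w')\<^sup>T * (nabla n A\<^sup>T)\<^sup>T * (nabla n w)\<^sup>T" .
    have "(nabla n (adj2 A))\<^sup>T * K = (nabla n w')\<^sup>T * ((nabla n A\<^sup>T)\<^sup>T * (((nabla n w)\<^sup>T * (nabla n w')\<^sup>T) * E))"
      unfolding eq K_def by (simp add: sqm_distrib(5)[where n = "Suc n"] sq)
    also have "\<dots> = (nabla n w')\<^sup>T * ((E * D) * ((nabla n A\<^sup>T)\<^sup>T * E))"
      unfolding Tn ED by (simp add: sq)
    also have "\<dots> = (nabla n w')\<^sup>T * (E * ((D * (nabla n A\<^sup>T)\<^sup>T) * E))"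
      by (simp add: sqm_distrib(5)[where n = "Suc n"] sq)
    also have "\<dots> = (nabla n w')\<^sup>T * (E * (nabla n A * (D * E)))"
      unfolding wD[OF Ac] by (simp add: sqm_distrib(5)[where n = "Suc n"] sq)
    also have "\<dots> = K * nabla n A"
      unfolding DE K_def by (simp add: sqm_distrib(5)[where n = "Suc n"] sq)
    finally show "K * act (dual_weyl_module n) A = act (weyl_module n) A * K"
      using A by (simp add: weyl_module_def dual_rep_def act_dual_weyl inv_SL2)
  qed (simp_all add: K_def sq weyl_module_def dual_rep_def)
qed

lemma tilting_dual_weyl:
  assumes "\<And>i. i \<le> n \<Longrightarrow> of_nat (n choose i) \<noteq> (0 :: 'k::alg_closed_field)"
  shows "tilting (dual_weyl_module n :: ('k mat, 'k) rep)"
  unfolding tilting_def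
proof (intro conjI)
  show "rational_rep (dual_weyl_module n :: ('k mat, 'k) rep)" by (rule rational_dual_weyl)
  show "has_filtration SL2 (range weyl_module) (dual_weyl_module n :: ('k mat, 'k) rep)"
    by (intro has_filtration_iso[OF group_SL2 representation_dual_weyl rangeI[of _ n]] dual_weyl_selfdual assms)
  show "has_filtration SL2 (range dual_weyl_module) (dual_weyl_module n :: ('k mat, 'k) rep)"
    by (intro has_filtration_iso[OF group_SL2 representation_dual_weyl rangeI[of _ n]] isomorphic_rep_refl representation_dual_weyl)
qed

lemma tilting_zero: "tilting (Rep 0 (\<lambda>_. 1\<^sub>m 0) :: ('k::alg_closed_field mat, 'k) rep)"
  unfolding tilting_def rational_rep_def
  using representation_zero[OF group_SL2] by (auto intro: has_filtration.zero)

section \<open>Factorization through the rank, and splitting off direct summands\<close>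

lemma rank_factorization:
  fixes P :: "nat \<Rightarrow> nat \<Rightarrow> 'k::field"
  shows "\<exists>(d::nat) (I::nat \<Rightarrow> nat \<Rightarrow> 'k) (Q::nat \<Rightarrow> nat \<Rightarrow> 'k) (J::nat \<Rightarrow> nat \<Rightarrow> 'k) (L::nat \<Rightarrow> nat \<Rightarrow> 'k). (\<forall>x<m. \<forall>y<n. P x y = (\<Sum>k<d. I k x * Q k y)) \<and>
    (\<forall>k<d. \<forall>l<d. (\<Sum>x<m. J k x * I l x) = (if k = l then 1 else 0)) \<and>
    (\<forall>k<d. \<forall>l<d. (\<Sum>y<n. Q k y * L l y) = (if k = l then 1 else 0))"
proof (induction "card {y. y < n \<and> (\<exists>x<m. P x y \<noteq> 0)}" arbitrary: P rule: less_induct)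
  case less
  show ?case
  proof (cases "\<exists>a<m. \<exists>b<n. P a b \<noteq> 0")
    case False
    then show ?thesis by (intro exI[of _ 0]) auto
  next
    case True
    then obtain a b where ab: "a < m" "b < n" "P a b \<noteq> 0" by blast
    \<comment> \<open>One elimination step: subtracting the matrix of rank one through the pivot
      clears row \<open>a\<close> and column \<open>b\<close>, so fewer columns are
      non-zero.\<close>
    define P' where "P' x y = P x y - P x b * P a y / P a b" for x y
    have "{y. y < n \<and> (\<exists>x<m. P' x y \<noteq> 0)} \<subset> {y. y < n \<and> (\<exists>x<m. P x y \<noteq> 0)}"
    proof (intro psubsetI)
      show "{y. y < n \<and> (\<exists>x<m. P' x y \<noteq> 0)} \<subseteq> {y. y < n \<and> (\<exists>x<m. P x y \<noteq> 0)}"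
      proof
        fix y assume "y \<in> {y. y < n \<and> (\<exists>x<m. P' x y \<noteq> 0)}"
        then obtain x where "y < n" "x < m" "P' x y \<noteq> 0" by blast
        moreover have "P x y \<noteq> 0 \<or> P a y \<noteq> 0" using \<open>P' x y \<noteq> 0\<close> by (auto simp: P'_def)
        ultimately show "y \<in> {y. y < n \<and> (\<exists>x<m. P x y \<noteq> 0)}" using ab by blast
      qed
      have "b \<notin> {y. y < n \<and> (\<exists>x<m. P' x y \<noteq> 0)}" using ab by (auto simp: P'_def)
      then show "{y. y < n \<and> (\<exists>x<m. P' x y \<noteq> 0)} \<noteq> {y. y < n \<and> (\<exists>x<m. P x y \<noteq> 0)}" using ab by blast
    qed
    then have "card {y. y < n \<and> (\<exists>x<m. P' x y \<noteq> 0)} < card {y. y < n \<and> (\<exists>x<m. P x y \<noteq> 0)}"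
      by (intro psubset_card_mono) auto
    from less[OF this] obtain d :: nat and I Q J L :: "nat \<Rightarrow> nat \<Rightarrow> 'k" where IH:
      "(\<forall>x<m. \<forall>y<n. P' x y = (\<Sum>k<d. I k x * Q k y)) \<and>
    (\<forall>k<d. \<forall>l<d. (\<Sum>x<m. J k x * I l x) = (if k = l then 1 else 0)) \<and>
    (\<forall>k<d. \<forall>l<d. (\<Sum>y<n. Q k y * L l y) = (if k = l then 1 else 0))" by blast
    then have
      P': "\<And>x y. x < m \<Longrightarrow> y < n \<Longrightarrow> P' x y = (\<Sum>k<d. I k x * Q k y)" and
      JI: "\<And>k l. k < d \<Longrightarrow> l < d \<Longrightarrow> (\<Sum>x<m. J k x * I l x) = (if k = l then 1 else 0)" and
      QL: "\<And>k l. k < d \<Longrightarrow> l < d \<Longrightarrow> (\<Sum>y<n. Q k y * L l y) = (if k = l then 1 else 0)" by blast+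
    have Ia: "I l a = 0" if "l < d" for l
    proof -
      have "0 = (\<Sum>y<n. P' a y * L l y)" using ab by (simp add: P'_def)
      also have "\<dots> = (\<Sum>y<n. \<Sum>k<d. I k a * (Q k y * L l y))"
        using ab by (simp add: P' sum_distrib_right mult.assoc)
      also have "\<dots> = (\<Sum>k<d. I k a * (\<Sum>y<n. Q k y * L l y))"
        by (subst sum.swap) (simp add: sum_distrib_left)
      also have "\<dots> = (\<Sum>k<d. if k = l then I l a else 0)" using that by (intro sum.cong) (auto simp: QL)
      finally show ?thesis using that by (simp add: sum.delta)
    qed
    have Qb: "Q l b = 0" if "l < d" for l
    proof -
      have "0 = (\<Sum>x<m. J l x * P' x b)" using ab by (simp add: P'_def)
      also have "\<dots> = (\<Sum>x<m. \<Sum>k<d. (J l x * I k x) * Q k b)"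
        using ab by (simp add: P' sum_distrib_left mult.assoc)
      also have "\<dots> = (\<Sum>k<d. (\<Sum>x<m. J l x * I k x) * Q k b)"
        by (subst sum.swap) (simp add: sum_distrib_right)
      also have "\<dots> = (\<Sum>k<d. if k = l then Q l b else 0)" using that by (intro sum.cong) (auto simp: JI)
      finally show ?thesis using that by (simp add: sum.delta)
    qed
    define I' where "I' k x = (case k of 0 \<Rightarrow> P x b / P a b | Suc k' \<Rightarrow> I k' x)" for k x
    define Q' where "Q' k y = (case k of 0 \<Rightarrow> P a y | Suc k' \<Rightarrow> Q k' y)" for k y
    \<comment> \<open>The old left inverse is changed at the single place \<open>a\<close> so that
      it kills the new column. The old columns vanish at \<open>a\<close> by \<open>Ia\<close>, so
      nothing else changes; \<open>L'\<close> is corrected at \<open>b\<close> in the same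
      way.\<close>
    define J' where "J' k x = (case k of 0 \<Rightarrow> if x = a then 1 else 0
      | Suc k' \<Rightarrow> J k' x - (if x = a then (\<Sum>z<m. J k' z * P z b) / P a b else 0))" for k x
    define L' where "L' k y = (case k of 0 \<Rightarrow> if y = b then 1 / P a b else 0
      | Suc k' \<Rightarrow> L k' y - (if y = b then (\<Sum>z<n. P a z * L k' z) / P a b else 0))" for k y
    have delta: "(\<Sum>x<m. (if x = a then c else 0) * f x) = c * f a" "(\<Sum>y<n. f y * (if y = b then c else 0)) = f b * c" for c :: 'k and f :: "nat \<Rightarrow> 'k"
      using ab by (simp_all add: if_distrib[of "\<lambda>t. t * _"] if_distrib[of "\<lambda>t. _ * t"] cong: if_cong)
    have "P x y = (\<Sum>k<Suc d. I' k x * Q' k y)" if "x < m" "y < n" for x y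
      unfolding sum.lessThan_Suc_shift using P'[OF that] ab by (simp add: I'_def Q'_def P'_def algebra_simps)
    moreover have "(\<Sum>x<m. J' k x * I' l x) = (if k = l then 1 else 0)" if "k < Suc d" "l < Suc d" for k l
    proof -
      have "(\<Sum>x<m. J' 0 x * I' l x) = I' l a"
        unfolding J'_def nat.case using delta(1)[of 1 "I' l"] by simp
      moreover have "(\<Sum>x<m. J' (Suc k) x * I' l x) = (\<Sum>x<m. J k x * I' l x) - (\<Sum>z<m. J k z * P z b) / P a b * I' l a" for k
        unfolding J'_def nat.case left_diff_distrib sum_subtractf delta(1) ..
      moreover have "(\<Sum>x<m. J k x * I' 0 x) = (\<Sum>x<m. J k x * P x b) / P a b" for k
        by (simp add: sum_divide_distrib I'_def)
      moreover have "I' 0 a = 1" "I' (Suc l) = I l" for l using ab by (simp_all add: I'_def fun_eq_iff)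
      ultimately show ?thesis using that JI Ia by (cases k; cases l) simp_all
    qed
    moreover have "(\<Sum>y<n. Q' k y * L' l y) = (if k = l then 1 else 0)" if "k < Suc d" "l < Suc d" for k l
    proof -
      have "(\<Sum>y<n. Q' k y * L' 0 y) = Q' k b / P a b"
        unfolding L'_def nat.case using delta(2)[of "Q' k" "1 / P a b"] by simp
      moreover have "(\<Sum>y<n. Q' k y * L' (Suc l) y) = (\<Sum>y<n. Q' k y * L l y) - Q' k b * ((\<Sum>z<n. P a z * L l z) / P a b)" for l
        unfolding L'_def nat.case right_diff_distrib sum_subtractf delta(2) ..
      moreover have "Q' 0 = P a" "Q' (Suc k) = Q k" for k by (simp_all add: Q'_def fun_eq_iff)
      ultimately show ?thesis using that ab QL Qb by (cases k; cases l) simp_all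
    qed
    ultimately show ?thesis by blast
  qed
qed

lemma mat_rank_factorization:
  fixes P :: "'k::field mat"
  assumes "P \<in> carrier_mat m n"
  obtains d I Q J L where "I \<in> carrier_mat m d" "Q \<in> carrier_mat d n" "J \<in> carrier_mat d m" "L \<in> carrier_mat n d"
    "P = I * Q" "J * I = 1\<^sub>m d" "Q * L = 1\<^sub>m d"
proof -
  obtain d :: nat and I Q J L :: "nat \<Rightarrow> nat \<Rightarrow> 'k" where *:
    "(\<forall>x<m. \<forall>y<n. P $$ (x, y) = (\<Sum>k<d. I k x * Q k y)) \<and>
    (\<forall>k<d. \<forall>l<d. (\<Sum>x<m. J k x * I l x) = (if k = l then 1 else 0)) \<and>
    (\<forall>k<d. \<forall>l<d. (\<Sum>y<n. Q k y * L l y) = (if k = l then 1 else 0))"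
    using rank_factorization[of m n "\<lambda>x y. P $$ (x, y)"] by blast
  show thesis
  proof (rule that)
    show "mat m d (\<lambda>(x, k). I k x) \<in> carrier_mat m d" "mat d n (\<lambda>(k, y). Q k y) \<in> carrier_mat d n"
      "mat d m (\<lambda>(k, x). J k x) \<in> carrier_mat d m" "mat n d (\<lambda>(y, k). L k y) \<in> carrier_mat n d" by simp_all
    show "P = mat m d (\<lambda>(x, k). I k x) * mat d n (\<lambda>(k, y). Q k y)"
      by (rule eq_matI) (use * assms in \<open>simp_all add: scalar_prod_def atLeast0LessThan\<close>)
    show "mat d m (\<lambda>(k, x). J k x) * mat m d (\<lambda>(x, k). I k x) = 1\<^sub>m d"
      by (rule eq_matI) (use * in \<open>simp_all add: scalar_prod_def atLeast0LessThan\<close>)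
    show "mat d n (\<lambda>(k, y). Q k y) * mat n d (\<lambda>(y, k). L k y) = 1\<^sub>m d"
      by (rule eq_matI) (use * in \<open>simp_all add: scalar_prod_def atLeast0LessThan\<close>)
  qed
qed

lemma four_block_empty: "A \<in> carrier_mat n m \<Longrightarrow> four_block_mat A (0\<^sub>m n 0) (0\<^sub>m 0 m) (0\<^sub>m 0 0) = A"
  by (rule eq_matI) auto

text \<open>The complement is the image of the equivariant idempotent \<open>P = 1 - A * B\<close>.
  Factoring \<open>P = I * Q\<close> through its rank gives coordinates on this image, with
  \<open>Q * I = 1\<close>.\<close>

lemma split_off:
  fixes V W :: "('g, 'k::field) rep"
  assumes G: "group G" and V: "representation G V" and W: "representation G W"
    and A: "A \<in> carrier_mat (deg V) (deg W)" and B: "B \<in> carrier_mat (deg W) (deg V)" and BA: "B * A = 1\<^sub>m (deg W)"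
    and Ag: "\<And>g. g \<in> carrier G \<Longrightarrow> A * act W g = act V g * A"
    and Bg: "\<And>g. g \<in> carrier G \<Longrightarrow> B * act V g = act W g * B"
  obtains N where "representation G N" "isomorphic_rep G V (direct_sum_rep W N)"
proof -
  define n m where "n = deg V" and "m = deg W"
  note A = A[folded n_def m_def] and B = B[folded n_def m_def] and BA = BA[folded m_def]
  interpret G: group G by (rule G)
  have Vc [simp]: "act V g \<in> carrier_mat n n" if "g \<in> carrier G" for g
    using representation_carrier[OF V that] by (simp add: n_def)
  have Wc [simp]: "act W g \<in> carrier_mat m m" if "g \<in> carrier G" for g
    using representation_carrier[OF W that] by (simp add: m_def)
  have AB [simp]: "A * B \<in> carrier_mat n n" by (rule mult_carrier_mat[OF A B])
  define P where "P = 1\<^sub>m n - A * B"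
  have P [simp]: "P \<in> carrier_mat n n" unfolding P_def by (rule minus_carrier_mat[OF AB])
  have PA: "P * A = 0\<^sub>m n m"
  proof -
    have "P * A = 1\<^sub>m n * A - A * B * A" unfolding P_def by (rule minus_mult_distrib_mat[OF _ AB A]) simp
    also have "A * B * A = A * (B * A)" by (rule assoc_mult_mat[OF A B A])
    finally show ?thesis using A unfolding BA by simp
  qed
  have BP: "B * P = 0\<^sub>m m n"
  proof -
    have "B * P = B * 1\<^sub>m n - B * (A * B)" unfolding P_def by (rule mult_minus_distrib_mat[OF B _ AB]) simp
    also have "B * (A * B) = B * A * B" by (rule assoc_mult_mat[OF B A B, symmetric])
    finally show ?thesis using B unfolding BA by simp
  qed
  have PP: "P * P = P"
  proof -
    have "P * P = P * 1\<^sub>m n - P * (A * B)" by (subst (2) P_def) (rule mult_minus_distrib_mat[OF P _ AB], simp)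
    also have "P * (A * B) = 0\<^sub>m n n" using assoc_mult_mat[OF P A B] B unfolding PA by simp
    also have "P * 1\<^sub>m n - 0\<^sub>m n n = P" using carrier_matD[OF P] by (intro eq_matI) auto
    finally show ?thesis .
  qed
  have Pg: "P * act V g = act V g * P" if g: "g \<in> carrier G" for g
  proof -
    have "A * B * act V g = A * (B * act V g)" by (rule assoc_mult_mat[OF A B Vc[OF g]])
    also have "\<dots> = A * act W g * B" unfolding Bg[OF g] by (rule assoc_mult_mat[OF A Wc[OF g] B, symmetric])
    also have "\<dots> = act V g * (A * B)" unfolding Ag[OF g] by (rule assoc_mult_mat[OF Vc[OF g] A B])
    finally have eq: "A * B * act V g = act V g * (A * B)" .
    have "P * act V g = 1\<^sub>m n * act V g - A * B * act V g"
      unfolding P_def by (rule minus_mult_distrib_mat[OF _ AB Vc[OF g]]) simp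
    also have "\<dots> = act V g * 1\<^sub>m n - act V g * (A * B)" unfolding eq using Vc[OF g] by simp
    also have "\<dots> = act V g * P"
      unfolding P_def by (rule mult_minus_distrib_mat[OF Vc[OF g] _ AB, symmetric]) simp
    finally show ?thesis .
  qed
  obtain d I Q J L where I: "I \<in> carrier_mat n d" and Q: "Q \<in> carrier_mat d n" and J: "J \<in> carrier_mat d n"
    and L: "L \<in> carrier_mat n d" and IQ: "P = I * Q" and JI: "J * I = 1\<^sub>m d" and QL: "Q * L = 1\<^sub>m d"
    by (rule mat_rank_factorization[OF P]) (rule that)
  have BI: "B * I = 0\<^sub>m m d"
  proof -
    have "B * I = B * I * (Q * L)" unfolding QL using B I by simp
    also have "\<dots> = B * I * Q * L" using B I Q L by (intro assoc_mult_mat[symmetric]) auto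
    also have "B * I * Q = B * P" unfolding IQ by (rule assoc_mult_mat[OF B I Q])
    finally show ?thesis unfolding BP using L by simp
  qed
  have QA: "Q * A = 0\<^sub>m d m"
  proof -
    have "Q * A = J * I * (Q * A)" unfolding JI using Q A by simp
    also have "\<dots> = J * (I * (Q * A))" using J I Q A by (intro assoc_mult_mat) auto
    also have "I * (Q * A) = P * A" unfolding IQ by (rule assoc_mult_mat[OF I Q A, symmetric])
    finally show ?thesis unfolding PA using J by simp
  qed
  have QP: "Q * P = Q"
  proof -
    have "Q * P = J * I * (Q * P)" unfolding JI using Q by simp
    also have "\<dots> = J * (I * (Q * P))" using J I Q by (intro assoc_mult_mat) auto
    also have "I * (Q * P) = P * P" using assoc_mult_mat[OF I Q P] IQ by simp
    also have "J * (P * P) = J * I * Q" unfolding PP unfolding IQ by (rule assoc_mult_mat[OF J I Q, symmetric])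
    finally show ?thesis unfolding JI using Q by simp
  qed
  have QI: "Q * I = 1\<^sub>m d"
  proof -
    have "Q * I = Q * I * (Q * L)" unfolding QL using Q I by simp
    also have "\<dots> = Q * I * Q * L" using Q I L by (intro assoc_mult_mat[symmetric]) auto
    also have "Q * I * Q = Q * P" unfolding IQ by (rule assoc_mult_mat[OF Q I Q])
    finally show ?thesis unfolding QP QL .
  qed
  define N where "N = Rep d (\<lambda>g. Q * act V g * I)"
  have QVIQ: "Q * act V g * I * Q = Q * act V g" if g: "g \<in> carrier G" for g
  proof -
    have QV: "Q * act V g \<in> carrier_mat d n" using Q Vc[OF g] by simp
    have "Q * act V g * I * Q = Q * act V g * P" unfolding IQ by (rule assoc_mult_mat[OF QV I Q])
    also have "\<dots> = Q * (act V g * P)" by (rule assoc_mult_mat[OF Q Vc[OF g] P])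
    also have "\<dots> = Q * P * act V g" unfolding Pg[OF g, symmetric] by (rule assoc_mult_mat[OF Q P Vc[OF g], symmetric])
    finally show ?thesis unfolding QP .
  qed
  have mult: "Q * act V (g \<otimes>\<^bsub>G\<^esub> h) * I = Q * act V g * I * (Q * act V h * I)" if g: "g \<in> carrier G" and h: "h \<in> carrier G" for g h
  proof -
    have QV: "Q * act V g \<in> carrier_mat d n" using Q Vc[OF g] by (rule mult_carrier_mat)
    have VI: "act V h * I \<in> carrier_mat n d" using Vc[OF h] I by (rule mult_carrier_mat)
    have "Q * act V g * I * (Q * act V h * I) = Q * act V g * I * (Q * (act V h * I))"
      unfolding assoc_mult_mat[OF Q Vc[OF h] I] ..
    also have "\<dots> = Q * act V g * I * Q * (act V h * I)"
      by (rule assoc_mult_mat[OF mult_carrier_mat[OF QV I] Q VI, symmetric])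
    also have "\<dots> = Q * act V g * act V h * I" unfolding QVIQ[OF g]
      by (rule assoc_mult_mat[OF QV Vc[OF h] I, symmetric])
    also have "Q * act V g * act V h = Q * act V (g \<otimes>\<^bsub>G\<^esub> h)"
      unfolding representation_mult[OF V g h] by (rule assoc_mult_mat[OF Q Vc[OF g] Vc[OF h]])
    finally show ?thesis by (rule sym)
  qed
  have repN: "representation G N"
  proof (rule representationI[OF G])
    show "act N g \<in> carrier_mat (deg N) (deg N)" if "g \<in> carrier G" for g
      using mult_carrier_mat[OF mult_carrier_mat[OF Q Vc[OF that]] I] by (simp add: N_def)
    show "act N (g \<otimes>\<^bsub>G\<^esub> h) = act N g * act N h" if "g \<in> carrier G" "h \<in> carrier G" for g h
      using mult[OF that] by (simp add: N_def)
    show "act N \<one>\<^bsub>G\<^esub> = 1\<^sub>m (deg N)"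
      using QI right_mult_one_mat[OF Q] by (simp add: N_def representation_one[OF G V, folded n_def])
  qed
  \<comment> \<open>\<open>B\<close> stacked on \<open>Q\<close>, and \<open>A\<close> next to
    \<open>I\<close>; the blocks of width or height zero give both the shape of four-block
    matrices.\<close>
  define Z Z' where "Z = four_block_mat B (0\<^sub>m m 0) Q (0\<^sub>m d 0)"
    and "Z' = four_block_mat A I (0\<^sub>m 0 m) (0\<^sub>m 0 d)"
  have Zc: "Z \<in> carrier_mat (m + d) n" "Z' \<in> carrier_mat n (m + d)"
    unfolding Z_def Z'_def
    using four_block_carrier_mat[OF B zero_carrier_mat[of d 0], where B = "0\<^sub>m m 0" and C = Q]
      four_block_carrier_mat[OF A zero_carrier_mat[of 0 d], where B = I and C = "0\<^sub>m 0 m"] by simp_all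
  have "Z * Z' = four_block_mat (B * A + 0\<^sub>m m 0 * 0\<^sub>m 0 m) (B * I + 0\<^sub>m m 0 * 0\<^sub>m 0 d)
      (Q * A + 0\<^sub>m d 0 * 0\<^sub>m 0 m) (Q * I + 0\<^sub>m d 0 * 0\<^sub>m 0 d)"
    unfolding Z_def Z'_def by (rule mult_four_block_mat) (rule A B I Q zero_carrier_mat one_carrier_mat)+
  also have "\<dots> = four_block_mat (1\<^sub>m m) (0\<^sub>m m d) (0\<^sub>m d m) (1\<^sub>m d)"
    unfolding BA BI QA QI by (intro arg_cong4[of _ _ _ _ _ _ _ _ four_block_mat] eq_matI) (auto simp: scalar_prod_def)
  also have "\<dots> = 1\<^sub>m (m + d)" by (rule four_block_one_mat)
  finally have ZZ': "Z * Z' = 1\<^sub>m (m + d)" .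
  have "Z' * Z = four_block_mat (A * B + I * Q) (A * 0\<^sub>m m 0 + I * 0\<^sub>m d 0)
      (0\<^sub>m 0 m * B + 0\<^sub>m 0 d * Q) (0\<^sub>m 0 m * 0\<^sub>m m 0 + 0\<^sub>m 0 d * 0\<^sub>m d 0)"
    unfolding Z_def Z'_def by (rule mult_four_block_mat) (rule A B I Q zero_carrier_mat one_carrier_mat)+
  also have "\<dots> = four_block_mat (1\<^sub>m n) (0\<^sub>m n 0) (0\<^sub>m 0 n) (0\<^sub>m 0 0)"
    unfolding IQ[symmetric] P_def using A B I Q
    by (intro arg_cong4[of _ _ _ _ _ _ _ _ four_block_mat] eq_matI) auto
  also have "\<dots> = 1\<^sub>m n" by (rule four_block_empty) simp
  finally have Z'Z: "Z' * Z = 1\<^sub>m n" .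
  have dim: "n = m + d" using right_inverse_dim[OF Zc ZZ'] right_inverse_dim[OF Zc(2,1) Z'Z] by simp
  have "isomorphic_rep G V (direct_sum_rep W N)"
  proof (rule isomorphic_repI[of Z "m + d" Z'])
    fix g assume g: "g \<in> carrier G"
    have Nc: "act N g \<in> carrier_mat d d" using representation_carrier[OF repN g] by (simp add: N_def)
    have "Z * four_block_mat (act V g) (0\<^sub>m n 0) (0\<^sub>m 0 n) (0\<^sub>m 0 0)
      = four_block_mat (B * act V g + 0\<^sub>m m 0 * 0\<^sub>m 0 n) (B * 0\<^sub>m n 0 + 0\<^sub>m m 0 * 0\<^sub>m 0 0)
          (Q * act V g + 0\<^sub>m d 0 * 0\<^sub>m 0 n) (Q * 0\<^sub>m n 0 + 0\<^sub>m d 0 * 0\<^sub>m 0 0)"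
      unfolding Z_def by (rule mult_four_block_mat) (rule A B I Q Vc[OF g] zero_carrier_mat one_carrier_mat)+
    also have "\<dots> = four_block_mat (B * act V g) (0\<^sub>m m 0) (Q * act V g) (0\<^sub>m d 0)"
      using B Q Vc[OF g] by (intro arg_cong4[of _ _ _ _ _ _ _ _ four_block_mat] eq_matI) (auto simp: scalar_prod_def)
    finally have 1: "Z * act V g = four_block_mat (B * act V g) (0\<^sub>m m 0) (Q * act V g) (0\<^sub>m d 0)"
      unfolding four_block_empty[OF Vc[OF g]] .
    have "four_block_mat (act W g) (0\<^sub>m m d) (0\<^sub>m d m) (act N g) * Z
      = four_block_mat (act W g * B + 0\<^sub>m m d * Q) (act W g * 0\<^sub>m m 0 + 0\<^sub>m m d * 0\<^sub>m d 0)
         (0\<^sub>m d m * B + act N g * Q) (0\<^sub>m d m * 0\<^sub>m m 0 + act N g * 0\<^sub>m d 0)"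
      unfolding Z_def by (rule mult_four_block_mat) (rule A B I Q Wc[OF g] Nc zero_carrier_mat one_carrier_mat)+
    also have "\<dots> = four_block_mat (act W g * B) (0\<^sub>m m 0) (act N g * Q) (0\<^sub>m d 0)"
      using Wc[OF g] Nc B Q by (intro arg_cong4[of _ _ _ _ _ _ _ _ four_block_mat] eq_matI) auto
    also have "act N g * Q = Q * act V g" using QVIQ[OF g] by (simp add: N_def)
    also have "act W g * B = B * act V g" by (rule Bg[OF g, symmetric])
    finally show "Z * act V g = act (direct_sum_rep W N) g * Z"
      unfolding 1 by (simp add: direct_sum_rep_def m_def N_def)
  qed (use Zc ZZ' dim in \<open>simp_all add: direct_sum_rep_def n_def m_def N_def\<close>)
  with repN show thesis by (rule that)
qed

lemma direct_summandE:
  fixes M V :: "('g, 'k::field) rep"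
  assumes "direct_summand G M V"
  obtains P I where "P \<in> carrier_mat (deg M) (deg V)" "I \<in> carrier_mat (deg V) (deg M)" "P * I = 1\<^sub>m (deg M)"
    "\<And>g. g \<in> carrier G \<Longrightarrow> act V g \<in> carrier_mat (deg V) (deg V) \<Longrightarrow> P * act V g = act M g * P"
    "\<And>g. g \<in> carrier G \<Longrightarrow> act V g \<in> carrier_mat (deg V) (deg V) \<Longrightarrow> act V g * I = I * act M g"
proof -
  obtain N where M: "representation G M" and N: "representation G N" and iso: "isomorphic_rep G V (direct_sum_rep M N)"
    using assms unfolding direct_summand_def by blast
  define n m d where "n = deg V" and "m = deg M" and "d = deg N"
  obtain A B where *: "deg V = deg (direct_sum_rep M N)" "A \<in> carrier_mat (deg (direct_sum_rep M N)) (deg (direct_sum_rep M N))"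
    "B \<in> carrier_mat (deg (direct_sum_rep M N)) (deg (direct_sum_rep M N))"
    "A * B = 1\<^sub>m (deg (direct_sum_rep M N))" "B * A = 1\<^sub>m (deg (direct_sum_rep M N))"
    and Ag: "\<And>g. g \<in> carrier G \<Longrightarrow> A * act V g = act (direct_sum_rep M N) g * A"
    by (rule isomorphic_repE[OF iso]) blast
  have dn: "n = m + d" "deg (direct_sum_rep M N) = n" using *(1) by (simp_all add: n_def m_def d_def direct_sum_rep_def)
  have A: "A \<in> carrier_mat n n" and B: "B \<in> carrier_mat n n" and AB: "A * B = 1\<^sub>m n" and BA: "B * A = 1\<^sub>m n"
    using *(2-5) unfolding dn(2) by simp_all
  define K K' :: "'k mat" where "K = four_block_mat (1\<^sub>m m) (0\<^sub>m m d) (0\<^sub>m 0 m) (0\<^sub>m 0 d)"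
    and "K' = four_block_mat (1\<^sub>m m) (0\<^sub>m m 0) (0\<^sub>m d m) (0\<^sub>m d 0)"
  have K: "K \<in> carrier_mat m n" "K' \<in> carrier_mat n m"
    unfolding K_def K'_def dn
    using four_block_carrier_mat[OF one_carrier_mat[of m] zero_carrier_mat[of 0 d], where B = "0\<^sub>m m d" and C = "0\<^sub>m 0 m"]
      four_block_carrier_mat[OF one_carrier_mat[of m] zero_carrier_mat[of d 0], where B = "0\<^sub>m m 0" and C = "0\<^sub>m d m"] by simp_all
  have "K * K' = four_block_mat (1\<^sub>m m * 1\<^sub>m m + 0\<^sub>m m d * 0\<^sub>m d m) (1\<^sub>m m * 0\<^sub>m m 0 + 0\<^sub>m m d * 0\<^sub>m d 0)
      (0\<^sub>m 0 m * 1\<^sub>m m + 0\<^sub>m 0 d * 0\<^sub>m d m) (0\<^sub>m 0 m * 0\<^sub>m m 0 + 0\<^sub>m 0 d * 0\<^sub>m d 0)"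
    unfolding K_def K'_def by (rule mult_four_block_mat) (rule zero_carrier_mat one_carrier_mat)+
  then have KK': "K * K' = 1\<^sub>m m" using four_block_empty[OF one_carrier_mat[of m]] by simp
  have S: "act (direct_sum_rep M N) g = four_block_mat (act M g) (0\<^sub>m m d) (0\<^sub>m d m) (act N g)" for g
    by (simp add: direct_sum_rep_def m_def d_def)
  have Sg: "act (direct_sum_rep M N) g \<in> carrier_mat n n" "K * act (direct_sum_rep M N) g = act M g * K"
    "act (direct_sum_rep M N) g * K' = K' * act M g" if g: "g \<in> carrier G" for g
  proof -
    have Mc: "act M g \<in> carrier_mat m m" and Nc: "act N g \<in> carrier_mat d d"
      using representation_carrier[OF M g] representation_carrier[OF N g] by (simp_all add: m_def d_def)
    show "act (direct_sum_rep M N) g \<in> carrier_mat n n" unfolding S dn(1) using Mc Nc by simp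
    have "K * act (direct_sum_rep M N) g = four_block_mat (1\<^sub>m m * act M g + 0\<^sub>m m d * 0\<^sub>m d m) (1\<^sub>m m * 0\<^sub>m m d + 0\<^sub>m m d * act N g)
      (0\<^sub>m 0 m * act M g + 0\<^sub>m 0 d * 0\<^sub>m d m) (0\<^sub>m 0 m * 0\<^sub>m m d + 0\<^sub>m 0 d * act N g)"
      unfolding K_def S by (rule mult_four_block_mat) (rule Mc Nc zero_carrier_mat one_carrier_mat)+
    moreover have "four_block_mat (act M g) (0\<^sub>m m 0) (0\<^sub>m 0 m) (0\<^sub>m 0 0) * K
      = four_block_mat (act M g * 1\<^sub>m m + 0\<^sub>m m 0 * 0\<^sub>m 0 m) (act M g * 0\<^sub>m m d + 0\<^sub>m m 0 * 0\<^sub>m 0 d)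
      (0\<^sub>m 0 m * 1\<^sub>m m + 0\<^sub>m 0 0 * 0\<^sub>m 0 m) (0\<^sub>m 0 m * 0\<^sub>m m d + 0\<^sub>m 0 0 * 0\<^sub>m 0 d)"
      unfolding K_def by (rule mult_four_block_mat) (rule Mc zero_carrier_mat one_carrier_mat)+
    ultimately show "K * act (direct_sum_rep M N) g = act M g * K"
      unfolding four_block_empty[OF Mc] using Mc Nc by simp
    have "act (direct_sum_rep M N) g * K' = four_block_mat (act M g * 1\<^sub>m m + 0\<^sub>m m d * 0\<^sub>m d m) (act M g * 0\<^sub>m m 0 + 0\<^sub>m m d * 0\<^sub>m d 0)
      (0\<^sub>m d m * 1\<^sub>m m + act N g * 0\<^sub>m d m) (0\<^sub>m d m * 0\<^sub>m m 0 + act N g * 0\<^sub>m d 0)"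
      unfolding K'_def S by (rule mult_four_block_mat) (rule Mc Nc zero_carrier_mat one_carrier_mat)+
    moreover have "K' * four_block_mat (act M g) (0\<^sub>m m 0) (0\<^sub>m 0 m) (0\<^sub>m 0 0)
      = four_block_mat (1\<^sub>m m * act M g + 0\<^sub>m m 0 * 0\<^sub>m 0 m) (1\<^sub>m m * 0\<^sub>m m 0 + 0\<^sub>m m 0 * 0\<^sub>m 0 0)
      (0\<^sub>m d m * act M g + 0\<^sub>m d 0 * 0\<^sub>m 0 m) (0\<^sub>m d m * 0\<^sub>m m 0 + 0\<^sub>m d 0 * 0\<^sub>m 0 0)"
      unfolding K'_def by (rule mult_four_block_mat) (rule Mc zero_carrier_mat one_carrier_mat)+
    ultimately show "act (direct_sum_rep M N) g * K' = K' * act M g"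
      unfolding four_block_empty[OF Mc] using Mc Nc by simp
  qed
  show thesis
  proof (rule that[of "K * A" "B * K'"])
    show "K * A \<in> carrier_mat (deg M) (deg V)" "B * K' \<in> carrier_mat (deg V) (deg M)"
      using K A B by (simp_all add: n_def m_def)
    have "K * A * (B * K') = K * (A * (B * K'))" using K A B by (intro assoc_mult_mat) auto
    also have "A * (B * K') = K'" using assoc_mult_mat[OF A B K(2)] K unfolding AB by simp
    finally show "K * A * (B * K') = 1\<^sub>m (deg M)" unfolding KK' m_def .
    fix g assume g: "g \<in> carrier G" and "act V g \<in> carrier_mat (deg V) (deg V)"
    then have Vc: "act V g \<in> carrier_mat n n" by (simp add: n_def)
    have Mc: "act M g \<in> carrier_mat m m" using representation_carrier[OF M g] by (simp add: m_def)
    have "K * A * act V g = K * (A * act V g)" by (rule assoc_mult_mat[OF K(1) A Vc])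
    also have "\<dots> = K * act (direct_sum_rep M N) g * A" unfolding Ag[OF g] by (rule assoc_mult_mat[OF K(1) Sg(1)[OF g] A, symmetric])
    also have "\<dots> = act M g * (K * A)" unfolding Sg(2)[OF g] by (rule assoc_mult_mat[OF Mc K(1) A])
    finally show "K * A * act V g = act M g * (K * A)" .
    have "act V g * (B * K') = (B * A) * (act V g * (B * K'))" unfolding BA using Vc B K by simp
    also have "\<dots> = B * (A * (act V g * (B * K')))" using A B Vc K by (intro assoc_mult_mat) auto
    also have "A * (act V g * (B * K')) = A * act V g * (B * K')" using A B Vc K by (intro assoc_mult_mat[symmetric]) auto
    also have "\<dots> = act (direct_sum_rep M N) g * (A * (B * K'))" unfolding Ag[OF g]
      using A B Sg(1)[OF g] K by (intro assoc_mult_mat) auto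
    also have "A * (B * K') = K'" using assoc_mult_mat[OF A B K(2)] K unfolding AB by simp
    also have "B * (act (direct_sum_rep M N) g * K') = B * K' * act M g" unfolding Sg(3)[OF g]
      by (rule assoc_mult_mat[OF B K(2) Mc, symmetric])
    finally show "act V g * (B * K') = B * K' * act M g" .
  qed
qed

section \<open>Modules with a highest weight vector\<close>

text \<open>A non-zero polynomial \<open>s = r * (a - b)\<close> with only zero values is
  impossible: \<open>1 + x * s\<close> has positive degree, hence a root, but its values are all
  \<open>1\<close>.\<close>

lemma poly_eq_off:
  fixes a b r :: "'k::alg_closed_field poly"
  assumes "r \<noteq> 0" "\<And>x. poly r x \<noteq> 0 \<Longrightarrow> poly a x = poly b x"
  shows "a = b"
proof (rule ccontr)
  define s where "s = r * (a - b)"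
  assume "a \<noteq> b"
  then have "s \<noteq> 0" using assms(1) by (simp add: s_def)
  then have "degree (pCons 1 s) > 0" by simp
  then obtain x where "poly (pCons 1 s) x = 0" using alg_closed_imp_poly_has_root by blast
  moreover have "poly s x = 0" using assms(2)[of x] by (auto simp: s_def)
  ultimately show False by simp
qed

lemma poly_eq_nonzero:
  fixes a b :: "'k::alg_closed_field poly"
  assumes "\<And>x. x \<noteq> 0 \<Longrightarrow> poly a x = poly b x"
  shows "a = b"
  by (rule poly_eq_off[of "[:0, 1:]"]) (use assms in auto)

lemma polynomial_functions_poly:
  assumes "f \<in> polynomial_functions"
  shows "\<exists>q. \<forall>t. f (mat2 (poly a t) (poly b t) (poly c t) (poly d t)) = poly q t"
  using assms
proof (induction rule: polynomial_functions.induct)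
  case (const c)
  show ?case by (rule exI[of _ "[:c:]"]) simp
next
  case (coord i j)
  then have "i = 0 \<or> i = Suc 0" "j = 0 \<or> j = Suc 0" by auto
  then show ?case by (elim disjE) auto
next
  case (add f g)
  then obtain q q' where "\<forall>t. f (mat2 (poly a t) (poly b t) (poly c t) (poly d t)) = poly q t"
    "\<forall>t. g (mat2 (poly a t) (poly b t) (poly c t) (poly d t)) = poly q' t" by blast
  then show ?case by (intro exI[of _ "q + q'"]) simp
next
  case (mult f g)
  then obtain q q' where "\<forall>t. f (mat2 (poly a t) (poly b t) (poly c t) (poly d t)) = poly q t"
    "\<forall>t. g (mat2 (poly a t) (poly b t) (poly c t) (poly d t)) = poly q' t" by blast
  then show ?case by (intro exI[of _ "q * q'"]) simp
qed

lemma polynomial_functions_torus: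
  assumes "f \<in> polynomial_functions"
  shows "\<exists>q M. \<forall>t. t \<noteq> 0 \<longrightarrow> f (mat2 t 0 0 (inverse t)) * t ^ M = poly q t"
  using assms
proof (induction rule: polynomial_functions.induct)
  case (const c)
  show ?case by (rule exI[of _ "[:c:]"], rule exI[of _ 0]) simp
next
  case (coord i j)
  then consider "i = 0" "j = 0" | "i = 0" "j = Suc 0" | "i = Suc 0" "j = 0" | "i = Suc 0" "j = Suc 0" by force
  then show ?case
  proof cases
    case 1 then show ?thesis by (intro exI[of _ "[:0, 1:]"] exI[of _ 0]) simp
  next
    case 2 then show ?thesis by (intro exI[of _ "0"] exI[of _ 0]) simp
  next
    case 3 then show ?thesis by (intro exI[of _ "0"] exI[of _ 0]) simp
  next
    case 4 then show ?thesis by (intro exI[of _ "1"] exI[of _ 1]) simp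
  qed
next
  case (add f g)
  then obtain q M q' M' where q: "\<forall>t. t \<noteq> 0 \<longrightarrow> f (mat2 t 0 0 (inverse t)) * t ^ M = poly q t"
    and q': "\<forall>t. t \<noteq> 0 \<longrightarrow> g (mat2 t 0 0 (inverse t)) * t ^ M' = poly q' t" by blast
  have "(f (mat2 t 0 0 (inverse t)) + g (mat2 t 0 0 (inverse t))) * t ^ (M + M')
      = poly (q * monom 1 M' + q' * monom 1 M) t" if "t \<noteq> 0" for t
    using q[rule_format, OF that, symmetric] q'[rule_format, OF that, symmetric]
    by (simp add: poly_monom power_add algebra_simps)
  then show ?case by blast
next
  case (mult f g)
  then obtain q M q' M' where q: "\<forall>t. t \<noteq> 0 \<longrightarrow> f (mat2 t 0 0 (inverse t)) * t ^ M = poly q t"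
    and q': "\<forall>t. t \<noteq> 0 \<longrightarrow> g (mat2 t 0 0 (inverse t)) * t ^ M' = poly q' t" by blast
  have "(f (mat2 t 0 0 (inverse t)) * g (mat2 t 0 0 (inverse t))) * t ^ (M + M') = poly (q * q') t" if "t \<noteq> 0" for t
    using q[rule_format, OF that, symmetric] q'[rule_format, OF that, symmetric]
    by (simp add: power_add mult_ac)
  then show ?case by blast
qed

lemma polynomial_functions_transpose:
  assumes "f \<in> polynomial_functions"
  shows "\<exists>f'\<in>polynomial_functions. \<forall>A\<in>carrier_mat 2 2. f A\<^sup>T = f' A"
  using assms
proof (induction rule: polynomial_functions.induct)
  case (const c)
  show ?case by (rule bexI[OF _ polynomial_functions.const[of c]]) simp
next
  case (coord i j)
  show ?case by (rule bexI[OF _ polynomial_functions.coord[OF coord(2,1)]]) (use coord in auto)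
next
  case (add f g)
  then obtain f' g' where *: "f' \<in> polynomial_functions" "g' \<in> polynomial_functions"
    "\<forall>A\<in>carrier_mat 2 2. f A\<^sup>T = f' A" "\<forall>A\<in>carrier_mat 2 2. g A\<^sup>T = g' A" by blast
  show ?case by (rule bexI[OF _ polynomial_functions.add[OF *(1,2)]]) (use * in auto)
next
  case (mult f g)
  then obtain f' g' where *: "f' \<in> polynomial_functions" "g' \<in> polynomial_functions"
    "\<forall>A\<in>carrier_mat 2 2. f A\<^sup>T = f' A" "\<forall>A\<in>carrier_mat 2 2. g A\<^sup>T = g' A" by blast
  show ?case by (rule bexI[OF _ polynomial_functions.mult[OF *(1,2)]]) (use * in auto)
qed

lemma mat_mult_vec_index:
  "A \<in> carrier_mat m n \<Longrightarrow> v \<in> carrier_vec n \<Longrightarrow> x < m \<Longrightarrow> (A *\<^sub>v v) $ x = (\<Sum>z<n. A $$ (x, z) * v $ z)"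
  by (auto simp: scalar_prod_def atLeast0LessThan)

lemma mat_mult_index:
  "A \<in> carrier_mat m n \<Longrightarrow> B \<in> carrier_mat n l \<Longrightarrow> x < m \<Longrightarrow> y < l \<Longrightarrow> (A * B) $$ (x, y) = (\<Sum>z<n. A $$ (x, z) * B $$ (z, y))"
  by (auto simp: scalar_prod_def atLeast0LessThan)

lemma rational_rep_mult:
  assumes "rational_rep V" "A \<in> carrier SL2" "B \<in> carrier SL2"
  shows "act V (A * B) = act V A * act V B"
  using representation_mult[of SL2 V A B] assms by (simp add: rational_rep_def SL2_mult)

lemma rational_rep_carrier:
  assumes "rational_rep V" "A \<in> carrier SL2"
  shows "act V A \<in> carrier_mat (deg V) (deg V)"
  using representation_carrier[of SL2 V A] assms by (simp add: rational_rep_def)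

lemma rational_rep_one: "rational_rep V \<Longrightarrow> act V (1\<^sub>m 2) = 1\<^sub>m (deg V)"
  using representation_one[OF group_SL2, of V] by (simp add: rational_rep_def SL2_one)

text \<open>Row vectors of \<open>V\<close> become column vectors, so that results on vectors also apply to functionals.\<close>

definition transpose_rep :: "('k::alg_closed_field mat, 'k) rep \<Rightarrow> ('k mat, 'k) rep" where
  "transpose_rep V = Rep (deg V) (\<lambda>A. (act V A\<^sup>T)\<^sup>T)"

lemma transpose_SL2: "A \<in> carrier SL2 \<Longrightarrow> A\<^sup>T \<in> carrier SL2"
  by (auto simp: SL2_iff mult.commute)

lemma rational_transpose_rep:
  assumes V: "rational_rep V"
  shows "rational_rep (transpose_rep V)"
  unfolding rational_rep_def
proof (intro conjI allI impI)
  note c = rational_rep_carrier[OF V transpose_SL2]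
  show "representation SL2 (transpose_rep V)"
  proof (rule representationI[OF group_SL2])
    show "act (transpose_rep V) g \<in> carrier_mat (deg (transpose_rep V)) (deg (transpose_rep V))" if "g \<in> carrier SL2" for g
      using c[OF that] by (simp add: transpose_rep_def)
    show "act (transpose_rep V) (g \<otimes>\<^bsub>SL2\<^esub> h) = act (transpose_rep V) g * act (transpose_rep V) h"
      if g: "g \<in> carrier SL2" and h: "h \<in> carrier SL2" for g h
    proof -
      have "(g * h)\<^sup>T = h\<^sup>T * g\<^sup>T" by (rule transpose_mult[of _ 2 2 _ 2]) (use g h in \<open>auto simp: SL2_iff\<close>)
      then show ?thesis
        using rational_rep_mult[OF V transpose_SL2[OF h] transpose_SL2[OF g]] transpose_mult[OF c[OF h] c[OF g]]
        by (simp add: transpose_rep_def SL2_mult)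
    qed
    show "act (transpose_rep V) \<one>\<^bsub>SL2\<^esub> = 1\<^sub>m (deg (transpose_rep V))"
      using rational_rep_one[OF V] by (simp add: transpose_rep_def SL2_one)
  qed
  fix i j assume "i < deg (transpose_rep V)" "j < deg (transpose_rep V)"
  then have ij: "i < deg V" "j < deg V" by (simp_all add: transpose_rep_def)
  then obtain f where f: "f \<in> polynomial_functions" "\<forall>A\<in>carrier SL2. act V A $$ (j, i) = f A"
    using V unfolding rational_rep_def by blast
  obtain f' where f': "f' \<in> polynomial_functions" "\<forall>A\<in>carrier_mat 2 2. f A\<^sup>T = f' A"
    using polynomial_functions_transpose[OF f(1)] by blast
  show "\<exists>f\<in>polynomial_functions. \<forall>A\<in>carrier SL2. act (transpose_rep V) A $$ (i, j) = f A"
  proof (rule bexI[OF _ f'(1)], rule ballI)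
    fix A :: "'a mat" assume A: "A \<in> carrier SL2"
    then have "A \<in> carrier_mat 2 2" by (simp add: SL2_iff)
    then show "act (transpose_rep V) A $$ (i, j) = f' A"
      using f(2) f'(2) transpose_SL2[OF A] c[OF A] ij by (simp add: transpose_rep_def)
  qed
qed

lemma torus_SL2: "t \<noteq> 0 \<Longrightarrow> mat2 t 0 0 (inverse t) \<in> carrier (SL2 :: 'k::field mat monoid)"
  by (simp add: mat2_SL2)

text \<open>Expanding the torus action into Laurent series, the coefficient at \<open>m\<close> projects to the vectors of weight \<open>m\<close>.\<close>

lemma weight_pairing:
  fixes V :: "('k::alg_closed_field mat, 'k) rep"
  assumes V: "rational_rep V"
    and \<eta>: "\<And>t z. t \<noteq> 0 \<Longrightarrow> z < deg V \<Longrightarrow> (\<Sum>x<deg V. \<eta> $ x * act V (mat2 t 0 0 (inverse t)) $$ (x, z)) = t powi m * \<eta> $ z"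
  obtains w where "w \<in> carrier_vec (deg V)"
    "\<And>t. t \<noteq> 0 \<Longrightarrow> act V (mat2 t 0 0 (inverse t)) *\<^sub>v w = t powi m \<cdot>\<^sub>v w"
    "(\<Sum>x<deg V. \<eta> $ x * w $ x) = (\<Sum>x<deg V. \<eta> $ x * y $ x)"
proof -
  define N where "N = deg V"
  define T where "T t = act V (mat2 t 0 0 (inverse t))" for t
  have Tc: "T t \<in> carrier_mat N N" if "t \<noteq> 0" for t
    unfolding T_def N_def by (rule rational_rep_carrier[OF V torus_SL2[OF that]])
  have TT: "T (s * r) = T s * T r" if "s \<noteq> 0" "r \<noteq> 0" for s r
  proof -
    have "mat2 s 0 0 (inverse s) * mat2 r 0 0 (inverse r) = mat2 (s * r) 0 0 (inverse (s * r))"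
      by (simp add: mat2_mult)
    then show ?thesis
      unfolding T_def using rational_rep_mult[OF V torus_SL2[OF that(1)] torus_SL2[OF that(2)]] by simp
  qed
  have "\<forall>\<^sub>F M in sequentially. \<exists>q. \<forall>t. t \<noteq> 0 \<longrightarrow> T t $$ (x, z) * t ^ M = poly q t" if xz: "x < N" "z < N" for x z
  proof -
    obtain f where f: "f \<in> polynomial_functions" "\<forall>A\<in>carrier SL2. act V A $$ (x, z) = f A"
      using V xz unfolding rational_rep_def N_def by blast
    obtain q M where qM: "\<forall>t. t \<noteq> 0 \<longrightarrow> f (mat2 t 0 0 (inverse t)) * t ^ M = poly q t"
      using polynomial_functions_torus[OF f(1)] by blast
    show ?thesis
    proof (rule eventually_sequentiallyI[of M])
      fix M' assume "M \<le> M'"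
      then have M': "M' = M + (M' - M)" by simp
      have "T t $$ (x, z) * t ^ M' = poly (q * monom 1 (M' - M)) t" if "t \<noteq> 0" for t
        using qM f(2) torus_SL2[OF that] that by (subst M') (simp add: T_def power_add poly_monom flip: mult.assoc)
      then show "\<exists>q. \<forall>t. t \<noteq> 0 \<longrightarrow> T t $$ (x, z) * t ^ M' = poly q t" by blast
    qed
  qed
  then have "\<forall>\<^sub>F M in sequentially. \<forall>x\<in>{..<N}. \<forall>z\<in>{..<N}. \<exists>q. \<forall>t. t \<noteq> 0 \<longrightarrow> T t $$ (x, z) * t ^ M = poly q t"
    by (intro eventually_ball_finite ballI) auto
  \<comment> \<open>\<open>M\<close> clears all denominators of the Laurent polynomials at once, and
    is also large enough to make \<open>m + M\<close> a natural number.\<close>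
  moreover have "\<forall>\<^sub>F M in sequentially. nat \<bar>m\<bar> \<le> M" by (rule eventually_ge_at_top)
  ultimately have "\<forall>\<^sub>F M in sequentially. (\<forall>x\<in>{..<N}. \<forall>z\<in>{..<N}. \<exists>q. \<forall>t. t \<noteq> 0 \<longrightarrow> T t $$ (x, z) * t ^ M = poly q t) \<and> nat \<bar>m\<bar> \<le> M"
    by (rule eventually_conj)
  then obtain M where M1: "\<forall>x\<in>{..<N}. \<forall>z\<in>{..<N}. \<exists>q. \<forall>t. t \<noteq> 0 \<longrightarrow> T t $$ (x, z) * t ^ M = poly q t" and M2: "nat \<bar>m\<bar> \<le> M"
    by (auto simp: eventually_sequentially)
  define q where "q x z = (SOME q. \<forall>t. t \<noteq> 0 \<longrightarrow> T t $$ (x, z) * t ^ M = poly q t)" for x z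
  have q: "T t $$ (x, z) * t ^ M = poly (q x z) t" if "x < N" "z < N" "t \<noteq> 0" for x z t
  proof -
    have "\<exists>q. \<forall>t. t \<noteq> 0 \<longrightarrow> T t $$ (x, z) * t ^ M = poly q t" using M1 that(1,2) by blast
    from someI_ex[OF this] show ?thesis unfolding q_def[symmetric] using that(3) by blast
  qed
  define K where "K = nat (m + int M)"
  have K: "int K = m + int M" using M2 by (simp add: K_def)
  have tK: "t powi m * t ^ M = t ^ K" if "t \<noteq> 0" for t :: 'k
    using that K power_int_add[of t m "int M"] by (metis power_int_of_nat)
  \<comment> \<open>The component of \<open>y\<close> of weight \<open>m\<close>: the coefficient of
    \<open>t ^ K\<close> in \<open>t ^ M * T t\<close> applied to \<open>y\<close>.\<close>
  define w where "w = vec N (\<lambda>x. \<Sum>z<N. coeff (q x z) K * y $ z)"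
  \<comment> \<open>In \<open>T s * T r = T (s * r)\<close> the coefficients of \<open>r ^ K\<close>
    are compared after clearing denominators.\<close>
  have eig: "(\<Sum>x'<N. T s $$ (x, x') * coeff (q x' z) K) = s powi m * coeff (q x z) K" if s: "s \<noteq> 0" and xz: "x < N" "z < N" for s x z
  proof -
    have "(\<Sum>x'<N. Polynomial.smult (T s $$ (x, x')) (q x' z)) = Polynomial.smult (inverse (s ^ M)) (pcompose (q x z) [:0, s:])"
    proof (rule poly_eq_nonzero)
      fix r :: 'k assume r: "r \<noteq> 0"
      have "(\<Sum>x'<N. T s $$ (x, x') * poly (q x' z) r) = (\<Sum>x'<N. T s $$ (x, x') * T r $$ (x', z)) * r ^ M"
        unfolding sum_distrib_right using q r xz by (intro sum.cong refl) (simp add: mult.assoc)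
      also have "(\<Sum>x'<N. T s $$ (x, x') * T r $$ (x', z)) = T (s * r) $$ (x, z)"
        unfolding TT[OF s r] using mat_mult_index[OF Tc[OF s] Tc[OF r] xz] by simp
      also have "T (s * r) $$ (x, z) * r ^ M = inverse (s ^ M) * (T (s * r) $$ (x, z) * (s * r) ^ M)"
        using s by (simp add: power_mult_distrib)
      also have "T (s * r) $$ (x, z) * (s * r) ^ M = poly (q x z) (s * r)" using q xz r s by simp
      finally show "poly (\<Sum>x'<N. Polynomial.smult (T s $$ (x, x')) (q x' z)) r
          = poly (Polynomial.smult (inverse (s ^ M)) (pcompose (q x z) [:0, s:])) r"
        by (simp add: poly_sum poly_pcompose mult.commute[of r])
    qed
    from arg_cong[OF this, of "\<lambda>P. coeff P K"]
    have "(\<Sum>x'<N. T s $$ (x, x') * coeff (q x' z) K) = inverse (s ^ M) * (s ^ K * coeff (q x z) K)"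
      by (simp add: coeff_sum coeff_pcompose_linear)
    also have "\<dots> = s powi m * coeff (q x z) K" using tK[OF s] s by (simp add: field_simps flip: tK[OF s])
    finally show ?thesis .
  qed
  have pair: "(\<Sum>x<N. \<eta> $ x * coeff (q x z) K) = \<eta> $ z" if z: "z < N" for z
  proof -
    have "(\<Sum>x<N. Polynomial.smult (\<eta> $ x) (q x z)) = monom (\<eta> $ z) K"
    proof (rule poly_eq_nonzero)
      fix r :: 'k assume r: "r \<noteq> 0"
      have "(\<Sum>x<N. \<eta> $ x * poly (q x z) r) = (\<Sum>x<N. \<eta> $ x * T r $$ (x, z)) * r ^ M"
        unfolding sum_distrib_right using q r z by (intro sum.cong refl) (simp add: mult.assoc)
      also have "\<dots> = \<eta> $ z * r ^ K" using \<eta>[OF r z[unfolded N_def]] tK[OF r] unfolding T_def N_def by (simp add: mult_ac)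
      finally show "poly (\<Sum>x<N. Polynomial.smult (\<eta> $ x) (q x z)) r = poly (monom (\<eta> $ z) K) r"
        by (simp add: poly_sum poly_monom)
    qed
    from arg_cong[OF this, of "\<lambda>P. coeff P K"] show ?thesis by (simp add: coeff_sum)
  qed
  show thesis
  proof (rule that[of w])
    show w: "w \<in> carrier_vec (deg V)" by (simp add: w_def N_def)
    then have wN: "w \<in> carrier_vec N" by (simp add: N_def)
    fix t :: 'k assume t: "t \<noteq> 0"
    have "T t *\<^sub>v w = t powi m \<cdot>\<^sub>v w"
    proof (rule eq_vecI)
      fix x assume "x < dim_vec (t powi m \<cdot>\<^sub>v w)"
      then have x: "x < N" using wN by simp
      have "(T t *\<^sub>v w) $ x = (\<Sum>x'<N. T t $$ (x, x') * (\<Sum>z<N. coeff (q x' z) K * y $ z))"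
        using mat_mult_vec_index[OF Tc[OF t] wN x] by (simp add: w_def)
      also have "\<dots> = (\<Sum>z<N. (\<Sum>x'<N. T t $$ (x, x') * coeff (q x' z) K) * y $ z)"
        unfolding sum_distrib_left sum_distrib_right by (subst sum.swap) (simp add: mult.assoc)
      also have "\<dots> = t powi m * (\<Sum>z<N. coeff (q x z) K * y $ z)"
        using eig[OF t x] by (simp add: sum_distrib_left mult.assoc)
      finally show "(T t *\<^sub>v w) $ x = (t powi m \<cdot>\<^sub>v w) $ x" using x by (simp add: w_def)
    qed (use Tc[OF t] wN in auto)
    then show "act V (mat2 t 0 0 (inverse t)) *\<^sub>v w = t powi m \<cdot>\<^sub>v w" by (simp add: T_def)
  next
    have "(\<Sum>x<N. \<eta> $ x * w $ x) = (\<Sum>z<N. (\<Sum>x<N. \<eta> $ x * coeff (q x z) K) * y $ z)"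
      unfolding sum_distrib_right by (subst sum.swap) (simp add: w_def sum_distrib_left mult.assoc)
    then show "(\<Sum>x<deg V. \<eta> $ x * w $ x) = (\<Sum>x<deg V. \<eta> $ x * y $ x)"
      unfolding N_def[symmetric] using pair by simp
  qed
qed

lemma nabla_entries:
  fixes t :: "'k::field"
  assumes "j < Suc n"
  shows "nabla n (mat2 1 t 0 1) $$ (0, j) = t ^ j"
    "nabla n (mat2 1 0 t 1) $$ (0, j) = (if j = 0 then 1 else 0)"
    "nabla n (mat2 1 0 t 1) $$ (j, 0) = of_nat (n choose j) * t ^ j"
proof -
  show "nabla n (mat2 1 t 0 1) $$ (0, j) = t ^ j" "nabla n (mat2 1 0 t 1) $$ (0, j) = (if j = 0 then 1 else 0)"
    using assms by (simp_all add: nabla_def flip: poly_0_coeff_0)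
  have "[:0, 1:] ^ 0 = (1 :: 'k poly)" by simp
  then show "nabla n (mat2 1 0 t 1) $$ (j, 0) = of_nat (n choose j) * t ^ j"
    using assms by (simp add: nabla_def coeff_linear_poly_power)
qed

lemma poly_bounded_sum:
  fixes p :: "'k::field poly"
  shows "degree p \<le> n \<Longrightarrow> poly p x = (\<Sum>i\<le>n. coeff p i * x ^ i)"
proof -
  assume "degree p \<le> n"
  then have "poly p x = poly (\<Sum>i\<le>n. monom (coeff p i) i) x" by (simp only: poly_as_sum_of_monoms')
  then show ?thesis by (simp only: poly_sum poly_monom)
qed

text \<open>The columns of \<open>F\<close> are the coefficients in \<open>t\<close> of the lower
  unipotent matrix with entry \<open>t\<close> applied to \<open>v\<close>. The action
  \<open>g \<mapsto> (nabla n g\<^sup>T)\<^sup>T\<close> on the source is a form of the Weyl module,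
  whose first basis vector goes to \<open>v\<close>.\<close>

lemma highest_weight_map:
  fixes V :: "('k::alg_closed_field mat, 'k) rep"
  assumes V: "rational_rep V" and v: "v \<in> carrier_vec (deg V)"
    and wt: "\<And>t. t \<noteq> 0 \<Longrightarrow> act V (mat2 t 0 0 (inverse t)) *\<^sub>v v = t powi int n \<cdot>\<^sub>v v"
    and top: "\<And>i e. i > 0 \<Longrightarrow> e \<in> carrier_vec (deg V) \<Longrightarrow>
      (\<And>t. t \<noteq> 0 \<Longrightarrow> act V (mat2 t 0 0 (inverse t)) *\<^sub>v e = t powi int (n + 2 * i) \<cdot>\<^sub>v e) \<Longrightarrow> e = 0\<^sub>v (deg V)"
  obtains F where "F \<in> carrier_mat (deg V) (Suc n)" "\<And>x. x < deg V \<Longrightarrow> F $$ (x, 0) = v $ x"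
    "\<And>g. g \<in> carrier SL2 \<Longrightarrow> act V g * F = F * (nabla n g\<^sup>T)\<^sup>T"
proof -
  define N where "N = deg V"
  note v = v[folded N_def]
  have c: "act V g \<in> carrier_mat N N" if "g \<in> carrier SL2" for g
    using rational_rep_carrier[OF V that] by (simp add: N_def)
  have mv: "act V (g * h) *\<^sub>v v = act V g *\<^sub>v (act V h *\<^sub>v v)" if "g \<in> carrier SL2" "h \<in> carrier SL2" for g h
    unfolding rational_rep_mult[OF V that] by (rule assoc_mult_mat_vec[OF c[OF that(1)] c[OF that(2)] v])
  have sm: "(act V g *\<^sub>v (k \<cdot>\<^sub>v v)) $ x = k * (act V g *\<^sub>v v) $ x" if "g \<in> carrier SL2" "x < N" for g k x
    using mult_mat_vec[OF c[OF that(1)] v, of k] carrier_matD[OF c[OF that(1)]] that(2) by simp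
  have curve: "\<exists>y. \<forall>x<N. \<forall>t. (act V (mat2 (poly a t) (poly b t) (poly c t) (poly d t)) *\<^sub>v v) $ x = poly (y x) t"
    if det: "\<And>t. poly a t * poly d t - poly b t * poly c t = 1" for a b c d
  proof -
    let ?g = "\<lambda>t. mat2 (poly a t) (poly b t) (poly c t) (poly d t)"
    have g: "?g t \<in> carrier SL2" for t using det[of t] by (simp add: mat2_SL2)
    have ex: "\<exists>q. \<forall>t. act V (?g t) $$ (x, z) = poly q t" if xz: "x < N" "z < N" for x z
    proof -
      obtain f where f: "f \<in> polynomial_functions" "\<forall>A\<in>carrier SL2. act V A $$ (x, z) = f A"
        using V xz unfolding rational_rep_def N_def by blast
      obtain q where "\<forall>t. f (?g t) = poly q t" using polynomial_functions_poly[OF f(1)] by blast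
      with f(2) g show ?thesis by (intro exI[of _ q]) simp
    qed
    define q where "q x z = (SOME q. \<forall>t. act V (?g t) $$ (x, z) = poly q t)" for x z
    have q: "act V (?g t) $$ (x, z) = poly (q x z) t" if "x < N" "z < N" for x z t
      using someI_ex[OF ex[OF that]] unfolding q_def[symmetric] by blast
    have "(act V (?g t) *\<^sub>v v) $ x = poly (\<Sum>z<N. Polynomial.smult (v $ z) (q x z)) t" if "x < N" for x t
      using mat_mult_vec_index[OF c[OF g] v that] q that by (simp add: poly_sum mult.commute)
    then show ?thesis by (intro exI[of _ "\<lambda>x. \<Sum>z<N. Polynomial.smult (v $ z) (q x z)"] allI impI) simp
  qed
  \<comment> \<open>Conjugation by the torus element \<open>s\<close> scales the upper entry
    \<open>t\<close> by \<open>s\<^sup>2\<close>, so the coefficient of \<open>t ^ i\<close> in the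
    orbit of \<open>v\<close> has weight \<open>n + 2 * i\<close>. By \<open>top\<close> only the
    constant coefficient survives.\<close>
  have U_inv: "act V (mat2 1 t 0 1) *\<^sub>v v = v" for t
  proof -
    obtain y where y: "\<And>x t. x < N \<Longrightarrow> (act V (mat2 1 t 0 1) *\<^sub>v v) $ x = poly (y x) t"
      using curve[of 1 1 "[:0, 1:]" 0] by auto
    have U: "mat2 1 t 0 1 \<in> carrier SL2" for t :: 'k by (simp add: mat2_SL2)
    have e0: "vec N (\<lambda>x. coeff (y x) i) = 0\<^sub>v (deg V)" if i: "i > 0" for i
    proof (rule top[OF i])
      fix s :: 'k assume s: "s \<noteq> 0"
      let ?T = "mat2 s 0 0 (inverse s)"
      note T = torus_SL2[OF s]
      have comm: "?T * mat2 1 t 0 1 = mat2 1 (s ^ 2 * t) 0 1 * ?T" for t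
      proof -
        have st: "s ^ 2 * t * inverse s = s * t" using s by (simp add: power2_eq_square)
        show ?thesis by (simp add: mat2_mult st)
      qed
      have P: "(\<Sum>z<N. Polynomial.smult (act V ?T $$ (x, z)) (y z)) = Polynomial.smult (s ^ n) (pcompose (y x) [:0, s ^ 2:])"
        if x: "x < N" for x
      proof (rule poly_eq_nonzero)
        fix t :: 'k
        have "poly (\<Sum>z<N. Polynomial.smult (act V ?T $$ (x, z)) (y z)) t = (act V ?T *\<^sub>v (act V (mat2 1 t 0 1) *\<^sub>v v)) $ x"
          using mat_mult_vec_index[OF c[OF T] mult_mat_vec_carrier[OF c[OF U] v] x] y by (simp add: poly_sum)
        also have "\<dots> = (act V (mat2 1 (s ^ 2 * t) 0 1) *\<^sub>v (s ^ n \<cdot>\<^sub>v v)) $ x"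
          unfolding mv[OF T U, symmetric] comm mv[OF U T] wt[OF s] by simp
        also have "\<dots> = s ^ n * poly (y x) (s ^ 2 * t)"
          unfolding sm[OF U x] y[OF x] ..
        finally show "poly (\<Sum>z<N. Polynomial.smult (act V ?T $$ (x, z)) (y z)) t
          = poly (Polynomial.smult (s ^ n) (pcompose (y x) [:0, s ^ 2:])) t" by (simp add: poly_pcompose mult.commute)
      qed
      have "act V ?T *\<^sub>v vec N (\<lambda>x. coeff (y x) i) = s ^ (n + 2 * i) \<cdot>\<^sub>v vec N (\<lambda>x. coeff (y x) i)"
      proof (rule eq_vecI)
        fix x assume "x < dim_vec (s ^ (n + 2 * i) \<cdot>\<^sub>v vec N (\<lambda>x. coeff (y x) i))"
        then have x: "x < N" by simp
        have "(act V ?T *\<^sub>v vec N (\<lambda>x. coeff (y x) i)) $ x = (\<Sum>z<N. act V ?T $$ (x, z) * coeff (y z) i)"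
          using mat_mult_vec_index[OF c[OF T] _ x] by simp
        also have "\<dots> = s ^ n * ((s ^ 2) ^ i * coeff (y x) i)"
          using arg_cong[OF P[OF x], of "\<lambda>p. coeff p i"] by (simp add: coeff_sum coeff_pcompose_linear)
        finally show "(act V ?T *\<^sub>v vec N (\<lambda>x. coeff (y x) i)) $ x = (s ^ (n + 2 * i) \<cdot>\<^sub>v vec N (\<lambda>x. coeff (y x) i)) $ x"
          using x by (simp add: power_add power_mult)
      qed (use c[OF T] in simp)
      then show "act V ?T *\<^sub>v vec N (\<lambda>x. coeff (y x) i) = s powi int (n + 2 * i) \<cdot>\<^sub>v vec N (\<lambda>x. coeff (y x) i)"
        unfolding power_int_of_nat .
    qed (simp add: N_def)
    have z: "coeff (y x) i = 0" if "i > 0" "x < N" for i x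
      using that(2) arg_cong[OF e0[OF that(1)], of "\<lambda>u. u $ x"] by (simp add: N_def)
    have yc: "poly (y x) t = poly (y x) 0" if "x < N" for x
      using poly_bounded_sum[of "y x" 0] degree_le[of 0 "y x"] z that by simp
    show ?thesis
    proof (rule eq_vecI)
      fix x assume "x < dim_vec v"
      then have x: "x < N" using v by simp
      show "(act V (mat2 1 t 0 1) *\<^sub>v v) $ x = v $ x"
        unfolding y[OF x] yc[OF x] unfolding y[OF x, symmetric] mat2_one rational_rep_one[OF V] using v by (simp add: N_def)
    qed (use c[OF U] v in auto)
  qed
  obtain y where y: "\<And>x t. x < N \<Longrightarrow> (act V (mat2 1 0 t 1) *\<^sub>v v) $ x = poly (y x) t"
    using curve[of 1 1 0 "[:0, 1:]"] by auto
  have L: "mat2 1 0 t 1 \<in> carrier SL2" and U: "mat2 1 t 0 1 \<in> carrier SL2" for t :: 'k by (simp_all add: mat2_SL2)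
  \<comment> \<open>Gauss decomposition of a matrix with \<open>a \<noteq> 0\<close>: the upper
    factor fixes \<open>v\<close>, the torus scales it by \<open>a ^ n\<close>, and the lower factor
    is described by \<open>y\<close>.\<close>
  have big: "(act V (mat2 a b c' d) *\<^sub>v v) $ x = a ^ n * poly (y x) (c' / a)"
    if "a * d - b * c' = 1" and a: "a \<noteq> 0" and x: "x < N" for a b c' d x
  proof -
    have eq: "mat2 a b c' d = mat2 1 0 (c' / a) 1 * (mat2 a 0 0 (inverse a) * mat2 1 (b / a) 0 1)"
    proof -
      have d: "d = (1 + b * c') / a" using that by (simp add: field_simps)
      show ?thesis unfolding d using a by (simp add: mat2_mult field_simps)
    qed
    have TU: "mat2 a 0 0 (inverse a) * mat2 1 (b / a) 0 1 \<in> carrier SL2"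
      using a by (simp add: mat2_mult mat2_SL2)
    show ?thesis
      unfolding eq mv[OF L TU] mv[OF torus_SL2[OF a] U] U_inv wt[OF a] sm[OF L x] y[OF x] by simp
  qed
  \<comment> \<open>Along the matrices with first column \<open>(s, 1)\<close> the vector is
    polynomial in \<open>s\<close>, but for \<open>s \<noteq> 0\<close> it has entries
    \<open>s ^ n * poly (y x) (1 / s)\<close>. A degree above \<open>n\<close> would produce a pole
    at \<open>0\<close>.\<close>
  have deg: "degree (y x) \<le> n" if x: "x < N" for x
  proof (rule ccontr)
    assume "\<not> degree (y x) \<le> n"
    then have D: "degree (y x) = n + (degree (y x) - n)" "degree (y x) - n > 0" by simp_all
    define k where "k = degree (y x) - n"
    obtain z where z: "\<And>x t. x < N \<Longrightarrow> (act V (mat2 t (- 1) 1 0) *\<^sub>v v) $ x = poly (z x) t"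
      using curve[of "[:0, 1:]" 0 "- 1" 1] by auto
    have "monom 1 k * z x = reflect_poly (y x)"
    proof (rule poly_eq_nonzero)
      fix s :: 'k assume s: "s \<noteq> 0"
      have "poly (z x) s = s ^ n * poly (y x) (inverse s)"
        using big[of s 0 "- 1" 1 x] z[OF x] s x by (simp add: field_simps)
      then show "poly (monom 1 k * z x) s = poly (reflect_poly (y x)) s"
        using D(1)[folded k_def] s by (simp add: poly_monom poly_reflect_poly_nz power_add)
    qed
    then have "poly (reflect_poly (y x)) 0 = poly (monom 1 k * z x) 0" by simp
    also have "\<dots> = 0" using D(2) by (simp add: poly_monom k_def)
    finally show False using D by simp
  qed
  define F where "F = mat N (Suc n) (\<lambda>(x, i). coeff (y x) i)"
  show thesis
  proof (rule that[of F])
    show "F \<in> carrier_mat (deg V) (Suc n)" by (simp add: F_def N_def)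
    then have Fc: "F \<in> carrier_mat N (Suc n)" by (simp add: N_def)
    show "F $$ (x, 0) = v $ x" if "x < deg V" for x
      using y[of x 0] that v unfolding mat2_one rational_rep_one[OF V] by (simp add: F_def N_def poly_0_coeff_0)
    fix g :: "'k mat" assume g: "g \<in> carrier SL2"
    define a b c' d where "a = g $$ (0, 0)" "b = g $$ (0, 1)" "c' = g $$ (1, 0)" "d = g $$ (1, 1)"
    have gc: "g \<in> carrier_mat 2 2" and det: "a * d - b * c' = 1" using g by (simp_all add: SL2_iff a_b_c'_d_def)
    have g_eq: "g = mat2 a b c' d" unfolding a_b_c'_d_def by (rule mat2_collapse[OF gc, symmetric])
    \<comment> \<open>The product of \<open>g\<close> with the lower unipotent matrix has first
      column \<open>(a + b * t, c' + d * t)\<close>, to which \<open>big\<close> applies wherever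
      \<open>a + b * t \<noteq> 0\<close>.\<close>
    have P: "(\<Sum>z<N. Polynomial.smult (act V g $$ (x, z)) (y z))
      = (\<Sum>i\<le>n. Polynomial.smult (coeff (y x) i) ([:a, b:] ^ (n - i) * [:c', d:] ^ i))" if x: "x < N" for x
    proof (rule poly_eq_off[of "[:a, b:]"])
      show "[:a, b:] \<noteq> 0" using det by auto
      fix t assume "poly [:a, b:] t \<noteq> 0"
      then have nz: "a + b * t \<noteq> 0" by (simp add: mult.commute)
      have "(a + b * t) * d - b * (c' + d * t) = a * d - b * c'" by (simp add: algebra_simps)
      then have det': "(a + b * t) * d - b * (c' + d * t) = 1" using det by simp
      have gL: "g * mat2 1 0 t 1 = mat2 (a + b * t) b (c' + d * t) d" unfolding g_eq by (simp add: mat2_mult)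
      have "poly (\<Sum>z<N. Polynomial.smult (act V g $$ (x, z)) (y z)) t = (act V (g * mat2 1 0 t 1) *\<^sub>v v) $ x"
        unfolding mv[OF g L] using mat_mult_vec_index[OF c[OF g] mult_mat_vec_carrier[OF c[OF L] v] x] y by (simp add: poly_sum)
      also have "\<dots> = (a + b * t) ^ n * poly (y x) ((c' + d * t) / (a + b * t))"
        unfolding gL by (rule big[OF det' nz x])
      also have "\<dots> = (\<Sum>i\<le>n. coeff (y x) i * ((a + b * t) ^ n * ((c' + d * t) / (a + b * t)) ^ i))"
        unfolding poly_bounded_sum[OF deg[OF x]] sum_distrib_left by (intro sum.cong refl) (simp add: mult_ac)
      also have "\<dots> = (\<Sum>i\<le>n. coeff (y x) i * ((a + b * t) ^ (n - i) * (c' + d * t) ^ i))"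
        using nz by (intro sum.cong refl) (simp add: power_divide power_diff)
      finally show "poly (\<Sum>z<N. Polynomial.smult (act V g $$ (x, z)) (y z)) t
        = poly (\<Sum>i\<le>n. Polynomial.smult (coeff (y x) i) ([:a, b:] ^ (n - i) * [:c', d:] ^ i)) t"
        by (simp add: poly_sum mult.commute[of t])
    qed
    show "act V g * F = F * (nabla n g\<^sup>T)\<^sup>T"
    proof (rule eq_matI)
      fix x j assume "x < dim_row (F * (nabla n g\<^sup>T)\<^sup>T)" "j < dim_col (F * (nabla n g\<^sup>T)\<^sup>T)"
      then have x: "x < N" and j: "j < Suc n" using carrier_matD[OF Fc] carrier_matD[OF nabla_carrier[of n "g\<^sup>T"]] by simp_all
      have "(act V g * F) $$ (x, j) = (\<Sum>z<N. act V g $$ (x, z) * coeff (y z) j)"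
        using mat_mult_index[OF c[OF g] Fc x j] j by (simp add: F_def)
      also have "\<dots> = (\<Sum>i\<le>n. coeff (y x) i * coeff ([:a, b:] ^ (n - i) * [:c', d:] ^ i) j)"
        using arg_cong[OF P[OF x], of "\<lambda>p. coeff p j"] by (simp add: coeff_sum)
      also have "\<dots> = (\<Sum>i<Suc n. F $$ (x, i) * (nabla n g\<^sup>T)\<^sup>T $$ (i, j))"
        unfolding lessThan_Suc_atMost using x j gc
        by (intro sum.cong refl) (simp add: F_def nabla_def a_b_c'_d_def)
      also have "\<dots> = (F * (nabla n g\<^sup>T)\<^sup>T) $$ (x, j)"
        by (rule mat_mult_index[OF Fc _ x j, symmetric]) simp
      finally show "(act V g * F) $$ (x, j) = (F * (nabla n g\<^sup>T)\<^sup>T) $$ (x, j)" .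
    qed (use c[OF g] Fc carrier_matD[OF nabla_carrier[of n "g\<^sup>T"]] in auto)
  qed
qed

lemma mult_unit_sum: "i < N \<Longrightarrow> (\<Sum>x<N. f x * (unit_vec N i :: 'k::field vec) $ x) = f i"
  by (simp add: unit_vec_def if_distrib[of "\<lambda>t. _ * t"] cong: if_cong)

text \<open>A vector of weight \<open>n\<close> gives a map \<open>F\<close> from the Weyl module to
  \<open>S\<close>, and a functional of weight \<open>n\<close> with value \<open>1\<close> on it
  gives a map \<open>B\<close> from \<open>S\<close> to \<open>\<nabla>(n)\<close>. Equivariance
  forces \<open>B * F\<close> to be the matrix of \<open>nabla_form\<close>, which is invertible. So
  \<open>\<nabla>(n)\<close> is a summand of the indecomposable \<open>S\<close>.\<close>

theorem highest_weight_dual_weyl: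
  fixes S :: "('k::alg_closed_field mat, 'k) rep"
  assumes S: "rational_rep S" and ind: "indecomposable_rep SL2 S" and hw: "highest_weight S (int n)"
    and binom: "\<And>i. i \<le> n \<Longrightarrow> of_nat (n choose i) \<noteq> (0 :: 'k)"
  shows "isomorphic_rep SL2 S (dual_weyl_module n)"
proof -
  define N where "N = deg S"
  define T where "T t = mat2 t 0 0 (inverse t)" for t :: 'k
  have TT: "(T t)\<^sup>T = T t" and TS: "t \<noteq> 0 \<Longrightarrow> T t \<in> carrier SL2" for t
    unfolding T_def by (auto simp: mat2_transpose intro!: torus_SL2)
  define S' where "S' = transpose_rep S"
  have S': "rational_rep S'" unfolding S'_def by (rule rational_transpose_rep[OF S])
  have dS': "deg S' = N" and aS': "act S' A = (act S A\<^sup>T)\<^sup>T" for A by (simp_all add: S'_def transpose_rep_def N_def)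
  have c: "act S g \<in> carrier_mat N N" if "g \<in> carrier SL2" for g
    using rational_rep_carrier[OF S that] by (simp add: N_def)
  have wtS: "m \<le> int n" if "is_weight S m" for m using hw that by (simp add: highest_weight_def)
  obtain v where v: "v \<in> carrier_vec N" and v0: "v \<noteq> 0\<^sub>v N"
    and wv: "\<And>t. t \<noteq> 0 \<Longrightarrow> act S (T t) *\<^sub>v v = t powi int n \<cdot>\<^sub>v v"
    using hw unfolding highest_weight_def is_weight_def N_def T_def by blast
  have nz_index: "\<exists>i<N. u $ i \<noteq> 0" if "u \<in> carrier_vec N" "u \<noteq> 0\<^sub>v N" for u :: "'k vec"
  proof (rule ccontr)
    assume "\<not> (\<exists>i<N. u $ i \<noteq> 0)"
    then have "u = 0\<^sub>v N" using that(1) by (intro eq_vecI) auto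
    with that(2) show False by simp
  qed
  have row: "(\<Sum>x<N. u $ x * act S (T t) $$ (x, z)) = (act S' (T t) *\<^sub>v u) $ z"
    and row': "(\<Sum>x<N. u $ x * act S' (T t) $$ (x, z)) = (act S (T t) *\<^sub>v u) $ z"
    if "u \<in> carrier_vec N" "t \<noteq> 0" "z < N" for u t z
  proof -
    have A: "act S (T t) \<in> carrier_mat N N" by (rule c[OF TS[OF that(2)]])
    then have A': "(act S (T t))\<^sup>T \<in> carrier_mat N N" by simp
    show "(\<Sum>x<N. u $ x * act S (T t) $$ (x, z)) = (act S' (T t) *\<^sub>v u) $ z"
      unfolding aS' TT mat_mult_vec_index[OF A' that(1,3)] using A that(3) by (intro sum.cong refl) (simp add: mult.commute)
    show "(\<Sum>x<N. u $ x * act S' (T t) $$ (x, z)) = (act S (T t) *\<^sub>v u) $ z"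
      unfolding aS' TT mat_mult_vec_index[OF A that(1,3)] using A that(3) by (intro sum.cong refl) (simp add: mult.commute)
  qed
  obtain i where i: "i < N" "v $ i \<noteq> 0" using nz_index[OF v v0] by blast
  \<comment> \<open>Here \<open>v\<close> plays the functional on the transposed module, and
    \<open>weight_pairing\<close> finds a vector of weight \<open>n\<close> on which it does not
    vanish.\<close>
  obtain w where w: "w \<in> carrier_vec N" and ww: "\<And>t. t \<noteq> 0 \<Longrightarrow> act S' (T t) *\<^sub>v w = t powi int n \<cdot>\<^sub>v w"
    and vw: "(\<Sum>x<N. v $ x * w $ x) = v $ i"
  proof (rule weight_pairing[OF S', of v "int n" "unit_vec N i", folded T_def, unfolded dS'])
    show "(\<Sum>x<N. v $ x * act S' (T t) $$ (x, z)) = t powi int n * v $ z" if "t \<noteq> 0" "z < N" for t z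
      unfolding row'[OF v that] wv[OF that(1)] using that v by simp
    fix w assume "w \<in> carrier_vec N" "\<And>t. t \<noteq> 0 \<Longrightarrow> act S' (T t) *\<^sub>v w = t powi int n \<cdot>\<^sub>v w"
      "(\<Sum>x<N. v $ x * w $ x) = (\<Sum>x<N. v $ x * unit_vec N i $ x)"
    then show thesis using that[of w] mult_unit_sum[OF i(1), of "\<lambda>x. v $ x"] by simp
  qed
  define \<xi> where "\<xi> = inverse (v $ i) \<cdot>\<^sub>v w"
  have \<xi>: "\<xi> \<in> carrier_vec N" using w by (simp add: \<xi>_def)
  have w\<xi>: "act S' (T t) *\<^sub>v \<xi> = t powi int n \<cdot>\<^sub>v \<xi>" if "t \<noteq> 0" for t
    unfolding \<xi>_def
    using mult_mat_vec[of "act S' (T t)" N N w] rational_rep_carrier[OF S' TS[OF that]] w ww[OF that]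
    by (simp add: dS' smult_smult_assoc mult.commute)
  have \<xi>v: "(\<Sum>x<N. \<xi> $ x * v $ x) = 1"
  proof -
    have "(\<Sum>x<N. \<xi> $ x * v $ x) = inverse (v $ i) * (\<Sum>x<N. v $ x * w $ x)"
      unfolding sum_distrib_left using w by (intro sum.cong refl) (simp add: \<xi>_def)
    then show ?thesis using vw i(2) by simp
  qed
  have gt: False if "j > 0" "is_weight S (int (n + 2 * j))" for j using wtS[OF that(2)] that(1) by simp
  obtain F where F: "F \<in> carrier_mat N (Suc n)" and F0: "\<And>x. x < N \<Longrightarrow> F $$ (x, 0) = v $ x"
    and Fg: "\<And>g. g \<in> carrier SL2 \<Longrightarrow> act S g * F = F * (nabla n g\<^sup>T)\<^sup>T"
  proof (rule highest_weight_map[OF S, folded N_def T_def, OF v])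
    show "act S (T t) *\<^sub>v v = t powi int n \<cdot>\<^sub>v v" if "t \<noteq> 0" for t by (rule wv[OF that])
    show "e = 0\<^sub>v N" if "j > 0" and e: "e \<in> carrier_vec N" "\<And>t. t \<noteq> 0 \<Longrightarrow> act S (T t) *\<^sub>v e = t powi int (n + 2 * j) \<cdot>\<^sub>v e" for j e
    proof (rule ccontr)
      assume "e \<noteq> 0\<^sub>v N"
      then have "is_weight S (int (n + 2 * j))" using e unfolding is_weight_def N_def T_def by blast
      with gt \<open>j > 0\<close> show False by blast
    qed
  qed (rule that; assumption)
  obtain F' where F': "F' \<in> carrier_mat N (Suc n)" and F'0: "\<And>x. x < N \<Longrightarrow> F' $$ (x, 0) = \<xi> $ x"
    and F'g: "\<And>g. g \<in> carrier SL2 \<Longrightarrow> act S' g * F' = F' * (nabla n g\<^sup>T)\<^sup>T"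
  proof (rule highest_weight_map[OF S', folded T_def, unfolded dS', OF \<xi>])
    show "act S' (T t) *\<^sub>v \<xi> = t powi int n \<cdot>\<^sub>v \<xi>" if "t \<noteq> 0" for t by (rule w\<xi>[OF that])
    \<comment> \<open>A functional of weight \<open>n + 2 * j\<close> pairs non-trivially with some
      vector of \<open>S\<close> of the same weight, which would exceed the highest weight.\<close>
    show "e = 0\<^sub>v N" if j: "j > 0" and e: "e \<in> carrier_vec N" "\<And>t. t \<noteq> 0 \<Longrightarrow> act S' (T t) *\<^sub>v e = t powi int (n + 2 * j) \<cdot>\<^sub>v e" for j e
    proof (rule ccontr)
      assume "e \<noteq> 0\<^sub>v N"
      then obtain i' where i': "i' < N" "e $ i' \<noteq> 0" using nz_index[OF e(1)] by blast
      show False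
      proof (rule weight_pairing[OF S, of e "int (n + 2 * j)" "unit_vec N i'", folded T_def N_def])
        show "(\<Sum>x<N. e $ x * act S (T t) $$ (x, z)) = t powi int (n + 2 * j) * e $ z" if "t \<noteq> 0" "z < N" for t z
          unfolding row[OF e(1) that] e(2)[OF that(1)] using that e(1) by simp
        fix w' assume w': "w' \<in> carrier_vec N" "\<And>t. t \<noteq> 0 \<Longrightarrow> act S (T t) *\<^sub>v w' = t powi int (n + 2 * j) \<cdot>\<^sub>v w'"
          "(\<Sum>x<N. e $ x * w' $ x) = (\<Sum>x<N. e $ x * unit_vec N i' $ x)"
        have "w' \<noteq> 0\<^sub>v N"
        proof
          assume "w' = 0\<^sub>v N"
          then show False using w'(3) mult_unit_sum[OF i'(1), of "\<lambda>x. e $ x"] i'(2) by simp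
        qed
        then have "is_weight S (int (n + 2 * j))" using w'(1,2) unfolding is_weight_def N_def T_def by blast
        with gt j show False by blast
      qed
    qed
  qed (rule that; assumption)
  define B where "B = F'\<^sup>T"
  have B: "B \<in> carrier_mat (Suc n) N" using F' by (simp add: B_def)
  have nc: "nabla n g \<in> carrier_mat (Suc n) (Suc n)" "(nabla n g)\<^sup>T \<in> carrier_mat (Suc n) (Suc n)" for g :: "'k mat" by simp_all
  have Bg: "B * act S g = nabla n g * B" if g: "g \<in> carrier SL2" for g
  proof -
    have "(act S g)\<^sup>T * F' = F' * (nabla n g)\<^sup>T" using F'g[OF transpose_SL2[OF g]] by (simp add: aS')
    from arg_cong[OF this, of transpose_mat] show ?thesis
      using transpose_mult[of "(act S g)\<^sup>T" N N F' "Suc n"] transpose_mult[OF F' nc(2)] c[OF g] F'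
      by (simp add: B_def)
  qed
  define X where "X = B * F"
  have X: "X \<in> carrier_mat (Suc n) (Suc n)" unfolding X_def by (rule mult_carrier_mat[OF B F])
  have Xg: "nabla n g * X = X * (nabla n g\<^sup>T)\<^sup>T" if g: "g \<in> carrier SL2" for g
  proof -
    have "nabla n g * X = B * act S g * F" unfolding X_def Bg[OF g] by (rule assoc_mult_mat[OF nc(1) B F, symmetric])
    also have "\<dots> = B * (F * (nabla n g\<^sup>T)\<^sup>T)" unfolding Fg[OF g, symmetric] by (rule assoc_mult_mat[OF B c[OF g] F])
    finally show ?thesis unfolding X_def by (simp add: assoc_mult_mat[OF B F nc(2)])
  qed
  have Xg': "(\<Sum>z<Suc n. nabla n g $$ (x, z) * X $$ (z, 0)) = (\<Sum>z<Suc n. X $$ (x, z) * nabla n g\<^sup>T $$ (0, z))"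
    if g: "g \<in> carrier SL2" and x: "x < Suc n" for g x
    using arg_cong[OF Xg[OF g], of "\<lambda>M. M $$ (x, 0)"] mat_mult_index[OF nc(1) X x, of 0 g] mat_mult_index[OF X nc(2) x, of 0 "g\<^sup>T"]
      carrier_matD[OF nc(1)[of "g\<^sup>T"]]
    by (simp del: sum.lessThan_Suc)
  have LT: "(mat2 1 t 0 1)\<^sup>T = mat2 1 0 t 1" "(mat2 1 0 t 1)\<^sup>T = mat2 1 t 0 1" for t :: 'k
    by (rule mat2_transpose)+
  have LU: "mat2 1 0 t 1 \<in> carrier SL2" "mat2 1 t 0 1 \<in> carrier SL2" for t :: 'k by (simp_all add: mat2_SL2)
  have X00: "X $$ (0, 0) = 1"
    using mat_mult_index[OF B F, of 0 0] F' F0 F'0 \<xi>v by (simp add: X_def B_def)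
  \<comment> \<open>Equivariance under upper unipotents determines column \<open>0\<close> of
    \<open>X\<close>; given this column, lower unipotents determine every row.\<close>
  have Xz: "X $$ (z, 0) = (if z = 0 then 1 else 0)" if z: "z < Suc n" for z
  proof -
    have "(\<Sum>z<Suc n. monom (X $$ (z, 0)) z) = [:1:]"
    proof (rule poly_eq_nonzero)
      fix t :: 'k
      have "(\<Sum>z<Suc n. X $$ (z, 0) * t ^ z) = (\<Sum>z<Suc n. nabla n (mat2 1 t 0 1) $$ (0, z) * X $$ (z, 0))"
        by (intro sum.cong refl) (simp add: nabla_entries)
      also have "\<dots> = (\<Sum>z<Suc n. if z = 0 then X $$ (0, 0) else 0)"
        unfolding Xg'[OF LU(2) zero_less_Suc] LT by (intro sum.cong refl) (simp add: nabla_entries)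
      also have "\<dots> = 1" using X00 by (simp del: sum.lessThan_Suc)
      finally show "poly (\<Sum>z<Suc n. monom (X $$ (z, 0)) z) t = poly [:1:] t"
        by (simp add: poly_sum poly_monom del: sum.lessThan_Suc)
    qed
    from arg_cong[OF this, of "\<lambda>p. coeff p z"] show ?thesis
      using z by (simp add: coeff_sum coeff_pCons del: sum.lessThan_Suc split: nat.splits)
  qed
  have Xij: "X $$ (i, j) = (if i = j then of_nat (n choose i) else 0)" if i: "i < Suc n" and j: "j < Suc n" for i j
  proof -
    have "(\<Sum>z<Suc n. monom (X $$ (i, z)) z) = monom (of_nat (n choose i)) i"
    proof (rule poly_eq_nonzero)
      fix t :: 'k
      have "(\<Sum>z<Suc n. X $$ (i, z) * t ^ z) = (\<Sum>z<Suc n. X $$ (i, z) * nabla n (mat2 1 0 t 1)\<^sup>T $$ (0, z))"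
        unfolding LT by (intro sum.cong refl) (simp add: nabla_entries)
      also have "\<dots> = (\<Sum>z<Suc n. if z = 0 then nabla n (mat2 1 0 t 1) $$ (i, 0) else 0)"
        unfolding Xg'[OF LU(1) i, symmetric] by (intro sum.cong refl) (simp add: Xz)
      also have "\<dots> = of_nat (n choose i) * t ^ i" using nabla_entries(3)[OF i, of t] by (simp del: sum.lessThan_Suc)
      finally show "poly (\<Sum>z<Suc n. monom (X $$ (i, z)) z) t = poly (monom (of_nat (n choose i)) i) t"
        by (simp add: poly_sum poly_monom del: sum.lessThan_Suc)
    qed
    from arg_cong[OF this, of "\<lambda>p. coeff p j"] show ?thesis
      using j by (simp add: coeff_sum del: sum.lessThan_Suc)
  qed
  obtain D E :: "'k mat" where D: "D \<in> carrier_mat (Suc n) (Suc n)" and E: "E \<in> carrier_mat (Suc n) (Suc n)"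
    and DE: "D * E = 1\<^sub>m (Suc n)" and ED: "E * D = 1\<^sub>m (Suc n)"
    and Dg: "\<And>A. A \<in> carrier_mat 2 2 \<Longrightarrow> D * (nabla n A\<^sup>T)\<^sup>T = nabla n A * D"
    and Dij: "\<And>i j. i < Suc n \<Longrightarrow> j < Suc n \<Longrightarrow> D $$ (i, j) = (if i = j then of_nat (n choose i) else 0)"
    by (rule nabla_form) (erule binom, (rule that; assumption))
  have XD: "X = D" by (rule eq_matI) (use X D Xij Dij in auto)
  define A where "A = F * E"
  have A: "A \<in> carrier_mat N (Suc n)" unfolding A_def by (rule mult_carrier_mat[OF F E])
  have BA: "B * A = 1\<^sub>m (Suc n)"
    unfolding A_def using assoc_mult_mat[OF B F E] XD DE by (simp add: X_def)
  have Ag: "A * nabla n g = act S g * A" if g: "g \<in> carrier SL2" for g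
  proof -
    have gc: "g \<in> carrier_mat 2 2" using g by (simp add: SL2_iff)
    note sq = sqm[where n = "Suc n"] sqm_distrib(5)[where n = "Suc n"]
    have "(nabla n g\<^sup>T)\<^sup>T * E = E * D * ((nabla n g\<^sup>T)\<^sup>T * E)" unfolding ED using E nc by (simp add: sq)
    also have "\<dots> = E * (D * (nabla n g\<^sup>T)\<^sup>T * E)" using D E nc by (simp add: sq)
    also have "\<dots> = E * (nabla n g * (D * E))" unfolding Dg[OF gc] using D E nc by (simp add: sq)
    finally have eq: "(nabla n g\<^sup>T)\<^sup>T * E = E * nabla n g" unfolding DE using nc by (simp add: sq)
    have "act S g * A = act S g * F * E" unfolding A_def by (rule assoc_mult_mat[OF c[OF g] F E, symmetric])
    also have "\<dots> = F * ((nabla n g\<^sup>T)\<^sup>T * E)" unfolding Fg[OF g] by (rule assoc_mult_mat[OF F nc(2) E])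
    also have "\<dots> = A * nabla n g" unfolding eq A_def by (rule assoc_mult_mat[OF F E nc(1), symmetric])
    finally show ?thesis by (rule sym)
  qed
  have rS: "representation SL2 S" using S by (simp add: rational_rep_def)
  obtain Q where Q: "representation SL2 Q" and iso: "isomorphic_rep SL2 S (direct_sum_rep (dual_weyl_module n) Q)"
  proof (rule split_off[OF group_SL2 rS representation_dual_weyl[of n], of A B])
    show "A \<in> carrier_mat (deg S) (deg (dual_weyl_module n))" "B \<in> carrier_mat (deg (dual_weyl_module n)) (deg S)"
      using A B by (simp_all add: N_def)
    show "B * A = 1\<^sub>m (deg (dual_weyl_module n))" using BA by simp
    show "A * act (dual_weyl_module n) g = act S g * A" "B * act S g = act (dual_weyl_module n) g * B"
      if "g \<in> carrier SL2" for g unfolding act_dual_weyl using Ag[OF that] Bg[OF that] by simp_all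
  qed (rule that; assumption)
  have "deg (dual_weyl_module n :: ('k mat, 'k) rep) = 0 \<or> deg Q = 0"
    using ind[unfolded indecomposable_rep_def, THEN conjunct2, rule_format, OF representation_dual_weyl Q iso] .
  then have "deg Q = 0" by simp
  moreover have "deg S = deg (direct_sum_rep (dual_weyl_module n) Q)" by (rule isomorphic_rep_deg[OF iso])
  ultimately have N: "N = Suc n" by (simp add: direct_sum_rep_def N_def)
  show ?thesis
  proof (rule isomorphic_repI[of B "Suc n" A])
    show "B * act S g = act (dual_weyl_module n) g * B" if "g \<in> carrier SL2" for g
      unfolding act_dual_weyl by (rule Bg[OF that])
  qed (use A B BA N in \<open>simp_all add: N_def\<close>)
qed

section \<open>Restriction to the elementary abelian group\<close>

text \<open>From \<open>i\<close> to \<open>i + 1\<close> the coefficient is multiplied by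
  \<open>(k * p - (i + 1)) / (i + 1)\<close>. If \<open>p\<close> does not divide
  \<open>i + 1\<close>, it does not divide the numerator either; if \<open>i + 1 = p * m\<close>,
  the factor is \<open>(k - m) / m\<close> with \<open>0 < k - m < p\<close>, and this is where
  \<open>k \<le> p\<close> enters.\<close>

lemma not_dvd_choose_block:
  assumes "prime p" "k \<le> p" "i < k * p"
  shows "\<not> p dvd ((k * p - 1) choose i)"
  using assms(3)
proof (induction i)
  case 0
  then show ?case using prime_gt_1_nat[OF assms(1)] by simp
next
  case (Suc i)
  define n where "n = k * p - 1"
  have n: "n - i = k * p - Suc i" by (simp add: n_def)
  have ih: "\<not> p dvd (n choose i)" using Suc by (simp add: n_def)
  have eq: "Suc i * (n choose Suc i) = (k * p - Suc i) * (n choose i)"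
    using binomial_absorb_comp[of n i] binomial_absorption[of i "n"] times_binomial_minus1_eq[of "Suc i" n]
    unfolding n[symmetric] by (metis Suc_times_binomial_add add.commute binomial_absorption choose_one diff_Suc_1 mult.commute)
  show ?case
  proof
    assume "p dvd (k * p - 1 choose Suc i)"
    then have d: "p dvd (n choose Suc i)" by (simp add: n_def)
    show False
    proof (cases "p dvd Suc i")
      case False
      have "p dvd (k * p - Suc i) * (n choose i)" unfolding eq[symmetric] using d by simp
      then have "p dvd k * p - Suc i" using ih prime_dvd_multD[OF assms(1)] by blast
      then have "p dvd Suc i" using Suc.prems dvd_diffD1[of p "k * p" "Suc i"] by simp
      with False show False by blast
    next
      case True
      then obtain m where m: "Suc i = p * m" by (elim dvdE)
      have mk: "m < k" "m > 0" using Suc.prems m prime_gt_0_nat[OF assms(1)]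
        by (auto simp: mult.commute intro: gr0I)
      have kp: "k * p - p * m = p * (k - m)" by (simp add: diff_mult_distrib2 mult.commute)
      have "p * m * (n choose Suc i) = (k * p - p * m) * (n choose i)" using eq by (simp only: m)
      then have "p * (m * (n choose Suc i)) = p * ((k - m) * (n choose i))" unfolding kp by (simp only: mult.assoc)
      then have "m * (n choose Suc i) = (k - m) * (n choose i)" using prime_gt_0_nat[OF assms(1)] by simp
      moreover have "p dvd m * (n choose Suc i)" using d by simp
      ultimately have "p dvd k - m" using ih prime_dvd_multD[OF assms(1)] by metis
      then show False using mk assms(2) dvd_imp_le[of p "k - m"] by simp
    qed
  qed
qed

text \<open>The one-parameter group through which \<open>E\<close> acts on
  \<open>\<nabla>(n)\<close>.\<close>

definition lower :: "nat \<Rightarrow> 'k::field \<Rightarrow> 'k mat" where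
  "lower n t = nabla n (mat2 1 0 t 1)"

lemma lower_carrier [simp]: "lower n t \<in> carrier_mat (Suc n) (Suc n)"
  by (simp add: lower_def)

lemma lower_index:
  fixes t :: "'k::field"
  assumes "i < Suc n" "j < Suc n"
  shows "lower n t $$ (i, j) = (if j \<le> i then of_nat ((n - j) choose (i - j)) * t ^ (i - j) else 0)"
proof -
  have "[:0, 1:] ^ j = (monom 1 j :: 'k poly)" by (simp add: monom_altdef)
  then have "lower n t $$ (i, j) = coeff (monom 1 j * [:1, t:] ^ (n - j)) i"
    using assms by (simp add: lower_def nabla_def mult.commute)
  then show ?thesis using assms by (simp add: coeff_monom_mult coeff_linear_poly_power)
qed

lemma lower_add: "lower n s * lower n t = lower n (s + t)"
proof -
  have "mat2 1 0 s 1 * mat2 1 0 t 1 = mat2 1 0 (s + t) 1" by (simp add: mat2_mult)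
  then show ?thesis unfolding lower_def by (simp only: nabla_mult[symmetric] mat2_carrier)
qed

lemma lower_0: "lower n 0 = 1\<^sub>m (Suc n)"
  unfolding lower_def mat2_one nabla_one ..

lemma lower_power: "lower n t ^\<^sub>m m = lower n (of_nat m * t)"
proof (induction m)
  case 0
  then show ?case using carrier_matD[OF lower_carrier[of n t]] by (simp add: lower_0)
next
  case (Suc m)
  then show ?case by (simp add: lower_add algebra_simps)
qed

text \<open>This is the surjectivity of a Vandermonde matrix. For a new node \<open>b\<close> the
  combinations \<open>s (m + 1) - b * s m\<close> of power sums do not involve the weight of
  \<open>b\<close>. So the weights of the old nodes come from the induction, divided by
  \<open>a - b\<close>, and the weight of \<open>b\<close> then corrects \<open>s 0\<close>.\<close>

lemma interpolation:
  fixes A :: "'k::field set"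
  assumes "finite A"
  shows "\<exists>c. \<forall>m < card A. (\<Sum>a\<in>A. c a * a ^ m) = w m"
  using assms
proof (induction A arbitrary: w rule: finite_induct)
  case empty
  then show ?case by simp
next
  case (insert b A)
  obtain c where c: "\<forall>m < card A. (\<Sum>a\<in>A. c a * a ^ m) = w (Suc m) - b * w m"
    using insert.IH[of "\<lambda>m. w (Suc m) - b * w m"] by blast
  define c' where "c' a = (if a = b then w 0 - (\<Sum>a\<in>A. c a / (a - b)) else c a / (a - b))" for a
  define s where "s m = (\<Sum>a\<in>insert b A. c' a * a ^ m)" for m
  have ne: "a - b \<noteq> 0" if "a \<in> A" for a using that insert.hyps by auto
  have cA: "(\<Sum>a\<in>A. c' a * f a) = (\<Sum>a\<in>A. c a / (a - b) * f a)" for f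
    using insert.hyps by (intro sum.cong refl) (auto simp: c'_def)
  have s0: "s 0 = w 0" unfolding s_def using insert.hyps cA[of "\<lambda>_. 1"] by (simp add: c'_def)
  have step: "s (Suc m) = b * s m + (\<Sum>a\<in>A. c a * a ^ m)" for m
  proof -
    have "s (Suc m) - b * s m = (\<Sum>a\<in>insert b A. c' a * ((a - b) * a ^ m))"
      unfolding s_def sum_distrib_left sum_subtractf[symmetric] by (intro sum.cong refl) (simp add: algebra_simps)
    also have "\<dots> = (\<Sum>a\<in>A. c a / (a - b) * ((a - b) * a ^ m))" using insert.hyps by (simp add: cA)
    also have "\<dots> = (\<Sum>a\<in>A. c a * a ^ m)" using ne by (intro sum.cong refl) simp
    finally show ?thesis by (simp add: algebra_simps)
  qed
  have "s m = w m" if "m < card (insert b A)" for m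
    using that
  proof (induction m)
    case (Suc m)
    then show ?case using c insert.hyps by (simp add: step)
  qed (rule s0)
  then show ?case unfolding s_def by blast
qed

lemma poly_eq_degree:
  fixes P Q :: "'k::field poly"
  assumes "degree P < m" "degree Q < m" "finite A" "card A = m" "\<And>x. x \<in> A \<Longrightarrow> poly P x = poly Q x"
  shows "P = Q"
proof (rule ccontr)
  assume "P \<noteq> Q"
  then have nz: "P - Q \<noteq> 0" by simp
  have "card A \<le> card {x. poly (P - Q) x = 0}"
    by (rule card_mono[OF poly_roots_finite[OF nz]]) (use assms(5) in auto)
  also have "\<dots> \<le> degree (P - Q)" by (rule poly_roots_degree[OF nz])
  also have "\<dots> < m" by (rule degree_diff_less[OF assms(1,2)])
  finally show False using assms(4) by simp
qed

lemma of_nat_inj_char: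
  assumes "CHAR('k::field) = p"
  shows "inj_on (of_nat :: nat \<Rightarrow> 'k) {..<p}"
proof (rule linorder_inj_onI')
  fix i j assume "i \<in> {..<p}" "j \<in> {..<p}" "i < j"
  then have "(of_nat (j - i) :: 'k) \<noteq> 0" by (intro of_nat_neq_0_char[OF assms]) auto
  then show "(of_nat i :: 'k) \<noteq> of_nat j" using \<open>i < j\<close> by (auto simp: of_nat_diff)
qed

lemma binom_coeff_of_nat:
  assumes "CHAR('k::field) = p" "prime p" "j < p"
  shows "binom_coeff (of_nat m) j = (of_nat (m choose j) :: 'k)"
  using assms(3)
proof (induction m arbitrary: j)
  case 0
  show ?case
  proof (cases j)
    case (Suc j')
    then show ?thesis by (simp add: binom_coeff_def prod.lessThan_Suc_shift del: prod.lessThan_Suc)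
  qed simp
next
  case (Suc m)
  show ?case
  proof (cases j)
    case (Suc j')
    then show ?thesis
      using binom_coeff_pascal[OF assms(1,2), of j' "of_nat m"] Suc.IH[of j] Suc.IH[of j'] Suc.prems
      by (simp add: add.commute)
  qed simp
qed

lemma poly_mat1_sum_index:
  fixes X :: "'k::field mat"
  assumes X: "X \<in> carrier_mat n n" and xy: "x < n" "y < n"
  shows "poly_mat1 n X (\<Sum>j<q. monom (c j) j) $$ (x, y) = (\<Sum>j<q. c j * (X ^\<^sub>m j) $$ (x, y))"
proof (induction q)
  case 0
  then show ?case using xy by (simp add: mat_hom.zero[OF poly_mat1_hom[OF X]])
next
  case (Suc q)
  interpret P: mat_hom n "poly_mat1 n X" by (rule poly_mat1_hom[OF X])
  have "poly_mat1 n X (monom (c q) q) = poly_mat1 n X ([:c q:] * [:0, 1:] ^ q)" by (simp add: monom_altdef)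
  also have "\<dots> = c q \<cdot>\<^sub>m 1\<^sub>m n * X ^\<^sub>m q" unfolding P.mult P.power poly_mat1_const[OF X] poly_mat1_var[OF X] ..
  also have "\<dots> = c q \<cdot>\<^sub>m (X ^\<^sub>m q)" using X by (simp add: mult_smult_assoc_mat[of _ n n _ n] pow_carrier_mat[OF X])
  finally have "poly_mat1 n X (monom (c q) q) $$ (x, y) = c q * (X ^\<^sub>m q) $$ (x, y)"
    using xy carrier_matD[OF pow_carrier_mat[OF X, of q]] by simp
  moreover have "poly_mat1 n X (\<Sum>j<Suc q. monom (c j) j) $$ (x, y)
      = poly_mat1 n X (\<Sum>j<q. monom (c j) j) $$ (x, y) + poly_mat1 n X (monom (c q) q) $$ (x, y)"
    unfolding sum.lessThan_Suc P.add using xy carrier_matD[OF P.carrier] by simp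
  ultimately show ?case using Suc.IH by simp
qed

text \<open>Each factor moves basis vectors down by at least \<open>p\<close> places. This will give
  \<open>Y ^ k = 0\<close> on \<open>\<nabla>(k * p - 1)\<close>.\<close>

lemma shifted_power_zero:
  fixes Z :: "'k::field mat"
  assumes Z: "Z \<in> carrier_mat n n" and z: "\<And>x y. x < n \<Longrightarrow> y < n \<Longrightarrow> x < y + p \<Longrightarrow> Z $$ (x, y) = 0" and n: "n \<le> k * p"
  shows "Z ^\<^sub>m k = 0\<^sub>m n n"
proof -
  have "(Z ^\<^sub>m m) $$ (x, y) = 0" if "x < n" "y < n" "x < y + m * p" for x y m
    using that
  proof (induction m arbitrary: y)
    case 0
    then show ?case using Z by simp
  next
    case (Suc m)
    have "(Z ^\<^sub>m m) $$ (x, i) * Z $$ (i, y) = 0" if "i < n" for i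
      using Suc z[OF that Suc.prems(2)] that by (cases "i < y + p") auto
    then have "(\<Sum>i<n. (Z ^\<^sub>m m) $$ (x, i) * Z $$ (i, y)) = 0" by (intro sum.neutral) simp
    then show ?case
      using mat_mult_index[OF pow_carrier_mat[OF Z] Z Suc.prems(1,2), of m] by simp
  qed
  then show ?thesis using carrier_matD[OF pow_carrier_mat[OF Z, of k]] n by (intro eq_matI) auto
qed

context unipotent_pair
begin

lemma span_orbit:
  assumes v: "v \<in> carrier_vec n" and "finite A" "\<And>a. a \<in> A \<Longrightarrow> \<exists>Q. M Q *\<^sub>v v = f a"
  shows "\<exists>Q. M Q *\<^sub>v v = vec n (\<lambda>i. \<Sum>a\<in>A. c a * f a $ i)"
  using assms(2,3)
proof (induction A rule: finite_induct)
  case empty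
  have "M 0 *\<^sub>v v = vec n (\<lambda>i. \<Sum>a\<in>{}. c a * f a $ i)" unfolding P2.zero_vec[OF v] by (intro eq_vecI) auto
  then show ?case by blast
next
  case (insert a A)
  obtain Q where Q: "M Q *\<^sub>v v = vec n (\<lambda>i. \<Sum>a\<in>A. c a * f a $ i)" using insert by blast
  obtain R where R: "M R *\<^sub>v v = f a" using insert by blast
  have fa: "f a \<in> carrier_vec n" using carrier_M_vec[OF v, of R] R by simp
  have "M (polyK (c a) * R + Q) *\<^sub>v v = vec n (\<lambda>i. \<Sum>a\<in>insert a A. c a * f a $ i)"
    unfolding P2.add_vec[OF v] M_K_vec[OF v] Q R using insert.hyps fa by (intro eq_vecI) auto
  then show ?case by blast
qed

end

lemma lower_unipotent:
  fixes l1 l2 :: "'k::field"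
  assumes "CHAR('k) = p" "prime p"
  shows "unipotent_pair (Suc n) p (lower n l1) (lower n l2)"
proof
  have "of_nat p = (0 :: 'k)" using assms(1) by (simp add: of_nat_eq_0_iff_char_dvd)
  then show "lower n l1 ^\<^sub>m p = 1\<^sub>m (Suc n)" "lower n l2 ^\<^sub>m p = 1\<^sub>m (Suc n)"
    by (simp_all add: lower_power lower_0)
qed (use assms in \<open>simp_all add: lower_add add.commute\<close>)

text \<open>Both sides of \<open>Y = 0\<close> are polynomials in \<open>\<mu>\<close>; in the entries close to the diagonal they have degree less
  than \<open>p\<close>, and they agree for \<open>\<mu>\<close> in the prime field.\<close>

lemma lower_Y_zero:
  fixes l1 l2 :: "'k::field"
  assumes p: "CHAR('k) = p" "prime p" and l1: "l1 \<noteq> 0" and xy: "x < Suc n" "y < Suc n" "x < y + p"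
  shows "unipotent_pair.Y (Suc n) p (l2 / l1) (lower n l1) (lower n l2) $$ (x, y) = 0"
proof -
  interpret U: unipotent_pair "Suc n" p "l2 / l1" "lower n l1" "lower n l2" by (rule lower_unipotent[OF p])
  define B :: "nat \<Rightarrow> 'k poly" where "B j = Polynomial.smult (inverse (of_nat (fact j))) (\<Prod>i<j. [:- of_nat i, 1:])" for j
  have B: "poly (B j) \<nu> = binom_coeff \<nu> j" for j \<nu>
    unfolding B_def binom_coeff_def by (simp add: poly_prod divide_inverse mult.commute add.commute[of _ \<nu>])
  have dB: "degree (B j) \<le> j" for j
  proof -
    have "degree (\<Prod>i<j. [:- of_nat i, 1 :: 'k:]) \<le> j"
      using degree_prod_sum_le[of "{..<j}" "\<lambda>i. [:- of_nat i, 1 :: 'k:]"] by simp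
    then show ?thesis unfolding B_def using degree_smult_le order_trans by blast
  qed
  define R where "R = (\<Sum>j<p. Polynomial.smult ((U.X ^\<^sub>m j) $$ (x, y)) (B j))"
  have R: "poly R \<nu> = (\<Sum>j<p. binom_coeff \<nu> j * (U.X ^\<^sub>m j) $$ (x, y))" for \<nu>
    by (simp add: R_def poly_sum B mult.commute)
  have p0: "p > 0" by (rule prime_gt_0_nat[OF p(2)])
  have "degree R \<le> p - 1" unfolding R_def
  proof (rule degree_sum_le)
    fix j assume "j \<in> {..<p}"
    then show "degree (Polynomial.smult ((U.X ^\<^sub>m j) $$ (x, y)) (B j)) \<le> p - 1"
      using dB[of j] degree_smult_le[of "(U.X ^\<^sub>m j) $$ (x, y)" "B j"] by simp
  qed simp
  then have dR: "degree R < p" using p0 by simp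
  define L where "L = (if y \<le> x then monom (of_nat ((n - y) choose (x - y)) * l1 ^ (x - y)) (x - y) else 0)"
  have L: "poly L \<nu> = lower n (\<nu> * l1) $$ (x, y)" for \<nu>
    using xy by (simp add: L_def lower_index poly_monom power_mult_distrib)
  have "degree L \<le> p - 1"
    using xy p0 unfolding L_def by (auto intro!: order_trans[OF degree_monom_le])
  then have dL: "degree L < p" using p0 by simp
  have "L = R"
  proof (rule poly_eq_degree[OF dL dR, of "of_nat ` {..<p}"])
    show "card (of_nat ` {..<p} :: 'k set) = p" using card_image[OF of_nat_inj_char[OF p(1)]] by simp
    fix \<nu> :: 'k assume "\<nu> \<in> of_nat ` {..<p}"
    then obtain m where m: "m < p" "\<nu> = of_nat m" by auto
    \<comment> \<open>For a natural exponent below \<open>p\<close> the truncated binomial series is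
      complete, so it gives the actual power of the first generator.\<close>
    have "[:1, 1:] ^ m = (\<Sum>j<p. monom (of_nat (m choose j)) j :: 'k poly)"
    proof (rule poly_eqI)
      fix j
      have "coeff (\<Sum>j<p. monom (of_nat (m choose j)) j :: 'k poly) j = (if j < p then of_nat (m choose j) else 0)"
        by (simp add: coeff_sum)
      then show "coeff ([:1, 1:] ^ m) j = coeff (\<Sum>j<p. monom (of_nat (m choose j)) j :: 'k poly) j"
        using m by (cases "j < p") (simp_all add: coeff_1_X_power binomial_eq_0)
    qed
    then have "lower n l1 ^\<^sub>m m = poly_mat1 (Suc n) U.X (\<Sum>j<p. monom (of_nat (m choose j)) j)"
      using U.P1.power[of "[:1, 1:]" m] by (simp only: U.P1_1x)
    then have "lower n (\<nu> * l1) $$ (x, y) = (\<Sum>j<p. of_nat (m choose j) * (U.X ^\<^sub>m j) $$ (x, y))"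
      using poly_mat1_sum_index[OF U.X xy(1,2), of "\<lambda>j. of_nat (m choose j)" p] by (simp add: lower_power m(2))
    then show "poly L \<nu> = poly R \<nu>" unfolding L R m(2) using binom_coeff_of_nat[OF p] by simp
  qed simp
  moreover have "U.Y $$ (x, y) = lower n l2 $$ (x, y) - poly_mat1 (Suc n) U.X (binom_poly p (l2 / l1)) $$ (x, y)"
    unfolding U.Y_def using xy carrier_matD[OF U.P1.carrier] carrier_matD[OF lower_carrier[of n l2]] by simp
  moreover have "poly_mat1 (Suc n) U.X (binom_poly p (l2 / l1)) $$ (x, y) = poly R (l2 / l1)"
    unfolding R binom_poly_def by (rule poly_mat1_sum_index[OF U.X xy(1,2)])
  moreover have "lower n l2 $$ (x, y) = poly L (l2 / l1)" using l1 by (simp add: L)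
  ultimately show ?thesis by simp
qed

text \<open>The matrix \<open>lower n a\<close> sends the first basis vector to the vector with
  entries \<open>(n choose i) * a ^ i\<close>. The products of powers of the generators provide
  \<open>k * p = n + 1\<close> distinct parameters \<open>a\<close>, so by
  \<open>interpolation\<close> these vectors span.\<close>

lemma lower_generates:
  fixes l1 l2 :: "'k::field"
  assumes p: "CHAR('k) = p" "prime p"
    and binom: "\<And>i. i \<le> n \<Longrightarrow> of_nat (n choose i) \<noteq> (0 :: 'k)"
    and inj: "inj_on (\<lambda>(i, j). of_nat i * l1 + of_nat j * l2) ({..<p} \<times> {..<k})" and n: "Suc n = k * p"
    and w: "w \<in> carrier_vec (Suc n)"
  shows "\<exists>Q. poly_mat2 (Suc n) (unipotent_pair.X (Suc n) (lower n l1))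
    (unipotent_pair.Y (Suc n) p \<mu> (lower n l1) (lower n l2)) Q *\<^sub>v unit_vec (Suc n) 0 = w"
proof -
  interpret U: unipotent_pair "Suc n" p \<mu> "lower n l1" "lower n l2" by (rule lower_unipotent[OF p])
  define A where "A = (\<lambda>(i, j). of_nat i * l1 + of_nat j * l2) ` ({..<p} \<times> {..<k})"
  have A: "finite A" "card A = Suc n" using card_image[OF inj] n by (simp_all add: A_def mult.commute)
  obtain c where c: "\<forall>m < card A. (\<Sum>a\<in>A. c a * a ^ m) = w $ m / of_nat (n choose m)"
    using interpolation[OF A(1), of "\<lambda>m. w $ m / of_nat (n choose m)"] by blast
  have f: "(lower n a *\<^sub>v unit_vec (Suc n) 0) $ i = of_nat (n choose i) * a ^ i" if "i < Suc n" for a :: 'k and i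
  proof -
    have "(lower n a *\<^sub>v unit_vec (Suc n) 0) $ i = lower n a $$ (i, 0)"
      unfolding mat_mult_vec_index[OF lower_carrier unit_vec_carrier that] by (rule mult_unit_sum) simp
    also have "\<dots> = of_nat (n choose i) * a ^ i" unfolding lower_index[OF that zero_less_Suc] by simp
    finally show ?thesis .
  qed
  have "\<exists>Q. U.M Q *\<^sub>v unit_vec (Suc n) 0 = vec (Suc n) (\<lambda>i. \<Sum>a\<in>A. c a * (lower n a *\<^sub>v unit_vec (Suc n) 0) $ i)"
  proof (rule U.span_orbit[OF unit_vec_carrier A(1)])
    fix a assume "a \<in> A"
    then obtain i j where a: "a = of_nat i * l1 + of_nat j * l2" by (auto simp: A_def)
    have "U.M ((1 + polyX) ^ i * ([:binom_poly p \<mu>:] + polyY) ^ j) = lower n a"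
      unfolding U.P2.mult U.P2.power U.M_G1 U.M_G2 lower_power lower_add a ..
    then have "U.M ((1 + polyX) ^ i * ([:binom_poly p \<mu>:] + polyY) ^ j) *\<^sub>v unit_vec (Suc n) 0 = lower n a *\<^sub>v unit_vec (Suc n) 0"
      by (simp only:)
    then show "\<exists>Q. U.M Q *\<^sub>v unit_vec (Suc n) 0 = lower n a *\<^sub>v unit_vec (Suc n) 0" by (rule exI)
  qed
  moreover have "vec (Suc n) (\<lambda>i. \<Sum>a\<in>A. c a * (lower n a *\<^sub>v unit_vec (Suc n) 0) $ i) = w"
  proof (rule eq_vecI)
    fix i assume "i < dim_vec w"
    then have i: "i < Suc n" using w by simp
    have "(\<Sum>a\<in>A. c a * (of_nat (n choose i) * a ^ i)) = of_nat (n choose i) * (\<Sum>a\<in>A. c a * a ^ i)"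
      by (simp add: sum_distrib_left mult_ac)
    then show "vec (Suc n) (\<lambda>i. \<Sum>a\<in>A. c a * (lower n a *\<^sub>v unit_vec (Suc n) 0) $ i) $ i = w $ i"
      using i c A(2) binom[of i] by (simp add: f)
  qed (use w in simp)
  ultimately show ?thesis by simp
qed

lemma independent_nodes:
  fixes l1 l2 :: "'k::field"
  assumes p: "CHAR('k) = p" and indep: "independent_over_prime_field l1 l2"
  shows "inj_on (\<lambda>(i, j). of_nat i * l1 + of_nat j * l2) ({..<p} \<times> {..<p})" and "l1 \<noteq> 0"
proof -
  have ind: "of_int a = (0 :: 'k) \<and> of_int b = (0 :: 'k)" if "of_int a * l1 + of_int b * l2 = 0" for a b
    by (rule indep[unfolded independent_over_prime_field_def, THEN bspec, OF rangeI, THEN bspec, OF rangeI, THEN mp, OF that])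
  show "l1 \<noteq> 0" using ind[of 1 0] by auto
  note inj = inj_onD[OF of_nat_inj_char[OF p]]
  show "inj_on (\<lambda>(i, j). of_nat i * l1 + of_nat j * l2) ({..<p} \<times> {..<p})"
  proof (rule inj_onI, clarsimp)
    fix i j i' j' assume lt: "i < p" "j < p" "i' < p" "j' < p"
      and "of_nat i * l1 + of_nat j * l2 = of_nat i' * l1 + of_nat j' * l2"
    then have "of_int (int i - int i') * l1 + of_int (int j - int j') * l2 = 0" by (simp add: algebra_simps)
    from ind[OF this] have "of_nat i = (of_nat i' :: 'k)" "of_nat j = (of_nat j' :: 'k)" by simp_all
    then show "i = i' \<and> j = j'" using inj lt by auto
  qed
qed

text \<open>For \<open>n = p - 1\<close> every position satisfies the bound \<open>x < y + p\<close>
  of \<open>lower_Y_zero\<close>, so \<open>Y = 0\<close>.\<close>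

theorem splitting_lower:
  fixes l1 l2 :: "'k::field"
  assumes p: "CHAR('k) = p" "prime p" and indep: "independent_over_prime_field l1 l2"
  shows "splitting p (binom_coeff (l2 / l1)) p (lower (p - 1) l1) (lower (p - 1) l2)"
proof -
  have p1: "Suc (p - 1) = p" using prime_gt_0_nat[OF p(2)] by simp
  interpret U: unipotent_pair "Suc (p - 1)" p "l2 / l1" "lower (p - 1) l1" "lower (p - 1) l2" by (rule lower_unipotent[OF p])
  note nodes = independent_nodes[OF p(1) indep]
  have "U.Y = 0\<^sub>m (Suc (p - 1)) (Suc (p - 1))"
    by (rule eq_matI) (use lower_Y_zero[OF p nodes(2), of _ "p - 1"] p1 carrier_matD[OF U.Y] in auto)
  then have "splitting p (binom_coeff (l2 / l1)) (Suc (p - 1)) (lower (p - 1) l1) (lower (p - 1) l2)"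
  proof (rule U.splitting_regular[OF _ p1 unit_vec_carrier[of _ 0]])
    show "\<exists>Q. U.M Q *\<^sub>v unit_vec (Suc (p - 1)) 0 = w" if "w \<in> carrier_vec (Suc (p - 1))" for w
    proof (rule lower_generates[where k = 1, OF p _ _ _ that])
      show "of_nat ((p - 1) choose i) \<noteq> (0 :: 'k)" if "i \<le> p - 1" for i
        using not_dvd_choose_block[OF p(2), of 1 i] that p1 by (simp add: of_nat_eq_0_iff_char_dvd p(1))
      show "inj_on (\<lambda>(i, j). of_nat i * l1 + of_nat j * l2) ({..<p} \<times> {..<1})"
        by (rule inj_on_subset[OF nodes(1)]) (use p1 in auto)
    qed (use p1 in simp)
  qed
  then show ?thesis by (simp only: p1)
qed

section \<open>The dimension of a cyclic module\<close>

lemma poly_split_at: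
  fixes q :: "'r::comm_ring_1 poly"
  shows "q = (\<Sum>i<m. monom (coeff q i) i) + monom 1 m * poly_shift m q"
  by (rule poly_eqI) (simp add: coeff_sum coeff_monom_mult coeff_poly_shift)

context unipotent_pair
begin

lemma M_sum_vec:
  fixes q :: nat
  assumes v: "v \<in> carrier_vec n" and x: "x < n"
  shows "(M (\<Sum>j<q. f j) *\<^sub>v v) $ x = (\<Sum>j<q. (M (f j) *\<^sub>v v) $ x)"
proof (induction q)
  case 0
  then show ?case using x by (simp add: P2.zero_vec[OF v])
next
  case (Suc q)
  then show ?case using x carrier_vecD[OF carrier_M_vec[OF v]] by (simp add: P2.add_vec[OF v])
qed

lemma M_kill_vec:
  assumes v: "v \<in> carrier_vec n" and Z: "M Z *\<^sub>v v = 0\<^sub>v n"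
  shows "M (R * Z) *\<^sub>v v = 0\<^sub>v n"
  unfolding P2.mult_vec[OF v] Z by (intro eq_vecI) (auto simp: carrier_matD[OF P2.carrier])

lemma M_expand_vec:
  assumes v: "v \<in> carrier_vec n" and k: "M (polyY ^ k) *\<^sub>v v = 0\<^sub>v n" and x: "x < n"
  shows "(M Q *\<^sub>v v) $ x = (\<Sum>j<k. \<Sum>i<p. coeff (coeff Q j) i * (M (polyX ^ i * polyY ^ j) *\<^sub>v v) $ x)"
proof -
  have Xp: "M (polyX ^ p) *\<^sub>v v = 0\<^sub>v n" unfolding M_X_p using v by (intro eq_vecI) auto
  have mY: "monom 1 j = polyY ^ j" for j by (simp add: polyY_def monom_altdef)
  have c: "dim_vec (M R *\<^sub>v v) = n" for R using carrier_vecD[OF carrier_M_vec[OF v]] .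
  have add: "(M (A + B) *\<^sub>v v) $ x = (M A *\<^sub>v v) $ x + (M B *\<^sub>v v) $ x" for A B
    using x c by (simp add: P2.add_vec[OF v])
  have inner: "(M (monom q j) *\<^sub>v v) $ x = (\<Sum>i<p. coeff q i * (M (polyX ^ i * polyY ^ j) *\<^sub>v v) $ x)" for q j
  proof -
    have e: "[:a + b:] = [:a:] + [:b:]" "[:a * b:] = [:a:] * [:b:]" for a b :: "'k poly" by simp_all
    have es: "[:\<Sum>i<m. g i:] = (\<Sum>i<m. [:g i:])" for g :: "nat \<Rightarrow> 'k poly" and m
      by (induction m) (simp_all add: e(1) del: add_pCons)
    have em: "[:monom a i:] = polyK a * polyX ^ i" for a i
      by (simp add: polyK_def polyX_def poly_const_pow monom_altdef)
    have "monom q j = [:q:] * polyY ^ j" by (simp add: mY[symmetric] smult_monom)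
    also have "[:q:] = (\<Sum>i<p. polyK (coeff q i) * polyX ^ i) + polyX ^ p * [:poly_shift p q:]"
      by (subst poly_split_at[of q p]) (simp only: e es em, simp add: polyK_def)
    also have "\<dots> * polyY ^ j = (\<Sum>i<p. polyK (coeff q i) * (polyX ^ i * polyY ^ j)) + ([:poly_shift p q:] * polyY ^ j) * polyX ^ p"
    proof -
      have "(s + x * r) * y = s * y + (r * y) * x" for s x r y :: "'k poly poly" by (simp add: algebra_simps)
      then show ?thesis by (simp only: sum_distrib_right mult.assoc)
    qed
    finally have eq: "monom q j = (\<Sum>i<p. polyK (coeff q i) * (polyX ^ i * polyY ^ j)) + ([:poly_shift p q:] * polyY ^ j) * polyX ^ p" .
    show ?thesis unfolding eq add M_kill_vec[OF v Xp] M_sum_vec[OF v x] M_K_vec[OF v] using x c by simp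
  qed
  show ?thesis
    by (subst poly_split_at[of Q k])
      (simp only: add M_sum_vec[OF v x] inner mY mult.commute[of "polyY ^ k"] M_kill_vec[OF v k] index_zero_vec(1)[OF x] add_0_right)
qed

text \<open>The vectors \<open>x ^ i * y ^ j * v\<close> with \<open>i < p\<close> and
  \<open>j < k\<close> span; the column index encodes the pair as \<open>j * p + i\<close>.\<close>

lemma cyclic_dim_le:
  assumes v: "v \<in> carrier_vec n" and k: "M (polyY ^ k) *\<^sub>v v = 0\<^sub>v n"
    and surj: "\<And>w. w \<in> carrier_vec n \<Longrightarrow> \<exists>Q. M Q *\<^sub>v v = w"
  shows "n \<le> k * p"
proof -
  define C where "C = mat n (k * p) (\<lambda>(x, a). (M (polyX ^ (a mod p) * polyY ^ (a div p)) *\<^sub>v v) $ x)"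
  have C: "C \<in> carrier_mat n (k * p)" by (simp add: C_def)
  obtain D where D: "D \<in> carrier_mat (k * p) n" "C * D = 1\<^sub>m n"
  proof (rule surj_right_inverse[OF C])
    fix w :: "'k vec" assume w: "w \<in> carrier_vec n"
    then obtain Q where Q: "M Q *\<^sub>v v = w" using surj by blast
    define u where "u = vec (k * p) (\<lambda>a. coeff (coeff Q (a div p)) (a mod p))"
    have u: "u \<in> carrier_vec (k * p)" by (simp add: u_def)
    have "C *\<^sub>v u = w"
    proof (rule eq_vecI)
      fix x assume "x < dim_vec w"
      then have x: "x < n" using w by simp
      have "(C *\<^sub>v u) $ x = (\<Sum>a<k * p. coeff (coeff Q (a div p)) (a mod p) * (M (polyX ^ (a mod p) * polyY ^ (a div p)) *\<^sub>v v) $ x)"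
        unfolding mat_mult_vec_index[OF C u x] using x by (intro sum.cong refl) (simp add: C_def u_def)
      also have "\<dots> = w $ x"
        unfolding sum_div_mod[of "\<lambda>j i. coeff (coeff Q j) i * (M (polyX ^ i * polyY ^ j) *\<^sub>v v) $ x"]
          M_expand_vec[OF v k x, symmetric] Q ..
      finally show "(C *\<^sub>v u) $ x = w $ x" .
    qed (use w C in auto)
    with u show "\<exists>u\<in>carrier_vec (k * p). C *\<^sub>v u = w" by blast
  qed (rule that; assumption)
  show ?thesis by (rule right_inverse_dim[OF C D])
qed

end

section \<open>From the abstract group to its two generators\<close>

lemma elementary_abelian:
  assumes E: "group E" and iso: "E \<cong> integer_mod_group p \<times>\<times> integer_mod_group p"
    and x: "x \<in> carrier E" and y: "y \<in> carrier E"
  shows "x \<otimes>\<^bsub>E\<^esub> y = y \<otimes>\<^bsub>E\<^esub> x" and "x [^]\<^bsub>E\<^esub> p = \<one>\<^bsub>E\<^esub>"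
proof -
  interpret E: group E by (rule E)
  define C where "C = integer_mod_group p"
  have H: "group (C \<times>\<times> C)" unfolding C_def by (intro DirProd_group) simp_all
  have C: "comm_monoid C" unfolding C_def by (rule comm_group.axioms(1)) simp
  obtain h where h: "h \<in> hom E (C \<times>\<times> C)" and inj: "inj_on h (carrier E)"
    using iso unfolding is_iso_def iso_def bij_betw_def C_def by blast
  have hc: "fst (h z) \<in> carrier C" "snd (h z) \<in> carrier C" if "z \<in> carrier E" for z
    using hom_in_carrier[OF h that] by (auto simp: DirProd_def)
  have "h (x \<otimes>\<^bsub>E\<^esub> y) = h (y \<otimes>\<^bsub>E\<^esub> x)"
    unfolding hom_mult[OF h x y] hom_mult[OF h y x] mult_DirProd'
    using comm_monoid.m_comm[OF C hc(1)[OF x] hc(1)[OF y]] comm_monoid.m_comm[OF C hc(2)[OF x] hc(2)[OF y]] by simp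
  then show "x \<otimes>\<^bsub>E\<^esub> y = y \<otimes>\<^bsub>E\<^esub> x" by (rule inj_onD[OF inj]) (use x y in simp_all)
  have pow: "z [^]\<^bsub>C \<times>\<times> C\<^esub> m = (fst z [^]\<^bsub>C\<^esub> m, snd z [^]\<^bsub>C\<^esub> m)" for z and m :: nat
    by (induction m) (simp_all add: mult_DirProd')
  have "h (x [^]\<^bsub>E\<^esub> p) = (fst (h x) [^]\<^bsub>C\<^esub> p, snd (h x) [^]\<^bsub>C\<^esub> p)"
    unfolding hom_nat_pow[OF h x E H] pow ..
  moreover have "z [^]\<^bsub>C\<^esub> p = \<one>\<^bsub>C\<^esub>" for z
    unfolding C_def pow_integer_mod_group by (simp add: integer_mod_group_def)
  ultimately have "h (x [^]\<^bsub>E\<^esub> p) = \<one>\<^bsub>C \<times>\<times> C\<^esub>" by simp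
  also have "\<dots> = h \<one>\<^bsub>E\<^esub>" by (rule hom_one[OF h E H, symmetric])
  finally show "x [^]\<^bsub>E\<^esub> p = \<one>\<^bsub>E\<^esub>" by (rule inj_onD[OF inj]) (use x in simp_all)
qed

lemma representation_pow:
  assumes G: "group G" and V: "representation G V" and g: "g \<in> carrier G"
  shows "act V (g [^]\<^bsub>G\<^esub> m) = act V g ^\<^sub>m (m :: nat)"
proof (induction m)
  case 0
  then show ?case using representation_one[OF G V] carrier_matD[OF representation_carrier[OF V g]] by simp
next
  case (Suc m)
  then show ?case using representation_mult[OF V monoid.nat_pow_closed[OF group.is_monoid[OF G] g] g] by simp
qed

lemma act_tensor_rep:
  assumes "act V g \<in> carrier_mat (deg V) (deg V)" "act W g \<in> carrier_mat (deg W) (deg W)"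
  shows "act (tensor_rep V W) g = kron (act V g) (act W g)"
  using assms by (simp add: tensor_rep_def kron_def)

lemma intertwines_generate:
  assumes G: "group G" and V: "representation G V" and W: "representation G W" and A: "A \<in> carrier_mat (deg W) (deg V)"
    and S: "S \<subseteq> carrier G" "\<And>g. g \<in> S \<Longrightarrow> A * act V g = act W g * A" and g: "g \<in> generate G S"
  shows "A * act V g = act W g * A"
proof -
  interpret G: group G by (rule G)
  define H where "H = {g \<in> carrier G. A * act V g = act W g * A}"
  have c: "act V g \<in> carrier_mat (deg V) (deg V)" "act W g \<in> carrier_mat (deg W) (deg W)" if "g \<in> carrier G" for g
    using representation_carrier[OF V that] representation_carrier[OF W that] by simp_all
  have "subgroup H G"
  proof (rule G.subgroupI)
    show "H \<noteq> {}" using representation_one[OF G V] representation_one[OF G W] A by (auto simp: H_def intro!: exI[of _ "\<one>\<^bsub>G\<^esub>"])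
    fix a assume "a \<in> H"
    then have a: "a \<in> carrier G" "A * act V a = act W a * A" by (simp_all add: H_def)
    note ia = G.inv_closed[OF a(1)]
    have "act W (inv\<^bsub>G\<^esub> a) * A = act W (inv\<^bsub>G\<^esub> a) * (A * (act V a * act V (inv\<^bsub>G\<^esub> a)))"
      unfolding representation_mult[OF V a(1) ia, symmetric] G.r_inv[OF a(1)] representation_one[OF G V] right_mult_one_mat[OF A] ..
    also have "A * (act V a * act V (inv\<^bsub>G\<^esub> a)) = act W a * (A * act V (inv\<^bsub>G\<^esub> a))"
      using a(2) assoc_mult_mat[OF A c(1)[OF a(1)] c(1)[OF ia]] assoc_mult_mat[OF c(2)[OF a(1)] A c(1)[OF ia]] by simp
    also have "act W (inv\<^bsub>G\<^esub> a) * \<dots> = (act W (inv\<^bsub>G\<^esub> a) * act W a) * (A * act V (inv\<^bsub>G\<^esub> a))"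
      by (rule assoc_mult_mat[OF c(2)[OF ia] c(2)[OF a(1)] mult_carrier_mat[OF A c(1)[OF ia]], symmetric])
    also have "\<dots> = A * act V (inv\<^bsub>G\<^esub> a)"
      using representation_mult[OF W ia a(1)] representation_one[OF G W] a(1) left_mult_one_mat[OF mult_carrier_mat[OF A c(1)[OF ia]]] by simp
    finally show "inv\<^bsub>G\<^esub> a \<in> H" using ia by (simp add: H_def)
    fix b assume "b \<in> H"
    then have b: "b \<in> carrier G" "A * act V b = act W b * A" by (simp_all add: H_def)
    have "A * (act V a * act V b) = act W a * (A * act V b)"
      using a(2) assoc_mult_mat[OF A c(1)[OF a(1)] c(1)[OF b(1)]] assoc_mult_mat[OF c(2)[OF a(1)] A c(1)[OF b(1)]] by simp
    also have "\<dots> = act W a * act W b * A" unfolding b(2) by (rule assoc_mult_mat[OF c(2)[OF a(1)] c(2)[OF b(1)] A, symmetric])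
    finally show "a \<otimes>\<^bsub>G\<^esub> b \<in> H"
      using a(1) b(1) representation_mult[OF V a(1) b(1)] representation_mult[OF W a(1) b(1)] by (simp add: H_def)
  qed (auto simp: H_def)
  moreover have "S \<subseteq> H" using S by (auto simp: H_def)
  ultimately show ?thesis using G.generate_subgroup_incl g unfolding H_def by blast
qed

text \<open>In a group of exponent \<open>p\<close> inverses are powers, so the polynomials reach
  the action of every group element as soon as they reach the generators. The vectors
  \<open>M Q *\<^sub>v v\<close> form a submodule that contains the orbit.\<close>

lemma cyclic_rep_surj:
  fixes V :: "('g, 'k::field) rep" and M :: "'q::comm_ring_1 \<Rightarrow> 'k mat" and p :: nat
  assumes G: "group G" and V: "representation G V" and cyc: "cyclic_rep G V"
    and fin: "p > 0" "\<And>g. g \<in> carrier G \<Longrightarrow> g [^]\<^bsub>G\<^esub> p = \<one>\<^bsub>G\<^esub>"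
    and S: "S \<subseteq> carrier G" "generate G S = carrier G"
    and M: "mat_hom (deg V) M" "\<And>a. M (\<kappa> a) = a \<cdot>\<^sub>m 1\<^sub>m (deg V)" and MS: "\<And>g. g \<in> S \<Longrightarrow> \<exists>Q. M Q = act V g"
  obtains v where "v \<in> carrier_vec (deg V)" "\<And>w. w \<in> carrier_vec (deg V) \<Longrightarrow> \<exists>Q. M Q *\<^sub>v v = w"
proof -
  interpret G: group G by (rule G)
  define n where "n = deg V"
  interpret M: mat_hom n M using M(1) by (simp add: n_def)
  obtain v where v: "v \<in> carrier_vec n"
    and span: "LinearCombinations.module.span class_ring (module_vec TYPE('k) n) ((\<lambda>g. act V g *\<^sub>v v) ` carrier G) = carrier_vec n"
    using cyc unfolding cyclic_rep_def n_def by blast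
  define H where "H = {g \<in> carrier G. \<exists>Q. M Q = act V g}"
  have mult: "a \<otimes>\<^bsub>G\<^esub> b \<in> H" if H: "a \<in> H" "b \<in> H" for a b
  proof -
    obtain Q R where QR: "M Q = act V a" "M R = act V b" using H unfolding H_def by blast
    have ab: "a \<in> carrier G" "b \<in> carrier G" using H by (simp_all add: H_def)
    have "M (Q * R) = act V (a \<otimes>\<^bsub>G\<^esub> b)" unfolding M.mult QR representation_mult[OF V ab] ..
    then show ?thesis using ab by (auto simp: H_def)
  qed
  have one: "\<one>\<^bsub>G\<^esub> \<in> H" using M.one representation_one[OF G V] by (auto simp: H_def n_def)
  have "subgroup H G"
  proof (rule G.subgroupI)
    fix a assume a: "a \<in> H"
    then have ac: "a \<in> carrier G" by (simp add: H_def)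
    have pw: "a [^]\<^bsub>G\<^esub> m \<in> H" for m :: nat by (induction m) (simp_all add: one mult a)
    have "a [^]\<^bsub>G\<^esub> (p - 1) \<otimes>\<^bsub>G\<^esub> a = a [^]\<^bsub>G\<^esub> p" using fin(1) by (cases p) simp_all
    then have "inv\<^bsub>G\<^esub> a = a [^]\<^bsub>G\<^esub> (p - 1)" using fin(2)[OF ac] ac by (intro G.inv_equality) simp_all
    then show "inv\<^bsub>G\<^esub> a \<in> H" using pw by simp
  qed (use one mult in \<open>auto simp: H_def\<close>)
  moreover have "S \<subseteq> H" using S(1) MS by (auto simp: H_def)
  ultimately have H: "carrier G \<subseteq> H" using G.generate_subgroup_incl S(2) by blast
  define R where "R = {M Q *\<^sub>v v | Q. True}"
  have Rc: "M Q *\<^sub>v v \<in> carrier_vec n" for Q by (rule mult_mat_vec_carrier[OF M.carrier v])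
  have sm: "a \<cdot>\<^sub>v (M Q *\<^sub>v v) = M (\<kappa> a * Q) *\<^sub>v v" for a Q
    unfolding M.mult_vec[OF v] M(2)[folded n_def] using Rc[of Q] by (simp add: smult_mat_vec[of _ n n])
  have "submodule class_ring R (module_vec TYPE('k) n)"
  proof (rule submodule.intro[OF vec_module])
    show "R \<subseteq> carrier (module_vec TYPE('k) n)" using Rc by (auto simp: R_def module_vec_def)
    show "\<zero>\<^bsub>module_vec TYPE('k) n\<^esub> \<in> R"
      using M.zero_vec[OF v] by (auto simp: R_def module_vec_def intro!: exI[of _ 0])
    show "x \<oplus>\<^bsub>module_vec TYPE('k) n\<^esub> y \<in> R" if xy: "x \<in> R" "y \<in> R" for x y
    proof -
      obtain P Q where "x = M P *\<^sub>v v" "y = M Q *\<^sub>v v" using xy by (auto simp: R_def)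
      then have "x + y = M (P + Q) *\<^sub>v v" by (simp only: M.add_vec[OF v])
      then show ?thesis by (auto simp: R_def module_vec_def)
    qed
    show "a \<odot>\<^bsub>module_vec TYPE('k) n\<^esub> x \<in> R" if x: "x \<in> R" for a x
    proof -
      obtain Q where "x = M Q *\<^sub>v v" using x by (auto simp: R_def)
      then have "a \<cdot>\<^sub>v x = M (\<kappa> a * Q) *\<^sub>v v" by (simp only: sm)
      then show ?thesis by (auto simp: R_def module_vec_def)
    qed
  qed
  moreover have "(\<lambda>g. act V g *\<^sub>v v) ` carrier G \<subseteq> R"
  proof (rule image_subsetI)
    fix g assume "g \<in> carrier G"
    then obtain Q where "M Q = act V g" using H unfolding H_def by blast
    then have "act V g *\<^sub>v v = M Q *\<^sub>v v" by simp
    then show "act V g *\<^sub>v v \<in> R" unfolding R_def by blast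
  qed
  ultimately have "LinearCombinations.module.span class_ring (module_vec TYPE('k) n) ((\<lambda>g. act V g *\<^sub>v v) ` carrier G) \<subseteq> R"
    by (intro module.span_is_subset[OF vec_module])
  then have "\<exists>Q. M Q *\<^sub>v v = w" if "w \<in> carrier_vec n" for w using that unfolding span R_def by blast
  with v show thesis using that unfolding n_def by blast
qed

theorem theorem3:
  fixes p :: nat
    and E :: "('e, 'm) monoid_scheme" and g\<^sub>1 g\<^sub>2 :: 'e
    and l\<^sub>1 l\<^sub>2 :: "'k::alg_closed_field" and \<phi> :: "'e \<Rightarrow> 'k mat"
    and S :: "('k mat, 'k) rep" and X M :: "('e, 'k) rep"
  assumes "CHAR('k) = p" and "p > 0"
    and "group E" and "E \<cong> integer_mod_group p \<times>\<times> integer_mod_group p"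
    and "g\<^sub>1 \<in> carrier E" and "g\<^sub>2 \<in> carrier E" and "generate E {g\<^sub>1, g\<^sub>2} = carrier E"
    and "independent_over_prime_field l\<^sub>1 l\<^sub>2"
    and "\<phi> \<in> hom E SL2" and "\<phi> g\<^sub>1 = mat2 1 0 l\<^sub>1 1" and "\<phi> g\<^sub>2 = mat2 1 0 l\<^sub>2 1"
    and "indecomposable_tilting (p - 1) S"
    and "representation E X"
    and "direct_summand E M (tensor_rep (restrict_rep \<phi> S) X)"
    and "cyclic_rep E M"
  shows "\<exists>T. tilting T \<and> isomorphic_rep E M (restrict_rep \<phi> T)"
proof -
  note char = assms(1) and E = assms(3) and g = assms(5,6) and \<phi> = assms(9) and \<phi>g = assms(10,11)
  have prime: "prime p" using prime_CHAR_semidom[where ?'a = 'k] assms(1,2) by simp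
  have p1: "Suc (p - 1) = p" using assms(2) by simp
  note p = char prime
  note nodes = independent_nodes[OF char assms(8)]
  define \<mu> where "\<mu> = l\<^sub>2 / l\<^sub>1"
  have binom: "of_nat ((k * p - 1) choose i) \<noteq> (0 :: 'k)" if "1 \<le> k" "k \<le> p" "i \<le> k * p - 1" for k i
  proof -
    have "0 < k * p" using that(1) assms(2) by simp
    then have "i < k * p" using that(3) by linarith
    then show ?thesis using not_dvd_choose_block[OF prime that(2)] by (simp add: of_nat_eq_0_iff_char_dvd char)
  qed
  have SL: "mat2 1 0 l 1 \<in> carrier SL2" for l :: 'k by (simp add: mat2_SL2)
  have S: "rational_rep S" "indecomposable_rep SL2 S" "highest_weight S (int (p - 1))"
    using assms(12) by (simp_all add: indecomposable_tilting_def tilting_def)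
  have rS: "representation SL2 S" using S(1) by (simp add: rational_rep_def)
  \<comment> \<open>\<open>S\<close> is given only through the predicate that characterizes
    \<open>T\<^sub>i\<close> up to isomorphism, so it has to be identified with
    \<open>\<nabla>(p - 1)\<close> first.\<close>
  have "isomorphic_rep SL2 S (dual_weyl_module (p - 1))"
  proof (rule highest_weight_dual_weyl[OF S])
    show "of_nat ((p - 1) choose i) \<noteq> (0 :: 'k)" if "i \<le> p - 1" for i
      using binom[of 1 i] that prime_ge_1_nat[OF prime] by simp
  qed
  then obtain A B where AB: "deg S = p" "A \<in> carrier_mat p p" "B \<in> carrier_mat p p" "B * A = 1\<^sub>m p" "A * B = 1\<^sub>m p"
    and Ag: "\<And>h. h \<in> carrier SL2 \<Longrightarrow> A * act S h = nabla (p - 1) h * A"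
    by (rule isomorphic_repE) (simp only: deg_dual_weyl p1 act_dual_weyl)
  define r where "r = restrict_rep \<phi> S"
  have r: "representation E r" unfolding r_def by (rule representation_restrict[OF rS \<phi>])
  have dr: "deg r = p" by (simp add: r_def restrict_rep_def AB(1))
  have rc: "act r h \<in> carrier_mat p p" if "h \<in> carrier E" for h using representation_carrier[OF r that] by (simp add: dr)
  have lc: "lower (p - 1) l \<in> carrier_mat p p" for l :: 'k using lower_carrier[of "p - 1" l] by (simp only: p1)
  have Ar: "A * act r h = lower (p - 1) l * A" "B * lower (p - 1) l = act r h * B"
    if "h \<in> carrier E" "\<phi> h = mat2 1 0 l 1" for h l
  proof -
    show 1: "A * act r h = lower (p - 1) l * A"
      using Ag[OF SL[of l]] that(2) by (simp add: r_def restrict_rep_def lower_def)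
    have "B * lower (p - 1) l = B * (lower (p - 1) l * A * B)"
      using AB lc[of l] by (simp add: sqm_distrib(5)[where n = p] sqm[where n = p])
    also have "\<dots> = B * A * (act r h * B)"
      unfolding 1[symmetric] using AB(2,3) rc[OF that(1)]
      by (simp add: sqm_distrib(5)[where n = p] sqm[where n = p])
    also have "\<dots> = act r h * B" unfolding AB(4) using AB(3) rc[OF that(1)] by (simp add: sqm[where n = p])
    finally show "B * lower (p - 1) l = act r h * B" .
  qed
  \<comment> \<open>Here \<open>B\<close> and \<open>A\<close> are mutually inverse, so this carries
    the splitting from \<open>\<nabla>(p - 1)\<close> over to \<open>S\<close>.\<close>
  have "splitting p (binom_coeff \<mu>) p (act r g\<^sub>1) (act r g\<^sub>2)"
    by (rule splitting_summand[OF splitting_lower[OF p assms(8), folded \<mu>_def] lc lc rc[OF g(1)] rc[OF g(2)] AB(3,2,4)])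
      (use Ar[OF g(1) \<phi>g(1)] Ar[OF g(2) \<phi>g(2)] in simp_all)
  moreover have Xc: "act X h \<in> carrier_mat (deg X) (deg X)" if "h \<in> carrier E" for h
    by (rule representation_carrier[OF assms(13) that])
  ultimately have "splitting p (binom_coeff \<mu>) (p * deg X) (kron (act r g\<^sub>1) (act X g\<^sub>1)) (kron (act r g\<^sub>2) (act X g\<^sub>2))"
    using rc g by (intro splitting_kron) simp_all
  moreover define V where "V = tensor_rep r X"
  have Vk: "act V h = kron (act r h) (act X h)" if "h \<in> carrier E" for h
    unfolding V_def using rc[OF that] Xc[OF that] by (intro act_tensor_rep) (simp_all add: dr)
  have dV: "deg V = p * deg X" by (simp add: V_def tensor_rep_def dr)
  ultimately have splV: "splitting p (binom_coeff \<mu>) (deg V) (act V g\<^sub>1) (act V g\<^sub>2)" by (simp add: Vk g dV)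
  have Vc: "act V h \<in> carrier_mat (deg V) (deg V)" if "h \<in> carrier E" for h
    unfolding Vk[OF that] dV by (rule kron_carrier[OF rc[OF that] Xc[OF that]])
  define n where "n = deg M"
  have rM: "representation E M" using assms(14) by (simp add: direct_summand_def)
  have Mc: "act M h \<in> carrier_mat n n" if "h \<in> carrier E" for h using representation_carrier[OF rM that] by (simp add: n_def)
  obtain P I where PI: "P \<in> carrier_mat n (deg V)" "I \<in> carrier_mat (deg V) n" "P * I = 1\<^sub>m n"
    and Pg: "\<And>h. h \<in> carrier E \<Longrightarrow> act V h \<in> carrier_mat (deg V) (deg V) \<Longrightarrow> P * act V h = act M h * P"
    and Ig: "\<And>h. h \<in> carrier E \<Longrightarrow> act V h \<in> carrier_mat (deg V) (deg V) \<Longrightarrow> act V h * I = I * act M h"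
    by (rule direct_summandE[OF assms(14)[folded r_def, folded V_def], folded n_def]) (rule that; assumption)
  have splM: "splitting p (binom_coeff \<mu>) n (act M g\<^sub>1) (act M g\<^sub>2)"
    by (rule splitting_summand[OF splV Vc[OF g(1)] Vc[OF g(2)] Mc[OF g(1)] Mc[OF g(2)] PI])
      (simp_all add: Pg Ig Vc g)
  note abelian = elementary_abelian[OF E assms(4)]
  have pow: "act M h ^\<^sub>m p = 1\<^sub>m n" if "h \<in> carrier E" for h
    unfolding representation_pow[OF E rM that, symmetric] abelian(2)[OF that that] n_def by (rule representation_one[OF E rM])
  interpret U: unipotent_pair n p \<mu> "act M g\<^sub>1" "act M g\<^sub>2"
    by unfold_locales
      (use p Mc pow g representation_mult[OF rM g] representation_mult[OF rM g(2,1)] abelian(1)[OF g] in simp_all)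
  show ?thesis
  proof (cases "n = 0")
    \<comment> \<open>The zero module is cyclic, but it is none of the modules
      \<open>\<nabla>(k * p - 1)\<close> with \<open>k \<ge> 1\<close>.\<close>
    case True
    have "isomorphic_rep E M (restrict_rep \<phi> (Rep 0 (\<lambda>_. 1\<^sub>m 0)))"
    proof (rule isomorphic_repI[of "1\<^sub>m 0" 0 "1\<^sub>m 0"])
      fix h assume "h \<in> carrier E"
      then have "act M h \<in> carrier_mat 0 0" using Mc[of h] True by simp
      then show "1\<^sub>m 0 * act M h = act (restrict_rep \<phi> (Rep 0 (\<lambda>_. 1\<^sub>m 0))) h * 1\<^sub>m 0"
        by (intro eq_matI) (auto simp: restrict_rep_def)
    qed (use True in \<open>simp_all add: restrict_rep_def n_def\<close>)
    then show ?thesis using tilting_zero by blast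
  next
    case False
    obtain v where v: "v \<in> carrier_vec n" and surj: "\<And>w. w \<in> carrier_vec n \<Longrightarrow> \<exists>Q. U.M Q *\<^sub>v v = w"
    proof (rule cyclic_rep_surj[where M = U.M and \<kappa> = polyK, OF E rM assms(15,2) abelian(2)[OF _ g(1)] _ assms(7), folded n_def])
      show "{g\<^sub>1, g\<^sub>2} \<subseteq> carrier E" using g by simp
      show "mat_hom n U.M" by (rule U.P2.mat_hom_axioms)
      show "\<exists>Q. U.M Q = act M h" if "h \<in> {g\<^sub>1, g\<^sub>2}" for h using that U.M_G1 U.M_G2 by blast
      show "U.M (polyK a) = a \<cdot>\<^sub>m 1\<^sub>m n" for a by (rule U.M_K)
    qed (assumption | (rule that; assumption))+
    obtain k where k: "1 \<le> k" "k \<le> p" and kill: "U.M (polyY ^ k) *\<^sub>v v = 0\<^sub>v n"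
      and ann: "\<And>J'. ideal_filtration J' \<Longrightarrow> polyX ^ p \<in> J' \<Longrightarrow> polyY ^ k \<in> J' \<Longrightarrow> {Q. U.M Q *\<^sub>v v = 0\<^sub>v n} \<subseteq> J'"
    proof (rule U.splitting_cyclic[OF splM v])
      show "\<exists>Q. U.M Q *\<^sub>v v = w" if "w \<in> carrier_vec n" for w by (rule surj[OF that])
      show "n > 0" using False by simp
    qed (rule that; assumption)
    \<comment> \<open>The candidate is \<open>\<nabla>(d)\<close>, of dimension
      \<open>k * p\<close>, the dimension of \<open>'k[x, y] / (x ^ p, y ^ k)\<close>.\<close>
    define d where "d = k * p - 1"
    have d: "Suc d = k * p" using k(1) assms(2) by (simp add: d_def)
    interpret W: unipotent_pair "Suc d" p \<mu> "lower d l\<^sub>1" "lower d l\<^sub>2" by (rule lower_unipotent[OF p])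
    define e where "e = (unit_vec (Suc d) 0 :: 'k vec)"
    have e: "e \<in> carrier_vec (Suc d)" by (simp add: e_def)
    have gen: "\<exists>Q. W.M Q *\<^sub>v e = w" if "w \<in> carrier_vec (Suc d)" for w
      unfolding e_def
    proof (rule lower_generates[OF p _ _ d that])
      show "of_nat (d choose i) \<noteq> (0 :: 'k)" if "i \<le> d" for i using binom[OF k, of i] that by (simp add: d_def)
      show "inj_on (\<lambda>(i, j). of_nat i * l\<^sub>1 + of_nat j * l\<^sub>2) ({..<p} \<times> {..<k})"
        by (rule inj_on_subset[OF nodes(1)]) (use k in auto)
    qed
    have "W.Y ^\<^sub>m k = 0\<^sub>m (Suc d) (Suc d)"
      by (rule shifted_power_zero[OF W.Y, of p])
        (use lower_Y_zero[OF p nodes(2), of _ d _ l\<^sub>2] d in \<open>simp_all add: \<mu>_def\<close>)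
    then have Wk: "W.M (polyY ^ k) *\<^sub>v e = 0\<^sub>v (Suc d)"
      unfolding W.P2.power W.M_Y using e by (intro eq_vecI) auto
    have WX: "W.M (polyX ^ p) *\<^sub>v e = 0\<^sub>v (Suc d)" unfolding W.M_X_p using e by (intro eq_vecI) auto
    \<comment> \<open>Since \<open>x ^ p\<close> and \<open>y ^ k\<close> kill \<open>e\<close>, the
      annihilator of \<open>v\<close> is contained in that of \<open>e\<close>. This yields a map of
      \<open>M\<close> onto \<open>\<nabla>(d)\<close>, and the bound \<open>k * p\<close> on the
      dimension of \<open>M\<close> makes it bijective.\<close>
    have ker: "W.M Q *\<^sub>v e = 0\<^sub>v (Suc d)" if "U.M Q *\<^sub>v v = 0\<^sub>v n" for Q
      using ann[OF W.annihilator_ideal[OF e]] WX Wk that by blast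
    obtain F where F: "F \<in> carrier_mat (Suc d) n" and FQ: "\<And>Q. F *\<^sub>v (U.M Q *\<^sub>v v) = W.M Q *\<^sub>v e"
    proof -
      have "\<exists>F\<in>carrier_mat (Suc d) n. \<forall>Q. F *\<^sub>v (U.M Q *\<^sub>v v) = W.M Q *\<^sub>v e"
        by (rule linear_extension[where sc = "\<lambda>a Q. polyK a * Q"])
          (simp_all add: U.carrier_M_vec[OF v] W.carrier_M_vec[OF e] U.P2.add_vec[OF v] W.P2.add_vec[OF e]
            U.M_K_vec[OF v] W.M_K_vec[OF e] surj ker)
      then show thesis using that by blast
    qed
    obtain K where K: "K \<in> carrier_mat n (Suc d)" "F * K = 1\<^sub>m (Suc d)"
    proof (rule surj_right_inverse[OF F])
      fix w :: "'k vec" assume "w \<in> carrier_vec (Suc d)"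
      then obtain Q where "W.M Q *\<^sub>v e = w" using gen by blast
      then show "\<exists>u\<in>carrier_vec n. F *\<^sub>v u = w" using FQ[of Q] U.carrier_M_vec[OF v, of Q] by blast
    qed (rule that; assumption)
    have dim: "n = Suc d"
      using right_inverse_dim[OF F K] U.cyclic_dim_le[OF v kill surj] d by simp
    have comm: "F * U.M Z = W.M Z * F" for Z
    proof (rule mat_eq_on_vecs[of _ "Suc d" n])
      fix w :: "'k vec" assume w: "w \<in> carrier_vec n"
      then obtain Q where Q: "U.M Q *\<^sub>v v = w" using surj by blast
      have "F * U.M Z *\<^sub>v w = F *\<^sub>v (U.M Z *\<^sub>v w)" by (rule assoc_mult_mat_vec[OF F U.P2.carrier w])
      also have "\<dots> = W.M Z *\<^sub>v (F *\<^sub>v w)"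
        unfolding Q[symmetric] U.P2.mult_vec[OF v, symmetric] FQ W.P2.mult_vec[OF e] ..
      also have "\<dots> = W.M Z * F *\<^sub>v w" by (rule assoc_mult_mat_vec[OF W.P2.carrier F w, symmetric])
      finally show "F * U.M Z *\<^sub>v w = W.M Z * F *\<^sub>v w" .
    qed (use mult_carrier_mat[OF F U.P2.carrier] mult_carrier_mat[OF W.P2.carrier F] in auto)
    define T where "T = (dual_weyl_module d :: ('k mat, 'k) rep)"
    have rT: "representation E (restrict_rep \<phi> T)"
      unfolding T_def by (rule representation_restrict[OF representation_dual_weyl \<phi>])
    have dT: "deg (restrict_rep \<phi> T) = Suc d" by (simp add: T_def restrict_rep_def)
    have aT: "act (restrict_rep \<phi> T) h = lower d l" if "\<phi> h = mat2 1 0 l 1" for h l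
      using that by (simp add: T_def restrict_rep_def act_dual_weyl lower_def)
    have "F * act M h = act (restrict_rep \<phi> T) h * F" if "h \<in> carrier E" for h
    proof (rule intertwines_generate[OF E rM rT _ _ _ that[folded assms(7)]])
      show "F \<in> carrier_mat (deg (restrict_rep \<phi> T)) (deg M)" using F by (simp add: dT n_def)
      show "{g\<^sub>1, g\<^sub>2} \<subseteq> carrier E" using g by simp
      show "F * act M h = act (restrict_rep \<phi> T) h * F" if "h \<in> {g\<^sub>1, g\<^sub>2}" for h
        using that comm[of "1 + polyX"] comm[of "[:binom_poly p \<mu>:] + polyY"] aT[OF \<phi>g(1)] aT[OF \<phi>g(2)]
        unfolding U.M_G1 W.M_G1 U.M_G2 W.M_G2 by auto
    qed
    then have "isomorphic_rep E M (restrict_rep \<phi> T)"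
      using F K dim dT by (intro isomorphic_repI[of F "Suc d" K]) (simp_all add: n_def)
    moreover have "tilting T"
      unfolding T_def by (rule tilting_dual_weyl) (use binom[OF k] in \<open>simp add: d_def\<close>)
    ultimately show ?thesis by blast
  qed
qed

end
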